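(* Let $0<\gamma<\tfrac12$, $\kappa=\frac{1-2\gamma}{2(1-\gamma)}$ and $\alpha\in(0,1)$. Let $g:\mathbb{R}\to\mathbb{R}$ be an odd function such that $g(\xi_2-\xi_1)$ has finite second moments, $\sigma^2=E(g_1^2(\xi_1))>0$ and $u(\Delta)>0$. Let the observations follow the change-point model with fixed jump height $\Delta$ and early change-points $k_n^*$, $k_n^*/n\to0$ (see context), and consider the test that rejects the hypothesis of no change when $\max_{1\le k<n}|G_n^\gamma(k)|>q_\alpha$, where $q_\alpha$ is the critical value corresponding to asymptotic size $\alpha$. (1) If $\liminf_{n\to\infty}k_n^*/n^\kappa>(q_\alpha/u(\Delta))^{1/(1-\gamma)}$, then the test is consistent, i.e. $P\big(\max_{1\le k<n}|G_n^\gamma(k)|>q_\alpha\big)\to1$. (2) If $\limsup_{n\to\infty}k_n^*/n^\kappa<(q_\alpha/u(\Delta))^{1/(1-\gamma)}$, then the test has asymptotically only trivial power $\alpha$, i.e. $P\big(\max_{1\le k<n}|G_n^\gamma(k)|>q_\alpha\big)\to\alpha$.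
   Context: $(\xi_i)_{i\ge1}$ is an i.i.d. sequence of mean-zero real random variables. For each $n$ the observations are $X_i=\mu+\xi_i$ for $i\le k_n^*$ and $X_i=\mu+\Delta+\xi_i$ for $k_n^*+1\le i\le n$, where $\mu\in\mathbb{R}$ is an unknown constant, $\Delta\ne0$ is a constant not depending on $n$, and $k_n^*\in\{1,\dots,n-1\}$. The test statistic is $$G_n^\gamma(k)=\frac{1}{n^{3/2}\big(\frac kn(1-\frac kn)\big)^\gamma}\sum_{i=1}^k\sum_{j=k+1}^n g(X_j-X_i),\qquad 1\le k<n.$$ With $\xi,\eta$ independent and distributed as $\xi_1$, define (the expectations being understood to exist) $$g_1(x)=E[g(\xi-x)]-E[g(\xi-\eta)],\qquad u(\Delta)=E[g(\xi-\eta+\Delta)-g(\xi-\eta)].$$ With $\{W^{(0)}(\lambda),0\le\lambda\le1\}$ a standard Brownian bridge, the critical value $q_\alpha$ is determined by $$P\Big(\sup_{0\le\lambda\le1}\frac{\sigma}{(\lambda(1-\lambda))^\gamma}|W^{(0)}(\lambda)|>q_\alpha\Big)=\alpha,$$ where the expression at $\lambda\in\{0,1\}$ is read as its limit $0$. *)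

theory Defs
  imports "HOL-Probability.Probability"
begin

text \<open>The degenerate case \<open>s = 0\<close> (a point mass) is included.\<close>

definition gaussian_rv :: "'a measure \<Rightarrow> ('a \<Rightarrow> real) \<Rightarrow> bool" where
  "gaussian_rv M X \<longleftrightarrow> X \<in> borel_measurable M \<and>
     (\<exists>m s. distr M borel X = distr std_normal_distribution borel (\<lambda>z. m + s * z))"

text \<open>Joint Gaussianity is expressed by all finite linear combinations being Gaussian.\<close>

definition brownian_bridge :: "'a measure \<Rightarrow> (real \<Rightarrow> 'a \<Rightarrow> real) \<Rightarrow> bool" where
  "brownian_bridge M W \<longleftrightarrow> prob_space M \<and>
     (\<forall>T c. finite T \<and> T \<subseteq> {0..1} \<longrightarrow> gaussian_rv M (\<lambda>\<omega>. \<Sum>t\<in>T. c t * W t \<omega>)) \<and>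
     (\<forall>t\<in>{0..1}. integral\<^sup>L M (W t) = 0) \<and>
     (\<forall>s\<in>{0..1}. \<forall>t\<in>{0..1}. integral\<^sup>L M (\<lambda>\<omega>. W s \<omega> * W t \<omega>) = min s t - s * t) \<and>
     (\<forall>\<omega>\<in>space M. continuous_on {0..1} (\<lambda>t. W t \<omega>))"

definition weighted_abs :: "real \<Rightarrow> real \<Rightarrow> (real \<Rightarrow> real) \<Rightarrow> real \<Rightarrow> real" where
  "weighted_abs \<sigma> \<gamma> w t =
     (if t = 0 \<or> t = 1 then 0 else \<sigma> / (t * (1 - t)) powr \<gamma> * \<bar>w t\<bar>)"

text \<open>The supremum is taken in the extended reals, because on a null set of paths the weighted
  bridge may be unbounded near the end points.\<close>

definition critical_value ::
  "'a measure \<Rightarrow> (real \<Rightarrow> 'a \<Rightarrow> real) \<Rightarrow> real \<Rightarrow> real \<Rightarrow> real \<Rightarrow> real \<Rightarrow> bool" where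
  "critical_value N W \<sigma> \<gamma> \<alpha> q \<longleftrightarrow>
     measure N {\<omega> \<in> space N.
       (SUP t\<in>{0..1}. ereal (weighted_abs \<sigma> \<gamma> (\<lambda>s. W s \<omega>) t)) > ereal q} = \<alpha>"

definition iid_mean_zero :: "'a measure \<Rightarrow> (nat \<Rightarrow> 'a \<Rightarrow> real) \<Rightarrow> bool" where
  "iid_mean_zero M \<xi> \<longleftrightarrow> prob_space M \<and>
     prob_space.indep_vars M (\<lambda>_. borel) \<xi> {1..} \<and>
     (\<forall>i\<ge>1. distr M borel (\<xi> i) = distr M borel (\<xi> 1)) \<and>
     integrable M (\<xi> 1) \<and> integral\<^sup>L M (\<xi> 1) = 0"

text \<open>Here \<open>D\<close> is the common law of the errors, so a pair of independent copies
  has law \<open>D \<Otimes>\<^sub>M D\<close>.\<close>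

definition g1 :: "real measure \<Rightarrow> (real \<Rightarrow> real) \<Rightarrow> real \<Rightarrow> real" where
  "g1 D g x = (\<integral>y. g (y - x) \<partial>D) - (\<integral>p. g (fst p - snd p) \<partial>(D \<Otimes>\<^sub>M D))"

definition u :: "real measure \<Rightarrow> (real \<Rightarrow> real) \<Rightarrow> real \<Rightarrow> real" where
  "u D g \<Delta> = (\<integral>p. g (fst p - snd p + \<Delta>) - g (fst p - snd p) \<partial>(D \<Otimes>\<^sub>M D))"

definition observation ::
  "real \<Rightarrow> real \<Rightarrow> nat \<Rightarrow> (nat \<Rightarrow> 'a \<Rightarrow> real) \<Rightarrow> nat \<Rightarrow> 'a \<Rightarrow> real" where
  "observation \<mu> \<Delta> kstar \<xi> i \<omega> =
     (if i \<le> kstar then \<mu> + \<xi> i \<omega> else \<mu> + \<Delta> + \<xi> i \<omega>)"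

definition G_stat :: "(real \<Rightarrow> real) \<Rightarrow> real \<Rightarrow> nat \<Rightarrow> (nat \<Rightarrow> real) \<Rightarrow> nat \<Rightarrow> real" where
  "G_stat g \<gamma> n x k =
     1 / (real n powr (3/2) * (real k / real n * (1 - real k / real n)) powr \<gamma>) *
     (\<Sum>i=1..k. \<Sum>j=k+1..n. g (x j - x i))"

definition rejection_prob ::
  "'a measure \<Rightarrow> (nat \<Rightarrow> 'a \<Rightarrow> real) \<Rightarrow> (real \<Rightarrow> real) \<Rightarrow> real \<Rightarrow> real \<Rightarrow> nat \<Rightarrow> real" where
  "rejection_prob M X g \<gamma> q n =
     measure M {\<omega> \<in> space M. Max ((\<lambda>k. \<bar>G_stat g \<gamma> n (\<lambda>i. X i \<omega>) k\<bar>) ` {1..<n}) > q}"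

end

theory Submission
  imports Defs "HOL-Real_Asymp.Real_Asymp"
begin

text \<open>
  The kernel splits as \<open>g (y - x) = h x - h y + \<psi> (y, x)\<close>, where \<open>h = g1 D g\<close> and \<open>\<psi>\<close> is degenerate.
  The degenerate part is negligible: a dyadic chaining argument bounds its maximum with a
  loss of only \<open>log\<^sup>2 n\<close>, which the exponent \<open>\<gamma> < 1/2\<close> absorbs. The linear part is a weighted
  tied-down partial sum process. Its finite-dimensional distributions converge by characteristic
  functions, oscillations are controlled by Ottaviani's inequality and the tails of the central
  limit theorem, and the contribution of the end points is small by dyadic blocks, uniformly in \<open>n\<close>.
  The law of the supremum of the weighted bridge has no atom at the critical value: given
  everything but an independent Gaussian multiple of a tent function, the supremum takes a given
  positive value at no more than two values of that Gaussian variable.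

  The jump adds a sum over the pairs \<open>i \<le> k\<^sup>* < j\<close>, whose size relative to the norming is at most
  \<open>u(\<Delta>) (k\<^sup>* / n\<^sup>\<kappa>)\<^bsup>1 - \<gamma>\<^esup>\<close>, attained near \<open>k = k\<^sup>*\<close>. Close to \<open>0\<close> the linear part vanishes in the limit, so
  the test rejects if this quantity exceeds the critical value; if it stays below, the jump
  influences neither the maximum near \<open>0\<close> nor, since \<open>k\<^sup>* = o(n\<^sup>1\<^sup>/\<^sup>2)\<close>, the maximum over the rest.
\<close>

section \<open>Maximal inequalities\<close>

text \<open>All events compared in the limit bound \<open>\<bar>X t\<bar>\<close> on a set of
  indices, so they are even in each coordinate. Hence every passage to the limit runs through the
  real transforms E cos (sum of c t * X t), and periodic cutoffs in cos (theta x) turn these into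
  box probabilities. The bridge is an arbitrary process with the stated law. Continuity of its paths
  says nothing about W / wgt near 0 and 1; the bound there is imported from the partial sums, whose
  end estimates are uniform in n (\<open>Z_ends\<close>). The exponent satisfies kappa (1 - gamma) =
  1/2 - gamma, which makes s^(1 - gamma) n^(gamma - 1/2) of order one for a change-point s of order
  n^kappa; this quantity compares the number of pairs separated by the change with the norming. The
  shifted kernel is assumed integrable only, so second moments are available just for a bounded
  truncation; the rest, small in L1, needs a first-moment bound that holds for all k at once
  (\<open>weighted_remainder_bound\<close>). In part (1) no upper bound of order n^kappa is given
  for the change-point, and the jump is evaluated at the single index k = s.\<close>

lemma dyadic_maximal:
  fixes V :: "nat \<Rightarrow> 'a \<Rightarrow> real" and w :: "nat \<Rightarrow> real"
  assumes meas[measurable]: "\<And>k. V k \<in> borel_measurable M"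
    and int: "\<And>k l. k \<le> l \<Longrightarrow> integrable M (\<lambda>\<omega>. (V l \<omega> - V k \<omega>)\<^sup>2)"
    and bd: "\<And>k l. k \<le> l \<Longrightarrow> (\<integral>\<omega>. (V l \<omega> - V k \<omega>)\<^sup>2 \<partial>M) \<le> (\<Sum>i\<in>{k<..l}. w i)"
  shows "\<exists>H. H \<in> borel_measurable M \<and> (\<forall>\<omega>. 0 \<le> H \<omega>) \<and> integrable M (\<lambda>\<omega>. (H \<omega>)\<^sup>2) \<and>
    (\<integral>\<omega>. (H \<omega>)\<^sup>2 \<partial>M) \<le> (real m + 1)\<^sup>2 * (\<Sum>i\<in>{a<..a + 2 ^ m}. w i) \<and>
    (\<forall>\<omega>. \<forall>k\<le>2 ^ m. \<bar>V (a + k) \<omega> - V a \<omega>\<bar> \<le> H \<omega>)"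
proof (induction m arbitrary: a)
  case 0
  have "\<forall>\<omega>. \<forall>k\<le>2 ^ 0. \<bar>V (a + k) \<omega> - V a \<omega>\<bar> \<le> \<bar>V (a + 1) \<omega> - V a \<omega>\<bar>"
    by (auto simp: le_Suc_eq)
  then show ?case
    using int[of a "a + 1"] bd[of a "a + 1"]
    by (intro exI[of _ "\<lambda>\<omega>. \<bar>V (a + 1) \<omega> - V a \<omega>\<bar>"]) auto
next
  case (Suc m)
  define s where "s = real m + 1"
  have s: "s > 0" by (simp add: s_def)
  obtain H1 where H1[measurable]: "H1 \<in> borel_measurable M" and H1p: "\<And>\<omega>. 0 \<le> H1 \<omega>"
    and H1i: "integrable M (\<lambda>\<omega>. (H1 \<omega>)\<^sup>2)"
    and H1b: "(\<integral>\<omega>. (H1 \<omega>)\<^sup>2 \<partial>M) \<le> s\<^sup>2 * (\<Sum>i\<in>{a<..a + 2 ^ m}. w i)"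
    and H1m: "\<And>\<omega> k. k \<le> 2 ^ m \<Longrightarrow> \<bar>V (a + k) \<omega> - V a \<omega>\<bar> \<le> H1 \<omega>"
    using Suc[of a] unfolding s_def by blast
  obtain H2 where H2[measurable]: "H2 \<in> borel_measurable M" and H2p: "\<And>\<omega>. 0 \<le> H2 \<omega>"
    and H2i: "integrable M (\<lambda>\<omega>. (H2 \<omega>)\<^sup>2)"
    and H2b: "(\<integral>\<omega>. (H2 \<omega>)\<^sup>2 \<partial>M) \<le> s\<^sup>2 * (\<Sum>i\<in>{a + 2 ^ m<..a + 2 ^ m + 2 ^ m}. w i)"
    and H2m: "\<And>\<omega> k. k \<le> 2 ^ m \<Longrightarrow> \<bar>V (a + 2 ^ m + k) \<omega> - V (a + 2 ^ m) \<omega>\<bar> \<le> H2 \<omega>"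
    using Suc[of "a + 2 ^ m"] unfolding s_def by blast
  \<comment> \<open>Rademacher-Menshov halving: a point of the right half is reached through the
    midpoint, so \<open>D\<close> plus the larger of \<open>H1\<close> and \<open>H2\<close>
    dominates. The root of the sum of squares replaces the maximum because second moments add over
    the two halves.\<close>
  define D where "D \<omega> = \<bar>V (a + 2 ^ m) \<omega> - V a \<omega>\<bar>" for \<omega>
  define R where "R \<omega> = sqrt ((H1 \<omega>)\<^sup>2 + (H2 \<omega>)\<^sup>2)" for \<omega>
  \<comment> \<open>Young's inequality 2 D R <= s D^2 + R^2 / s with s = m + 1. The weight is tuned
    to the induction: (1 + s) + (1 + 1/s) s^2 = (1 + s)^2, the constant for m + 1.\<close>
  define Q where "Q \<omega> = (1 + s) * (D \<omega>)\<^sup>2 + (1 + 1 / s) * ((H1 \<omega>)\<^sup>2 + (H2 \<omega>)\<^sup>2)" for \<omega>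
  have [measurable]: "D \<in> borel_measurable M" "R \<in> borel_measurable M"
    unfolding D_def R_def by measurable
  have w: "w i \<ge> 0" if "i > 0" for i
  proof -
    have "0 \<le> (\<integral>\<omega>. (V i \<omega> - V (i - 1) \<omega>)\<^sup>2 \<partial>M)" by simp
    also have "\<dots> \<le> (\<Sum>j\<in>{i - 1<..i}. w j)" by (rule bd) simp
    also have "{i - 1<..i} = {i}" using that by auto
    finally show ?thesis by simp
  qed
  have Di: "integrable M (\<lambda>\<omega>. (D \<omega>)\<^sup>2)"
    using int[of a "a + 2 ^ m"] by (simp add: D_def)
  have Db: "(\<integral>\<omega>. (D \<omega>)\<^sup>2 \<partial>M) \<le> (\<Sum>i\<in>{a<..a + 2 ^ m}. w i)"
    using bd[of a "a + 2 ^ m"] by (simp add: D_def)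
  have Q: "(D \<omega> + R \<omega>)\<^sup>2 \<le> Q \<omega>" for \<omega>
  proof -
    have "0 \<le> (s * D \<omega> - R \<omega>)\<^sup>2 / s" using s by simp
    also have "\<dots> = s * (D \<omega>)\<^sup>2 - 2 * D \<omega> * R \<omega> + (R \<omega>)\<^sup>2 / s"
      using s by (simp add: power2_eq_square field_simps)
    also have "(R \<omega>)\<^sup>2 = (H1 \<omega>)\<^sup>2 + (H2 \<omega>)\<^sup>2" by (simp add: R_def)
    finally have "2 * D \<omega> * R \<omega> \<le> s * (D \<omega>)\<^sup>2 + ((H1 \<omega>)\<^sup>2 + (H2 \<omega>)\<^sup>2) / s" by simp
    moreover have "(D \<omega> + R \<omega>)\<^sup>2 = (D \<omega>)\<^sup>2 + 2 * D \<omega> * R \<omega> + ((H1 \<omega>)\<^sup>2 + (H2 \<omega>)\<^sup>2)"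
      by (simp add: power2_sum R_def)
    ultimately show ?thesis by (simp add: Q_def algebra_simps add_divide_distrib)
  qed
  have Qi: "integrable M Q"
    unfolding Q_def using Di H1i H2i by auto
  have i: "integrable M (\<lambda>\<omega>. (D \<omega> + R \<omega>)\<^sup>2)"
    by (rule Bochner_Integration.integrable_bound[OF Qi])
       (use Q in \<open>auto intro!: AE_I2 order_trans[OF _ abs_ge_self]\<close>)
  have split: "(\<Sum>i\<in>{a<..a + 2 ^ Suc m}. w i) =
      (\<Sum>i\<in>{a<..a + 2 ^ m}. w i) + (\<Sum>i\<in>{a + 2 ^ m<..a + 2 ^ m + 2 ^ m}. w i)"
    by (subst sum.union_disjoint[symmetric]) (auto intro!: sum.cong)
  let ?W = "\<Sum>i\<in>{a<..a + 2 ^ Suc m}. w i"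
  have "(\<integral>\<omega>. (D \<omega> + R \<omega>)\<^sup>2 \<partial>M) \<le> (\<integral>\<omega>. Q \<omega> \<partial>M)"
    by (rule integral_mono[OF i Qi Q])
  also have "\<dots> = (1 + s) * (\<integral>\<omega>. (D \<omega>)\<^sup>2 \<partial>M) + (1 + 1 / s) * ((\<integral>\<omega>. (H1 \<omega>)\<^sup>2 \<partial>M) + (\<integral>\<omega>. (H2 \<omega>)\<^sup>2 \<partial>M))"
    unfolding Q_def using Di H1i H2i by simp
  also have "\<dots> \<le> (1 + s) * ?W + (1 + 1 / s) * (s\<^sup>2 * ?W)"
  proof (intro add_mono mult_left_mono)
    have "0 \<le> (\<Sum>i\<in>{a + 2 ^ m<..a + 2 ^ m + 2 ^ m}. w i)"
      by (intro sum_nonneg) (auto intro: w)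
    then show "(\<integral>\<omega>. (D \<omega>)\<^sup>2 \<partial>M) \<le> ?W" using Db split by linarith
    show "(\<integral>\<omega>. (H1 \<omega>)\<^sup>2 \<partial>M) + (\<integral>\<omega>. (H2 \<omega>)\<^sup>2 \<partial>M) \<le> s\<^sup>2 * ?W"
      using H1b H2b unfolding split by (simp add: algebra_simps)
  qed (use s in auto)
  also have "\<dots> = (real (Suc m) + 1)\<^sup>2 * ?W"
    using s by (simp add: s_def field_simps power2_eq_square)
  finally have b: "(\<integral>\<omega>. (D \<omega> + R \<omega>)\<^sup>2 \<partial>M) \<le> (real (Suc m) + 1)\<^sup>2 * ?W" .
  have R1: "H1 \<omega> \<le> R \<omega>" "H2 \<omega> \<le> R \<omega>" for \<omega>
    unfolding R_def by (auto intro!: real_le_rsqrt)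
  have "\<bar>V (a + k) \<omega> - V a \<omega>\<bar> \<le> D \<omega> + R \<omega>" if "k \<le> 2 ^ Suc m" for k \<omega>
  proof (cases "k \<le> 2 ^ m")
    case True
    then show ?thesis using H1m[of k \<omega>] R1(1)[of \<omega>] by (simp add: D_def)
  next
    case False
    then have "\<bar>V (a + 2 ^ m + (k - 2 ^ m)) \<omega> - V (a + 2 ^ m) \<omega>\<bar> \<le> H2 \<omega>"
      using that by (intro H2m) simp
    moreover have "a + 2 ^ m + (k - 2 ^ m) = a + k" using False by simp
    ultimately show ?thesis using R1(2)[of \<omega>] unfolding D_def by simp
  qed
  moreover have "0 \<le> D \<omega> + R \<omega>" for \<omega> by (simp add: D_def R_def)
  ultimately show ?case using i b by (intro exI[of _ "\<lambda>\<omega>. D \<omega> + R \<omega>"]) auto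
qed

text \<open>Markov's inequality for the square of the dominating variable \<open>H\<close>. The
  index range is rounded up to a power of two; the process is frozen after n and the weights vanish
  there, so that the sum of weights remains that over 1..n. Rounding up costs one unit in m, whence
  log 2 n + 2.\<close>

lemma (in prob_space) maximal_inequality_log:
  fixes V :: "nat \<Rightarrow> 'a \<Rightarrow> real" and w :: "nat \<Rightarrow> real"
  assumes meas[measurable]: "\<And>k. k \<le> n \<Longrightarrow> V k \<in> borel_measurable M"
    and int: "\<And>k l. k \<le> l \<Longrightarrow> l \<le> n \<Longrightarrow> integrable M (\<lambda>\<omega>. (V l \<omega> - V k \<omega>)\<^sup>2)"
    and bd: "\<And>k l. k \<le> l \<Longrightarrow> l \<le> n \<Longrightarrow> expectation (\<lambda>\<omega>. (V l \<omega> - V k \<omega>)\<^sup>2) \<le> (\<Sum>i\<in>{k<..l}. w i)"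
    and V0: "\<And>\<omega>. V 0 \<omega> = 0" and x: "x > 0" and n: "n \<ge> 1"
  shows "prob {\<omega> \<in> space M. \<exists>k\<le>n. \<bar>V k \<omega>\<bar> \<ge> x} \<le> (log 2 n + 2)\<^sup>2 * (\<Sum>i\<in>{1..n}. w i) / x\<^sup>2"
proof -
  define m where "m = nat \<lceil>log 2 n\<rceil>"
  have m1: "log 2 n \<le> real m" unfolding m_def by linarith
  have m2: "real m \<le> log 2 n + 1"
  proof -
    have "0 \<le> log 2 (real n)" using n by simp
    then show ?thesis unfolding m_def by linarith
  qed
  have "real n = 2 powr (log 2 n)" using n by simp
  also have "\<dots> \<le> 2 powr real m" using m1 by simp
  also have "\<dots> = real (2 ^ m)" by (simp add: powr_realpow)
  finally have nm: "n \<le> 2 ^ m" by linarith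
  define w' where "w' i = (if i \<le> n then w i else 0)" for i
  define V' where "V' k = V (min k n)" for k
  have s: "(\<Sum>i\<in>{min k n<..min l n}. w i) = (\<Sum>i\<in>{k<..l}. w' i)" for k l
    unfolding w'_def by (rule sum.mono_neutral_cong_left) auto
  have "\<exists>H. H \<in> borel_measurable M \<and> (\<forall>\<omega>. 0 \<le> H \<omega>) \<and> integrable M (\<lambda>\<omega>. (H \<omega>)\<^sup>2) \<and>
    (\<integral>\<omega>. (H \<omega>)\<^sup>2 \<partial>M) \<le> (real m + 1)\<^sup>2 * (\<Sum>i\<in>{0<..0 + 2 ^ m}. w' i) \<and>
    (\<forall>\<omega>. \<forall>k\<le>2 ^ m. \<bar>V' (0 + k) \<omega> - V' 0 \<omega>\<bar> \<le> H \<omega>)"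
  proof (rule dyadic_maximal)
    fix k l :: nat assume "k \<le> l"
    then show "integrable M (\<lambda>\<omega>. (V' l \<omega> - V' k \<omega>)\<^sup>2)"
      unfolding V'_def by (intro int) auto
    show "(\<integral>\<omega>. (V' l \<omega> - V' k \<omega>)\<^sup>2 \<partial>M) \<le> (\<Sum>i\<in>{k<..l}. w' i)"
      unfolding s[symmetric] V'_def using \<open>k \<le> l\<close> by (intro bd) auto
  qed (simp add: V'_def)
  then obtain H where [measurable]: "H \<in> borel_measurable M" and Hp: "\<And>\<omega>. 0 \<le> H \<omega>"
    and Hi: "integrable M (\<lambda>\<omega>. (H \<omega>)\<^sup>2)"
    and Hb: "(\<integral>\<omega>. (H \<omega>)\<^sup>2 \<partial>M) \<le> (real m + 1)\<^sup>2 * (\<Sum>i\<in>{0<..2 ^ m}. w' i)"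
    and Hm: "\<And>\<omega> k. k \<le> 2 ^ m \<Longrightarrow> \<bar>V' k \<omega> - V' 0 \<omega>\<bar> \<le> H \<omega>"
    by auto
  have Vle: "\<bar>V k \<omega>\<bar> \<le> H \<omega>" if "k \<le> n" for k \<omega>
    using Hm[of k \<omega>] that nm V0 by (simp add: V'_def)
  have W: "(\<Sum>i\<in>{0<..2 ^ m}. w' i) = (\<Sum>i\<in>{1..n}. w i)"
    unfolding w'_def by (rule sum.mono_neutral_cong_right) (use nm in auto)
  have "0 \<le> (\<integral>\<omega>. (H \<omega>)\<^sup>2 \<partial>M)" by simp
  from order_trans[OF this Hb] have "0 \<le> (real m + 1)\<^sup>2 * (\<Sum>i\<in>{1..n}. w i)" unfolding W .
  then have W0: "0 \<le> (\<Sum>i\<in>{1..n}. w i)" by (simp add: zero_le_mult_iff)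
  have "prob {\<omega> \<in> space M. \<exists>k\<le>n. \<bar>V k \<omega>\<bar> \<ge> x} \<le> prob {\<omega> \<in> space M. (H \<omega>)\<^sup>2 \<ge> x\<^sup>2}"
  proof (intro finite_measure_mono)
    show "{\<omega> \<in> space M. \<exists>k\<le>n. \<bar>V k \<omega>\<bar> \<ge> x} \<subseteq> {\<omega> \<in> space M. (H \<omega>)\<^sup>2 \<ge> x\<^sup>2}"
      using Vle x by (auto intro!: power_mono intro: order_trans)
  qed measurable
  also have "\<dots> \<le> (\<integral>\<omega>. (H \<omega>)\<^sup>2 \<partial>M) / x\<^sup>2"
    using x by (intro integral_Markov_inequality_measure[OF Hi, of "{}"]) auto
  also have "\<dots> \<le> (real m + 1)\<^sup>2 * (\<Sum>i\<in>{1..n}. w i) / x\<^sup>2"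
    using Hb W x by (intro divide_right_mono) auto
  also have "\<dots> \<le> (log 2 n + 2)\<^sup>2 * (\<Sum>i\<in>{1..n}. w i) / x\<^sup>2"
    using m2 W0 x by (intro divide_right_mono mult_right_mono power_mono) auto
  finally show ?thesis .
qed

text \<open>Split according to the first k at which the partial sum reaches 2c. If the sum of the
  later terms is at most c, the full sum is still at least c, and this has probability at least 1 -
  beta independently of what happened up to k.\<close>

lemma (in prob_space) ottaviani_inequality:
  fixes Y :: "nat \<Rightarrow> 'a \<Rightarrow> real"
  assumes ind: "indep_vars (\<lambda>_. borel) Y {1..n}"
    and \<beta>: "\<And>k. k \<le> n \<Longrightarrow> prob {\<omega> \<in> space M. \<bar>\<Sum>i\<in>{k<..n}. Y i \<omega>\<bar> > c} \<le> \<beta>"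
  shows "(1 - \<beta>) * prob {\<omega> \<in> space M. \<exists>k\<le>n. \<bar>\<Sum>i\<in>{1..k}. Y i \<omega>\<bar> \<ge> 2 * c} \<le>
    prob {\<omega> \<in> space M. \<bar>\<Sum>i\<in>{1..n}. Y i \<omega>\<bar> \<ge> c}"
proof -
  have Ym[measurable]: "Y i \<in> borel_measurable M" if "i \<in> {1..n}" for i
    using ind that by (auto simp: indep_vars_def)
  define A where "A k = {\<omega> \<in> space M. \<bar>\<Sum>i\<in>{1..k}. Y i \<omega>\<bar> \<ge> 2 * c \<and> (\<forall>j<k. \<not> \<bar>\<Sum>i\<in>{1..j}. Y i \<omega>\<bar> \<ge> 2 * c)}" for k
  define B where "B k = {\<omega> \<in> space M. \<not> \<bar>\<Sum>i\<in>{k<..n}. Y i \<omega>\<bar> > c}" for k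
  have Sm[measurable]: "(\<lambda>\<omega>. \<Sum>i\<in>{1..j}. Y i \<omega>) \<in> borel_measurable M" if "j \<le> n" for j
    using that by (intro borel_measurable_sum Ym) auto
  have Rm[measurable]: "(\<lambda>\<omega>. \<Sum>i\<in>{k<..n}. Y i \<omega>) \<in> borel_measurable M" for k
    by (intro borel_measurable_sum Ym) auto
  have Am[measurable]: "A k \<in> sets M" if "k \<le> n" for k
  proof -
    have "A k = {\<omega> \<in> space M. \<bar>\<Sum>i\<in>{1..k}. Y i \<omega>\<bar> \<ge> 2 * c} - (\<Union>j<k. {\<omega> \<in> space M. \<bar>\<Sum>i\<in>{1..j}. Y i \<omega>\<bar> \<ge> 2 * c})"
      by (auto simp: A_def)
    moreover have "{\<omega> \<in> space M. \<bar>\<Sum>i\<in>{1..j}. Y i \<omega>\<bar> \<ge> 2 * c} \<in> sets M" if "j \<le> n" for j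
      using Sm[OF that] by measurable
    ultimately show ?thesis using that by auto
  qed
  have Bm[measurable]: "B k \<in> sets M" for k unfolding B_def by measurable
  have U: "{\<omega> \<in> space M. \<exists>k\<le>n. \<bar>\<Sum>i\<in>{1..k}. Y i \<omega>\<bar> \<ge> 2 * c} = (\<Union>k\<in>{..n}. A k)"
  proof safe
    fix \<omega> k assume w: "\<omega> \<in> space M" "k \<le> n" "2 * c \<le> \<bar>\<Sum>i\<in>{1..k}. Y i \<omega>\<bar>"
    define k0 where "k0 = (LEAST k. 2 * c \<le> \<bar>\<Sum>i\<in>{1..k}. Y i \<omega>\<bar>)"
    have "2 * c \<le> \<bar>\<Sum>i\<in>{1..k0}. Y i \<omega>\<bar>" unfolding k0_def by (rule LeastI[of "\<lambda>k. 2 * c \<le> \<bar>\<Sum>i\<in>{1..k}. Y i \<omega>\<bar>", OF w(3)])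
    moreover have "k0 \<le> k" unfolding k0_def by (rule Least_le[of "\<lambda>k. 2 * c \<le> \<bar>\<Sum>i\<in>{1..k}. Y i \<omega>\<bar>", OF w(3)])
    moreover have "\<forall>j<k0. \<not> 2 * c \<le> \<bar>\<Sum>i\<in>{1..j}. Y i \<omega>\<bar>" unfolding k0_def using not_less_Least by blast
    ultimately show "\<omega> \<in> (\<Union>k\<in>{..n}. A k)" using w by (intro UN_I[of k0]) (auto simp: A_def)
  qed (auto simp: A_def)
  have disj: "disjoint_family_on A {..n}"
    unfolding disjoint_family_on_def
  proof (intro ballI impI)
    fix k l assume "k \<in> {..n}" "l \<in> {..n}" "k \<noteq> l"
    then consider "k < l" | "l < k" by linarith
    then show "A k \<inter> A l = {}" by cases (auto simp: A_def)
  qed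
  have AB: "prob (A k \<inter> B k) = prob (A k) * prob (B k)" if k: "k \<le> n" for k
  proof -
    let ?P1 = "PiM {1..k} (\<lambda>_. borel :: real measure)" and ?P2 = "PiM {k<..n} (\<lambda>_. borel :: real measure)"
    define a where "a = {f \<in> space ?P1. \<bar>\<Sum>i\<in>{1..k}. f i\<bar> \<ge> 2 * c} - (\<Union>j<k. {f \<in> space ?P1. \<bar>\<Sum>i\<in>{1..j}. f i\<bar> \<ge> 2 * c})"
    define b where "b = {f \<in> space ?P2. \<not> \<bar>\<Sum>i\<in>{k<..n}. f i\<bar> > c}"
    have sa: "(\<lambda>f. \<Sum>i\<in>{1..j}. f i) \<in> borel_measurable ?P1" if "j \<le> k" for j
      using that by (intro borel_measurable_sum measurable_component_singleton) auto
    have "{f \<in> space ?P1. \<bar>\<Sum>i\<in>{1..j}. f i\<bar> \<ge> 2 * c} \<in> sets ?P1" if "j \<le> k" for j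
      using sa[OF that] by measurable
    then have am: "a \<in> sets ?P1" unfolding a_def by (intro sets.Diff sets.finite_UN) auto
    have "(\<lambda>f. \<Sum>i\<in>{k<..n}. f i) \<in> borel_measurable ?P2"
      by (intro borel_measurable_sum measurable_component_singleton) auto
    then have bm: "b \<in> sets ?P2" unfolding b_def by measurable
    have iv: "indep_var ?P1 (\<lambda>\<omega>. restrict (\<lambda>i. Y i \<omega>) {1..k}) ?P2 (\<lambda>\<omega>. restrict (\<lambda>i. Y i \<omega>) {k<..n})"
      using k by (intro indep_var_restrict[OF ind]) auto
    have ea: "(\<lambda>\<omega>. restrict (\<lambda>i. Y i \<omega>) {1..k}) -` a \<inter> space M = A k"
      by (auto simp: a_def A_def space_PiM)
    have eb: "(\<lambda>\<omega>. restrict (\<lambda>i. Y i \<omega>) {k<..n}) -` b \<inter> space M = B k"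
      by (auto simp: b_def B_def space_PiM)
    have eab: "(\<lambda>\<omega>. (restrict (\<lambda>i. Y i \<omega>) {1..k}, restrict (\<lambda>i. Y i \<omega>) {k<..n})) -` (a \<times> b) \<inter> space M = A k \<inter> B k"
      using ea eb by auto
    show ?thesis using indep_varD[OF iv am bm] unfolding eab ea eb .
  qed
  have B1: "1 - \<beta> \<le> prob (B k)" if "k \<le> n" for k
  proof -
    have "prob (B k) = 1 - prob {\<omega> \<in> space M. \<bar>\<Sum>i\<in>{k<..n}. Y i \<omega>\<bar> > c}"
      unfolding B_def by (intro prob_neg) measurable
    then show ?thesis using \<beta>[OF that] by simp
  qed
  have "(1 - \<beta>) * prob {\<omega> \<in> space M. \<exists>k\<le>n. \<bar>\<Sum>i\<in>{1..k}. Y i \<omega>\<bar> \<ge> 2 * c} = (\<Sum>k\<le>n. (1 - \<beta>) * prob (A k))"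
    unfolding U by (subst finite_measure_finite_Union) (use disj in \<open>auto simp: sum_distrib_left\<close>)
  also have "\<dots> \<le> (\<Sum>k\<le>n. prob (A k \<inter> B k))"
    by (intro sum_mono) (auto simp: AB mult.commute[of "prob (A _)"] intro!: mult_right_mono B1)
  also have "\<dots> = prob (\<Union>k\<in>{..n}. A k \<inter> B k)"
    by (subst finite_measure_finite_Union) (use disj in \<open>auto simp: disjoint_family_on_def\<close>)
  also have "\<dots> \<le> prob {\<omega> \<in> space M. \<bar>\<Sum>i\<in>{1..n}. Y i \<omega>\<bar> \<ge> c}"
  proof (intro finite_measure_mono subsetI)
    fix \<omega> assume "\<omega> \<in> (\<Union>k\<in>{..n}. A k \<inter> B k)"
    then obtain k where k: "k \<le> n" "\<omega> \<in> A k" "\<omega> \<in> B k" by auto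
    have "(\<Sum>i\<in>{1..n}. Y i \<omega>) = (\<Sum>i\<in>{1..k}. Y i \<omega>) + (\<Sum>i\<in>{k<..n}. Y i \<omega>)"
      by (subst sum.union_disjoint[symmetric]) (use k in \<open>auto intro!: sum.cong\<close>)
    then show "\<omega> \<in> {\<omega> \<in> space M. \<bar>\<Sum>i\<in>{1..n}. Y i \<omega>\<bar> \<ge> c}"
      using k by (auto simp: A_def B_def)
  qed measurable
  finally show ?thesis .
qed

section \<open>Convergence of finite-dimensional distributions\<close>

lemma LIMSEQ_uniform_approx:
  fixes a :: "nat \<Rightarrow> real"
  assumes "\<And>e. e > 0 \<Longrightarrow> \<exists>a' b'. (a' \<longlonglongrightarrow> b') \<and> (\<forall>n. \<bar>a n - a' n\<bar> \<le> e) \<and> \<bar>b - b'\<bar> \<le> e"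
  shows "a \<longlonglongrightarrow> b"
proof (rule tendstoI)
  fix e :: real assume "e > 0"
  then obtain a' b' where ab: "a' \<longlonglongrightarrow> b'" "\<And>n. \<bar>a n - a' n\<bar> \<le> e / 4" "\<bar>b - b'\<bar> \<le> e / 4"
    using assms[of "e / 4"] by auto
  have "\<forall>\<^sub>F n in sequentially. dist (a' n) b' < e / 4"
    using ab(1) \<open>e > 0\<close> by (intro tendstoD) auto
  then show "\<forall>\<^sub>F n in sequentially. dist (a n) b < e"
  proof eventually_elim
    case (elim n)
    then show ?case using ab(2)[of n] ab(3) \<open>e > 0\<close> unfolding dist_real_def by linarith
  qed
qed

text \<open>Product-to-sum: cos (theta x) cos y = (cos (y + theta x) + cos (y - theta x)) / 2 only
  moves the coefficient of coordinate s by theta or -theta. Since convergence is known for every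
  coefficient vector, powers of the cosine follow by induction and continuous \<open>r\<close> by
  polynomial approximation on [-1, 1]. The factors \<open>F\<close> and \<open>G\<close> carry the
  coordinates treated before.\<close>

lemma cos_transform_mult:
  fixes X :: "nat \<Rightarrow> 't \<Rightarrow> 'a \<Rightarrow> real" and Y :: "'t \<Rightarrow> 'b \<Rightarrow> real"
  assumes M: "prob_space M" and N: "prob_space N" and T: "finite T" and s: "s \<in> T"
    and X[measurable]: "\<And>n t. t \<in> T \<Longrightarrow> X n t \<in> borel_measurable M"
    and Y[measurable]: "\<And>t. t \<in> T \<Longrightarrow> Y t \<in> borel_measurable N"
    and F[measurable]: "\<And>n. F n \<in> borel_measurable M" and Fb: "\<And>n \<omega>. \<bar>F n \<omega>\<bar> \<le> B"
    and G[measurable]: "G \<in> borel_measurable N" and Gb: "\<And>\<omega>. \<bar>G \<omega>\<bar> \<le> B"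
    and conv: "\<And>c. (\<lambda>n. \<integral>\<omega>. F n \<omega> * cos (\<Sum>t\<in>T. c t * X n t \<omega>) \<partial>M)
      \<longlonglongrightarrow> (\<integral>\<omega>. G \<omega> * cos (\<Sum>t\<in>T. c t * Y t \<omega>) \<partial>N)"
    and r: "continuous_on UNIV (r :: real \<Rightarrow> real)"
  shows "(\<lambda>n. \<integral>\<omega>. (r (cos (\<theta> * X n s \<omega>)) * F n \<omega>) * cos (\<Sum>t\<in>T. c t * X n t \<omega>) \<partial>M)
      \<longlonglongrightarrow> (\<integral>\<omega>. (r (cos (\<theta> * Y s \<omega>)) * G \<omega>) * cos (\<Sum>t\<in>T. c t * Y t \<omega>) \<partial>N)"
proof -
  interpret M: prob_space M by (rule M)
  interpret N: prob_space N by (rule N)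
  note [measurable] = X[OF s] Y[OF s]
  have B0: "B \<ge> 0" using Fb[of 0 undefined] by linarith
  have Fi: "integrable M (\<lambda>\<omega>. f \<omega> * F n \<omega> * cos (\<Sum>t\<in>T. c t * X n t \<omega>))"
    if [measurable]: "f \<in> borel_measurable M" and fK: "\<And>\<omega>. \<bar>f \<omega>\<bar> \<le> K" for n c f and K :: real
  proof (rule M.integrable_const_bound)
    have "\<bar>f \<omega> * F n \<omega> * cos x\<bar> \<le> K * B * 1" for \<omega> x
      unfolding abs_mult using fK Fb B0 order_trans[OF abs_ge_zero fK[of undefined]]
      by (intro mult_mono mult_nonneg_nonneg) auto
    then show "AE \<omega> in M. norm (f \<omega> * F n \<omega> * cos (\<Sum>t\<in>T. c t * X n t \<omega>)) \<le> K * B" by auto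
  qed measurable
  have Gi: "integrable N (\<lambda>\<omega>. f \<omega> * G \<omega> * cos (\<Sum>t\<in>T. c t * Y t \<omega>))"
    if [measurable]: "f \<in> borel_measurable N" and fK: "\<And>\<omega>. \<bar>f \<omega>\<bar> \<le> K" for c f and K :: real
  proof (rule N.integrable_const_bound)
    have "\<bar>f \<omega> * G \<omega> * cos x\<bar> \<le> K * B * 1" for \<omega> x
      unfolding abs_mult using fK Gb B0 order_trans[OF abs_ge_zero fK[of undefined]]
      by (intro mult_mono mult_nonneg_nonneg) auto
    then show "AE \<omega> in N. norm (f \<omega> * G \<omega> * cos (\<Sum>t\<in>T. c t * Y t \<omega>)) \<le> K * B" by auto
  qed measurable
  have pw: "\<bar>cos x ^ i\<bar> \<le> 1" for x :: real and i
    by (simp add: power_abs power_le_one)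
  have monomial: "(\<lambda>n. \<integral>\<omega>. (cos (\<theta> * X n s \<omega>) ^ i * F n \<omega>) * cos (\<Sum>t\<in>T. c t * X n t \<omega>) \<partial>M)
      \<longlonglongrightarrow> (\<integral>\<omega>. (cos (\<theta> * Y s \<omega>) ^ i * G \<omega>) * cos (\<Sum>t\<in>T. c t * Y t \<omega>) \<partial>N)" for i c
  proof (induction i arbitrary: c)
    case 0
    then show ?case using conv by simp
  next
    case (Suc i)
    define c1 where "c1 t = c t + (if t = s then \<theta> else 0)" for t
    define c2 where "c2 t = c t - (if t = s then \<theta> else 0)" for t
    have c1: "(\<Sum>t\<in>T. c1 t * x t) = (\<Sum>t\<in>T. c t * x t) + \<theta> * x s" for x
    proof -
      have "(\<Sum>t\<in>T. c1 t * x t) = (\<Sum>t\<in>T. c t * x t + (if t = s then \<theta> * x t else 0))"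
        by (intro sum.cong) (auto simp: c1_def algebra_simps)
      then show ?thesis using s T by (simp add: sum.distrib)
    qed
    have c2: "(\<Sum>t\<in>T. c2 t * x t) = (\<Sum>t\<in>T. c t * x t) - \<theta> * x s" for x
    proof -
      have "(\<Sum>t\<in>T. c2 t * x t) = (\<Sum>t\<in>T. c t * x t - (if t = s then \<theta> * x t else 0))"
        by (intro sum.cong) (auto simp: c2_def algebra_simps)
      then show ?thesis using s T by (simp add: sum_subtractf)
    qed
    have e: "(cos (\<theta> * x s) ^ Suc i * f) * cos (\<Sum>t\<in>T. c t * x t) =
        ((cos (\<theta> * x s) ^ i * f) * cos (\<Sum>t\<in>T. c1 t * x t) + (cos (\<theta> * x s) ^ i * f) * cos (\<Sum>t\<in>T. c2 t * x t)) / 2"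
      for x f
      unfolding c1 c2 by (simp add: cos_add cos_diff algebra_simps)
    have "(\<lambda>n. ((\<integral>\<omega>. (cos (\<theta> * X n s \<omega>) ^ i * F n \<omega>) * cos (\<Sum>t\<in>T. c1 t * X n t \<omega>) \<partial>M) +
        (\<integral>\<omega>. (cos (\<theta> * X n s \<omega>) ^ i * F n \<omega>) * cos (\<Sum>t\<in>T. c2 t * X n t \<omega>) \<partial>M)) / 2)
      \<longlonglongrightarrow> ((\<integral>\<omega>. (cos (\<theta> * Y s \<omega>) ^ i * G \<omega>) * cos (\<Sum>t\<in>T. c1 t * Y t \<omega>) \<partial>N) +
        (\<integral>\<omega>. (cos (\<theta> * Y s \<omega>) ^ i * G \<omega>) * cos (\<Sum>t\<in>T. c2 t * Y t \<omega>) \<partial>N)) / 2"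
      by (intro tendsto_intros Suc) auto
    moreover have "(\<integral>\<omega>. (cos (\<theta> * X n s \<omega>) ^ Suc i * F n \<omega>) * cos (\<Sum>t\<in>T. c t * X n t \<omega>) \<partial>M) =
       ((\<integral>\<omega>. (cos (\<theta> * X n s \<omega>) ^ i * F n \<omega>) * cos (\<Sum>t\<in>T. c1 t * X n t \<omega>) \<partial>M) +
        (\<integral>\<omega>. (cos (\<theta> * X n s \<omega>) ^ i * F n \<omega>) * cos (\<Sum>t\<in>T. c2 t * X n t \<omega>) \<partial>M)) / 2" for n
      unfolding e[of "\<lambda>t. X n t _"] integral_divide_zero
      by (subst Bochner_Integration.integral_add) (auto intro!: Fi[OF _ pw])
    moreover have "(\<integral>\<omega>. (cos (\<theta> * Y s \<omega>) ^ Suc i * G \<omega>) * cos (\<Sum>t\<in>T. c t * Y t \<omega>) \<partial>N) =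
       ((\<integral>\<omega>. (cos (\<theta> * Y s \<omega>) ^ i * G \<omega>) * cos (\<Sum>t\<in>T. c1 t * Y t \<omega>) \<partial>N) +
        (\<integral>\<omega>. (cos (\<theta> * Y s \<omega>) ^ i * G \<omega>) * cos (\<Sum>t\<in>T. c2 t * Y t \<omega>) \<partial>N)) / 2"
      unfolding e[of "\<lambda>t. Y t _"] integral_divide_zero
      by (subst Bochner_Integration.integral_add) (auto intro!: Gi[OF _ pw])
    ultimately show ?case by (simp only:)
  qed
  show ?thesis
  proof (rule LIMSEQ_uniform_approx)
    fix e :: real assume "e > 0"
    \<comment> \<open>Dividing by B + 1 gives e' * B <= e also when B = 0.\<close>
    define e' where "e' = e / (B + 1)"
    have e': "e' > 0" "e' * B \<le> e" using \<open>e > 0\<close> B0 by (auto simp: e'_def field_simps)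
    obtain p where p: "real_polynomial_function p" "\<And>x. x \<in> {-1..1} \<Longrightarrow> \<bar>r x - p x\<bar> < e'"
      using Stone_Weierstrass_real_polynomial_function[OF compact_Icc, of "-1" 1 r e'] e'
        continuous_on_subset[OF r subset_UNIV] by auto
    from p(1) obtain a m where pa: "p = (\<lambda>x. \<Sum>i\<le>m. a i * x ^ i)"
      unfolding real_polynomial_function_iff_sum by auto
    have [measurable]: "p \<in> borel_measurable borel" "r \<in> borel_measurable borel"
      unfolding pa using r by (auto intro: borel_measurable_continuous_onI)
    have bnd: "\<exists>K. \<forall>x\<in>{-1..1}. \<bar>f x\<bar> \<le> K" if "continuous_on UNIV f" for f :: "real \<Rightarrow> real"
    proof -
      have "bounded (f ` {-1..1})"
        by (intro compact_imp_bounded compact_continuous_image continuous_on_subset[OF that]) auto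
      then show ?thesis by (auto simp: bounded_iff)
    qed
    obtain Kr where Kr: "\<And>x. x \<in> {-1..1} \<Longrightarrow> \<bar>r x\<bar> \<le> Kr" using bnd[OF r] by blast
    have "continuous_on UNIV p" unfolding pa by (intro continuous_intros)
    then obtain Kp where Kp: "\<And>x. x \<in> {-1..1} \<Longrightarrow> \<bar>p x\<bar> \<le> Kp" using bnd by metis
    have lim: "(\<lambda>n. \<Sum>i\<le>m. a i * (\<integral>\<omega>. (cos (\<theta> * X n s \<omega>) ^ i * F n \<omega>) * cos (\<Sum>t\<in>T. c t * X n t \<omega>) \<partial>M))
      \<longlonglongrightarrow> (\<Sum>i\<le>m. a i * (\<integral>\<omega>. (cos (\<theta> * Y s \<omega>) ^ i * G \<omega>) * cos (\<Sum>t\<in>T. c t * Y t \<omega>) \<partial>N))"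
      by (intro tendsto_intros monomial)
    have ep: "p x * f * y = (\<Sum>i\<le>m. a i * (x ^ i * f * y))" for x f y
      by (simp add: pa sum_distrib_right mult.assoc)
    have eX: "(\<Sum>i\<le>m. a i * (\<integral>\<omega>. (cos (\<theta> * X n s \<omega>) ^ i * F n \<omega>) * cos (\<Sum>t\<in>T. c t * X n t \<omega>) \<partial>M)) =
      (\<integral>\<omega>. (p (cos (\<theta> * X n s \<omega>)) * F n \<omega>) * cos (\<Sum>t\<in>T. c t * X n t \<omega>) \<partial>M)" for n
      unfolding ep by (subst Bochner_Integration.integral_sum) (auto intro!: Fi[OF _ pw])
    have eY: "(\<Sum>i\<le>m. a i * (\<integral>\<omega>. (cos (\<theta> * Y s \<omega>) ^ i * G \<omega>) * cos (\<Sum>t\<in>T. c t * Y t \<omega>) \<partial>N)) =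
      (\<integral>\<omega>. (p (cos (\<theta> * Y s \<omega>)) * G \<omega>) * cos (\<Sum>t\<in>T. c t * Y t \<omega>) \<partial>N)"
      unfolding ep by (subst Bochner_Integration.integral_sum) (auto intro!: Gi[OF _ pw])
    have d: "\<bar>r (cos x) * f * cos y - p (cos x) * f * cos y\<bar> \<le> e" if "\<bar>f\<bar> \<le> B" for x y f
    proof -
      have "\<bar>r (cos x) * f * cos y - p (cos x) * f * cos y\<bar> = \<bar>r (cos x) - p (cos x)\<bar> * \<bar>f\<bar> * \<bar>cos y\<bar>"
        by (simp add: abs_mult[symmetric] algebra_simps)
      also have "\<dots> \<le> e' * B * 1"
        using that p(2)[of "cos x"] by (intro mult_mono) auto
      finally show ?thesis using e' by simp
    qed
    have dX: "\<bar>(\<integral>\<omega>. (r (cos (\<theta> * X n s \<omega>)) * F n \<omega>) * cos (\<Sum>t\<in>T. c t * X n t \<omega>) \<partial>M) -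
      (\<integral>\<omega>. (p (cos (\<theta> * X n s \<omega>)) * F n \<omega>) * cos (\<Sum>t\<in>T. c t * X n t \<omega>) \<partial>M)\<bar> \<le> e" for n
    proof -
      have i: "integrable M (\<lambda>\<omega>. (r (cos (\<theta> * X n s \<omega>)) * F n \<omega>) * cos (\<Sum>t\<in>T. c t * X n t \<omega>))"
        "integrable M (\<lambda>\<omega>. (p (cos (\<theta> * X n s \<omega>)) * F n \<omega>) * cos (\<Sum>t\<in>T. c t * X n t \<omega>))"
        by (rule Fi, measurable, rule Kr, simp) (rule Fi, measurable, rule Kp, simp)
      show ?thesis
        unfolding Bochner_Integration.integral_diff[OF i, symmetric]
        by (intro order_trans[OF integral_abs_bound] M.integral_le_const)
           (use i d[OF Fb] in \<open>auto\<close>)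
    qed
    have dY: "\<bar>(\<integral>\<omega>. (r (cos (\<theta> * Y s \<omega>)) * G \<omega>) * cos (\<Sum>t\<in>T. c t * Y t \<omega>) \<partial>N) -
      (\<integral>\<omega>. (p (cos (\<theta> * Y s \<omega>)) * G \<omega>) * cos (\<Sum>t\<in>T. c t * Y t \<omega>) \<partial>N)\<bar> \<le> e"
    proof -
      have i: "integrable N (\<lambda>\<omega>. (r (cos (\<theta> * Y s \<omega>)) * G \<omega>) * cos (\<Sum>t\<in>T. c t * Y t \<omega>))"
        "integrable N (\<lambda>\<omega>. (p (cos (\<theta> * Y s \<omega>)) * G \<omega>) * cos (\<Sum>t\<in>T. c t * Y t \<omega>))"
        by (rule Gi, measurable, rule Kr, simp) (rule Gi, measurable, rule Kp, simp)
      show ?thesis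
        unfolding Bochner_Integration.integral_diff[OF i, symmetric]
        by (intro order_trans[OF integral_abs_bound] N.integral_le_const)
           (use i d[OF Gb] in \<open>auto\<close>)
    qed
    show "\<exists>a' b'. (a' \<longlonglongrightarrow> b') \<and>
      (\<forall>n. \<bar>(\<integral>\<omega>. (r (cos (\<theta> * X n s \<omega>)) * F n \<omega>) * cos (\<Sum>t\<in>T. c t * X n t \<omega>) \<partial>M) - a' n\<bar> \<le> e) \<and>
      \<bar>(\<integral>\<omega>. (r (cos (\<theta> * Y s \<omega>)) * G \<omega>) * cos (\<Sum>t\<in>T. c t * Y t \<omega>) \<partial>N) - b'\<bar> \<le> e"
      using lim dX dY unfolding eX eY by blast
  qed
qed

text \<open>One coordinate at a time: the induction over S keeps the full cosine factor over T with
  arbitrary coefficients, which is what \<open>cos_transform_mult\<close> consumes; zero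
  coefficients finally remove it.\<close>

lemma cos_transform_prod:
  fixes X :: "nat \<Rightarrow> 't \<Rightarrow> 'a \<Rightarrow> real" and Y :: "'t \<Rightarrow> 'b \<Rightarrow> real" and r :: "real \<Rightarrow> real"
  assumes M: "prob_space M" and N: "prob_space N" and T: "finite T"
    and X[measurable]: "\<And>n t. t \<in> T \<Longrightarrow> X n t \<in> borel_measurable M"
    and Y[measurable]: "\<And>t. t \<in> T \<Longrightarrow> Y t \<in> borel_measurable N"
    and conv: "\<And>c. (\<lambda>n. \<integral>\<omega>. cos (\<Sum>t\<in>T. c t * X n t \<omega>) \<partial>M) \<longlonglongrightarrow> (\<integral>\<omega>. cos (\<Sum>t\<in>T. c t * Y t \<omega>) \<partial>N)"
    and r: "continuous_on UNIV r" and rb: "\<And>x. 0 \<le> r x" "\<And>x. r x \<le> 1"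
  shows "(\<lambda>n. \<integral>\<omega>. (\<Prod>t\<in>T. r (cos (\<theta> * X n t \<omega>))) \<partial>M) \<longlonglongrightarrow> (\<integral>\<omega>. (\<Prod>t\<in>T. r (cos (\<theta> * Y t \<omega>))) \<partial>N)"
proof -
  have [measurable]: "r \<in> borel_measurable borel"
    using r by (rule borel_measurable_continuous_onI)
  have "(\<lambda>n. \<integral>\<omega>. (\<Prod>t\<in>S. r (cos (\<theta> * X n t \<omega>))) * cos (\<Sum>t\<in>T. c t * X n t \<omega>) \<partial>M)
     \<longlonglongrightarrow> (\<integral>\<omega>. (\<Prod>t\<in>S. r (cos (\<theta> * Y t \<omega>))) * cos (\<Sum>t\<in>T. c t * Y t \<omega>) \<partial>N)" if "S \<subseteq> T" for c S
    using finite_subset[OF that T] that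
  proof (induction S arbitrary: c)
    case empty
    then show ?case using conv by simp
  next
    case (insert s S)
    have [measurable]: "X n t \<in> borel_measurable M" "Y t \<in> borel_measurable N" if "t \<in> S" for t n
      using insert that X Y by auto
    have b: "\<bar>\<Prod>t\<in>S. r (cos (\<theta> * f t))\<bar> \<le> 1" for f
    proof -
      have "0 \<le> (\<Prod>t\<in>S. r (cos (\<theta> * f t)))" by (intro prod_nonneg) (auto intro: rb)
      moreover have "(\<Prod>t\<in>S. r (cos (\<theta> * f t))) \<le> 1" by (intro prod_le_1) (auto intro: rb)
      ultimately show ?thesis by simp
    qed
    show ?case unfolding prod.insert[OF insert(1,2)]
      by (rule cos_transform_mult[OF M N T, where B=1])
         (use insert X Y in \<open>auto intro: r b\<close>)
  qed
  from this[OF order_refl, of "\<lambda>_. 0"] show ?thesis by simp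
qed

text \<open>Composed with x -> cos (theta x) this is an even cutoff, 1 on |x| <= a and 0 for b < |x|
  <= pi / theta. As a function of the cosine it is periodic and equals 1 again further out; the
  estimates below therefore carry a tail term beyond pi / theta.\<close>

definition cos_bump :: "real \<Rightarrow> real \<Rightarrow> real \<Rightarrow> real \<Rightarrow> real" where
  "cos_bump \<theta> a b y = max 0 (min 1 ((y - cos (\<theta> * b)) / (cos (\<theta> * a) - cos (\<theta> * b))))"

lemma cos_bump:
  assumes "0 \<le> a" "a < b" "0 < \<theta>" "\<theta> * b < pi"
  shows "\<bar>x\<bar> \<le> a \<Longrightarrow> cos_bump \<theta> a b (cos (\<theta> * x)) = 1"
    and "\<bar>x\<bar> > b \<Longrightarrow> \<bar>x\<bar> \<le> pi / \<theta> \<Longrightarrow> cos_bump \<theta> a b (cos (\<theta> * x)) = 0"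
proof -
  have m: "cos (\<theta> * b) < cos (\<theta> * a)"
    using assms by (intro cos_monotone_0_pi) auto
  have c: "cos (\<theta> * x) = cos (\<theta> * \<bar>x\<bar>)" by (auto simp: abs_if)
  show "cos_bump \<theta> a b (cos (\<theta> * x)) = 1" if "\<bar>x\<bar> \<le> a"
  proof -
    have "cos (\<theta> * a) \<le> cos (\<theta> * \<bar>x\<bar>)"
    proof (rule cos_monotone_0_pi_le)
      show "\<theta> * a \<le> pi" using assms by (meson less_imp_le mult_left_mono order_trans)
    qed (use that assms in auto)
    then have "1 \<le> (cos (\<theta> * \<bar>x\<bar>) - cos (\<theta> * b)) / (cos (\<theta> * a) - cos (\<theta> * b))"
      using m by (simp add: le_divide_eq)
    then show ?thesis unfolding cos_bump_def c by simp
  qed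
  show "cos_bump \<theta> a b (cos (\<theta> * x)) = 0" if "\<bar>x\<bar> > b" "\<bar>x\<bar> \<le> pi / \<theta>"
  proof -
    have "cos (\<theta> * \<bar>x\<bar>) \<le> cos (\<theta> * b)"
      by (rule cos_monotone_0_pi_le) (use that assms in \<open>auto simp: field_simps\<close>)
    then have "(cos (\<theta> * \<bar>x\<bar>) - cos (\<theta> * b)) / (cos (\<theta> * a) - cos (\<theta> * b)) \<le> 0"
      using m by (simp add: divide_le_0_iff)
    then show ?thesis unfolding cos_bump_def c by simp
  qed
qed

lemma (in prob_space) cos_bump_sandwich:
  fixes X :: "'t \<Rightarrow> 'a \<Rightarrow> real"
  assumes ab: "0 \<le> a" "a < b" "0 < \<theta>" "\<theta> * b < pi" and T: "finite T"
    and X[measurable]: "\<And>t. t \<in> T \<Longrightarrow> X t \<in> borel_measurable M"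
  defines "f \<equiv> (\<lambda>\<omega>. \<Prod>t\<in>T. cos_bump \<theta> a b (cos (\<theta> * X t \<omega>)))"
  shows "prob {\<omega> \<in> space M. \<forall>t\<in>T. \<bar>X t \<omega>\<bar> \<le> a} \<le> expectation f"
    and "expectation f \<le> prob {\<omega> \<in> space M. \<forall>t\<in>T. \<bar>X t \<omega>\<bar> \<le> b} + prob {\<omega> \<in> space M. \<exists>t\<in>T. \<bar>X t \<omega>\<bar> > pi / \<theta>}"
proof -
  have [measurable]: "cos_bump \<theta> a b \<in> borel_measurable borel"
    unfolding cos_bump_def[abs_def] by measurable
  have r: "0 \<le> cos_bump \<theta> a b y" "cos_bump \<theta> a b y \<le> 1" for y
    by (auto simp: cos_bump_def)
  have f01: "0 \<le> f \<omega>" "f \<omega> \<le> 1" for \<omega>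
    unfolding f_def by (auto intro!: prod_nonneg prod_le_1 r)
  have fm[measurable]: "f \<in> borel_measurable M"
    unfolding f_def by (intro borel_measurable_prod) measurable
  have fi: "integrable M f"
    by (rule integrable_const_bound[where B=1]) (use f01 in auto)
  let ?A = "{\<omega> \<in> space M. \<forall>t\<in>T. \<bar>X t \<omega>\<bar> \<le> a}" and ?B = "{\<omega> \<in> space M. \<forall>t\<in>T. \<bar>X t \<omega>\<bar> \<le> b}"
  let ?C = "{\<omega> \<in> space M. \<exists>t\<in>T. \<bar>X t \<omega>\<bar> > pi / \<theta>}"
  have [measurable]: "?A \<in> sets M" "?B \<in> sets M" "?C \<in> sets M"
    using T by measurable
  have "prob ?A = expectation (indicator ?A)" by simp
  also have "\<dots> \<le> expectation f"
  proof (rule integral_mono[OF _ fi])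
    show "integrable M (indicator ?A :: 'a \<Rightarrow> real)" by (intro integrable_real_indicator) (auto simp: less_top[symmetric])
  next
    fix \<omega> show "indicator ?A \<omega> \<le> f \<omega>"
      using f01[of \<omega>] by (auto simp: indicator_def f_def cos_bump(1)[OF ab])
  qed
  finally show "prob ?A \<le> expectation f" .
  have "expectation f \<le> expectation (\<lambda>\<omega>. indicator ?B \<omega> + indicator ?C \<omega>)"
  proof (rule integral_mono[OF fi])
    show "integrable M (\<lambda>\<omega>. indicator ?B \<omega> + indicator ?C \<omega> :: real)"
      by (intro Bochner_Integration.integrable_add integrable_real_indicator) (auto simp: less_top[symmetric])
    fix \<omega> assume w: "\<omega> \<in> space M"
    show "f \<omega> \<le> indicator ?B \<omega> + indicator ?C \<omega>"
    proof (cases "\<omega> \<in> ?B \<or> \<omega> \<in> ?C")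
      case True
      then show ?thesis using f01(2)[of \<omega>] by (auto simp: indicator_def)
    next
      case False
      then obtain t where "t \<in> T" "\<bar>X t \<omega>\<bar> > b" "\<bar>X t \<omega>\<bar> \<le> pi / \<theta>" using w by force
      then have "f \<omega> = 0" unfolding f_def using T cos_bump(2)[OF ab] by (auto intro!: prod_zero)
      then show ?thesis by simp
    qed
  qed
  also have "\<dots> = prob ?B + prob ?C"
    by (subst Bochner_Integration.integral_add) (auto simp: less_top[symmetric] intro!: integrable_real_indicator)
  finally show "expectation f \<le> prob ?B + prob ?C" .
qed

lemma (in prob_space) tail_prob_small:
  fixes X :: "'t \<Rightarrow> 'a \<Rightarrow> real"
  assumes T: "finite T" and X[measurable]: "\<And>t. t \<in> T \<Longrightarrow> X t \<in> borel_measurable M" and "\<eta> > 0"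
  shows "\<exists>K>0. \<forall>L\<ge>K. prob {\<omega> \<in> space M. \<exists>t\<in>T. \<bar>X t \<omega>\<bar> > L} \<le> \<eta>"
proof -
  let ?A = "\<lambda>k::nat. {\<omega> \<in> space M. \<exists>t\<in>T. \<bar>X t \<omega>\<bar> > real k}"
  have m[measurable]: "{\<omega> \<in> space M. \<exists>t\<in>T. \<bar>X t \<omega>\<bar> > L} \<in> sets M" for L using T by measurable
  have "(\<lambda>k. prob (?A k)) \<longlonglongrightarrow> prob (\<Inter>k. ?A k)"
    by (intro finite_Lim_measure_decseq) (force simp: decseq_def intro: m)+
  moreover have "(\<Inter>k. ?A k) = {}"
  proof safe
    fix \<omega> assume w: "\<omega> \<in> (\<Inter>k. ?A k)"
    obtain k :: nat where k: "(\<Sum>t\<in>T. \<bar>X t \<omega>\<bar>) \<le> real k" using real_arch_simple by blast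
    from w obtain t where t: "t \<in> T" "\<bar>X t \<omega>\<bar> > real k" by auto
    have "\<bar>X t \<omega>\<bar> \<le> (\<Sum>t\<in>T. \<bar>X t \<omega>\<bar>)" using t T by (intro member_le_sum) auto
    then show "\<omega> \<in> {}" using k t by simp
  qed
  ultimately have "(\<lambda>k. prob (?A k)) \<longlonglongrightarrow> 0" by simp
  then have "\<forall>\<^sub>F k in sequentially. prob (?A k) < \<eta>" using \<open>\<eta> > 0\<close> by (rule order_tendstoD)
  then obtain k where k: "prob (?A k) < \<eta>" by (auto simp: eventually_sequentially)
  have "prob {\<omega> \<in> space M. \<exists>t\<in>T. \<bar>X t \<omega>\<bar> > L} \<le> \<eta>" if "L \<ge> real k + 1" for L
  proof -
    have "prob {\<omega> \<in> space M. \<exists>t\<in>T. \<bar>X t \<omega>\<bar> > L} \<le> prob (?A k)"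
      using that by (intro finite_measure_mono) force+
    then show ?thesis using k by simp
  qed
  then show ?thesis by (intro exI[of _ "real k + 1"]) auto
qed

text \<open>The periodic tail of the cutoff falls on the limit, a single finite family, whose tail
  is small by itself. Between a and b the cutoff interpolates, which is why the two levels
  differ.\<close>

lemma fdd_upper:
  fixes X :: "nat \<Rightarrow> 't \<Rightarrow> 'a \<Rightarrow> real" and Y :: "'t \<Rightarrow> 'b \<Rightarrow> real"
  assumes M: "prob_space M" and N: "prob_space N" and T: "finite T"
    and X: "\<And>n t. t \<in> T \<Longrightarrow> X n t \<in> borel_measurable M"
    and Y: "\<And>t. t \<in> T \<Longrightarrow> Y t \<in> borel_measurable N"
    and conv: "\<And>c. (\<lambda>n. \<integral>\<omega>. cos (\<Sum>t\<in>T. c t * X n t \<omega>) \<partial>M) \<longlonglongrightarrow> (\<integral>\<omega>. cos (\<Sum>t\<in>T. c t * Y t \<omega>) \<partial>N)"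
    and ab: "0 \<le> a" "a < b" and \<eta>: "\<eta> > 0"
  shows "\<forall>\<^sub>F n in sequentially. measure M {\<omega> \<in> space M. \<forall>t\<in>T. \<bar>X n t \<omega>\<bar> \<le> a} \<le>
    measure N {\<omega> \<in> space N. \<forall>t\<in>T. \<bar>Y t \<omega>\<bar> \<le> b} + \<eta>"
proof -
  interpret M: prob_space M by (rule M)
  interpret N: prob_space N by (rule N)
  obtain K where K: "K > 0" "\<And>L. L \<ge> K \<Longrightarrow> N.prob {\<omega> \<in> space N. \<exists>t\<in>T. \<bar>Y t \<omega>\<bar> > L} \<le> \<eta> / 2"
    using N.tail_prob_small[OF T, where X=Y and \<eta>="\<eta> / 2", OF Y] \<eta> by auto
  \<comment> \<open>Half a period of the cutoff: beyond the tail level K, and beyond b so that theta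
    b < pi.\<close>
  define L where "L = max K (b + 1)"
  define \<theta> where "\<theta> = pi / L"
  have L: "L > 0" "L \<ge> K" "L > b" using K ab by (auto simp: L_def)
  have \<theta>: "\<theta> > 0" "\<theta> * b < pi" "pi / \<theta> = L" using L by (auto simp: \<theta>_def field_simps)
  let ?r = "cos_bump \<theta> a b"
  have m: "cos (\<theta> * b) < cos (\<theta> * a)"
    using ab \<theta> by (intro cos_monotone_0_pi) auto
  have "(\<lambda>n. \<integral>\<omega>. (\<Prod>t\<in>T. ?r (cos (\<theta> * X n t \<omega>))) \<partial>M) \<longlonglongrightarrow> (\<integral>\<omega>. (\<Prod>t\<in>T. ?r (cos (\<theta> * Y t \<omega>))) \<partial>N)"
    by (rule cos_transform_prod[OF M N T X Y conv])
       (use m in \<open>auto simp: cos_bump_def[abs_def] intro!: continuous_intros\<close>)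
  then have "\<forall>\<^sub>F n in sequentially. (\<integral>\<omega>. (\<Prod>t\<in>T. ?r (cos (\<theta> * X n t \<omega>))) \<partial>M) < (\<integral>\<omega>. (\<Prod>t\<in>T. ?r (cos (\<theta> * Y t \<omega>))) \<partial>N) + \<eta> / 2"
    using \<eta> by (intro order_tendstoD) auto
  then show ?thesis
  proof eventually_elim
    case (elim n)
    show ?case
      using M.cos_bump_sandwich(1)[OF ab \<theta>(1,2) T, where X="X n", OF X]
        N.cos_bump_sandwich(2)[OF ab \<theta>(1,2) T, where X=Y, OF Y] K(2)[OF L(2)] elim unfolding \<theta>(3) by linarith
  qed
qed

text \<open>Mirror image of \<open>fdd_upper\<close>: the periodic tail now falls on the sequence,
  and \<open>tight\<close> bounds it for large n.\<close>

lemma fdd_lower: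
  fixes X :: "nat \<Rightarrow> 't \<Rightarrow> 'a \<Rightarrow> real" and Y :: "'t \<Rightarrow> 'b \<Rightarrow> real"
  assumes M: "prob_space M" and N: "prob_space N" and T: "finite T"
    and X: "\<And>n t. t \<in> T \<Longrightarrow> X n t \<in> borel_measurable M"
    and Y: "\<And>t. t \<in> T \<Longrightarrow> Y t \<in> borel_measurable N"
    and conv: "\<And>c. (\<lambda>n. \<integral>\<omega>. cos (\<Sum>t\<in>T. c t * X n t \<omega>) \<partial>M) \<longlonglongrightarrow> (\<integral>\<omega>. cos (\<Sum>t\<in>T. c t * Y t \<omega>) \<partial>N)"
    and tight: "\<And>\<eta>. \<eta> > 0 \<Longrightarrow> \<exists>K. \<forall>L\<ge>K. \<forall>\<^sub>F n in sequentially. measure M {\<omega> \<in> space M. \<exists>t\<in>T. \<bar>X n t \<omega>\<bar> > L} \<le> \<eta>"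
    and ab: "0 \<le> a" "a < b" and \<eta>: "\<eta> > 0"
  shows "\<forall>\<^sub>F n in sequentially. measure N {\<omega> \<in> space N. \<forall>t\<in>T. \<bar>Y t \<omega>\<bar> \<le> a} - \<eta> \<le>
    measure M {\<omega> \<in> space M. \<forall>t\<in>T. \<bar>X n t \<omega>\<bar> \<le> b}"
proof -
  interpret M: prob_space M by (rule M)
  interpret N: prob_space N by (rule N)
  obtain K where K: "\<And>L. L \<ge> K \<Longrightarrow> \<forall>\<^sub>F n in sequentially. M.prob {\<omega> \<in> space M. \<exists>t\<in>T. \<bar>X n t \<omega>\<bar> > L} \<le> \<eta> / 2"
    using tight[of "\<eta> / 2"] \<eta> by auto
  define L where "L = max K (b + 1)"
  define \<theta> where "\<theta> = pi / L"
  have L: "L > 0" "L \<ge> K" "L > b" using ab by (auto simp: L_def)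
  have \<theta>: "\<theta> > 0" "\<theta> * b < pi" "pi / \<theta> = L" using L by (auto simp: \<theta>_def field_simps)
  let ?r = "cos_bump \<theta> a b"
  have m: "cos (\<theta> * b) < cos (\<theta> * a)"
    using ab \<theta> by (intro cos_monotone_0_pi) auto
  have "(\<lambda>n. \<integral>\<omega>. (\<Prod>t\<in>T. ?r (cos (\<theta> * X n t \<omega>))) \<partial>M) \<longlonglongrightarrow> (\<integral>\<omega>. (\<Prod>t\<in>T. ?r (cos (\<theta> * Y t \<omega>))) \<partial>N)"
    by (rule cos_transform_prod[OF M N T X Y conv])
       (use m in \<open>auto simp: cos_bump_def[abs_def] intro!: continuous_intros\<close>)
  then have "\<forall>\<^sub>F n in sequentially. (\<integral>\<omega>. (\<Prod>t\<in>T. ?r (cos (\<theta> * X n t \<omega>))) \<partial>M) > (\<integral>\<omega>. (\<Prod>t\<in>T. ?r (cos (\<theta> * Y t \<omega>))) \<partial>N) - \<eta> / 2"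
    using \<eta> by (intro order_tendstoD) auto
  then show ?thesis using K[OF L(2)]
  proof eventually_elim
    case (elim n)
    show ?case
      using M.cos_bump_sandwich(2)[OF ab \<theta>(1,2) T, where X="X n", OF X]
        N.cos_bump_sandwich(1)[OF ab \<theta>(1,2) T, where X=Y, OF Y] elim unfolding \<theta>(3) by linarith
  qed
qed

section \<open>Second moments of two-sample sums\<close>

lemma integrable_mult_square:
  fixes f g :: "'a \<Rightarrow> real"
  assumes [measurable]: "f \<in> borel_measurable M" "g \<in> borel_measurable M"
    and "integrable M (\<lambda>x. (f x)\<^sup>2)" "integrable M (\<lambda>x. (g x)\<^sup>2)"
  shows "integrable M (\<lambda>x. f x * g x)"
proof (rule Bochner_Integration.integrable_bound)
  show "integrable M (\<lambda>x. (f x)\<^sup>2 + (g x)\<^sup>2)" using assms by auto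
  have "\<bar>a * b\<bar> \<le> a\<^sup>2 + b\<^sup>2" for a b :: real
  proof -
    have "2 * \<bar>a\<bar> * \<bar>b\<bar> \<le> a\<^sup>2 + b\<^sup>2" "0 \<le> \<bar>a\<bar> * \<bar>b\<bar>"
      using sum_squares_bound[of "\<bar>a\<bar>" "\<bar>b\<bar>"] by auto
    then show ?thesis unfolding abs_mult by linarith
  qed
  then show "AE x in M. norm (f x * g x) \<le> norm ((f x)\<^sup>2 + (g x)\<^sup>2)" by auto
qed measurable

lemma integrable_square_add:
  fixes f g :: "'a \<Rightarrow> real"
  assumes [measurable]: "f \<in> borel_measurable M" "g \<in> borel_measurable M"
    and "integrable M (\<lambda>x. (f x)\<^sup>2)" "integrable M (\<lambda>x. (g x)\<^sup>2)"
  shows "integrable M (\<lambda>x. (f x + g x)\<^sup>2)"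
  using assms integrable_mult_square[OF assms] by (simp add: power2_sum mult.assoc)

lemma integral_square_sum:
  fixes Z :: "'p \<Rightarrow> 'a \<Rightarrow> real"
  assumes [measurable]: "\<And>p. p \<in> P \<Longrightarrow> Z p \<in> borel_measurable M"
    and Z: "\<And>p. p \<in> P \<Longrightarrow> integrable M (\<lambda>x. (Z p x)\<^sup>2)"
  shows "integrable M (\<lambda>x. (\<Sum>p\<in>P. Z p x)\<^sup>2)"
    and "(\<integral>x. (\<Sum>p\<in>P. Z p x)\<^sup>2 \<partial>M) = (\<Sum>p\<in>P. \<Sum>q\<in>P. \<integral>x. Z p x * Z q x \<partial>M)"
proof -
  have e: "(\<Sum>p\<in>P. Z p x)\<^sup>2 = (\<Sum>p\<in>P. \<Sum>q\<in>P. Z p x * Z q x)" for x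
    by (simp add: power2_eq_square sum_product)
  have i: "integrable M (\<lambda>x. Z p x * Z q x)" if "p \<in> P" "q \<in> P" for p q
    using that by (intro integrable_mult_square Z) auto
  show "integrable M (\<lambda>x. (\<Sum>p\<in>P. Z p x)\<^sup>2)"
    unfolding e by (intro Bochner_Integration.integrable_sum i)
  show "(\<integral>x. (\<Sum>p\<in>P. Z p x)\<^sup>2 \<partial>M) = (\<Sum>p\<in>P. \<Sum>q\<in>P. \<integral>x. Z p x * Z q x \<partial>M)"
    unfolding e by (subst Bochner_Integration.integral_sum, intro Bochner_Integration.integrable_sum i)
      (auto intro!: sum.cong Bochner_Integration.integral_sum i)
qed

lemma (in prob_space) expectation_square_sum_indep:
  fixes Y :: "'i \<Rightarrow> 'a \<Rightarrow> real" and v :: real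
  assumes ind: "indep_vars (\<lambda>_. borel) Y I" and I: "finite I"
    and sq: "\<And>i. i \<in> I \<Longrightarrow> integrable M (\<lambda>\<omega>. (Y i \<omega>)\<^sup>2)"
    and mean: "\<And>i. i \<in> I \<Longrightarrow> expectation (Y i) = 0"
    and var: "\<And>i. i \<in> I \<Longrightarrow> expectation (\<lambda>\<omega>. (Y i \<omega>)\<^sup>2) = v"
  shows "integrable M (\<lambda>\<omega>. (\<Sum>i\<in>I. Y i \<omega>)\<^sup>2)"
    and "expectation (\<lambda>\<omega>. (\<Sum>i\<in>I. Y i \<omega>)\<^sup>2) = card I * v"
proof -
  have m[measurable]: "Y i \<in> borel_measurable M" if "i \<in> I" for i
    using ind that by (auto simp: indep_vars_def)
  have int: "integrable M (Y i)" if "i \<in> I" for i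
    by (rule square_integrable_imp_integrable[OF m[OF that] sq[OF that]])
  show "integrable M (\<lambda>\<omega>. (\<Sum>i\<in>I. Y i \<omega>)\<^sup>2)" by (intro integral_square_sum sq) auto
  have z: "expectation (\<lambda>\<omega>. Y i \<omega> * Y j \<omega>) = (if j = i then v else 0)" if ij: "i \<in> I" "j \<in> I" for i j
  proof (cases "i = j")
    case True
    then show ?thesis using var[OF ij(1)] by (simp add: power2_eq_square)
  next
    case False
    have "indep_vars (\<lambda>_. borel) Y {i, j}" by (rule indep_vars_subset[OF ind]) (use ij in auto)
    then have "expectation (\<lambda>\<omega>. \<Prod>k\<in>{i, j}. Y k \<omega>) = (\<Prod>k\<in>{i, j}. expectation (Y k))"
      by (intro indep_vars_lebesgue_integral) (use int ij in auto)
    then show ?thesis using mean ij False by simp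
  qed
  have "expectation (\<lambda>\<omega>. (\<Sum>i\<in>I. Y i \<omega>)\<^sup>2) = (\<Sum>i\<in>I. \<Sum>j\<in>I. expectation (\<lambda>\<omega>. Y i \<omega> * Y j \<omega>))"
    by (intro integral_square_sum sq) auto
  also have "\<dots> = (\<Sum>i\<in>I. \<Sum>j\<in>I. if j = i then v else 0)" by (intro sum.cong z refl)
  also have "\<dots> = card I * v" using I by simp
  finally show "expectation (\<lambda>\<omega>. (\<Sum>i\<in>I. Y i \<omega>)\<^sup>2) = card I * v" .
qed

lemma (in prob_space) chebyshev_second_moment:
  fixes f :: "'a \<Rightarrow> real" and v x :: real
  assumes [measurable]: "f \<in> borel_measurable M" and "integrable M (\<lambda>\<omega>. (f \<omega>)\<^sup>2)" and "x > (0::real)"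
    and "expectation (\<lambda>\<omega>. (f \<omega>)\<^sup>2) \<le> v"
  shows "prob {\<omega> \<in> space M. \<bar>f \<omega>\<bar> \<ge> x} \<le> v / x\<^sup>2"
proof -
  have "prob {\<omega> \<in> space M. \<bar>f \<omega>\<bar> \<ge> x} = prob {\<omega> \<in> space M. (f \<omega>)\<^sup>2 \<ge> x\<^sup>2}"
    using assms(3) abs_le_square_iff[of x] by simp
  also have "\<dots> \<le> expectation (\<lambda>\<omega>. (f \<omega>)\<^sup>2) / x\<^sup>2"
    using assms by (intro integral_Markov_inequality_measure[OF assms(2), of "{}"]) auto
  also have "\<dots> \<le> v / x\<^sup>2" using assms by (intro divide_right_mono) auto
  finally show ?thesis .
qed

lemma (in prob_space) indep_var_distr_pair:
  assumes ind: "indep_var S A T B" and f[measurable]: "f \<in> S \<rightarrow>\<^sub>M S'" and g[measurable]: "g \<in> T \<rightarrow>\<^sub>M T'"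
  shows "distr M (S' \<Otimes>\<^sub>M T') (\<lambda>\<omega>. (f (A \<omega>), g (B \<omega>))) = distr M S' (\<lambda>\<omega>. f (A \<omega>)) \<Otimes>\<^sub>M distr M T' (\<lambda>\<omega>. g (B \<omega>))"
proof -
  have A[measurable]: "A \<in> M \<rightarrow>\<^sub>M S" and B[measurable]: "B \<in> M \<rightarrow>\<^sub>M T"
    using indep_var_rv1[OF ind] indep_var_rv2[OF ind] by auto
  interpret gB: prob_space "distr (distr M T B) T' g"
    by (intro prob_space.prob_space_distr prob_space_distr) auto
  have "distr M S' (\<lambda>\<omega>. f (A \<omega>)) \<Otimes>\<^sub>M distr M T' (\<lambda>\<omega>. g (B \<omega>)) =
      distr (distr M S A) S' f \<Otimes>\<^sub>M distr (distr M T B) T' g"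
    by (simp add: distr_distr comp_def)
  also have "\<dots> = distr (distr M S A \<Otimes>\<^sub>M distr M T B) (S' \<Otimes>\<^sub>M T') (\<lambda>(x, y). (f x, g y))"
    by (intro pair_measure_distr) (auto intro: gB.sigma_finite_measure_axioms)
  also have "distr M S A \<Otimes>\<^sub>M distr M T B = distr M (S \<Otimes>\<^sub>M T) (\<lambda>x. (A x, B x))"
    using ind by (simp add: indep_var_distribution_eq)
  also have "distr \<dots> (S' \<Otimes>\<^sub>M T') (\<lambda>(x, y). (f x, g y)) = distr M (S' \<Otimes>\<^sub>M T') (\<lambda>\<omega>. (f (A \<omega>), g (B \<omega>)))"
    by (subst distr_distr) (auto simp: comp_def)
  finally show ?thesis by simp
qed

text \<open>Fubini with X integrated first: for fixed (Y, W) the factor W comes out and the inner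
  integral of rho vanishes. With another value of the kernel as W this gives orthogonality of two
  kernel values that may share the variable Y but not X.\<close>

lemma (in prob_space) expectation_mult_conditionally_centered:
  fixes \<rho> :: "real \<times> real \<Rightarrow> real" and X Y W :: "'a \<Rightarrow> real"
  assumes law: "distr M (borel \<Otimes>\<^sub>M (borel \<Otimes>\<^sub>M borel)) (\<lambda>\<omega>. (X \<omega>, (Y \<omega>, W \<omega>))) =
      distr M borel X \<Otimes>\<^sub>M distr M (borel \<Otimes>\<^sub>M borel) (\<lambda>\<omega>. (Y \<omega>, W \<omega>))"
    and [measurable]: "X \<in> borel_measurable M" "Y \<in> borel_measurable M" "W \<in> borel_measurable M"
    and \<rho>[measurable]: "\<rho> \<in> borel_measurable (borel \<Otimes>\<^sub>M borel)"
    and zero: "AE y in distr M borel Y. (\<integral>x. \<rho> (y, x) \<partial>distr M borel X) = 0"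
    and int: "integrable M (\<lambda>\<omega>. \<rho> (Y \<omega>, X \<omega>) * W \<omega>)"
  shows "expectation (\<lambda>\<omega>. \<rho> (Y \<omega>, X \<omega>) * W \<omega>) = (0::real)"
proof -
  let ?D = "distr M borel X" and ?L = "distr M (borel \<Otimes>\<^sub>M borel) (\<lambda>\<omega>. (Y \<omega>, W \<omega>))"
  interpret D: prob_space ?D by (rule prob_space_distr) simp
  interpret L: prob_space ?L by (rule prob_space_distr) simp
  interpret DL: pair_prob_space ?D ?L ..
  let ?F = "\<lambda>(x, z). \<rho> (fst z, x) * snd z"
  have F[measurable]: "?F \<in> borel_measurable (borel \<Otimes>\<^sub>M (borel \<Otimes>\<^sub>M borel))"
    by measurable
  have iF: "integrable (?D \<Otimes>\<^sub>M ?L) ?F"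
    unfolding law[symmetric] by (subst integrable_distr_eq) (use int in auto)
  have "expectation (\<lambda>\<omega>. \<rho> (Y \<omega>, X \<omega>) * W \<omega>) = (\<integral>p. ?F p \<partial>(?D \<Otimes>\<^sub>M ?L))"
    unfolding law[symmetric] by (subst integral_distr) auto
  also have "\<dots> = (\<integral>z. (\<integral>x. ?F (x, z) \<partial>?D) \<partial>?L)"
    using DL.integral_snd[of "\<lambda>x z. \<rho> (fst z, x) * snd z"] iF by (simp add: case_prod_unfold)
  also have "\<dots> = (\<integral>z. 0 \<partial>?L)"
  proof (rule integral_cong_AE)
    have "AE \<omega> in M. (\<integral>x. \<rho> (Y \<omega>, x) \<partial>?D) = 0"
      using zero by (subst (asm) AE_distr_iff) auto
    then have "AE z in ?L. (\<integral>x. \<rho> (fst z, x) \<partial>?D) = 0"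
      by (subst AE_distr_iff) auto
    then show "AE z in ?L. (\<integral>x. ?F (x, z) \<partial>?D) = 0" by auto
  qed auto
  finally show ?thesis by simp
qed

section \<open>Second moments of kernel sums over index rectangles of an i.i.d. sample\<close>

locale iid_sample = prob_space M for M :: "'a measure" +
  fixes \<xi> :: "nat \<Rightarrow> 'a \<Rightarrow> real" and D :: "real measure"
  assumes indep: "indep_vars (\<lambda>_. borel) \<xi> {1..}"
    and law: "\<And>i. i \<ge> 1 \<Longrightarrow> distr M borel (\<xi> i) = D"
begin

lemma xi_measurable[measurable]: "i \<ge> 1 \<Longrightarrow> \<xi> i \<in> borel_measurable M"
  using indep by (auto simp: indep_vars_def)

lemma sets_D[measurable_cong, simp]: "sets D = sets borel"
  using law[of 1] by auto

lemma space_D[simp]: "space D = UNIV"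
  using law[of 1] by auto

sublocale D: prob_space D
  using law[of 1] prob_space_distr[of "\<xi> 1" borel] by auto

sublocale DD: pair_prob_space D D ..

lemma distr_pair:
  assumes "i \<ge> 1" "j \<ge> 1" "i \<noteq> j"
  shows "distr M (borel \<Otimes>\<^sub>M borel) (\<lambda>\<omega>. (\<xi> j \<omega>, \<xi> i \<omega>)) = D \<Otimes>\<^sub>M D"
proof -
  have "indep_var borel (\<xi> j) borel (\<xi> i)"
  proof -
    have "indep_vars (\<lambda>_. borel) \<xi> {i, j}" by (rule indep_vars_subset[OF indep]) (use assms in auto)
    then have "indep_var (PiM {j} (\<lambda>_. borel)) (\<lambda>\<omega>. restrict (\<lambda>i. \<xi> i \<omega>) {j}) (PiM {i} (\<lambda>_. borel)) (\<lambda>\<omega>. restrict (\<lambda>i. \<xi> i \<omega>) {i})"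
      using assms by (intro indep_var_restrict) auto
    then have "indep_var borel ((\<lambda>f. f j) \<circ> (\<lambda>\<omega>. restrict (\<lambda>i. \<xi> i \<omega>) {j})) borel ((\<lambda>f. f i) \<circ> (\<lambda>\<omega>. restrict (\<lambda>i. \<xi> i \<omega>) {i}))"
      by (rule indep_var_compose) auto
    then show ?thesis by (simp add: comp_def)
  qed
  then show ?thesis using law assms by (simp add: indep_var_distribution_eq)
qed

lemma kernel_expectation:
  fixes K :: "real \<times> real \<Rightarrow> real"
  assumes "i \<ge> 1" "j \<ge> 1" "i \<noteq> j" and [measurable]: "K \<in> borel_measurable (borel \<Otimes>\<^sub>M borel)"
  shows "expectation (\<lambda>\<omega>. K (\<xi> j \<omega>, \<xi> i \<omega>)) = (\<integral>p. K p \<partial>(D \<Otimes>\<^sub>M D))"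
    and "integrable M (\<lambda>\<omega>. K (\<xi> j \<omega>, \<xi> i \<omega>)) \<longleftrightarrow> integrable (D \<Otimes>\<^sub>M D) K"
  unfolding distr_pair[OF assms(1-3), symmetric]
  by (subst integral_distr; use assms in auto) (subst integrable_distr_eq; use assms in auto)

lemma distr_one_pair:
  fixes w :: "real \<times> real \<Rightarrow> real"
  assumes ijkl: "i \<ge> 1" "j \<ge> 1" "k \<ge> 1" "l \<ge> 1" "i \<notin> {j, k, l}"
    and [measurable]: "w \<in> borel_measurable (borel \<Otimes>\<^sub>M borel)"
  shows "distr M (borel \<Otimes>\<^sub>M (borel \<Otimes>\<^sub>M borel)) (\<lambda>\<omega>. (\<xi> i \<omega>, (\<xi> j \<omega>, w (\<xi> k \<omega>, \<xi> l \<omega>)))) =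
    distr M borel (\<xi> i) \<Otimes>\<^sub>M distr M (borel \<Otimes>\<^sub>M borel) (\<lambda>\<omega>. (\<xi> j \<omega>, w (\<xi> k \<omega>, \<xi> l \<omega>)))"
proof -
  have iv: "indep_var (PiM {i} (\<lambda>_. borel)) (\<lambda>\<omega>. restrict (\<lambda>i. \<xi> i \<omega>) {i}) (PiM {j,k,l} (\<lambda>_. borel)) (\<lambda>\<omega>. restrict (\<lambda>i. \<xi> i \<omega>) {j,k,l})"
    using assms by (intro indep_var_restrict[OF indep]) auto
  have "(\<lambda>f. f i) \<in> PiM {i} (\<lambda>_. borel) \<rightarrow>\<^sub>M (borel :: real measure)"
    "(\<lambda>f. (f j, w (f k, f l))) \<in> PiM {j,k,l} (\<lambda>_. borel) \<rightarrow>\<^sub>M (borel \<Otimes>\<^sub>M borel)"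
    by measurable
  from indep_var_distr_pair[OF iv this] show ?thesis by simp
qed

lemma indep_var_pairs:
  fixes v w :: "real \<times> real \<Rightarrow> real"
  assumes "i \<ge> 1" "j \<ge> 1" "k \<ge> 1" "l \<ge> 1" "{i, j} \<inter> {k, l} = {}"
    and [measurable]: "v \<in> borel_measurable (borel \<Otimes>\<^sub>M borel)" "w \<in> borel_measurable (borel \<Otimes>\<^sub>M borel)"
  shows "indep_var borel (\<lambda>\<omega>. v (\<xi> i \<omega>, \<xi> j \<omega>)) borel (\<lambda>\<omega>. w (\<xi> k \<omega>, \<xi> l \<omega>))"
proof -
  have "indep_var (PiM {i,j} (\<lambda>_. borel)) (\<lambda>\<omega>. restrict (\<lambda>i. \<xi> i \<omega>) {i,j}) (PiM {k,l} (\<lambda>_. borel)) (\<lambda>\<omega>. restrict (\<lambda>i. \<xi> i \<omega>) {k,l})"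
    using assms by (intro indep_var_restrict[OF indep]) auto
  then have "indep_var borel ((\<lambda>f. v (f i, f j)) \<circ> (\<lambda>\<omega>. restrict (\<lambda>i. \<xi> i \<omega>) {i,j})) borel
     ((\<lambda>f. w (f k, f l)) \<circ> (\<lambda>\<omega>. restrict (\<lambda>i. \<xi> i \<omega>) {k,l}))"
    by (rule indep_var_compose) measurable
  then show ?thesis by (simp add: comp_def)
qed

text \<open>Two different pairs (i, j) and (k, l) differ in one index, and since I and J are
  disjoint, that index of the first pair occurs in only one of the two kernel values; integrating it
  out gives zero. The summands are orthogonal and their second moments add exactly.\<close>

lemma degenerate_second_moment:
  fixes \<rho> :: "real \<times> real \<Rightarrow> real"
  assumes \<rho>[measurable]: "\<rho> \<in> borel_measurable (borel \<Otimes>\<^sub>M borel)"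
    and sq: "integrable (D \<Otimes>\<^sub>M D) (\<lambda>p. (\<rho> p)\<^sup>2)"
    and zero1: "AE y in D. (\<integral>x. \<rho> (y, x) \<partial>D) = 0" and zero2: "AE x in D. (\<integral>y. \<rho> (y, x) \<partial>D) = 0"
    and IJ: "finite I" "finite J" "I \<subseteq> {1..}" "J \<subseteq> {1..}" "I \<inter> J = {}"
  shows "integrable M (\<lambda>\<omega>. (\<Sum>i\<in>I. \<Sum>j\<in>J. \<rho> (\<xi> j \<omega>, \<xi> i \<omega>))\<^sup>2)"
    and "expectation (\<lambda>\<omega>. (\<Sum>i\<in>I. \<Sum>j\<in>J. \<rho> (\<xi> j \<omega>, \<xi> i \<omega>))\<^sup>2) = card I * card J * (\<integral>p. (\<rho> p)\<^sup>2 \<partial>(D \<Otimes>\<^sub>M D))"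
proof -
  define Z where "Z p \<omega> = \<rho> (\<xi> (snd p) \<omega>, \<xi> (fst p) \<omega>)" for p \<omega>
  define v where "v = (\<integral>p. (\<rho> p)\<^sup>2 \<partial>(D \<Otimes>\<^sub>M D))"
  have ge: "i \<ge> 1" "j \<ge> 1" "i \<noteq> j" if "i \<in> I" "j \<in> J" for i j
    using that IJ by (auto simp: subset_eq)
  have Zm[measurable]: "Z p \<in> borel_measurable M" if "p \<in> I \<times> J" for p
    unfolding Z_def using ge[of "fst p" "snd p"] that by (auto intro!: measurable_compose[OF _ \<rho>])
  have Zi: "integrable M (\<lambda>\<omega>. (Z p \<omega>)\<^sup>2)" "expectation (\<lambda>\<omega>. (Z p \<omega>)\<^sup>2) = v" if "p \<in> I \<times> J" for p
    unfolding Z_def v_def using kernel_expectation[of "fst p" "snd p" "\<lambda>p. (\<rho> p)\<^sup>2"] ge[of "fst p" "snd p"] that sq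
    by auto
  have rect: "(\<Sum>i\<in>I. \<Sum>j\<in>J. \<rho> (\<xi> j \<omega>, \<xi> i \<omega>)) = (\<Sum>p\<in>I \<times> J. Z p \<omega>)" for \<omega>
    by (simp add: sum.cartesian_product Z_def case_prod_beta)
  have orth: "expectation (\<lambda>\<omega>. Z p \<omega> * Z q \<omega>) = (if q = p then v else 0)" if pq: "p \<in> I \<times> J" "q \<in> I \<times> J" for p q
  proof -
    obtain i j k l where p: "p = (i, j)" and q: "q = (k, l)" and mem: "i \<in> I" "j \<in> J" "k \<in> I" "l \<in> J"
      using pq by auto
    note g = ge[OF mem(1,2)] ge[OF mem(3,4)] ge[OF mem(1,4)] ge[OF mem(3,2)]
    have int: "integrable M (\<lambda>\<omega>. Z p \<omega> * Z q \<omega>)"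
      using pq by (intro integrable_mult_square Zi) auto
    consider "i \<noteq> k" | "i = k" "j \<noteq> l" | "p = q" using p q by auto
    then show ?thesis
    proof cases
      case 1
      have "expectation (\<lambda>\<omega>. \<rho> (\<xi> j \<omega>, \<xi> i \<omega>) * \<rho> (\<xi> l \<omega>, \<xi> k \<omega>)) = 0"
        by (rule expectation_mult_conditionally_centered[OF distr_one_pair])
          (use g 1 int zero1 law in \<open>auto simp: Z_def p q\<close>)
      then show ?thesis using 1 by (simp add: Z_def p q)
    next
      case 2
      \<comment> \<open>Here j is the free index, so the kernel is read with its arguments exchanged
        to bring the free variable into second place.\<close>
      have "expectation (\<lambda>\<omega>. (\<lambda>p. \<rho> (snd p, fst p)) (\<xi> i \<omega>, \<xi> j \<omega>) * \<rho> (\<xi> l \<omega>, \<xi> k \<omega>)) = 0"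
        by (rule expectation_mult_conditionally_centered[OF distr_one_pair])
          (use g 2 int zero2 law in \<open>auto simp: Z_def p q\<close>)
      then show ?thesis using 2 by (simp add: Z_def p q)
    next
      case 3
      then show ?thesis using Zi(2)[OF pq(1)] by (simp add: power2_eq_square)
    qed
  qed
  show "integrable M (\<lambda>\<omega>. (\<Sum>i\<in>I. \<Sum>j\<in>J. \<rho> (\<xi> j \<omega>, \<xi> i \<omega>))\<^sup>2)"
    unfolding rect by (intro integral_square_sum Zi) auto
  have "expectation (\<lambda>\<omega>. (\<Sum>p\<in>I \<times> J. Z p \<omega>)\<^sup>2) = (\<Sum>p\<in>I \<times> J. \<Sum>q\<in>I \<times> J. expectation (\<lambda>\<omega>. Z p \<omega> * Z q \<omega>))"
    by (intro integral_square_sum Zi) auto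
  also have "\<dots> = (\<Sum>p\<in>I \<times> J. \<Sum>q\<in>I \<times> J. if q = p then v else 0)"
    by (intro sum.cong orth refl)
  also have "\<dots> = card I * card J * v" using IJ by (simp add: card_cartesian_product)
  finally show "expectation (\<lambda>\<omega>. (\<Sum>i\<in>I. \<Sum>j\<in>J. \<rho> (\<xi> j \<omega>, \<xi> i \<omega>))\<^sup>2) = card I * card J * (\<integral>p. (\<rho> p)\<^sup>2 \<partial>(D \<Otimes>\<^sub>M D))"
    unfolding rect v_def .
qed

text \<open>Without degeneracy only pairs with disjoint indices are uncorrelated. A given pair
  shares its first index with card J pairs and its second with card I pairs, and each such product
  has expectation at most C^2.\<close>

lemma bounded_second_moment:
  fixes K :: "real \<times> real \<Rightarrow> real"
  assumes K[measurable]: "K \<in> borel_measurable (borel \<Otimes>\<^sub>M borel)"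
    and Kb: "\<And>p. \<bar>K p\<bar> \<le> C" and mean: "(\<integral>p. K p \<partial>(D \<Otimes>\<^sub>M D)) = 0"
    and IJ: "finite I" "finite J" "I \<subseteq> {1..}" "J \<subseteq> {1..}" "I \<inter> J = {}"
  shows "integrable M (\<lambda>\<omega>. (\<Sum>i\<in>I. \<Sum>j\<in>J. K (\<xi> j \<omega>, \<xi> i \<omega>))\<^sup>2)"
    and "expectation (\<lambda>\<omega>. (\<Sum>i\<in>I. \<Sum>j\<in>J. K (\<xi> j \<omega>, \<xi> i \<omega>))\<^sup>2) \<le> C\<^sup>2 * (card I * card J * (card I + card J))"
proof -
  define Z where "Z p \<omega> = K (\<xi> (snd p) \<omega>, \<xi> (fst p) \<omega>)" for p \<omega>
  have ge: "i \<ge> 1" "j \<ge> 1" "i \<noteq> j" if "i \<in> I" "j \<in> J" for i j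
    using that IJ by (auto simp: subset_eq)
  have Zm[measurable]: "Z p \<in> borel_measurable M" if "p \<in> I \<times> J" for p
    unfolding Z_def using ge[of "fst p" "snd p"] that by (auto intro!: measurable_compose[OF _ K])
  have Zb: "\<bar>Z p \<omega>\<bar> \<le> C" for p \<omega> unfolding Z_def by (rule Kb)
  have C0: "C \<ge> 0" using Kb[of undefined] by linarith
  have ZZb: "\<bar>Z p \<omega> * Z q \<omega>\<bar> \<le> C\<^sup>2" for p q \<omega>
    unfolding abs_mult power2_eq_square by (intro mult_mono Zb C0) auto
  have ZZi: "integrable M (\<lambda>\<omega>. Z p \<omega> * Z q \<omega>)" if "p \<in> I \<times> J" "q \<in> I \<times> J" for p q
    by (rule integrable_const_bound[where B="C\<^sup>2"]) (use that ZZb in auto)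
  have Z2: "integrable M (\<lambda>\<omega>. (Z p \<omega>)\<^sup>2)" if "p \<in> I \<times> J" for p
    using ZZi[OF that that] by (simp add: power2_eq_square)
  have Zi: "integrable M (Z p)" "expectation (Z p) = 0" if "p \<in> I \<times> J" for p
  proof -
    show "integrable M (Z p)" by (rule integrable_const_bound[where B=C]) (use that Zb in auto)
    show "expectation (Z p) = 0"
      unfolding Z_def using kernel_expectation[of "fst p" "snd p" K] ge[of "fst p" "snd p"] that mean by auto
  qed
  have rect: "(\<Sum>i\<in>I. \<Sum>j\<in>J. K (\<xi> j \<omega>, \<xi> i \<omega>)) = (\<Sum>p\<in>I \<times> J. Z p \<omega>)" for \<omega>
    by (simp add: sum.cartesian_product Z_def case_prod_beta)
  have cov: "expectation (\<lambda>\<omega>. Z p \<omega> * Z q \<omega>) \<le> C\<^sup>2 * ((if fst q = fst p then 1 else 0) + (if snd q = snd p then 1 else 0))"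
    if pq: "p \<in> I \<times> J" "q \<in> I \<times> J" for p q
  proof (cases "fst q = fst p \<or> snd q = snd p")
    case True
    have "expectation (\<lambda>\<omega>. Z p \<omega> * Z q \<omega>) \<le> C\<^sup>2"
      by (intro integral_le_const ZZi pq AE_I2 order_trans[OF abs_ge_self ZZb])
    also have "\<dots> \<le> C\<^sup>2 * ((if fst q = fst p then 1 else 0) + (if snd q = snd p then 1 else 0))"
      using True by auto
    finally show ?thesis .
  next
    case False
    obtain i j k l where p: "p = (i, j)" and q: "q = (k, l)" and mem: "i \<in> I" "j \<in> J" "k \<in> I" "l \<in> J"
      using pq by auto
    have "indep_var borel (\<lambda>\<omega>. K (\<xi> j \<omega>, \<xi> i \<omega>)) borel (\<lambda>\<omega>. K (\<xi> l \<omega>, \<xi> k \<omega>))"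
      by (rule indep_var_pairs) (use False ge mem IJ p q in auto)
    then have "indep_var borel (Z p) borel (Z q)" by (simp add: Z_def[abs_def] p q)
    from indep_var_lebesgue_integral[OF this Zi(1)[OF pq(1)] Zi(1)[OF pq(2)]] show ?thesis
      using Zi(2)[OF pq(1)] False by simp
  qed
  show "integrable M (\<lambda>\<omega>. (\<Sum>i\<in>I. \<Sum>j\<in>J. K (\<xi> j \<omega>, \<xi> i \<omega>))\<^sup>2)"
    unfolding rect by (intro integral_square_sum Z2) auto
  have "expectation (\<lambda>\<omega>. (\<Sum>p\<in>I \<times> J. Z p \<omega>)\<^sup>2) = (\<Sum>p\<in>I \<times> J. \<Sum>q\<in>I \<times> J. expectation (\<lambda>\<omega>. Z p \<omega> * Z q \<omega>))"
    by (intro integral_square_sum Z2) auto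
  also have "\<dots> \<le> (\<Sum>p\<in>I \<times> J. \<Sum>q\<in>I \<times> J. C\<^sup>2 * ((if fst q = fst p then 1 else 0) + (if snd q = snd p then 1 else 0)))"
    by (intro sum_mono cov)
  also have "\<dots> = (\<Sum>p\<in>I \<times> J. C\<^sup>2 * (card J + card I))"
  proof (rule sum.cong[OF refl])
    fix p assume p: "p \<in> I \<times> J"
    have "(\<Sum>q\<in>I \<times> J. (if fst q = fst p then 1 else 0) + (if snd q = snd p then 1 else (0::real)))
      = (\<Sum>k\<in>I. \<Sum>l\<in>J. (if k = fst p then 1 else 0) + (if l = snd p then 1 else 0))"
      by (simp add: sum.cartesian_product case_prod_beta)
    also have "\<dots> = (\<Sum>k\<in>I. real (card J) * (if k = fst p then 1 else 0) + 1)"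
      using p IJ by (intro sum.cong) (auto simp: sum.distrib)
    also have "\<dots> = real (card J + card I)"
      using p IJ by (simp add: sum.distrib sum_distrib_left[symmetric] mem_Times_iff)
    finally show "(\<Sum>q\<in>I \<times> J. C\<^sup>2 * ((if fst q = fst p then 1 else 0) + (if snd q = snd p then 1 else 0))) = C\<^sup>2 * (card J + card I)"
      by (simp add: sum_distrib_left[symmetric])
  qed
  also have "\<dots> = C\<^sup>2 * (card I * card J * (card I + card J))"
    by (simp add: card_cartesian_product algebra_simps)
  finally show "expectation (\<lambda>\<omega>. (\<Sum>i\<in>I. \<Sum>j\<in>J. K (\<xi> j \<omega>, \<xi> i \<omega>))\<^sup>2) \<le> C\<^sup>2 * (card I * card J * (card I + card J))"
    unfolding rect .
qed

end

section \<open>Tied-down sums near the end points\<close>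

lemma (in prob_space) indep_vars_reindex_inj:
  fixes X :: "'i \<Rightarrow> 'a \<Rightarrow> real"
  assumes ind: "indep_vars (\<lambda>_. borel) X I" and f: "inj_on f L" "f ` L \<subseteq> I"
  shows "indep_vars (\<lambda>_. borel) (\<lambda>j. X (f j)) L"
proof -
  have "indep_vars (\<lambda>j. PiM {f j} (\<lambda>_. borel)) (\<lambda>j \<omega>. restrict (\<lambda>i. X i \<omega>) {f j}) L"
    by (rule indep_vars_restrict[OF ind]) (use f in \<open>auto simp: disjoint_family_on_def inj_on_def\<close>)
  then have "indep_vars (\<lambda>_. borel) (\<lambda>j \<omega>. (\<lambda>g. g (f j)) (restrict (\<lambda>i. X i \<omega>) {f j})) L"
    by (rule indep_vars_compose2) auto
  then show ?thesis by (simp add: fun_eq_iff[symmetric])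
qed

definition partial_sum :: "(nat \<Rightarrow> 'a \<Rightarrow> real) \<Rightarrow> nat \<Rightarrow> 'a \<Rightarrow> real" where
  "partial_sum Y k \<omega> = (\<Sum>i\<in>{1..k}. Y i \<omega>)"

text \<open>Discrete Brownian bridge. Multiplied by n it is the double sum of Y i - Y j over i <= k
  < j <= n, that is, the linear part of the two-sample sum.\<close>

definition tied_down :: "(nat \<Rightarrow> 'a \<Rightarrow> real) \<Rightarrow> nat \<Rightarrow> nat \<Rightarrow> 'a \<Rightarrow> real" where
  "tied_down Y n k \<omega> = partial_sum Y k \<omega> - real k / real n * partial_sum Y n \<omega>"

text \<open>A finite row instead of an infinite sequence, so that the row read backwards and blocks
  of consecutive variables are instances as well.\<close>

locale centered_row = prob_space M for M :: "'a measure" +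
  fixes Y :: "nat \<Rightarrow> 'a \<Rightarrow> real" and n :: nat and v :: real
  assumes row_indep: "indep_vars (\<lambda>_. borel) Y {1..n}"
    and row_square: "\<And>i. i \<in> {1..n} \<Longrightarrow> integrable M (\<lambda>\<omega>. (Y i \<omega>)\<^sup>2)"
    and row_mean: "\<And>i. i \<in> {1..n} \<Longrightarrow> expectation (Y i) = 0"
    and row_var: "\<And>i. i \<in> {1..n} \<Longrightarrow> expectation (\<lambda>\<omega>. (Y i \<omega>)\<^sup>2) = v"
    and v_nonneg: "v \<ge> 0"
begin

lemma row_measurable[measurable]: "i \<in> {1..n} \<Longrightarrow> Y i \<in> borel_measurable M"
  using row_indep by (auto simp: indep_vars_def)

lemma partial_sum_measurable[measurable]: "k \<le> n \<Longrightarrow> partial_sum Y k \<in> borel_measurable M"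
  unfolding partial_sum_def by (intro borel_measurable_sum row_measurable) auto

lemma tied_down_measurable[measurable]: "k \<le> n \<Longrightarrow> tied_down Y n k \<in> borel_measurable M"
  unfolding tied_down_def by (intro borel_measurable_diff borel_measurable_times partial_sum_measurable) auto

lemma block_tail:
  assumes I: "I \<subseteq> {1..n}" and c: "c > 0"
  shows "prob {\<omega> \<in> space M. \<bar>\<Sum>i\<in>I. Y i \<omega>\<bar> \<ge> c} \<le> card I * v / c\<^sup>2"
proof (rule chebyshev_second_moment)
  have fI: "finite I" using finite_subset[OF I] by auto
  have ind: "indep_vars (\<lambda>_. borel) Y I" by (rule indep_vars_subset[OF row_indep I])
  show "(\<lambda>\<omega>. \<Sum>i\<in>I. Y i \<omega>) \<in> borel_measurable M" using I by (intro borel_measurable_sum) auto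
  show "integrable M (\<lambda>\<omega>. (\<Sum>i\<in>I. Y i \<omega>)\<^sup>2)"
    by (rule expectation_square_sum_indep(1)[OF ind fI row_square row_mean row_var]) (use I in auto)
  show "expectation (\<lambda>\<omega>. (\<Sum>i\<in>I. Y i \<omega>)\<^sup>2) \<le> card I * v"
    using expectation_square_sum_indep(2)[OF ind fI row_square row_mean row_var] I by (simp add: subset_eq)
qed (rule c)

text \<open>Ottaviani with Chebyshev's bound beta = r v / c^2: if beta >= 1/2 the right side is at
  least 1, otherwise the factor 1 - beta costs at most 2.\<close>

lemma partial_sum_maximal:
  assumes c: "c > 0" and r: "r \<le> n"
  shows "prob {\<omega> \<in> space M. \<exists>k\<le>r. \<bar>partial_sum Y k \<omega>\<bar> \<ge> 2 * c} \<le> 2 * (r * v / c\<^sup>2)"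
proof (cases "r * v / c\<^sup>2 \<ge> 1 / 2")
  case True
  then have "1 \<le> 2 * (r * v / c\<^sup>2)" by linarith
  then show ?thesis by (rule order_trans[OF prob_le_1])
next
  case False
  let ?P = "prob {\<omega> \<in> space M. \<exists>k\<le>r. \<bar>partial_sum Y k \<omega>\<bar> \<ge> 2 * c}"
  have "(1 - r * v / c\<^sup>2) * ?P \<le> prob {\<omega> \<in> space M. \<bar>\<Sum>i\<in>{1..r}. Y i \<omega>\<bar> \<ge> c}"
    unfolding partial_sum_def
  proof (rule ottaviani_inequality)
    show "indep_vars (\<lambda>_. borel) Y {1..r}" by (rule indep_vars_subset[OF row_indep]) (use r in auto)
    fix k assume "k \<le> r"
    have [measurable]: "(\<lambda>\<omega>. \<Sum>i\<in>{k<..r}. Y i \<omega>) \<in> borel_measurable M"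
      using r by (intro borel_measurable_sum row_measurable) auto
    have "prob {\<omega> \<in> space M. \<bar>\<Sum>i\<in>{k<..r}. Y i \<omega>\<bar> > c} \<le> prob {\<omega> \<in> space M. \<bar>\<Sum>i\<in>{k<..r}. Y i \<omega>\<bar> \<ge> c}"
      by (intro finite_measure_mono) auto
    also have "\<dots> \<le> card {k<..r} * v / c\<^sup>2"
      by (rule block_tail[OF _ c]) (use r in auto)
    also have "\<dots> \<le> r * v / c\<^sup>2"
      using v_nonneg by (intro divide_right_mono mult_right_mono) auto
    finally show "prob {\<omega> \<in> space M. \<bar>\<Sum>i\<in>{k<..r}. Y i \<omega>\<bar> > c} \<le> r * v / c\<^sup>2" .
  qed
  also have "\<dots> \<le> card {1..r} * v / c\<^sup>2" by (rule block_tail[OF _ c]) (use r in auto)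
  finally have "(1 - r * v / c\<^sup>2) * ?P \<le> r * v / c\<^sup>2" by simp
  moreover have "1 / 2 * ?P \<le> (1 - r * v / c\<^sup>2) * ?P" using False by (intro mult_right_mono) auto
  ultimately show ?thesis by linarith
qed

end

lemma powr_square: "((x::real) powr a)\<^sup>2 = x powr (2 * a)"
  by (simp add: power2_eq_square powr_add[symmetric])

lemma sum_dyadic_powr_le:
  fixes p x :: real
  assumes p: "p > 0" and x: "x > 0"
  shows "(\<Sum>j\<in>{j. 2 ^ j \<le> x}. (2 ^ j) powr p) \<le> 2 powr p / (2 powr p - 1) * x powr p"
    and "finite {j. 2 ^ j \<le> x}"
proof -
  define r :: real where "r = 2 powr p"
  have r: "r > 1" using p by (simp add: r_def)
  have jr: "(2 ^ j) powr p = r ^ j" for j :: nat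
    by (simp add: r_def powr_realpow[symmetric] powr_powr mult.commute)
  have "finite {j. 2 ^ j \<le> x} \<and> (\<Sum>j\<in>{j. 2 ^ j \<le> x}. (2 ^ j) powr p) \<le> r / (r - 1) * x powr p"
  proof (cases "x \<ge> 1")
    case True
    define m where "m = nat \<lfloor>log 2 x\<rfloor>"
    have "0 \<le> log 2 x" using True by simp
    then have m: "real m \<le> log 2 x" "log 2 x < real m + 1" unfolding m_def by linarith+
    have "2 powr real m \<le> 2 powr log 2 x" using m by simp
    then have mx: "2 ^ m \<le> x" using x by (simp add: powr_realpow)
    have sub: "{j. 2 ^ j \<le> x} \<subseteq> {..m}"
    proof safe
      fix j :: nat assume "2 ^ j \<le> x"
      then have "real j \<le> log 2 x" using x by (simp add: le_log_iff powr_realpow)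
      then show "j \<le> m" using m by linarith
    qed
    have "(\<Sum>j\<in>{j. 2 ^ j \<le> x}. (2 ^ j) powr p) \<le> (\<Sum>j\<le>m. (2 ^ j) powr p)"
      by (rule sum_mono2) (use sub in auto)
    also have "\<dots> = (\<Sum>j\<le>m. r ^ j)" by (simp add: jr)
    also have "\<dots> = (r ^ Suc m - 1) / (r - 1)"
      using r geometric_sum[of r "Suc m"] by (simp only: lessThan_Suc_atMost)
    also have "\<dots> \<le> r ^ Suc m / (r - 1)" using r by (intro divide_right_mono) auto
    also have "\<dots> = r / (r - 1) * (2 ^ m) powr p" by (simp add: jr)
    also have "\<dots> \<le> r / (r - 1) * x powr p"
      using r mx p by (intro mult_left_mono powr_mono2) auto
    finally show ?thesis using finite_subset[OF sub] by auto
  next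
    case False
    have "{j. 2 ^ j \<le> x} = {}"
    proof safe
      fix j :: nat assume "2 ^ j \<le> x"
      moreover have "(1::real) \<le> 2 ^ j" by simp
      ultimately show "j \<in> {}" using False by linarith
    qed
    then show ?thesis using r by simp
  qed
  then show "finite {j. 2 ^ j \<le> x}" "(\<Sum>j\<in>{j. 2 ^ j \<le> x}. (2 ^ j) powr p) \<le> 2 powr p / (2 powr p - 1) * x powr p"
    unfolding r_def by auto
qed

text \<open>The first summand collects the dyadic blocks of \<open>left_end\<close>: 64 = 2 * 2 * 16
  from the maximal inequality, the block length 2 * 2^j and the threshold epsilon / 4, times the
  constant of a geometric sum of ratio 2^(1 - 2 gamma). The 4 is Chebyshev's bound for the term
  (k/n) S_n.\<close>

definition end_const :: "real \<Rightarrow> real" where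
  "end_const \<gamma> = 64 * (2 powr (1 - 2 * \<gamma>) / (2 powr (1 - 2 * \<gamma>) - 1)) + 4"

text \<open>On a dyadic block 2^j <= k < 2^(j+1) the weight is at least its value at the left end,
  and the maximal inequality gives a bound of order (2^j / n)^(1 - 2 gamma). As 1 - 2 gamma > 0, the
  sum over the blocks is governed by the largest one, of order delta^(1 - 2 gamma) independently of
  n.\<close>

lemma (in centered_row) left_end:
  fixes \<gamma> \<delta> \<epsilon> :: real
  assumes n: "n \<ge> 1" and \<gamma>: "0 < \<gamma>" "\<gamma> < 1 / 2" and \<delta>: "0 < \<delta>" "\<delta> \<le> 1 / 2" and \<epsilon>: "\<epsilon> > 0"
  shows "prob {\<omega> \<in> space M. \<exists>k\<in>{1..n}. k \<le> \<delta> * n \<and> \<bar>tied_down Y n k \<omega>\<bar> \<ge> \<epsilon> * sqrt n * (k / n) powr \<gamma>}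
    \<le> end_const \<gamma> * v * \<delta> powr (1 - 2 * \<gamma>) / \<epsilon>\<^sup>2"
proof -
  define p where "p = 1 - 2 * \<gamma>"
  have p: "0 < p" "p < 1" using \<gamma> by (auto simp: p_def)
  define Q where "Q = {j::nat. 2 ^ j \<le> \<delta> * n}"
  have n0: "real n > 0" "\<delta> * n > 0" using n \<delta> by auto
  have fQ: "finite Q" unfolding Q_def using sum_dyadic_powr_le(2)[OF p(1) n0(2)] .
  \<comment> \<open>2 * c j is half the threshold at the left end of block j; the other half is left
    for the term (k/n) S_n.\<close>
  define c where "c j = \<epsilon> / 4 * sqrt n * (2 ^ j / n) powr \<gamma>" for j :: nat
  have c0: "c j > 0" for j using \<epsilon> n0 by (simp add: c_def)
  have c2: "(c j)\<^sup>2 = \<epsilon>\<^sup>2 / 16 * n * (2 ^ j / n) powr (2 * \<gamma>)" for j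
    by (simp add: c_def power_mult_distrib power_divide powr_square)
  \<comment> \<open>Since gamma < 1, (k/n)^(gamma - 1) >= delta^(gamma - 1) for all k <= delta n, so
    |S_n| < d makes (k/n) |S_n| smaller than half the threshold for all these k at once.\<close>
  define d where "d = \<epsilon> / 2 * sqrt n * \<delta> powr (\<gamma> - 1)"
  have d0: "d > 0" using \<epsilon> n0 \<delta> by (simp add: d_def)
  define E where "E j = {\<omega> \<in> space M. \<exists>k\<le>2 ^ Suc j. \<bar>partial_sum Y k \<omega>\<bar> \<ge> 2 * c j}" for j
  define F where "F = {\<omega> \<in> space M. \<bar>\<Sum>i\<in>{1..n}. Y i \<omega>\<bar> \<ge> d}"
  have le: "2 ^ Suc j \<le> n" if "j \<in> Q" for j
  proof -
    have "2 ^ j \<le> \<delta> * n" using that by (simp add: Q_def)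
    also have "\<dots> \<le> 1 / 2 * n" using \<delta> by (intro mult_right_mono) auto
    finally have "real (2 ^ Suc j) \<le> real n" by simp
    then show ?thesis by linarith
  qed
  have Em: "E j \<in> sets M" if "j \<in> Q" for j
  proof -
    have "E j = (\<Union>k\<in>{..2 ^ Suc j}. {\<omega> \<in> space M. 2 * c j \<le> \<bar>partial_sum Y k \<omega>\<bar>})" by (auto simp: E_def)
    moreover have "{\<omega> \<in> space M. 2 * c j \<le> \<bar>partial_sum Y k \<omega>\<bar>} \<in> sets M" if "k \<le> 2 ^ Suc j" for k
    proof -
      have "partial_sum Y k \<in> borel_measurable M"
        using le[OF \<open>j \<in> Q\<close>] that by (intro partial_sum_measurable) linarith
      then show ?thesis by measurable
    qed
    ultimately show ?thesis by auto
  qed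
  have Fm: "F \<in> sets M" unfolding F_def by measurable
  have sub: "{\<omega> \<in> space M. \<exists>k\<in>{1..n}. k \<le> \<delta> * n \<and> \<bar>tied_down Y n k \<omega>\<bar> \<ge> \<epsilon> * sqrt n * (k / n) powr \<gamma>} \<subseteq> (\<Union>j\<in>Q. E j) \<union> F"
  proof safe
    fix \<omega> k assume w: "\<omega> \<in> space M" and k: "k \<in> {1..n}" "k \<le> \<delta> * n"
      and t: "\<epsilon> * sqrt n * (k / n) powr \<gamma> \<le> \<bar>tied_down Y n k \<omega>\<bar>" and nF: "\<omega> \<notin> F"
    obtain j where j: "2 ^ j \<le> k" "k < 2 ^ (j + 1)" using ex_power_ivl1[of 2 k] k by auto
    have jr: "(2::real) ^ j \<le> k" using j(1) by (metis of_nat_le_iff of_nat_numeral of_nat_power)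
    have jQ: "j \<in> Q" using k(2) jr unfolding Q_def mem_Collect_eq by linarith
    have kn: "0 < k / n" "k / n \<le> \<delta>" using k n0 by (auto simp: field_simps)
    have "k / n * \<bar>partial_sum Y n \<omega>\<bar> < \<epsilon> / 2 * sqrt n * (k / n) powr \<gamma>"
    proof -
      have "\<bar>partial_sum Y n \<omega>\<bar> < d" using nF w by (simp add: F_def partial_sum_def not_le)
      also have "d \<le> \<epsilon> / 2 * sqrt n * (k / n) powr (\<gamma> - 1)"
        unfolding d_def using kn \<gamma> \<epsilon> by (intro mult_left_mono powr_mono2') auto
      finally have "k / n * \<bar>partial_sum Y n \<omega>\<bar> < k / n * (\<epsilon> / 2 * sqrt n * (k / n) powr (\<gamma> - 1))"
        using kn by (intro mult_strict_left_mono) auto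
      also have "\<dots> = \<epsilon> / 2 * sqrt n * (k / n) powr \<gamma>"
        using kn by (simp add: powr_diff)
      finally show ?thesis .
    qed
    moreover have "\<bar>tied_down Y n k \<omega>\<bar> \<le> \<bar>partial_sum Y k \<omega>\<bar> + k / n * \<bar>partial_sum Y n \<omega>\<bar>"
    proof -
      have e: "\<bar>k / n * partial_sum Y n \<omega>\<bar> = k / n * \<bar>partial_sum Y n \<omega>\<bar>" using kn by (simp add: abs_mult)
      show ?thesis unfolding tied_down_def
        by (rule order_trans[OF abs_triangle_ineq4]) (unfold e, rule order_refl)
    qed
    ultimately have "\<epsilon> / 2 * sqrt n * (k / n) powr \<gamma> \<le> \<bar>partial_sum Y k \<omega>\<bar>" using t by linarith
    moreover have "2 * c j \<le> \<epsilon> / 2 * sqrt n * (k / n) powr \<gamma>"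
    proof -
      have "(2 ^ j / n) powr \<gamma> \<le> (k / n) powr \<gamma>"
        using jr n0 \<gamma> by (intro powr_mono2 divide_right_mono) auto
      then have "\<epsilon> / 2 * sqrt n * (2 ^ j / n) powr \<gamma> \<le> \<epsilon> / 2 * sqrt n * (k / n) powr \<gamma>"
        using \<epsilon> by (intro mult_left_mono) auto
      then show ?thesis by (simp add: c_def)
    qed
    ultimately have "2 * c j \<le> \<bar>partial_sum Y k \<omega>\<bar>" by linarith
    then have "\<omega> \<in> E j" using w j by (auto simp: E_def intro!: exI[of _ k])
    then show "\<omega> \<in> (\<Union>j\<in>Q. E j)" using jQ by auto
  qed
  have pE: "prob (E j) \<le> 64 * v / \<epsilon>\<^sup>2 / n powr p * (2 ^ j) powr p" if "j \<in> Q" for j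
  proof -
    have "prob (E j) \<le> 2 * (2 ^ Suc j * v / (c j)\<^sup>2)"
      unfolding E_def using partial_sum_maximal[OF c0 le[OF that]] by simp
    also have "\<dots> = 64 * v / \<epsilon>\<^sup>2 * (2 ^ j / n / (2 ^ j / n) powr (2 * \<gamma>))"
      unfolding c2 by (simp add: field_simps)
    also have "2 ^ j / n / (2 ^ j / n) powr (2 * \<gamma>) = (2 ^ j / n) powr p"
      using n0 by (simp add: p_def powr_diff)
    also have "\<dots> = (2 ^ j) powr p / n powr p" using n0 by (simp add: powr_divide)
    finally show ?thesis by simp
  qed
  have "prob {\<omega> \<in> space M. \<exists>k\<in>{1..n}. k \<le> \<delta> * n \<and> \<bar>tied_down Y n k \<omega>\<bar> \<ge> \<epsilon> * sqrt n * (k / n) powr \<gamma>} \<le> prob ((\<Union>j\<in>Q. E j) \<union> F)"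
    by (intro finite_measure_mono sub sets.Un sets.finite_UN fQ Em Fm)
  also have "\<dots> \<le> prob (\<Union>j\<in>Q. E j) + prob F"
    by (intro measure_Un_le sets.finite_UN fQ Em Fm)
  also have "prob (\<Union>j\<in>Q. E j) \<le> (\<Sum>j\<in>Q. prob (E j))"
    by (intro finite_measure_subadditive_finite fQ) (use Em in auto)
  also have "\<dots> \<le> (\<Sum>j\<in>Q. 64 * v / \<epsilon>\<^sup>2 / n powr p * (2 ^ j) powr p)"
    by (intro sum_mono pE)
  also have "\<dots> = 64 * v / \<epsilon>\<^sup>2 / n powr p * (\<Sum>j\<in>Q. (2 ^ j) powr p)"
    by (simp add: sum_distrib_left)
  also have "\<dots> \<le> 64 * v / \<epsilon>\<^sup>2 / n powr p * (2 powr p / (2 powr p - 1) * (\<delta> * n) powr p)"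
    using sum_dyadic_powr_le(1)[OF p(1) n0(2)] v_nonneg unfolding Q_def by (intro mult_left_mono) auto
  also have "\<dots> = 64 * (2 powr p / (2 powr p - 1)) * v * \<delta> powr p / \<epsilon>\<^sup>2"
    using n0 \<delta> by (simp add: powr_mult ac_simps)
  also have "prob F \<le> 4 * v * \<delta> powr p / \<epsilon>\<^sup>2"
  proof -
    have "prob F \<le> card {1..n} * v / d\<^sup>2" unfolding F_def by (rule block_tail[OF _ d0]) auto
    also have "\<dots> = 4 * v / \<epsilon>\<^sup>2 / \<delta> powr (2 * (\<gamma> - 1))"
      using n0 by (simp add: d_def power_mult_distrib power_divide powr_square)
    also have "\<dots> = 4 * v / \<epsilon>\<^sup>2 * \<delta> powr (2 - 2 * \<gamma>)"
      by (simp add: powr_minus_divide[of \<delta> "2 * (\<gamma> - 1)", symmetric] divide_inverse powr_minus[symmetric])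
    also have "\<dots> \<le> 4 * v / \<epsilon>\<^sup>2 * \<delta> powr p"
      using \<delta> v_nonneg by (intro mult_left_mono powr_mono') (auto simp: p_def)
    finally show ?thesis by simp
  qed
  finally show ?thesis unfolding end_const_def p_def[symmetric] by (simp add: algebra_simps add_divide_distrib)
qed

text \<open>Time reversal: for the row read backwards the tied-down sum at k is minus the tied-down
  sum of Y at n - k, so \<open>left_end\<close> applies to the reversed row.\<close>

lemma (in centered_row) right_end:
  fixes \<gamma> \<delta> \<epsilon> :: real
  assumes n: "n \<ge> 1" and \<gamma>: "0 < \<gamma>" "\<gamma> < 1 / 2" and \<delta>: "0 < \<delta>" "\<delta> \<le> 1 / 2" and \<epsilon>: "\<epsilon> > 0"
  shows "prob {\<omega> \<in> space M. \<exists>k\<in>{1..n}. k \<le> \<delta> * n \<and> \<bar>tied_down Y n (n - k) \<omega>\<bar> \<ge> \<epsilon> * sqrt n * (k / n) powr \<gamma>}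
    \<le> end_const \<gamma> * v * \<delta> powr (1 - 2 * \<gamma>) / \<epsilon>\<^sup>2"
proof -
  define Y' where "Y' i = Y (Suc n - i)" for i
  interpret R: centered_row M Y' n v
  proof
    show "indep_vars (\<lambda>_. borel) Y' {1..n}"
      unfolding Y'_def by (rule indep_vars_reindex_inj[OF row_indep]) (auto simp: inj_on_def)
  next
    fix i assume "i \<in> {1..n}"
    then have "Suc n - i \<in> {1..n}" by auto
    then show "integrable M (\<lambda>\<omega>. (Y' i \<omega>)\<^sup>2)" "expectation (Y' i) = 0" "expectation (\<lambda>\<omega>. (Y' i \<omega>)\<^sup>2) = v"
      unfolding Y'_def by (rule row_square row_mean row_var)+
  qed (rule v_nonneg)
  have S: "partial_sum Y' k \<omega> = partial_sum Y n \<omega> - partial_sum Y (n - k) \<omega>" if "k \<le> n" for k \<omega>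
  proof -
    have "partial_sum Y' k \<omega> = (\<Sum>i\<in>{n - k<..n}. Y i \<omega>)"
      unfolding partial_sum_def Y'_def
      by (rule sum.reindex_bij_witness[of _ "\<lambda>i. Suc n - i" "\<lambda>i. Suc n - i"]) (use that in auto)
    moreover have "partial_sum Y n \<omega> = partial_sum Y (n - k) \<omega> + (\<Sum>i\<in>{n - k<..n}. Y i \<omega>)"
      unfolding partial_sum_def by (subst sum.union_disjoint[symmetric]) (use that in \<open>auto intro!: sum.cong\<close>)
    ultimately show ?thesis by simp
  qed
  have T: "\<bar>tied_down Y' n k \<omega>\<bar> = \<bar>tied_down Y n (n - k) \<omega>\<bar>" if "k \<in> {1..n}" for k \<omega>
  proof -
    have "partial_sum Y 0 \<omega> = 0" by (simp add: partial_sum_def)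
    then have "tied_down Y' n k \<omega> = - tied_down Y n (n - k) \<omega>"
    proof -
      have e: "real (n - k) / n = 1 - k / n" using that n by (simp add: of_nat_diff field_simps)
      show ?thesis using that \<open>partial_sum Y 0 \<omega> = 0\<close> S[of k \<omega>] S[of n \<omega>]
        unfolding tied_down_def e by (simp add: algebra_simps)
    qed
    then show ?thesis by simp
  qed
  have "(\<exists>k\<in>{1..n}. k \<le> \<delta> * n \<and> \<bar>tied_down Y' n k \<omega>\<bar> \<ge> \<epsilon> * sqrt n * (k / n) powr \<gamma>) =
    (\<exists>k\<in>{1..n}. k \<le> \<delta> * n \<and> \<bar>tied_down Y n (n - k) \<omega>\<bar> \<ge> \<epsilon> * sqrt n * (k / n) powr \<gamma>)" for \<omega>
    by (rule bex_cong[OF refl]) (simp only: T)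
  with R.left_end[OF assms] show ?thesis by (simp only:)
qed

lemma (in centered_row) both_ends:
  fixes \<gamma> \<delta> \<epsilon> :: real
  assumes n: "n \<ge> 1" and \<gamma>: "0 < \<gamma>" "\<gamma> < 1 / 2" and \<delta>: "0 < \<delta>" "\<delta> \<le> 1 / 2" and \<epsilon>: "\<epsilon> > 0"
  shows "prob {\<omega> \<in> space M. \<exists>k\<in>{1..<n}. (k \<le> \<delta> * n \<or> real n - k \<le> \<delta> * n) \<and>
      \<bar>tied_down Y n k \<omega>\<bar> \<ge> \<epsilon> * sqrt n * (k / n * (1 - k / n)) powr \<gamma>}
    \<le> 8 * end_const \<gamma> * v * \<delta> powr (1 - 2 * \<gamma>) / \<epsilon>\<^sup>2"
proof -
  have n0: "real n > 0" using n by auto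
  define L where "L = {\<omega> \<in> space M. \<exists>k\<in>{1..n}. k \<le> \<delta> * n \<and> \<bar>tied_down Y n k \<omega>\<bar> \<ge> (\<epsilon> / 2) * sqrt n * (k / n) powr \<gamma>}"
  define R where "R = {\<omega> \<in> space M. \<exists>k\<in>{1..n}. k \<le> \<delta> * n \<and> \<bar>tied_down Y n (n - k) \<omega>\<bar> \<ge> (\<epsilon> / 2) * sqrt n * (k / n) powr \<gamma>}"
  have Lm: "L \<in> sets M" unfolding L_def
    by (intro sets.sets_Collect_finite_Ex sets.sets_Collect) (auto intro!: borel_measurable_le tied_down_measurable)
  have Rm: "R \<in> sets M" unfolding R_def
    by (intro sets.sets_Collect_finite_Ex sets.sets_Collect) (auto intro!: borel_measurable_le tied_down_measurable)
  \<comment> \<open>The factor of the weight that belongs to the far end is at least (1/2)^gamma >=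
    1/2, so epsilon is halved; the square of this 2 and the two ends give the constant 8.\<close>
  have half: "\<epsilon> * sqrt n * (x * y) powr \<gamma> \<ge> \<epsilon> / 2 * sqrt n * x powr \<gamma>" if "x \<ge> 0" "y \<ge> 1 / 2" for x y
  proof -
    have "(1 / 2) powr 1 \<le> y powr \<gamma>"
    proof -
      have "(1 / 2) powr 1 \<le> (1 / 2 :: real) powr \<gamma>" using \<gamma> by (intro powr_mono') auto
      also have "\<dots> \<le> y powr \<gamma>" using that \<gamma> by (intro powr_mono2) auto
      finally show ?thesis .
    qed
    then have "\<epsilon> * sqrt n * x powr \<gamma> * (1 / 2) \<le> \<epsilon> * sqrt n * x powr \<gamma> * y powr \<gamma>"
      using \<epsilon> by (intro mult_left_mono) auto
    then show ?thesis using that by (simp add: powr_mult)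
  qed
  have "prob {\<omega> \<in> space M. \<exists>k\<in>{1..<n}. (k \<le> \<delta> * n \<or> real n - k \<le> \<delta> * n) \<and>
      \<bar>tied_down Y n k \<omega>\<bar> \<ge> \<epsilon> * sqrt n * (k / n * (1 - k / n)) powr \<gamma>} \<le> prob (L \<union> R)"
  proof (intro finite_measure_mono subsetI)
    fix \<omega> assume "\<omega> \<in> {\<omega> \<in> space M. \<exists>k\<in>{1..<n}. (k \<le> \<delta> * n \<or> real n - k \<le> \<delta> * n) \<and>
      \<bar>tied_down Y n k \<omega>\<bar> \<ge> \<epsilon> * sqrt n * (k / n * (1 - k / n)) powr \<gamma>}"
    then obtain k where w: "\<omega> \<in> space M" and k: "k \<in> {1..<n}" "k \<le> \<delta> * n \<or> real n - k \<le> \<delta> * n"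
      and t: "\<bar>tied_down Y n k \<omega>\<bar> \<ge> \<epsilon> * sqrt n * (k / n * (1 - k / n)) powr \<gamma>" by auto
    have dn: "\<delta> * n \<le> 1 / 2 * n" using \<delta> by (intro mult_right_mono) auto
    show "\<omega> \<in> L \<union> R"
    proof (cases "k \<le> \<delta> * n")
      case True
      have "2 * real k \<le> n" using True dn by linarith
      then have "1 - k / n \<ge> 1 / 2" using n0 by (simp add: field_simps)
      from half[of "k / n", OF _ this] t have "\<bar>tied_down Y n k \<omega>\<bar> \<ge> (\<epsilon> / 2) * sqrt n * (k / n) powr \<gamma>" by simp
      then show ?thesis using True w k by (auto simp: L_def)
    next
      case False
      then have kk: "real n - k \<le> \<delta> * n" using k by auto
      have "n \<le> 2 * real k" using kk dn by linarith
      then have "k / n \<ge> 1 / 2" using n0 by (simp add: field_simps)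
      from half[of "1 - k / n", OF _ this] t k n0
      have "\<bar>tied_down Y n k \<omega>\<bar> \<ge> (\<epsilon> / 2) * sqrt n * (1 - k / n) powr \<gamma>"
        by (simp add: mult.commute[of "1 - real k / real n"])
      moreover have "1 - k / n = real (n - k) / n" using k n0 by (simp add: of_nat_diff field_simps)
      moreover have "n - (n - k) = k" using k by auto
      ultimately show ?thesis using w k kk by (auto simp: R_def of_nat_diff intro!: bexI[of _ "n - k"])
    qed
  qed (use Lm Rm in auto)
  also have "\<dots> \<le> prob L + prob R" by (intro measure_Un_le Lm Rm)
  also have "\<dots> \<le> end_const \<gamma> * v * \<delta> powr (1 - 2 * \<gamma>) / (\<epsilon> / 2)\<^sup>2 + end_const \<gamma> * v * \<delta> powr (1 - 2 * \<gamma>) / (\<epsilon> / 2)\<^sup>2"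
    unfolding L_def R_def using \<epsilon> by (intro add_mono left_end right_end n \<gamma> \<delta>) auto
  also have "\<dots> = 8 * end_const \<gamma> * v * \<delta> powr (1 - 2 * \<gamma>) / \<epsilon>\<^sup>2"
    by (simp add: power_divide field_simps)
  finally show ?thesis .
qed

section \<open>The linear part of the statistic\<close>

lemma exp_minus_bound:
  fixes x :: real
  assumes "x \<ge> 0"
  shows "\<bar>exp (- x) - (1 - x)\<bar> \<le> x\<^sup>2"
proof -
  have "1 - x \<le> exp (- x)" using exp_ge_add_one_self[of "- x"] by simp
  moreover have "exp (- x) \<le> 1 - x + x\<^sup>2"
  proof -
    have "exp (- x) = 1 / exp x" by (simp add: exp_minus divide_inverse)
    also have "\<dots> \<le> 1 / (1 + x)" using assms exp_ge_add_one_self[of x] by (intro divide_left_mono) auto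
    also have "\<dots> \<le> 1 - x + x\<^sup>2"
    proof -
      have "(1 - x + x\<^sup>2) * (1 + x) = 1 + x ^ 3" by (simp add: power2_eq_square power3_eq_cube algebra_simps)
      moreover have "x ^ 3 \<ge> 0" using assms by simp
      ultimately show ?thesis using assms by (simp add: pos_divide_le_eq)
    qed
    finally show ?thesis .
  qed
  ultimately show ?thesis by simp
qed

lemma (in iid_sample) one_variable_expectation:
  fixes f :: "real \<Rightarrow> real"
  assumes i: "i \<ge> 1" and [measurable]: "f \<in> borel_measurable borel"
  shows "expectation (\<lambda>\<omega>. f (\<xi> i \<omega>)) = (\<integral>x. f x \<partial>D)"
    and "integrable M (\<lambda>\<omega>. f (\<xi> i \<omega>)) \<longleftrightarrow> integrable D f"
    and "distr M borel (\<lambda>\<omega>. f (\<xi> i \<omega>)) = distr D borel f"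
  unfolding law[OF i, symmetric]
  using i by (subst integral_distr; simp) (subst integrable_distr_eq distr_distr; use i in \<open>simp add: comp_def\<close>)+

locale iid_score = iid_sample M \<xi> D for M :: "'a measure" and \<xi> :: "nat \<Rightarrow> 'a \<Rightarrow> real" and D :: "real measure" +
  fixes h :: "real \<Rightarrow> real" and \<sigma> :: real
  assumes h_measurable[measurable]: "h \<in> borel_measurable borel"
    and h_square: "integrable D (\<lambda>x. (h x)\<^sup>2)" and h_mean: "(\<integral>x. h x \<partial>D) = 0"
    and h_var: "(\<integral>x. (h x)\<^sup>2 \<partial>D) = \<sigma>\<^sup>2" and sigma_pos: "\<sigma> > 0"
begin

definition Y :: "nat \<Rightarrow> 'a \<Rightarrow> real" where "Y i \<omega> = h (\<xi> i \<omega>)"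

lemma Y_measurable[measurable]: "i \<ge> 1 \<Longrightarrow> Y i \<in> borel_measurable M"
  unfolding Y_def by measurable

lemma Y_indep: "indep_vars (\<lambda>_. borel) Y {1..}"
  unfolding Y_def[abs_def] by (rule indep_vars_compose2[OF indep]) auto

lemma Y_square: "i \<ge> 1 \<Longrightarrow> integrable M (\<lambda>\<omega>. (Y i \<omega>)\<^sup>2)"
  using one_variable_expectation(2)[of i "\<lambda>x. (h x)\<^sup>2"] h_square by (simp add: Y_def)

lemma Y_mean: "i \<ge> 1 \<Longrightarrow> expectation (Y i) = 0"
  using one_variable_expectation(1)[of i h] h_mean by (simp add: Y_def[abs_def])

lemma Y_var: "i \<ge> 1 \<Longrightarrow> expectation (\<lambda>\<omega>. (Y i \<omega>)\<^sup>2) = \<sigma>\<^sup>2"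
  using one_variable_expectation(1)[of i "\<lambda>x. (h x)\<^sup>2"] h_var by (simp add: Y_def)

lemma Y_law: "i \<ge> 1 \<Longrightarrow> distr M borel (Y i) = distr D borel h"
  using one_variable_expectation(3)[of i h] by (simp add: Y_def[abs_def])

lemma shifted_row: "centered_row M (\<lambda>i. Y (a + i)) n (\<sigma>\<^sup>2)"
proof
  show "indep_vars (\<lambda>_. borel) (\<lambda>i. Y (a + i)) {1..n}"
    by (rule indep_vars_reindex_inj[OF Y_indep]) (auto simp: inj_on_def)
qed (auto simp: Y_square Y_mean Y_var)

lemma row: "centered_row M Y n (\<sigma>\<^sup>2)"
  using shifted_row[of 0 n] by simp

lemma partial_sum_Y_measurable[measurable]: "partial_sum Y k \<in> borel_measurable M"
  using centered_row.partial_sum_measurable[OF row[of k], of k] by simp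

lemma tied_down_Y_measurable[measurable]: "tied_down Y n k \<in> borel_measurable M"
  unfolding tied_down_def by measurable

text \<open>Both characteristic functions are the r-th power of that of h. It lets the central limit
  bound for the first r variables serve every block of length r.\<close>

lemma distr_shifted_sum:
  "distr M borel (\<lambda>\<omega>. \<Sum>i\<in>{1..r}. Y (a + i) \<omega>) = distr M borel (partial_sum Y r)"
proof (rule Levy_uniqueness)
  have ind: "indep_vars (\<lambda>_. borel) (\<lambda>i. Y (b + i)) {1..r}" for b
    using shifted_row[of b r] by (simp add: centered_row_def centered_row_axioms_def)
  have e: "char (distr M borel (\<lambda>\<omega>. \<Sum>i\<in>{1..r}. Y (b + i) \<omega>)) t = char (distr D borel h) t ^ r" for b t
    by (subst char_distr_sum[OF ind]) (simp add: Y_law)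
  show "char (distr M borel (\<lambda>\<omega>. \<Sum>i\<in>{1..r}. Y (a + i) \<omega>)) = char (distr M borel (partial_sum Y r))"
    using e[of a] e[of 0] by (auto simp: partial_sum_def[abs_def])
  have "(\<lambda>\<omega>. \<Sum>i\<in>{1..r}. Y (a + i) \<omega>) \<in> borel_measurable M" by (intro borel_measurable_sum Y_measurable) auto
  then show "real_distribution (distr M borel (\<lambda>\<omega>. \<Sum>i\<in>{1..r}. Y (a + i) \<omega>))"
    by (rule real_distribution_distr)
  show "real_distribution (distr M borel (partial_sum Y r))" by (rule real_distribution_distr) simp
qed

text \<open>The factor \<open>4\<close> instead of the fourth normal moment \<open>3\<close> absorbs the error of the central limit theorem.\<close>

lemma partial_sum_tail:
  assumes L: "L > 0"
  shows "\<forall>\<^sub>F r in sequentially. prob {\<omega> \<in> space M. \<bar>partial_sum Y r \<omega>\<bar> \<ge> L * (\<sigma> * sqrt r)} \<le> 4 / L ^ 4"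
proof -
  let ?Z = "std_normal_distribution" and ?\<mu> = "\<lambda>n. distr M borel (\<lambda>x. (\<Sum>i<n. Y (Suc i) x) / sqrt (real n * \<sigma>\<^sup>2))"
  have conv: "weak_conv_m ?\<mu> ?Z"
  proof (rule central_limit_theorem_zero_mean)
    show "indep_vars (\<lambda>_. borel) (\<lambda>i. Y (Suc i)) UNIV"
      by (rule indep_vars_reindex_inj[OF Y_indep]) (auto simp: inj_on_def)
    show "distr M borel (Y (Suc n)) = distr D borel h" for n by (rule Y_law) simp
  qed (auto simp: Y_mean Y_square Y_var sigma_pos)
  \<comment> \<open>A bounded continuous majorant of the indicator of |x| >= L whose normal integral
    is at most the fourth moment over L^4; the fourth power of L is what makes
    \<open>oscillation\<close> summable over the blocks.\<close>
  define f :: "real \<Rightarrow> real" where "f x = min 1 ((x / L) ^ 4)" for x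
  have fm[measurable]: "f \<in> borel_measurable borel" unfolding f_def[abs_def] by measurable
  have f01: "0 \<le> f x" "f x \<le> 1" for x by (auto simp: f_def)
  have Ym: "(\<lambda>x. (\<Sum>i<n. Y (Suc i) x) / sqrt (real n * \<sigma>\<^sup>2)) \<in> borel_measurable M" for n
    by (intro borel_measurable_divide borel_measurable_sum Y_measurable) auto
  have "(\<lambda>n. integral\<^sup>L (?\<mu> n) f) \<longlonglongrightarrow> integral\<^sup>L ?Z f"
  proof (rule weak_conv_imp_integral_bdd_continuous_conv[OF _ _ conv, where B=1])
    show "isCont f x" for x unfolding f_def[abs_def] by (intro continuous_intros) (use L in auto)
    show "norm (f x) \<le> 1" for x using f01[of x] by simp
    show "real_distribution (?\<mu> n)" for n by (rule real_distribution_distr[OF Ym])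
  qed (rule real_dist_normal_dist)
  moreover have "integral\<^sup>L ?Z f < 4 / L ^ 4"
  proof -
    interpret Z: real_distribution ?Z by (rule real_dist_normal_dist)
    have "integral\<^sup>L ?Z f \<le> (\<integral>x. x ^ 4 / L ^ 4 \<partial>?Z)"
    proof (rule integral_mono)
      show "integrable ?Z f" by (rule Z.integrable_const_bound[where B=1]) (use f01 in auto)
      show "integrable ?Z (\<lambda>x. x ^ 4 / L ^ 4)" using integrable_std_normal_distribution_moment[of 4] by auto
      show "f x \<le> x ^ 4 / L ^ 4" for x by (simp add: f_def power_divide)
    qed
    also have "\<dots> = 3 / L ^ 4"
      using std_normal_distribution_even_moments(1)[of 2] by (simp add: fact_numeral)
    also have "\<dots> < 4 / L ^ 4" using L by (intro divide_strict_right_mono) auto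
    finally show ?thesis .
  qed
  ultimately have "\<forall>\<^sub>F n in sequentially. integral\<^sup>L (?\<mu> n) f < 4 / L ^ 4" by (rule order_tendstoD)
  then show ?thesis using eventually_gt_at_top[of 0]
  proof eventually_elim
    case (elim r)
    let ?X = "\<lambda>x. (\<Sum>i<r. Y (Suc i) x) / sqrt (real r * \<sigma>\<^sup>2)"
    have s: "(\<Sum>i<r. Y (Suc i) \<omega>) = partial_sum Y r \<omega>" for \<omega>
      unfolding partial_sum_def by (rule sum.reindex_bij_witness[of _ "\<lambda>i. i - 1" Suc]) auto
    have X: "?X \<omega> = partial_sum Y r \<omega> / (\<sigma> * sqrt r)" for \<omega>
      unfolding s using sigma_pos by (simp add: real_sqrt_mult mult.commute)
    let ?A = "{\<omega> \<in> space M. \<bar>partial_sum Y r \<omega>\<bar> \<ge> L * (\<sigma> * sqrt r)}"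
    have Xm[measurable]: "?X \<in> borel_measurable M" by (rule Ym)
    have "prob ?A = expectation (indicator ?A)" by simp
    also have "\<dots> \<le> expectation (\<lambda>\<omega>. f (?X \<omega>))"
    proof (rule integral_mono)
      show "integrable M (indicator ?A :: 'a \<Rightarrow> real)" by (intro integrable_real_indicator) (auto simp: less_top[symmetric])
      show "integrable M (\<lambda>\<omega>. f (?X \<omega>))"
        by (rule integrable_const_bound[where B=1]) (use f01 in \<open>auto intro!: measurable_compose[OF Xm fm]\<close>)
      fix \<omega>
      show "indicator ?A \<omega> \<le> f (?X \<omega>)"
      proof (cases "\<omega> \<in> ?A")
        case True
        have "L \<le> \<bar>partial_sum Y r \<omega>\<bar> / (\<sigma> * sqrt r)" using True sigma_pos elim by (simp add: pos_le_divide_eq)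
        also have "\<dots> = \<bar>?X \<omega>\<bar>" unfolding X using sigma_pos by (simp add: abs_divide abs_mult)
        finally have "1 \<le> \<bar>?X \<omega> / L\<bar>" using L by (simp only: abs_divide abs_of_pos pos_le_divide_eq mult_1)
        then have "1 \<le> \<bar>?X \<omega> / L\<bar> ^ 4" by (rule one_le_power)
        then have "1 \<le> (?X \<omega> / L) ^ 4" by (subst (asm) power_even_abs) simp_all
        then have "f (?X \<omega>) = 1" unfolding f_def by (rule min_absorb1)
        then show ?thesis unfolding indicator_simps(1)[OF True] by (simp only: order_refl)
      qed (use f01 in simp)
    qed
    also have "\<dots> = integral\<^sup>L (?\<mu> r) f" by (rule integral_distr[symmetric]) auto
    finally show ?case using elim by simp
  qed
qed

text \<open>There are m blocks of length about n/m, and on the scale of a block the threshold is L,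
  of order sqrt m, standard deviations. Chebyshev would give m * O(1/m); the fourth-power tail gives
  m * O(1/m^2), which becomes small for large m.\<close>

lemma oscillation:
  assumes \<epsilon>: "\<epsilon> > 0" and \<eta>: "\<eta> > 0"
  shows "\<exists>m0. \<forall>m\<ge>m0. \<forall>\<^sub>F n in sequentially.
    prob {\<omega> \<in> space M. \<exists>j<m. \<exists>k\<le>n div m + 1. \<bar>partial_sum Y (n * j div m + k) \<omega> - partial_sum Y (n * j div m) \<omega>\<bar> \<ge> \<epsilon> * sqrt n} \<le> \<eta>"
proof -
  \<comment> \<open>The final bound is m * 8 / L^4 = C / m, with 8 = 2 * 4 from Ottaviani's factor
    and the tail 4 / L^4. In m0 the first bound makes r sigma^2 / c^2 <= 1/2, the beta of
    Ottaviani's inequality, and the second makes C / m <= eta.\<close>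
  define C where "C = 512 * \<sigma> ^ 4 / \<epsilon> ^ 4"
  define m0 where "m0 = nat \<lceil>max (16 * \<sigma>\<^sup>2 / \<epsilon>\<^sup>2) (C / \<eta>)\<rceil> + 1"
  have C0: "C \<ge> 0" by (simp add: C_def)
  show ?thesis
  proof (intro exI[of _ m0] allI impI)
    fix m assume "m0 \<le> m"
    then have m: "m \<ge> 1" "16 * \<sigma>\<^sup>2 / \<epsilon>\<^sup>2 \<le> m" "C / \<eta> \<le> m"
      unfolding m0_def by linarith+
    \<comment> \<open>With block length r <= 2n/m this gives L sigma sqrt r <= epsilon sqrt n / 2,
      the half threshold that appears in Ottaviani's inequality.\<close>
    define L where "L = \<epsilon> * sqrt m / (2 * sqrt 2 * \<sigma>)"
    have L: "L > 0" using \<epsilon> m sigma_pos by (simp add: L_def)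
    have L4: "L ^ 4 = \<epsilon> ^ 4 * (real m)\<^sup>2 / (64 * \<sigma> ^ 4)"
    proof -
      have "sqrt x ^ 4 = x\<^sup>2" if "x \<ge> 0" for x :: real
        using that by (simp add: power4_eq_xxxx power2_eq_square)
      then show ?thesis by (simp add: L_def power_divide power_mult_distrib)
    qed
    have tend: "filterlim (\<lambda>n. n div m + 1) sequentially sequentially"
      unfolding filterlim_at_top
    proof
      fix Z :: nat
      show "\<forall>\<^sub>F n in sequentially. Z \<le> n div m + 1"
      proof (rule eventually_sequentiallyI[of "Z * m"])
        fix n assume "Z * m \<le> n"
        then have "Z * m div m \<le> n div m" by (rule div_le_mono)
        then show "Z \<le> n div m + 1" using m by simp
      qed
    qed
    have "\<forall>\<^sub>F n in sequentially. prob {\<omega> \<in> space M. \<bar>partial_sum Y (n div m + 1) \<omega>\<bar> \<ge> L * (\<sigma> * sqrt (real (n div m + 1)))} \<le> 4 / L ^ 4"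
      using eventually_compose_filterlim[OF partial_sum_tail[OF L] tend] .
    then show "\<forall>\<^sub>F n in sequentially. prob {\<omega> \<in> space M. \<exists>j<m. \<exists>k\<le>n div m + 1.
        \<bar>partial_sum Y (n * j div m + k) \<omega> - partial_sum Y (n * j div m) \<omega>\<bar> \<ge> \<epsilon> * sqrt n} \<le> \<eta>"
      using eventually_ge_at_top[of m]
    proof eventually_elim
      case (elim n)
      define r where "r = n div m + 1"
      have n0: "real n > 0" using elim m by auto
      have rm: "real r * m \<le> 2 * n"
      proof -
        have "r * m \<le> n + m" using div_times_less_eq_dividend[of n m] by (simp add: r_def)
        then have "r * m \<le> 2 * n" using elim by linarith
        then show ?thesis by (metis of_nat_le_iff of_nat_mult of_nat_numeral)
      qed
      define c where "c = \<epsilon> * sqrt n / 2"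
      have c: "c > 0" using \<epsilon> n0 by (simp add: c_def)
      have c2: "c\<^sup>2 = \<epsilon>\<^sup>2 * n / 4" using n0 by (simp add: c_def power_divide power_mult_distrib)
      have rc: "r * \<sigma>\<^sup>2 / c\<^sup>2 \<le> 1 / 2"
      proof -
        have "16 * \<sigma>\<^sup>2 \<le> m * \<epsilon>\<^sup>2" using m(2) \<epsilon> by (simp add: pos_divide_le_eq)
        then have "r * (16 * \<sigma>\<^sup>2) \<le> r * (m * \<epsilon>\<^sup>2)" by (intro mult_left_mono) auto
        also have "\<dots> = (real r * m) * \<epsilon>\<^sup>2" by simp
        also have "\<dots> \<le> (2 * n) * \<epsilon>\<^sup>2" using rm by (intro mult_right_mono) auto
        finally show ?thesis unfolding c2 using \<epsilon> n0 by (simp add: pos_divide_le_eq mult.commute)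
      qed
      have Lc: "L * (\<sigma> * sqrt r) \<le> c"
      proof -
        have "L * (\<sigma> * sqrt r) = \<epsilon> / (2 * sqrt 2) * sqrt (real r * m)"
          using sigma_pos by (simp add: L_def real_sqrt_mult field_simps)
        also have "\<dots> \<le> \<epsilon> / (2 * sqrt 2) * sqrt (2 * n)"
          using rm \<epsilon> by (intro mult_left_mono) auto
        also have "\<dots> = c" by (simp add: c_def real_sqrt_mult)
        finally show ?thesis .
      qed
      define E where "E a = {\<omega> \<in> space M. \<exists>k\<le>r. \<bar>\<Sum>i\<in>{1..k}. Y (a + i) \<omega>\<bar> \<ge> 2 * c}" for a
      have shift: "partial_sum Y (a + k) \<omega> - partial_sum Y a \<omega> = (\<Sum>i\<in>{1..k}. Y (a + i) \<omega>)" for a k \<omega>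
      proof -
        have "partial_sum Y (a + k) \<omega> = partial_sum Y a \<omega> + (\<Sum>i\<in>{a<..a + k}. Y i \<omega>)"
          unfolding partial_sum_def by (subst sum.union_disjoint[symmetric]) (auto intro!: sum.cong)
        moreover have "(\<Sum>i\<in>{a<..a + k}. Y i \<omega>) = (\<Sum>i\<in>{1..k}. Y (a + i) \<omega>)"
          by (rule sum.reindex_bij_witness[of _ "\<lambda>i. a + i" "\<lambda>i. i - a"]) auto
        ultimately show ?thesis by simp
      qed
      have sm[measurable]: "(\<lambda>\<omega>. \<Sum>i\<in>{1..k}. Y (a + i) \<omega>) \<in> borel_measurable M" for a k
        by (intro borel_measurable_sum Y_measurable) auto
      have Em: "E a \<in> sets M" for a unfolding E_def by measurable
      have pE: "prob (E a) \<le> 8 / L ^ 4" for a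
      proof -
        interpret R: centered_row M "\<lambda>i. Y (a + i)" r "\<sigma>\<^sup>2" by (rule shifted_row)
        have "(1 - 1 / 2) * prob (E a) \<le> prob {\<omega> \<in> space M. \<bar>\<Sum>i\<in>{1..r}. Y (a + i) \<omega>\<bar> \<ge> c}"
          unfolding E_def
        proof (rule ottaviani_inequality[OF R.row_indep])
          fix k assume "k \<le> r"
          have bm: "(\<lambda>\<omega>. \<Sum>i\<in>{k<..r}. Y (a + i) \<omega>) \<in> borel_measurable M"
            by (intro borel_measurable_sum Y_measurable) auto
          have "prob {\<omega> \<in> space M. \<bar>\<Sum>i\<in>{k<..r}. Y (a + i) \<omega>\<bar> > c} \<le> prob {\<omega> \<in> space M. \<bar>\<Sum>i\<in>{k<..r}. Y (a + i) \<omega>\<bar> \<ge> c}"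
            using bm by (intro finite_measure_mono) auto
          also have "\<dots> \<le> card {k<..r} * \<sigma>\<^sup>2 / c\<^sup>2" by (rule R.block_tail[OF _ c]) auto
          also have "\<dots> \<le> r * \<sigma>\<^sup>2 / c\<^sup>2" by (intro divide_right_mono mult_right_mono) auto
          finally show "prob {\<omega> \<in> space M. \<bar>\<Sum>i\<in>{k<..r}. Y (a + i) \<omega>\<bar> > c} \<le> 1 / 2" using rc by linarith
        qed
        also have "\<dots> = measure (distr M borel (\<lambda>\<omega>. \<Sum>i\<in>{1..r}. Y (a + i) \<omega>)) {x. \<bar>x\<bar> \<ge> c}"
          by (subst measure_distr) (auto intro!: arg_cong[where f=prob])
        also have "\<dots> = prob {\<omega> \<in> space M. \<bar>partial_sum Y r \<omega>\<bar> \<ge> c}"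
          unfolding distr_shifted_sum by (subst measure_distr) (auto intro!: arg_cong[where f=prob])
        also have "\<dots> \<le> prob {\<omega> \<in> space M. \<bar>partial_sum Y r \<omega>\<bar> \<ge> L * (\<sigma> * sqrt r)}"
          using Lc by (intro finite_measure_mono) auto
        also have "\<dots> \<le> 4 / L ^ 4" using elim(1) by (simp add: r_def)
        finally show ?thesis by simp
      qed
      have "{\<omega> \<in> space M. \<exists>j<m. \<exists>k\<le>n div m + 1.
        \<bar>partial_sum Y (n * j div m + k) \<omega> - partial_sum Y (n * j div m) \<omega>\<bar> \<ge> \<epsilon> * sqrt n} = (\<Union>j\<in>{..<m}. E (n * j div m))"
        unfolding shift by (auto simp: E_def r_def c_def)
      also have "prob \<dots> \<le> (\<Sum>j<m. prob (E (n * j div m)))"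
        by (intro finite_measure_subadditive_finite) (use Em in auto)
      also have "\<dots> \<le> (\<Sum>j<m. 8 / L ^ 4)" by (intro sum_mono pE)
      also have "\<dots> = C / m" using m \<epsilon> sigma_pos by (simp add: L4 C_def power2_eq_square field_simps)
      also have "\<dots> \<le> \<eta>" using m \<eta> by (simp add: field_simps)
      finally show ?case .
    qed
  qed
qed

end

section \<open>Finite-dimensional limits of the weighted tied-down sums\<close>

definition wgt :: "real \<Rightarrow> real \<Rightarrow> real" where
  "wgt \<gamma> x = (x * (1 - x)) powr \<gamma>"

lemma wgt_pos: "0 < x \<Longrightarrow> x < 1 \<Longrightarrow> wgt \<gamma> x > 0"
  by (simp add: wgt_def)

lemma abs_min_le:
  fixes a b :: real
  assumes "0 \<le> a" "0 \<le> b"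
  shows "\<bar>min a b\<bar> \<le> a"
  using assms by simp

lemma floor_ratio_tendsto:
  assumes "t \<ge> (0::real)"
  shows "(\<lambda>n. real (nat \<lfloor>real n * t\<rfloor>) / real n) \<longlonglongrightarrow> t"
proof (rule real_tendsto_sandwich)
  show "\<forall>\<^sub>F n in sequentially. t - 1 / real n \<le> real (nat \<lfloor>real n * t\<rfloor>) / real n"
    using eventually_gt_at_top[of 0]
  proof eventually_elim
    case (elim n)
    have "real n * t - 1 \<le> real (nat \<lfloor>real n * t\<rfloor>)" using assms by linarith
    then have "(real n * t - 1) / n \<le> real (nat \<lfloor>real n * t\<rfloor>) / n" by (rule divide_right_mono) simp
    then show ?case using elim by (simp add: diff_divide_distrib)
  qed
  show "\<forall>\<^sub>F n in sequentially. real (nat \<lfloor>real n * t\<rfloor>) / real n \<le> t"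
    using eventually_gt_at_top[of 0]
  proof eventually_elim
    case (elim n)
    have "real (nat \<lfloor>real n * t\<rfloor>) \<le> real n * t" using assms by (simp add: of_nat_nat)
    then have "real (nat \<lfloor>real n * t\<rfloor>) / n \<le> real n * t / n" by (rule divide_right_mono) simp
    then show ?case using elim by simp
  qed
  have "(\<lambda>n. t - 1 / real n) \<longlonglongrightarrow> t - 0" by (intro tendsto_intros lim_1_over_n)
  then show "(\<lambda>n. t - 1 / real n) \<longlonglongrightarrow> t" by simp
qed auto

lemma floor_index_range:
  assumes "0 < t" "t < (1::real)"
  shows "\<forall>\<^sub>F n in sequentially. nat \<lfloor>real n * t\<rfloor> \<in> {1..<n}"
proof -
  obtain N :: nat where N: "1 / t < N" using reals_Archimedean2 by blast
  show ?thesis using eventually_ge_at_top[of N] eventually_gt_at_top[of 0]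
  proof eventually_elim
    case (elim n)
    have "1 < real N * t" using N assms by (simp add: field_simps)
    also have "\<dots> \<le> real n * t" using elim assms by (intro mult_right_mono) auto
    finally have 1: "1 \<le> real n * t" by simp
    have "real n * t < real n * 1" using elim assms by (intro mult_strict_left_mono) auto
    then have 2: "real n * t < real n" by simp
    have "1 \<le> \<lfloor>real n * t\<rfloor>" "\<lfloor>real n * t\<rfloor> < int n"
      using 1 2 by (simp_all add: le_floor_iff floor_less_iff)
    then show ?case unfolding atLeastLessThan_iff by linarith
  qed
qed

lemma floor_index_le: "t \<le> 1 \<Longrightarrow> nat \<lfloor>real n * t\<rfloor> \<le> n"
proof -
  assume "t \<le> 1"
  then have "real n * t \<le> real n * 1" by (intro mult_left_mono) auto
  then have "\<lfloor>real n * t\<rfloor> \<le> int n" by linarith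
  then show ?thesis by simp
qed

context iid_score
begin

definition A :: "real \<Rightarrow> nat \<Rightarrow> nat \<Rightarrow> 'a \<Rightarrow> real" where
  "A \<gamma> n k \<omega> = tied_down Y n k \<omega> / (sqrt n * wgt \<gamma> (k / n))"

lemma A_measurable[measurable]: "A \<gamma> n k \<in> borel_measurable M"
  unfolding A_def by measurable

text \<open>Factorwise comparison with the Gaussian transform: a product of numbers of modulus at
  most 1 changes by at most the sum of the changes of its factors. The third-order error is kept as
  an integral of min (6 x^2) (s |x|^3), so that it can be made to vanish under a second
  moment.\<close>

lemma linear_combination_transform:
  assumes B: "B \<ge> 0" and b: "\<And>i. i \<in> {1..n} \<Longrightarrow> \<bar>b i\<bar> \<le> B" and n: "n \<ge> 1"
  defines "\<mu> \<equiv> distr D borel h"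
  shows "\<bar>expectation (\<lambda>\<omega>. cos (\<Sum>i\<in>{1..n}. b i / sqrt n * Y i \<omega>)) - exp (- (\<sigma>\<^sup>2 * ((\<Sum>i\<in>{1..n}. (b i)\<^sup>2) / n) / 2))\<bar>
    \<le> B\<^sup>2 * ((\<integral>x. min (6 * x\<^sup>2) (B / sqrt n * \<bar>x\<bar> ^ 3) \<partial>\<mu>) / 6 + B\<^sup>2 * \<sigma> ^ 4 / 4 / n)"
proof -
  interpret \<mu>: real_distribution \<mu> unfolding \<mu>_def by (rule D.real_distribution_distr) simp
  have hD: "integrable D h" by (rule D.square_integrable_imp_integrable[OF _ h_square]) simp
  have \<mu>m: "integrable \<mu> (\<lambda>x. x)" "\<mu>.expectation (\<lambda>x. x) = 0" "integrable \<mu> (\<lambda>x. x\<^sup>2)" "\<mu>.expectation (\<lambda>x. x\<^sup>2) = \<sigma>\<^sup>2"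
    unfolding \<mu>_def using hD h_square h_mean h_var by (auto simp: integrable_distr_eq integral_distr)
  define I where "I = (\<integral>x. min (6 * x\<^sup>2) (B / sqrt n * \<bar>x\<bar> ^ 3) \<partial>\<mu>)"
  have n0: "real n > 0" using n by simp
  have int_min: "integrable \<mu> (\<lambda>x. min (6 * x\<^sup>2) (s * \<bar>x\<bar> ^ 3))" if "s \<ge> 0" for s
  proof (rule Bochner_Integration.integrable_bound)
    show "integrable \<mu> (\<lambda>x. 6 * x\<^sup>2)" using \<mu>m(3) by simp
    show "AE x in \<mu>. norm (min (6 * x\<^sup>2) (s * \<bar>x\<bar> ^ 3)) \<le> norm (6 * x\<^sup>2)"
      using that by (intro AE_I2) (simp add: abs_min_le)
  qed measurable
  have one: "cmod (char \<mu> s - complex_of_real (exp (- (\<sigma>\<^sup>2 * s\<^sup>2 / 2)))) \<le> B\<^sup>2 / n * (I / 6 + B\<^sup>2 * \<sigma> ^ 4 / 4 / n)"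
    if s: "\<bar>s\<bar> \<le> B / sqrt n" for s
  proof -
    have s2: "s\<^sup>2 \<le> B\<^sup>2 / n"
      using power_mono[OF s, of 2] n0 by (simp add: power_divide)
    have "cmod (char \<mu> s - (1 - s\<^sup>2 * \<sigma>\<^sup>2 / 2)) \<le> s\<^sup>2 / 6 * \<mu>.expectation (\<lambda>x. min (6 * x\<^sup>2) (\<bar>s\<bar> * \<bar>x\<bar> ^ 3))"
      by (rule \<mu>.char_approx3) (use \<mu>m in auto)
    also have "\<dots> \<le> s\<^sup>2 / 6 * I"
      unfolding I_def using s B
      by (intro mult_left_mono integral_mono int_min min.mono mult_right_mono) auto
    finally have 1: "cmod (char \<mu> s - (1 - s\<^sup>2 * \<sigma>\<^sup>2 / 2)) \<le> s\<^sup>2 * (I / 6)" by simp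
    define x where "x = \<sigma>\<^sup>2 * s\<^sup>2 / 2"
    have "cmod (complex_of_real (exp (- x)) - (1 - s\<^sup>2 * \<sigma>\<^sup>2 / 2)) = \<bar>exp (- x) - (1 - x)\<bar>"
    proof -
      have "complex_of_real (exp (- x)) - (1 - s\<^sup>2 * \<sigma>\<^sup>2 / 2) = complex_of_real (exp (- x) - (1 - x))"
        by (simp add: x_def mult.commute)
      then show ?thesis by (simp only: norm_of_real)
    qed
    also have "\<dots> \<le> x\<^sup>2" by (rule exp_minus_bound) (simp add: x_def)
    also have "x\<^sup>2 = s\<^sup>2 * (s\<^sup>2 * \<sigma> ^ 4 / 4)" by (simp add: x_def power2_eq_square power4_eq_xxxx)
    also have "\<dots> \<le> s\<^sup>2 * (B\<^sup>2 / n * \<sigma> ^ 4 / 4)" using s2 by (intro mult_left_mono divide_right_mono mult_right_mono) auto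
    finally have 2: "cmod (complex_of_real (exp (- x)) - (1 - s\<^sup>2 * \<sigma>\<^sup>2 / 2)) \<le> s\<^sup>2 * (B\<^sup>2 * \<sigma> ^ 4 / 4 / n)" by simp
    have I0: "I \<ge> 0" unfolding I_def using B by (intro integral_nonneg_AE AE_I2) auto
    have "cmod (char \<mu> s - complex_of_real (exp (- x))) \<le> s\<^sup>2 * (I / 6) + s\<^sup>2 * (B\<^sup>2 * \<sigma> ^ 4 / 4 / n)"
      by (rule norm_diff_triangle_le[OF 1]) (use 2 in \<open>simp add: norm_minus_commute\<close>)
    also have "\<dots> = s\<^sup>2 * (I / 6 + B\<^sup>2 * \<sigma> ^ 4 / 4 / n)" by (simp add: algebra_simps)
    also have "\<dots> \<le> B\<^sup>2 / n * (I / 6 + B\<^sup>2 * \<sigma> ^ 4 / 4 / n)" using s2 I0 by (intro mult_right_mono) auto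
    finally show ?thesis by (simp add: x_def)
  qed
  let ?X = "\<lambda>\<omega>. \<Sum>i\<in>{1..n}. b i / sqrt n * Y i \<omega>"
  have Xm[measurable]: "?X \<in> borel_measurable M"
    by (intro borel_measurable_sum borel_measurable_times Y_measurable) auto
  have ind: "indep_vars (\<lambda>_. borel) (\<lambda>i \<omega>. b i / sqrt n * Y i \<omega>) {1..n}"
    by (rule indep_vars_compose2[where X=Y, OF indep_vars_subset[OF Y_indep]]) auto
  have "char (distr M borel ?X) 1 = (\<Prod>i\<in>{1..n}. char (distr M borel (\<lambda>\<omega>. b i / sqrt n * Y i \<omega>)) 1)"
    by (rule char_distr_sum[OF ind])
  also have "\<dots> = (\<Prod>i\<in>{1..n}. char \<mu> (b i / sqrt n))"
  proof (rule prod.cong[OF refl])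
    fix i assume i: "i \<in> {1..n}"
    have "char (distr M borel (\<lambda>\<omega>. b i / sqrt n * Y i \<omega>)) 1 = char (distr M borel (Y i)) (b i / sqrt n)"
      unfolding char_def using i by (subst (1 2) integral_distr) auto
    then show "char (distr M borel (\<lambda>\<omega>. b i / sqrt n * Y i \<omega>)) 1 = char \<mu> (b i / sqrt n)"
      using i by (simp add: Y_law \<mu>_def)
  qed
  finally have ch: "char (distr M borel ?X) 1 = (\<Prod>i\<in>{1..n}. char \<mu> (b i / sqrt n))" .
  have e1: "expectation (\<lambda>\<omega>. cos (?X \<omega>)) = Re (char (distr M borel ?X) 1)"
  proof -
    have "char (distr M borel ?X) 1 = (CLINT \<omega>|M. iexp (?X \<omega>))"
      unfolding char_def by (subst integral_distr) auto
    moreover have "Re (CLINT \<omega>|M. iexp (?X \<omega>)) = (\<integral>\<omega>. Re (iexp (?X \<omega>)) \<partial>M)"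
      by (rule integral_Re[symmetric, OF integrable_iexp]) auto
    ultimately show ?thesis by (simp add: Re_exp)
  qed
  have e2: "complex_of_real (exp (- (\<sigma>\<^sup>2 * ((\<Sum>i\<in>{1..n}. (b i)\<^sup>2) / n) / 2))) =
      (\<Prod>i\<in>{1..n}. complex_of_real (exp (- (\<sigma>\<^sup>2 * (b i / sqrt n)\<^sup>2 / 2))))"
  proof -
    have "- (\<sigma>\<^sup>2 * ((\<Sum>i\<in>{1..n}. (b i)\<^sup>2) / n) / 2) = (\<Sum>i\<in>{1..n}. - (\<sigma>\<^sup>2 * (b i / sqrt n)\<^sup>2 / 2))"
      by (simp add: sum_negf sum_distrib_left sum_divide_distrib power_divide)
    then show ?thesis unfolding of_real_prod[symmetric] by (simp only: exp_sum finite_atLeastAtMost)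
  qed
  have "cmod ((\<Prod>i\<in>{1..n}. char \<mu> (b i / sqrt n)) - (\<Prod>i\<in>{1..n}. complex_of_real (exp (- (\<sigma>\<^sup>2 * (b i / sqrt n)\<^sup>2 / 2)))))
    \<le> (\<Sum>i\<in>{1..n}. cmod (char \<mu> (b i / sqrt n) - complex_of_real (exp (- (\<sigma>\<^sup>2 * (b i / sqrt n)\<^sup>2 / 2)))))"
    by (rule norm_prod_diff) (auto intro: \<mu>.cmod_char_le_1)
  also have "\<dots> \<le> (\<Sum>i\<in>{1..n}. B\<^sup>2 / n * (I / 6 + B\<^sup>2 * \<sigma> ^ 4 / 4 / n))"
    using b by (intro sum_mono one) (auto simp: abs_divide divide_right_mono)
  also have "\<dots> = B\<^sup>2 * (I / 6 + B\<^sup>2 * \<sigma> ^ 4 / 4 / n)" using n0 by simp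
  finally have e3: "cmod (char (distr M borel ?X) 1 - complex_of_real (exp (- (\<sigma>\<^sup>2 * ((\<Sum>i\<in>{1..n}. (b i)\<^sup>2) / n) / 2))))
    \<le> B\<^sup>2 * (I / 6 + B\<^sup>2 * \<sigma> ^ 4 / 4 / n)"
    unfolding ch e2 .
  have "\<bar>Re z - r\<bar> \<le> cmod (z - complex_of_real r)" for z r
    using abs_Re_le_cmod[of "z - complex_of_real r"] by simp
  from order_trans[OF this e3] show ?thesis unfolding e1 I_def .
qed

text \<open>Divided by n this is min x y - x y at x = k/n and y = l/n, the covariance of the
  Brownian bridge.\<close>

lemma indicator_products_sum:
  fixes k l :: nat
  assumes "k \<le> n" "l \<le> n" "n \<ge> 1"
  shows "(\<Sum>i\<in>{1..n}. ((if i \<le> k then 1 else 0) - real k / n) * ((if i \<le> l then 1 else 0) - real l / n))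
    = min (real k) l - real k * l / n"
proof -
  have c: "(\<Sum>i\<in>{1..n}. if i \<le> k then 1 else 0) = real k" if "k \<le> n" for k
  proof -
    have "(\<Sum>i\<in>{1..n}. if i \<le> k then 1 else (0::real)) = (\<Sum>i\<in>{1..k}. 1)"
      by (rule sum.mono_neutral_cong_right) (use that in auto)
    then show ?thesis by simp
  qed
  have e: "((if i \<le> k then 1 else 0) - real k / n) * ((if i \<le> l then 1 else 0) - real l / n) =
      (if i \<le> min k l then 1 else 0) - real l / n * (if i \<le> k then 1 else 0) - real k / n * (if i \<le> l then 1 else 0)
       + real k / n * (real l / n)" for i
    by (auto simp: algebra_simps)
  have "(\<Sum>i\<in>{1..n}. ((if i \<le> k then 1 else 0) - real k / n) * ((if i \<le> l then 1 else 0) - real l / n))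
    = (\<Sum>i\<in>{1..n}. if i \<le> min k l then 1 else 0) - real l / n * (\<Sum>i\<in>{1..n}. if i \<le> k then 1 else 0)
      - real k / n * (\<Sum>i\<in>{1..n}. if i \<le> l then 1 else 0) + n * (real k / n * (real l / n))"
    unfolding e by (simp only: sum.distrib sum_subtractf sum_distrib_left[symmetric] sum_constant card_atLeastAtMost) simp
  also have "\<dots> = min (real k) l - real k * l / n"
    using assms by (subst (1 2 3) c) (auto simp: of_nat_min)
  finally show ?thesis .
qed

text \<open>The combination is linear in Y with coefficients b n i / sqrt n, where b is bounded
  uniformly in n and i. Averaging b^2 over i gives the bridge covariance form at the points floor (n
  t) / n, which tend to t, where the weight is continuous and positive.\<close>

lemma cos_transform_A:
  assumes T: "finite T" "T \<subseteq> {0<..<1}"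
  shows "(\<lambda>n. expectation (\<lambda>\<omega>. cos (\<Sum>t\<in>T. c t * A \<gamma> n (nat \<lfloor>real n * t\<rfloor>) \<omega>)))
    \<longlonglongrightarrow> exp (- (\<sigma>\<^sup>2 * (\<Sum>s\<in>T. \<Sum>t\<in>T. c s / wgt \<gamma> s * (c t / wgt \<gamma> t) * (min s t - s * t)) / 2))"
proof -
  define k where "k n t = nat \<lfloor>real n * t\<rfloor>" for n t
  define d where "d n t = c t / wgt \<gamma> (k n t / n)" for n t
  define b where "b n i = (\<Sum>t\<in>T. d n t * ((if i \<le> k n t then 1 else 0) - real (k n t) / n))" for n i
  have T01: "0 < t" "t < 1" if "t \<in> T" for t using that T by auto
  have kn: "k n t \<le> n" if "t \<in> T" for n t unfolding k_def using T01[OF that] by (intro floor_index_le) auto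
  have ktend: "(\<lambda>n. k n t / n) \<longlonglongrightarrow> t" if "t \<in> T" for t
    unfolding k_def using T01[OF that] by (intro floor_ratio_tendsto) auto
  have dtend: "(\<lambda>n. d n t) \<longlonglongrightarrow> c t / wgt \<gamma> t" if "t \<in> T" for t
    unfolding d_def wgt_def using T01[OF that] ktend[OF that]
    by (intro tendsto_intros) auto
  have "\<exists>K. \<forall>n. \<bar>d n t\<bar> \<le> K" if "t \<in> T" for t
    using Bseq_def convergent_imp_Bseq[OF convergentI[OF dtend[OF that]]] by (auto simp: Bseq_def)
  then obtain K where K: "\<And>t n. t \<in> T \<Longrightarrow> \<bar>d n t\<bar> \<le> K t" by metis
  define B where "B = (\<Sum>t\<in>T. K t)"
  have B0: "B \<ge> 0" unfolding B_def using K by (intro sum_nonneg) (auto intro: order_trans[OF abs_ge_zero])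
  have bB: "\<bar>b n i\<bar> \<le> B" for n i
  proof -
    have "\<bar>b n i\<bar> \<le> (\<Sum>t\<in>T. \<bar>d n t * ((if i \<le> k n t then 1 else 0) - real (k n t) / n)\<bar>)"
      unfolding b_def by (rule sum_abs)
    also have "\<dots> \<le> (\<Sum>t\<in>T. K t * 1)"
    proof (rule sum_mono)
      fix t assume t: "t \<in> T"
      have "0 \<le> real (k n t) / n" "real (k n t) / n \<le> 1" using kn[OF t, of n] by (auto simp: divide_le_eq_1)
      then have "\<bar>(if i \<le> k n t then 1 else 0) - real (k n t) / n\<bar> \<le> 1" by auto
      then show "\<bar>d n t * ((if i \<le> k n t then 1 else 0) - real (k n t) / n)\<bar> \<le> K t * 1"
        unfolding abs_mult using K[OF t] by (intro mult_mono) (auto intro: order_trans[OF abs_ge_zero])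
    qed
    finally show ?thesis by (simp add: B_def)
  qed
  have lin: "(\<Sum>t\<in>T. c t * A \<gamma> n (k n t) \<omega>) = (\<Sum>i\<in>{1..n}. b n i / sqrt n * Y i \<omega>)" for n \<omega>
  proof -
    have td: "tied_down Y n (k n t) \<omega> = (\<Sum>i\<in>{1..n}. ((if i \<le> k n t then 1 else 0) - real (k n t) / n) * Y i \<omega>)"
      if "t \<in> T" for t
    proof -
      have "partial_sum Y (k n t) \<omega> = (\<Sum>i\<in>{1..n}. (if i \<le> k n t then 1 else 0) * Y i \<omega>)"
        unfolding partial_sum_def by (rule sum.mono_neutral_cong_left) (use kn[OF that] in auto)
      then show ?thesis
        unfolding tied_down_def by (simp add: partial_sum_def[of Y n] sum_distrib_left sum_subtractf[symmetric] left_diff_distrib)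
    qed
    have "(\<Sum>t\<in>T. c t * A \<gamma> n (k n t) \<omega>) = (\<Sum>t\<in>T. \<Sum>i\<in>{1..n}. d n t * ((if i \<le> k n t then 1 else 0) - real (k n t) / n) / sqrt n * Y i \<omega>)"
      by (intro sum.cong refl) (simp add: A_def d_def td sum_distrib_left sum_divide_distrib mult_ac)
    also have "\<dots> = (\<Sum>i\<in>{1..n}. \<Sum>t\<in>T. d n t * ((if i \<le> k n t then 1 else 0) - real (k n t) / n) / sqrt n * Y i \<omega>)"
      by (rule sum.swap)
    also have "\<dots> = (\<Sum>i\<in>{1..n}. b n i / sqrt n * Y i \<omega>)"
      by (simp add: b_def sum_distrib_right sum_divide_distrib)
    finally show ?thesis .
  qed
  have quad: "(\<Sum>i\<in>{1..n}. (b n i)\<^sup>2) / n = (\<Sum>s\<in>T. \<Sum>t\<in>T. d n s * d n t * (min (k n s / n) (k n t / n) - k n s / n * (k n t / n)))"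
    if n: "n \<ge> 1" for n
  proof -
    let ?e = "\<lambda>i t. (if i \<le> k n t then 1 else 0) - real (k n t) / n"
    have "(\<Sum>i\<in>{1..n}. (b n i)\<^sup>2) = (\<Sum>i\<in>{1..n}. \<Sum>s\<in>T. \<Sum>t\<in>T. d n s * d n t * (?e i s * ?e i t))"
      by (simp add: b_def power2_eq_square sum_product mult_ac)
    also have "\<dots> = (\<Sum>s\<in>T. \<Sum>i\<in>{1..n}. \<Sum>t\<in>T. d n s * d n t * (?e i s * ?e i t))" by (rule sum.swap)
    also have "\<dots> = (\<Sum>s\<in>T. \<Sum>t\<in>T. \<Sum>i\<in>{1..n}. d n s * d n t * (?e i s * ?e i t))" by (intro sum.cong refl sum.swap)
    also have "\<dots> = (\<Sum>s\<in>T. \<Sum>t\<in>T. d n s * d n t * (min (real (k n s)) (k n t) - real (k n s) * k n t / n))"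
      by (intro sum.cong refl) (simp only: sum_distrib_left[symmetric] indicator_products_sum[OF kn kn n])
    finally have "(\<Sum>i\<in>{1..n}. (b n i)\<^sup>2) / n = (\<Sum>s\<in>T. \<Sum>t\<in>T. d n s * d n t * (min (real (k n s)) (k n t) - real (k n s) * k n t / n)) / n"
      by simp
    also have "\<dots> = (\<Sum>s\<in>T. \<Sum>t\<in>T. d n s * d n t * (min (k n s / n) (k n t / n) - k n s / n * (k n t / n)))"
    proof -
      have e: "min (real i / n) (real j / n) = min (real i) (real j) / n" for i j
        by (simp add: min_divide_distrib_right)
      have e': "x * (m - real i * real j / n) / n = x * (m / n - real i / n * (real j / n))" for x m :: real and i j
        by (simp add: diff_divide_distrib right_diff_distrib)
      show ?thesis unfolding sum_divide_distrib e e' ..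
    qed
    finally show ?thesis .
  qed
  let ?V = "\<Sum>s\<in>T. \<Sum>t\<in>T. c s / wgt \<gamma> s * (c t / wgt \<gamma> t) * (min s t - s * t)"
  have "(\<lambda>n. \<Sum>s\<in>T. \<Sum>t\<in>T. d n s * d n t * (min (k n s / n) (k n t / n) - k n s / n * (k n t / n))) \<longlonglongrightarrow> ?V"
    by (intro tendsto_sum tendsto_mult tendsto_diff tendsto_min dtend ktend)
  then have qlim: "(\<lambda>n. (\<Sum>i\<in>{1..n}. (b n i)\<^sup>2) / n) \<longlonglongrightarrow> ?V"
    by (rule Lim_transform_eventually) (intro eventually_mono[OF eventually_ge_at_top[of 1]], simp only: quad)
  define \<mu> where "\<mu> = distr D borel h"
  interpret \<mu>: real_distribution \<mu> unfolding \<mu>_def by (rule D.real_distribution_distr) simp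
  have \<mu>2: "integrable \<mu> (\<lambda>x. x\<^sup>2)"
    unfolding \<mu>_def using h_square by (auto simp: integrable_distr_eq)
  \<comment> \<open>The truncated third moment tends to zero by dominated convergence with majorant
    6 x^2; this takes the place of a higher moment of the score.\<close>
  define I where "I n = (\<integral>x. min (6 * x\<^sup>2) (B / sqrt (real n) * \<bar>x\<bar> ^ 3) \<partial>\<mu>)" for n
  have rt: "(\<lambda>n. B / sqrt (real n)) \<longlonglongrightarrow> 0"
    by (intro tendsto_divide_0[OF tendsto_const] filterlim_at_top_imp_at_infinity
        filterlim_compose[OF sqrt_at_top filterlim_real_sequentially])
  have "I \<longlonglongrightarrow> (\<integral>x. 0 \<partial>\<mu>)"
    unfolding I_def
  proof (rule integral_dominated_convergence[where w="\<lambda>x. 6 * x\<^sup>2"])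
    show "AE x in \<mu>. (\<lambda>n. min (6 * x\<^sup>2) (B / sqrt (real n) * \<bar>x\<bar> ^ 3)) \<longlonglongrightarrow> 0"
    proof (rule AE_I2)
      fix x
      have "(\<lambda>n. min (6 * x\<^sup>2) (B / sqrt (real n) * \<bar>x\<bar> ^ 3)) \<longlonglongrightarrow> min (6 * x\<^sup>2) (0 * \<bar>x\<bar> ^ 3)"
        by (intro tendsto_min tendsto_mult rt tendsto_const)
      then show "(\<lambda>n. min (6 * x\<^sup>2) (B / sqrt (real n) * \<bar>x\<bar> ^ 3)) \<longlonglongrightarrow> 0" by (simp add: min_absorb2)
    qed
    show "integrable \<mu> (\<lambda>x. 6 * x\<^sup>2)" using \<mu>2 by simp
    show "AE x in \<mu>. norm (min (6 * x\<^sup>2) (B / sqrt (real n) * \<bar>x\<bar> ^ 3)) \<le> 6 * x\<^sup>2" for n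
      unfolding real_norm_def using B0 by (intro AE_I2 abs_min_le) auto
  qed measurable
  then have Ilim: "I \<longlonglongrightarrow> 0" by simp
  have "(\<lambda>n. expectation (\<lambda>\<omega>. cos (\<Sum>i\<in>{1..n}. b n i / sqrt n * Y i \<omega>)) - exp (- (\<sigma>\<^sup>2 * ((\<Sum>i\<in>{1..n}. (b n i)\<^sup>2) / n) / 2))) \<longlonglongrightarrow> 0"
  proof (rule Lim_null_comparison)
    show "\<forall>\<^sub>F n in sequentially. norm (expectation (\<lambda>\<omega>. cos (\<Sum>i\<in>{1..n}. b n i / sqrt n * Y i \<omega>)) - exp (- (\<sigma>\<^sup>2 * ((\<Sum>i\<in>{1..n}. (b n i)\<^sup>2) / n) / 2)))
       \<le> B\<^sup>2 * (I n / 6 + B\<^sup>2 * \<sigma> ^ 4 / 4 / n)"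
      using eventually_ge_at_top[of 1]
    proof eventually_elim
      case (elim n)
      show ?case unfolding real_norm_def I_def \<mu>_def
        by (rule linear_combination_transform[OF B0 _ elim]) (rule bB)
    qed
    have "(\<lambda>n. B\<^sup>2 * (I n / 6 + B\<^sup>2 * \<sigma> ^ 4 / 4 / n)) \<longlonglongrightarrow> B\<^sup>2 * (0 / 6 + 0)"
      by (intro tendsto_intros Ilim lim_const_over_n) auto
    then show "(\<lambda>n. B\<^sup>2 * (I n / 6 + B\<^sup>2 * \<sigma> ^ 4 / 4 / n)) \<longlonglongrightarrow> 0" by simp
  qed
  note diff = this
  have "(\<lambda>n. exp (- (\<sigma>\<^sup>2 * ((\<Sum>i\<in>{1..n}. (b n i)\<^sup>2) / n) / 2))) \<longlonglongrightarrow> exp (- (\<sigma>\<^sup>2 * ?V / 2))"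
    by (intro tendsto_intros qlim) auto
  from Lim_transform[OF this diff] show ?thesis by (simp only: lin k_def[symmetric])
qed

text \<open>Chebyshev at each of the finitely many points, where the weight converges to a positive
  limit. It supplies the hypothesis \<open>tight\<close> of \<open>fdd_lower\<close>.\<close>

lemma A_tight:
  assumes T: "finite T" "T \<subseteq> {0<..<1}" and \<eta>: "\<eta> > 0"
  shows "\<exists>K. \<forall>L\<ge>K. \<forall>\<^sub>F n in sequentially. prob {\<omega> \<in> space M. \<exists>t\<in>T. \<bar>A \<gamma> n (nat \<lfloor>real n * t\<rfloor>) \<omega>\<bar> > L} \<le> \<eta>"
proof -
  have one: "\<exists>K. \<forall>L\<ge>K. \<forall>\<^sub>F n in sequentially. prob {\<omega> \<in> space M. \<bar>A \<gamma> n (nat \<lfloor>real n * t\<rfloor>) \<omega>\<bar> > L} \<le> \<eta> / (card T + 1)"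
    if t: "t \<in> T" for t
  proof -
    define w where "w = wgt \<gamma> t"
    have t01: "0 < t" "t < 1" using t T by auto
    have w: "w > 0" unfolding w_def using t01 by (rule wgt_pos)
    \<comment> \<open>The summand 1 forces L >= 1, so that Chebyshev's 1 / L^2 may be weakened to 1
      / L; for large n the weight is bounded below by w / 2.\<close>
    define K where "K = 1 + 32 * \<sigma>\<^sup>2 / w\<^sup>2 * (card T + 1) / \<eta>"
    have tend: "(\<lambda>n. wgt \<gamma> (nat \<lfloor>real n * t\<rfloor> / n)) \<longlonglongrightarrow> w"
      unfolding w_def wgt_def using t01 by (intro tendsto_intros floor_ratio_tendsto) auto
    have "\<forall>\<^sub>F n in sequentially. wgt \<gamma> (nat \<lfloor>real n * t\<rfloor> / n) > w / 2"
      using tend w by (intro order_tendstoD) auto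
    note ev = this eventually_gt_at_top[of 0]
    show ?thesis
    proof (intro exI[of _ K] allI impI)
      fix L assume L: "K \<le> L"
      have "0 \<le> 32 * \<sigma>\<^sup>2 / w\<^sup>2 * (card T + 1) / \<eta>" using \<eta> by simp
      then have L1: "L \<ge> 1" using L by (simp add: K_def)
      show "\<forall>\<^sub>F n in sequentially. prob {\<omega> \<in> space M. \<bar>A \<gamma> n (nat \<lfloor>real n * t\<rfloor>) \<omega>\<bar> > L} \<le> \<eta> / (card T + 1)"
        using ev
      proof eventually_elim
        case (elim n)
        define k where "k = nat \<lfloor>real n * t\<rfloor>"
        have kn: "k \<le> n" unfolding k_def using t01 by (intro floor_index_le) auto
        interpret R: centered_row M Y n "\<sigma>\<^sup>2" by (rule row)
        define c where "c = L * (sqrt n * w / 2) / 2"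
        have c: "c > 0" using L1 elim w by (simp add: c_def)
        have c2: "c\<^sup>2 = L\<^sup>2 * n * w\<^sup>2 / 16" by (simp add: c_def power_mult_distrib power_divide)
        have sub: "{\<omega> \<in> space M. \<bar>A \<gamma> n k \<omega>\<bar> > L} \<subseteq> {\<omega> \<in> space M. \<bar>\<Sum>i\<in>{1..k}. Y i \<omega>\<bar> \<ge> c} \<union> {\<omega> \<in> space M. \<bar>\<Sum>i\<in>{1..n}. Y i \<omega>\<bar> \<ge> c}"
        proof safe
          fix \<omega> assume a: "\<bar>A \<gamma> n k \<omega>\<bar> > L" and nc: "\<not> c \<le> \<bar>\<Sum>i\<in>{1..n}. Y i \<omega>\<bar>"
          have wk: "wgt \<gamma> (k / n) > w / 2" using elim by (simp add: k_def)
          have den: "sqrt n * wgt \<gamma> (k / n) > 0" using elim wk w by simp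
          have "L * (sqrt n * (w / 2)) \<le> L * (sqrt n * wgt \<gamma> (k / n))"
            using wk L1 by (intro mult_left_mono) auto
          also have "\<dots> < \<bar>tied_down Y n k \<omega>\<bar>"
            using a den w wk unfolding A_def by (simp add: abs_divide abs_mult pos_less_divide_eq)
          finally have "2 * c < \<bar>tied_down Y n k \<omega>\<bar>" by (simp add: c_def mult_ac)
          also have "\<dots> \<le> \<bar>partial_sum Y k \<omega>\<bar> + \<bar>real k / n * partial_sum Y n \<omega>\<bar>"
            unfolding tied_down_def by (rule abs_triangle_ineq4)
          also have "\<bar>real k / n * partial_sum Y n \<omega>\<bar> \<le> 1 * \<bar>partial_sum Y n \<omega>\<bar>"
            unfolding abs_mult using kn elim by (intro mult_right_mono) auto
          finally show "c \<le> \<bar>\<Sum>i\<in>{1..k}. Y i \<omega>\<bar>" using nc unfolding partial_sum_def by linarith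
        qed
        have m: "(\<lambda>\<omega>. \<Sum>i\<in>{1..j}. Y i \<omega>) \<in> borel_measurable M" for j by (intro borel_measurable_sum Y_measurable) auto
        have "prob {\<omega> \<in> space M. \<bar>A \<gamma> n k \<omega>\<bar> > L} \<le> prob ({\<omega> \<in> space M. \<bar>\<Sum>i\<in>{1..k}. Y i \<omega>\<bar> \<ge> c} \<union> {\<omega> \<in> space M. \<bar>\<Sum>i\<in>{1..n}. Y i \<omega>\<bar> \<ge> c})"
          by (rule finite_measure_mono[OF sub]) (use m[of k] m[of n] in measurable)
        also have "\<dots> \<le> prob {\<omega> \<in> space M. \<bar>\<Sum>i\<in>{1..k}. Y i \<omega>\<bar> \<ge> c} + prob {\<omega> \<in> space M. \<bar>\<Sum>i\<in>{1..n}. Y i \<omega>\<bar> \<ge> c}"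
          by (rule measure_Un_le) (use m[of k] m[of n] in measurable)
        also have "\<dots> \<le> card {1..k} * \<sigma>\<^sup>2 / c\<^sup>2 + card {1..n} * \<sigma>\<^sup>2 / c\<^sup>2"
          by (intro add_mono R.block_tail c) (use kn in auto)
        also have "\<dots> \<le> n * \<sigma>\<^sup>2 / c\<^sup>2 + n * \<sigma>\<^sup>2 / c\<^sup>2"
          using kn by (intro add_mono divide_right_mono mult_right_mono) auto
        also have "\<dots> = 32 * \<sigma>\<^sup>2 / w\<^sup>2 / L\<^sup>2" unfolding c2 using elim by (simp add: field_simps)
        also have "\<dots> \<le> 32 * \<sigma>\<^sup>2 / w\<^sup>2 / L"
          using L1 by (intro divide_left_mono) (auto simp: power2_eq_square)
        also have "\<dots> \<le> \<eta> / (card T + 1)"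
        proof -
          have "32 * \<sigma>\<^sup>2 / w\<^sup>2 * (card T + 1) / \<eta> \<le> L" using L by (simp add: K_def)
          then have "32 * \<sigma>\<^sup>2 / w\<^sup>2 * (card T + 1) \<le> L * \<eta>" using \<eta> by (simp only: pos_divide_le_eq)
          then have "32 * \<sigma>\<^sup>2 / w\<^sup>2 * (card T + 1) \<le> \<eta> * L" by (simp only: mult.commute)
          then have "32 * \<sigma>\<^sup>2 / w\<^sup>2 \<le> \<eta> * L / (card T + 1)"
            by (subst pos_le_divide_eq) auto
          then show ?thesis using L1 by (subst pos_divide_le_eq) auto
        qed
        finally show ?case by (simp add: k_def)
      qed
    qed
  qed
  then have "\<forall>t\<in>T. \<exists>K. \<forall>L\<ge>K. \<forall>\<^sub>F n in sequentially. prob {\<omega> \<in> space M. \<bar>A \<gamma> n (nat \<lfloor>real n * t\<rfloor>) \<omega>\<bar> > L} \<le> \<eta> / (card T + 1)"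
    by blast
  from bchoice[OF this] obtain K where "\<forall>t\<in>T. \<forall>L\<ge>K t.
    \<forall>\<^sub>F n in sequentially. prob {\<omega> \<in> space M. \<bar>A \<gamma> n (nat \<lfloor>real n * t\<rfloor>) \<omega>\<bar> > L} \<le> \<eta> / (card T + 1)" ..
  then have K: "\<forall>\<^sub>F n in sequentially. prob {\<omega> \<in> space M. \<bar>A \<gamma> n (nat \<lfloor>real n * t\<rfloor>) \<omega>\<bar> > L} \<le> \<eta> / (card T + 1)"
    if "t \<in> T" "L \<ge> K t" for t L using that by blast
  show ?thesis
  proof (intro exI[of _ "\<Sum>t\<in>T. \<bar>K t\<bar>"] allI impI)
    fix L assume L: "(\<Sum>t\<in>T. \<bar>K t\<bar>) \<le> L"
    have KL: "K t \<le> L" if "t \<in> T" for t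
      using member_le_sum[of t T "\<lambda>t. \<bar>K t\<bar>"] that T L by simp
    have "\<forall>\<^sub>F n in sequentially. \<forall>t\<in>T. prob {\<omega> \<in> space M. \<bar>A \<gamma> n (nat \<lfloor>real n * t\<rfloor>) \<omega>\<bar> > L} \<le> \<eta> / (card T + 1)"
      by (rule eventually_ball_finite[OF T(1)]) (use K KL in blast)
    then show "\<forall>\<^sub>F n in sequentially. prob {\<omega> \<in> space M. \<exists>t\<in>T. \<bar>A \<gamma> n (nat \<lfloor>real n * t\<rfloor>) \<omega>\<bar> > L} \<le> \<eta>"
    proof eventually_elim
      case (elim n)
      have "{\<omega> \<in> space M. \<exists>t\<in>T. \<bar>A \<gamma> n (nat \<lfloor>real n * t\<rfloor>) \<omega>\<bar> > L} = (\<Union>t\<in>T. {\<omega> \<in> space M. \<bar>A \<gamma> n (nat \<lfloor>real n * t\<rfloor>) \<omega>\<bar> > L})" by auto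
      also have "prob \<dots> \<le> (\<Sum>t\<in>T. prob {\<omega> \<in> space M. \<bar>A \<gamma> n (nat \<lfloor>real n * t\<rfloor>) \<omega>\<bar> > L})"
        by (intro finite_measure_subadditive_finite T) auto
      also have "\<dots> \<le> (\<Sum>t\<in>T. \<eta> / (card T + 1))" using elim by (intro sum_mono) auto
      also have "\<dots> \<le> \<eta>" using \<eta> by (simp add: field_simps)
      finally show ?case .
    qed
  qed
qed

end

section \<open>Weighted Brownian bridges\<close>

lemma sets_Collect_Ball_abs_le:
  fixes X :: "'t \<Rightarrow> 'a \<Rightarrow> real"
  assumes Q: "countable Q" and X: "\<And>t. t \<in> Q \<Longrightarrow> X t \<in> borel_measurable M"
  shows "{\<omega> \<in> space M. \<forall>t\<in>Q. \<bar>X t \<omega>\<bar> \<le> a} \<in> sets M"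
proof -
  have "{\<omega> \<in> space M. \<bar>X t \<omega>\<bar> > a} \<in> sets M" if "t \<in> Q" for t
    using X[OF that] by measurable
  then have "space M - (\<Union>t\<in>Q. {\<omega> \<in> space M. \<bar>X t \<omega>\<bar> > a}) \<in> sets M"
    using Q by (intro sets.Diff sets.countable_UN') auto
  moreover have "space M - (\<Union>t\<in>Q. {\<omega> \<in> space M. \<bar>X t \<omega>\<bar> > a}) = {\<omega> \<in> space M. \<forall>t\<in>Q. \<bar>X t \<omega>\<bar> \<le> a}"
    by (auto simp: not_le)
  ultimately show ?thesis by simp
qed

lemma (in prob_space) prob_bounded_from_above:
  fixes X :: "'t \<Rightarrow> 'a \<Rightarrow> real"
  assumes Q: "countable Q" and X[measurable]: "\<And>t. t \<in> Q \<Longrightarrow> X t \<in> borel_measurable M" and \<eta>: "\<eta> > 0"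
  shows "\<exists>b>a. prob {\<omega> \<in> space M. \<forall>t\<in>Q. \<bar>X t \<omega>\<bar> \<le> b} \<le> prob {\<omega> \<in> space M. \<forall>t\<in>Q. \<bar>X t \<omega>\<bar> \<le> a} + \<eta>"
proof -
  let ?A = "\<lambda>b. {\<omega> \<in> space M. \<forall>t\<in>Q. \<bar>X t \<omega>\<bar> \<le> b}"
  have m: "?A b \<in> sets M" for b by (rule sets_Collect_Ball_abs_le[OF Q X])
  let ?b = "\<lambda>k::nat. a + 1 / real (Suc k)"
  have "(\<lambda>k. prob (?A (?b k))) \<longlonglongrightarrow> prob (\<Inter>k. ?A (?b k))"
  proof (rule finite_Lim_measure_decseq)
    show "range (\<lambda>k. ?A (?b k)) \<subseteq> sets M" using m by auto
    show "decseq (\<lambda>k. ?A (?b k))"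
      unfolding decseq_def
    proof (intro allI impI subsetI)
      fix i j :: nat and \<omega> assume ij: "i \<le> j" and w: "\<omega> \<in> ?A (?b j)"
      have "1 / real (Suc j) \<le> 1 / real (Suc i)" using ij by (intro divide_left_mono) auto
      then show "\<omega> \<in> ?A (?b i)" using w by force
    qed
  qed
  moreover have "(\<Inter>k. ?A (?b k)) = ?A a"
  proof safe
    fix \<omega> t assume w: "\<omega> \<in> (\<Inter>k. ?A (?b k))" and t: "t \<in> Q"
    show "\<bar>X t \<omega>\<bar> \<le> a"
    proof (rule LIMSEQ_le_const)
      show "(\<lambda>k. a + 1 / real (Suc k)) \<longlonglongrightarrow> a"
        using tendsto_add[OF tendsto_const LIMSEQ_inverse_real_of_nat, of a] by (simp add: inverse_eq_divide)
    qed (use w t in auto)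
  qed (auto intro: order_trans)
  ultimately have "(\<lambda>k. prob (?A (?b k))) \<longlonglongrightarrow> prob (?A a)" by simp
  then have "\<forall>\<^sub>F k in sequentially. prob (?A (?b k)) < prob (?A a) + \<eta>" using \<eta> by (intro order_tendstoD) auto
  then obtain k where "prob (?A (?b k)) < prob (?A a) + \<eta>" by (auto simp: eventually_sequentially)
  then show ?thesis by (intro exI[of _ "?b k"]) auto
qed

lemma (in prob_space) prob_bounded_finite_subset:
  fixes X :: "'t \<Rightarrow> 'a \<Rightarrow> real"
  assumes Q: "countable Q" and X[measurable]: "\<And>t. t \<in> Q \<Longrightarrow> X t \<in> borel_measurable M" and \<eta>: "\<eta> > 0"
  shows "\<exists>T. finite T \<and> T \<subseteq> Q \<and>
    prob {\<omega> \<in> space M. \<forall>t\<in>T. \<bar>X t \<omega>\<bar> \<le> a} \<le> prob {\<omega> \<in> space M. \<forall>t\<in>Q. \<bar>X t \<omega>\<bar> \<le> a} + \<eta>"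
proof -
  let ?A = "\<lambda>T. {\<omega> \<in> space M. \<forall>t\<in>T. \<bar>X t \<omega>\<bar> \<le> a}"
  have m: "?A T \<in> sets M" if "T \<subseteq> Q" for T
    by (rule sets_Collect_Ball_abs_le[OF countable_subset[OF that Q]]) (use that in auto)
  define T where "T k = {t \<in> Q. to_nat_on Q t \<le> k}" for k
  have TQ: "T k \<subseteq> Q" for k by (auto simp: T_def)
  have fT: "finite (T k)" for k
  proof (rule finite_imageD)
    show "finite (to_nat_on Q ` T k)" by (rule finite_subset[of _ "{..k}"]) (auto simp: T_def)
    show "inj_on (to_nat_on Q) (T k)" by (rule inj_on_subset[OF inj_on_to_nat_on[OF Q] TQ])
  qed
  have "(\<lambda>k. prob (?A (T k))) \<longlonglongrightarrow> prob (\<Inter>k. ?A (T k))"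
  proof (rule finite_Lim_measure_decseq)
    show "range (\<lambda>k. ?A (T k)) \<subseteq> sets M" using m[OF TQ] by auto
    show "decseq (\<lambda>k. ?A (T k))" by (auto simp: decseq_def T_def)
  qed
  moreover have "(\<Inter>k. ?A (T k)) = ?A Q" by (auto simp: T_def)
  ultimately have "(\<lambda>k. prob (?A (T k))) \<longlonglongrightarrow> prob (?A Q)" by simp
  then have "\<forall>\<^sub>F k in sequentially. prob (?A (T k)) < prob (?A Q) + \<eta>" using \<eta> by (intro order_tendstoD) auto
  then obtain k where "prob (?A (T k)) < prob (?A Q) + \<eta>" by (auto simp: eventually_sequentially)
  then show ?thesis using fT[of k] TQ[of k] by (intro exI[of _ "T k"]) auto
qed

text \<open>\<open>fdd_upper\<close> for a constant sequence compares finite boxes at levels a < b;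
  b is chosen by continuity from above in the level, the finite set by continuity over the countable
  index set. Used in both directions it shows that the transforms determine the probability.\<close>

lemma cos_transform_determines_le:
  fixes X :: "'t \<Rightarrow> 'a \<Rightarrow> real" and Y :: "'t \<Rightarrow> 'b \<Rightarrow> real"
  assumes M: "prob_space M" and N: "prob_space N" and Q: "countable Q"
    and X: "\<And>t. t \<in> Q \<Longrightarrow> X t \<in> borel_measurable M"
    and Y: "\<And>t. t \<in> Q \<Longrightarrow> Y t \<in> borel_measurable N"
    and eq: "\<And>T c. finite T \<Longrightarrow> T \<subseteq> Q \<Longrightarrow> (\<integral>\<omega>. cos (\<Sum>t\<in>T. c t * X t \<omega>) \<partial>M) = (\<integral>\<omega>. cos (\<Sum>t\<in>T. c t * Y t \<omega>) \<partial>N)"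
    and a: "0 \<le> a"
  shows "measure M {\<omega> \<in> space M. \<forall>t\<in>Q. \<bar>X t \<omega>\<bar> \<le> a} \<le> measure N {\<omega> \<in> space N. \<forall>t\<in>Q. \<bar>Y t \<omega>\<bar> \<le> a}"
proof (rule field_le_epsilon)
  fix \<eta> :: real assume "\<eta> > 0"
  then have \<eta>: "\<eta> / 3 > 0" by simp
  interpret M: prob_space M by (rule M)
  interpret N: prob_space N by (rule N)
  obtain b where b: "b > a" "N.prob {\<omega> \<in> space N. \<forall>t\<in>Q. \<bar>Y t \<omega>\<bar> \<le> b} \<le> N.prob {\<omega> \<in> space N. \<forall>t\<in>Q. \<bar>Y t \<omega>\<bar> \<le> a} + \<eta> / 3"
    using N.prob_bounded_from_above[OF Q, where X=Y and a=a, OF Y \<eta>] by blast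
  obtain T where T: "finite T" "T \<subseteq> Q"
    "N.prob {\<omega> \<in> space N. \<forall>t\<in>T. \<bar>Y t \<omega>\<bar> \<le> b} \<le> N.prob {\<omega> \<in> space N. \<forall>t\<in>Q. \<bar>Y t \<omega>\<bar> \<le> b} + \<eta> / 3"
    using N.prob_bounded_finite_subset[OF Q, where X=Y and a=b, OF Y \<eta>] by blast
  have XT: "X t \<in> borel_measurable M" and YT: "Y t \<in> borel_measurable N" if "t \<in> T" for t
    using that T X Y by auto
  have "\<forall>\<^sub>F n::nat in sequentially. M.prob {\<omega> \<in> space M. \<forall>t\<in>T. \<bar>X t \<omega>\<bar> \<le> a} \<le> N.prob {\<omega> \<in> space N. \<forall>t\<in>T. \<bar>Y t \<omega>\<bar> \<le> b} + \<eta> / 3"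
    by (rule fdd_upper[OF M N T(1), where X="\<lambda>_. X" and Y=Y, OF XT YT _ a b(1) \<eta>]) (auto simp: eq[OF T(1,2)])
  then have "M.prob {\<omega> \<in> space M. \<forall>t\<in>T. \<bar>X t \<omega>\<bar> \<le> a} \<le> N.prob {\<omega> \<in> space N. \<forall>t\<in>T. \<bar>Y t \<omega>\<bar> \<le> b} + \<eta> / 3"
    by (auto simp: eventually_sequentially)
  moreover have "M.prob {\<omega> \<in> space M. \<forall>t\<in>Q. \<bar>X t \<omega>\<bar> \<le> a} \<le> M.prob {\<omega> \<in> space M. \<forall>t\<in>T. \<bar>X t \<omega>\<bar> \<le> a}"
  proof (rule M.finite_measure_mono)
    show "{\<omega> \<in> space M. \<forall>t\<in>T. \<bar>X t \<omega>\<bar> \<le> a} \<in> sets M"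
      by (rule sets_Collect_Ball_abs_le[OF countable_finite[OF T(1)] XT])
  qed (use T in auto)
  ultimately show "M.prob {\<omega> \<in> space M. \<forall>t\<in>Q. \<bar>X t \<omega>\<bar> \<le> a} \<le> N.prob {\<omega> \<in> space N. \<forall>t\<in>Q. \<bar>Y t \<omega>\<bar> \<le> a} + \<eta>"
    using b T by linarith
qed

section \<open>Gaussian combinations of bridge values and resampling at 1/2\<close>

lemma finite_null_set_std_normal:
  assumes "finite S"
  shows "S \<in> null_sets std_normal_distribution"
proof -
  have S: "S \<in> null_sets lborel" using assms by (rule finite_imp_null_set_lborel)
  have "AE x in lborel. x \<in> S \<longrightarrow> ennreal (std_normal_density x) = 0"
    using AE_not_in[OF S] by eventually_elim simp
  then show ?thesis using S by (subst null_sets_density_iff) auto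
qed

lemma gaussian_rv_centered:
  assumes "prob_space N" and g: "gaussian_rv N X" and mean: "integral\<^sup>L N X = 0"
  shows "integrable N (\<lambda>\<omega>. (X \<omega>)\<^sup>2)"
    and "(\<integral>\<omega>. cos (X \<omega>) \<partial>N) = exp (- (\<integral>\<omega>. (X \<omega>)\<^sup>2 \<partial>N) / 2)"
    and "(\<integral>\<omega>. (X \<omega>)\<^sup>2 \<partial>N) \<noteq> 0 \<Longrightarrow> measure N {\<omega> \<in> space N. X \<omega> = 0} = 0"
proof -
  interpret N: prob_space N by fact
  define Z where "Z = std_normal_distribution"
  interpret Z: real_distribution Z unfolding Z_def by (rule real_dist_normal_dist)
  have [measurable]: "X \<in> borel_measurable N" using g by (simp add: gaussian_rv_def)
  obtain m s where ms: "distr N borel X = distr Z borel (\<lambda>z. m + s * z)" using g by (auto simp: gaussian_rv_def Z_def)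
  have Z1: "integrable Z (\<lambda>z. z)" "(\<integral>z. z \<partial>Z) = 0"
    using integrable_std_normal_distribution_moment[of 1] integral_std_normal_distribution_moment_odd[of 1]
    unfolding Z_def[symmetric] by simp_all
  have Z2: "integrable Z (\<lambda>z. z\<^sup>2)" "(\<integral>z. z\<^sup>2 \<partial>Z) = 1"
    using integrable_std_normal_distribution_moment[of 2] std_normal_distribution_even_moments(1)[of 1]
    unfolding Z_def[symmetric] by simp_all
  have tr: "(\<integral>\<omega>. f (X \<omega>) \<partial>N) = (\<integral>z. f (m + s * z) \<partial>Z)" if [measurable]: "f \<in> borel_measurable borel" for f :: "real \<Rightarrow> real"
  proof -
    have "(\<integral>\<omega>. f (X \<omega>) \<partial>N) = (\<integral>x. f x \<partial>distr N borel X)" by (simp add: integral_distr)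
    also have "\<dots> = (\<integral>z. f (m + s * z) \<partial>Z)" unfolding ms by (subst integral_distr) auto
    finally show ?thesis .
  qed
  have "integral\<^sup>L N X = (\<integral>z. m + s * z \<partial>Z)" by (rule tr[OF measurable_ident_sets[OF refl]])
  also have "\<dots> = (\<integral>z. m \<partial>Z) + (\<integral>z. s * z \<partial>Z)"
    by (rule Bochner_Integration.integral_add[OF Z.integrable_const integrable_mult_right[OF Z1(1)]])
  also have "\<dots> = m"
    unfolding integral_mult_right_zero Z1(2) lebesgue_integral_const Z.prob_space by (simp only: scaleR_one mult_zero_right add_0_right)
  finally have "integral\<^sup>L N X = m" .
  then have m: "m = 0" using mean by simp
  have var: "(\<integral>\<omega>. (X \<omega>)\<^sup>2 \<partial>N) = s\<^sup>2"
  proof -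
    have "(\<integral>\<omega>. (X \<omega>)\<^sup>2 \<partial>N) = (\<integral>z. s\<^sup>2 * z\<^sup>2 \<partial>Z)"
      using tr[of "\<lambda>x. x\<^sup>2"] by (simp add: m power_mult_distrib)
    also have "\<dots> = s\<^sup>2" using Z2 by simp
    finally show ?thesis .
  qed
  have "integrable N (\<lambda>\<omega>. (X \<omega>)\<^sup>2) \<longleftrightarrow> integrable (distr N borel X) (\<lambda>x. x\<^sup>2)" by (subst integrable_distr_eq) auto
  also have "\<dots> \<longleftrightarrow> integrable Z (\<lambda>z. (m + s * z)\<^sup>2)" unfolding ms by (subst integrable_distr_eq) auto
  finally show "integrable N (\<lambda>\<omega>. (X \<omega>)\<^sup>2)" using Z2 by (simp add: m power_mult_distrib)
  have "(\<integral>\<omega>. cos (X \<omega>) \<partial>N) = (\<integral>z. Re (iexp (s * z)) \<partial>Z)" using tr[of cos] by (simp add: m Re_exp)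
  also have "\<dots> = Re (char Z s)" unfolding char_def by (rule integral_Re) (rule Z.integrable_iexp, auto)
  also have "\<dots> = exp (- (\<integral>\<omega>. (X \<omega>)\<^sup>2 \<partial>N) / 2)" unfolding Z_def char_std_normal_distribution var by simp
  finally show "(\<integral>\<omega>. cos (X \<omega>) \<partial>N) = exp (- (\<integral>\<omega>. (X \<omega>)\<^sup>2 \<partial>N) / 2)" .
  assume "(\<integral>\<omega>. (X \<omega>)\<^sup>2 \<partial>N) \<noteq> 0"
  then have s: "s \<noteq> 0" using var by auto
  have "measure N {\<omega> \<in> space N. X \<omega> = 0} = measure (distr N borel X) {0}"
    by (subst measure_distr) (auto intro!: arg_cong[where f="measure N"])
  also have "\<dots> = measure Z {0}" unfolding ms using s m
    by (subst measure_distr) (auto intro!: arg_cong[where f="measure Z"])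
  also have "\<dots> = 0"
    unfolding Z_def by (rule measure_eq_0_null_sets) (rule finite_null_set_std_normal, simp)
  finally show "measure N {\<omega> \<in> space N. X \<omega> = 0} = 0" .
qed

locale std_bridge = prob_space N for N :: "'b measure" +
  fixes W :: "real \<Rightarrow> 'b \<Rightarrow> real"
  assumes bridge: "brownian_bridge N W"
begin

lemma W_gaussian: "finite T \<Longrightarrow> T \<subseteq> {0..1} \<Longrightarrow> gaussian_rv N (\<lambda>\<omega>. \<Sum>t\<in>T. c t * W t \<omega>)"
  using bridge by (auto simp: brownian_bridge_def)

lemma W_gaussian1: "t \<in> {0..1} \<Longrightarrow> gaussian_rv N (W t)"
  using W_gaussian[of "{t}" "\<lambda>_. 1"] by simp

lemma W_measurable[measurable]: "t \<in> {0..1} \<Longrightarrow> W t \<in> borel_measurable N"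
  using W_gaussian1[of t] by (simp add: gaussian_rv_def)

lemma W_mean: "t \<in> {0..1} \<Longrightarrow> expectation (W t) = 0"
  and W_cov: "s \<in> {0..1} \<Longrightarrow> t \<in> {0..1} \<Longrightarrow> expectation (\<lambda>\<omega>. W s \<omega> * W t \<omega>) = min s t - s * t"
  and W_continuous: "\<omega> \<in> space N \<Longrightarrow> continuous_on {0..1} (\<lambda>t. W t \<omega>)"
  using bridge by (auto simp: brownian_bridge_def)

lemma W_square: "t \<in> {0..1} \<Longrightarrow> integrable N (\<lambda>\<omega>. (W t \<omega>)\<^sup>2)"
  by (rule gaussian_rv_centered(1)[OF prob_space_axioms W_gaussian1 W_mean])

lemma W_integrable: "t \<in> {0..1} \<Longrightarrow> integrable N (W t)"
  by (rule square_integrable_imp_integrable[OF _ W_square]) auto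

lemma W_combination:
  assumes T: "finite T" "T \<subseteq> {0..1}"
  shows "expectation (\<lambda>\<omega>. (\<Sum>t\<in>T. c t * W t \<omega>)\<^sup>2) = (\<Sum>s\<in>T. \<Sum>t\<in>T. c s * c t * (min s t - s * t))"
    and "expectation (\<lambda>\<omega>. cos (\<Sum>t\<in>T. c t * W t \<omega>)) = exp (- (\<Sum>s\<in>T. \<Sum>t\<in>T. c s * c t * (min s t - s * t)) / 2)"
proof -
  have m: "(\<lambda>\<omega>. c t * W t \<omega>) \<in> borel_measurable N" and sq: "integrable N (\<lambda>\<omega>. (c t * W t \<omega>)\<^sup>2)" if "t \<in> T" for t
    using that T W_square[of t] by (auto simp: power_mult_distrib)
  have "expectation (\<lambda>\<omega>. (\<Sum>t\<in>T. c t * W t \<omega>)\<^sup>2) = (\<Sum>s\<in>T. \<Sum>t\<in>T. expectation (\<lambda>\<omega>. c s * W s \<omega> * (c t * W t \<omega>)))"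
    by (rule integral_square_sum(2)[OF m sq])
  also have "\<dots> = (\<Sum>s\<in>T. \<Sum>t\<in>T. c s * c t * (min s t - s * t))"
  proof (intro sum.cong refl)
    fix s t assume st: "s \<in> T" "t \<in> T"
    have "expectation (\<lambda>\<omega>. c s * W s \<omega> * (c t * W t \<omega>)) = expectation (\<lambda>\<omega>. (c s * c t) * (W s \<omega> * W t \<omega>))"
      by (simp add: mult_ac)
    also have "\<dots> = c s * c t * (min s t - s * t)" using W_cov[of s t] subsetD[OF T(2) st(1)] subsetD[OF T(2) st(2)] by simp
    finally show "expectation (\<lambda>\<omega>. c s * W s \<omega> * (c t * W t \<omega>)) = c s * c t * (min s t - s * t)" .
  qed
  finally show 1: "expectation (\<lambda>\<omega>. (\<Sum>t\<in>T. c t * W t \<omega>)\<^sup>2) = (\<Sum>s\<in>T. \<Sum>t\<in>T. c s * c t * (min s t - s * t))" .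
  have "expectation (\<lambda>\<omega>. \<Sum>t\<in>T. c t * W t \<omega>) = (\<Sum>t\<in>T. c t * expectation (W t))"
    using T W_integrable by (subst Bochner_Integration.integral_sum) auto
  also have "\<dots> = 0" using T W_mean by (intro sum.neutral) auto
  finally show "expectation (\<lambda>\<omega>. cos (\<Sum>t\<in>T. c t * W t \<omega>)) = exp (- (\<Sum>s\<in>T. \<Sum>t\<in>T. c s * c t * (min s t - s * t)) / 2)"
    using gaussian_rv_centered(2)[OF prob_space_axioms W_gaussian[OF T]] 1 by simp
qed

text \<open>Replacing the value of the bridge at \<open>1/2\<close> by an independent copy does not change the law.\<close>

definition tent :: "real \<Rightarrow> real" where "tent t = 2 * min t (1 - t)"

definition W_resampled :: "real \<Rightarrow> 'b \<times> real \<Rightarrow> real" where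
  "W_resampled t p = W t (fst p) + tent t * (snd p / 2 - W (1 / 2) (fst p))"

lemma W_resampled_measurable: "t \<in> {0..1} \<Longrightarrow> W_resampled t \<in> borel_measurable (N \<Otimes>\<^sub>M std_normal_distribution)"
  unfolding W_resampled_def by measurable

text \<open>The covariance of W t and W (1/2) is tent t / 4 and the variance of W (1/2) is 1/4, so W
  t - tent t * W (1/2) is the residual of the regression on W (1/2). A normal variable of standard
  deviation 1/2, independent of the path, restores the variance E^2 / 4 which the combination has
  lost.\<close>

lemma W_resampled_transform:
  assumes T: "finite T" "T \<subseteq> {0..1}"
  shows "(\<integral>p. cos (\<Sum>t\<in>T. c t * W_resampled t p) \<partial>(N \<Otimes>\<^sub>M std_normal_distribution)) = expectation (\<lambda>\<omega>. cos (\<Sum>t\<in>T. c t * W t \<omega>))"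
proof -
  define Z where "Z = std_normal_distribution"
  interpret Z: real_distribution Z unfolding Z_def by (rule real_dist_normal_dist)
  interpret NZ: pair_prob_space N Z ..
  define E where "E = (\<Sum>t\<in>T. c t * tent t)"
  define V where "V = (\<Sum>s\<in>T. \<Sum>t\<in>T. c s * c t * (min s t - s * t))"
  define X where "X \<omega> = (\<Sum>t\<in>T. c t * W t \<omega>)" for \<omega>
  define L where "L \<omega> = X \<omega> - E * W (1 / 2) \<omega>" for \<omega>
  have Wm: "W t \<in> borel_measurable N" if "t \<in> T" for t using that T by auto
  have Xm[measurable]: "X \<in> borel_measurable N" unfolding X_def using Wm by measurable
  have hm[measurable]: "W (1 / 2) \<in> borel_measurable N" by (rule W_measurable) simp
  have Lm[measurable]: "L \<in> borel_measurable N" unfolding L_def by measurable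
  have comb: "(\<Sum>t\<in>T. c t * W_resampled t p) = L (fst p) + E / 2 * snd p" for p
    by (simp add: W_resampled_def L_def X_def E_def algebra_simps sum.distrib sum_subtractf sum_distrib_left sum_distrib_right sum_divide_distrib)
  \<comment> \<open>L is again a finite combination of bridge values, now with the point 1/2 added;
    T may or may not contain it already, which the case distinctions absorb.\<close>
  define c' where "c' t = (if t \<in> T then c t else 0) - (if t = 1 / 2 then E else 0)" for t
  have Lc: "L \<omega> = (\<Sum>t\<in>insert (1 / 2) T. c' t * W t \<omega>)" for \<omega>
  proof -
    have "(\<Sum>t\<in>insert (1 / 2) T. c' t * W t \<omega>) =
       (\<Sum>t\<in>insert (1 / 2) T. (if t \<in> T then c t * W t \<omega> else 0)) - (\<Sum>t\<in>insert (1 / 2) T. if t = 1 / 2 then E * W t \<omega> else 0)"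
      unfolding sum_subtractf[symmetric] by (intro sum.cong) (auto simp: c'_def algebra_simps)
    also have "(\<Sum>t\<in>insert (1 / 2) T. if t = 1 / 2 then E * W t \<omega> else 0) = E * W (1 / 2) \<omega>"
      using T by (subst sum.delta) auto
    also have "(\<Sum>t\<in>insert (1 / 2) T. (if t \<in> T then c t * W t \<omega> else 0)) = X \<omega>"
      unfolding X_def by (rule sum.mono_neutral_cong_right) (use T in auto)
    finally show ?thesis by (simp add: L_def)
  qed
  have Lg: "gaussian_rv N L"
    using W_gaussian[of "insert (1 / 2) T" c'] T unfolding Lc[symmetric] by auto
  have hh: "(1 / 2 :: real) \<in> {0..1}" by simp
  have Xi: "integrable N X" unfolding X_def using T W_integrable by (intro Bochner_Integration.integrable_sum) auto
  have X0: "expectation X = 0"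
  proof -
    have "expectation X = (\<Sum>t\<in>T. c t * expectation (W t))"
      unfolding X_def using T W_integrable by (subst Bochner_Integration.integral_sum) auto
    then show ?thesis using T W_mean by (auto intro!: sum.neutral)
  qed
  have L0: "expectation L = 0"
    unfolding L_def using Xi X0 W_integrable[OF hh] W_mean[OF hh] by simp
  have X2: "integrable N (\<lambda>\<omega>. (X \<omega>)\<^sup>2)"
    unfolding X_def by (rule integral_square_sum(1)) (use T W_square in \<open>auto simp: power_mult_distrib\<close>)
  have Xh: "integrable N (\<lambda>\<omega>. X \<omega> * W (1 / 2) \<omega>)" by (rule integrable_mult_square[OF Xm hm X2 W_square[OF hh]])
  have EX2: "expectation (\<lambda>\<omega>. (X \<omega>)\<^sup>2) = V" unfolding X_def V_def by (rule W_combination(1)[OF T])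
  have EXh: "expectation (\<lambda>\<omega>. X \<omega> * W (1 / 2) \<omega>) = E / 4"
  proof -
    have i: "integrable N (\<lambda>\<omega>. c t * (W t \<omega> * W (1 / 2) \<omega>))" if "t \<in> T" for t
      using that T by (intro integrable_mult_right integrable_mult_square W_square) auto
    have "expectation (\<lambda>\<omega>. X \<omega> * W (1 / 2) \<omega>) = expectation (\<lambda>\<omega>. \<Sum>t\<in>T. c t * (W t \<omega> * W (1 / 2) \<omega>))"
      by (simp add: X_def sum_distrib_right mult.assoc)
    also have "\<dots> = (\<Sum>t\<in>T. expectation (\<lambda>\<omega>. c t * (W t \<omega> * W (1 / 2) \<omega>)))"
      by (rule Bochner_Integration.integral_sum[OF i])
    also have "\<dots> = (\<Sum>t\<in>T. c t * tent t / 4)"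
    proof (intro sum.cong refl)
      fix t assume t: "t \<in> T"
      have "expectation (\<lambda>\<omega>. c t * (W t \<omega> * W (1 / 2) \<omega>)) = c t * (min t (1 / 2) - t * (1 / 2))"
        using W_cov[OF subsetD[OF T(2) t] hh] by simp
      also have "min t (1 / 2) - t * (1 / 2) = tent t / 4" by (auto simp: tent_def min_def)
      finally show "expectation (\<lambda>\<omega>. c t * (W t \<omega> * W (1 / 2) \<omega>)) = c t * tent t / 4" by simp
    qed
    finally show ?thesis by (simp add: E_def sum_divide_distrib)
  qed
  have Eh: "expectation (\<lambda>\<omega>. (W (1 / 2) \<omega>)\<^sup>2) = 1 / 4"
    using W_cov[OF hh hh] by (simp add: power2_eq_square)
  have L2: "expectation (\<lambda>\<omega>. (L \<omega>)\<^sup>2) = V - E\<^sup>2 / 4"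
  proof -
    have "expectation (\<lambda>\<omega>. (L \<omega>)\<^sup>2) = expectation (\<lambda>\<omega>. (X \<omega>)\<^sup>2 - 2 * E * (X \<omega> * W (1 / 2) \<omega>) + E\<^sup>2 * (W (1 / 2) \<omega>)\<^sup>2)"
      by (simp add: L_def power2_diff power_mult_distrib algebra_simps)
    also have "\<dots> = V - 2 * E * (E / 4) + E\<^sup>2 * (1 / 4)"
      using X2 Xh W_square[OF hh] by (simp add: EX2 EXh Eh)
    finally show ?thesis by (simp add: power2_eq_square)
  qed
  have cosL: "expectation (\<lambda>\<omega>. cos (L \<omega>)) = exp (- (V - E\<^sup>2 / 4) / 2)"
    using gaussian_rv_centered(2)[OF prob_space_axioms Lg L0] L2 by simp
  have inner: "(\<integral>z. cos (l + E / 2 * z) \<partial>Z) = cos l * exp (- E\<^sup>2 / 8)" for l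
  proof -
    have ie: "(\<integral>z. Re (iexp (E / 2 * z)) \<partial>Z) = Re (char Z (E / 2))" "(\<integral>z. Im (iexp (E / 2 * z)) \<partial>Z) = Im (char Z (E / 2))"
    proof -
      have i: "complex_integrable Z (\<lambda>z. iexp (E / 2 * z))" by (rule Z.integrable_iexp) auto
      show "(\<integral>z. Re (iexp (E / 2 * z)) \<partial>Z) = Re (char Z (E / 2))" "(\<integral>z. Im (iexp (E / 2 * z)) \<partial>Z) = Im (char Z (E / 2))"
        unfolding char_def using integral_Re[OF i] integral_Im[OF i] by blast+
    qed
    have "(\<integral>z. cos (l + E / 2 * z) \<partial>Z) = (\<integral>z. cos l * Re (iexp (E / 2 * z)) - sin l * Im (iexp (E / 2 * z)) \<partial>Z)"
      by (simp add: cos_add Re_exp Im_exp)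
    also have "\<dots> = cos l * (\<integral>z. Re (iexp (E / 2 * z)) \<partial>Z) - sin l * (\<integral>z. Im (iexp (E / 2 * z)) \<partial>Z)"
    proof -
      have "integrable Z (\<lambda>z. Re (iexp (E / 2 * z)))" "integrable Z (\<lambda>z. Im (iexp (E / 2 * z)))"
        by (rule Z.integrable_const_bound[where B=1]; auto intro!: AE_I2 simp: Re_exp Im_exp)+
      then show ?thesis by simp
    qed
    finally show ?thesis unfolding ie unfolding Z_def char_std_normal_distribution by (simp add: power_divide)
  qed
  have ci: "integrable (N \<Otimes>\<^sub>M Z) (\<lambda>p. cos (L (fst p) + E / 2 * snd p))"
    by (rule NZ.integrable_const_bound[where B=1]) auto
  have "(\<integral>p. cos (\<Sum>t\<in>T. c t * W_resampled t p) \<partial>(N \<Otimes>\<^sub>M Z)) = (\<integral>\<omega>. (\<integral>z. cos (L \<omega> + E / 2 * z) \<partial>Z) \<partial>N)"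
    unfolding comb using NZ.integral_fst[of "\<lambda>\<omega> z. cos (L \<omega> + E / 2 * z)"] ci by (simp add: case_prod_unfold)
  also have "\<dots> = exp (- (V - E\<^sup>2 / 4) / 2) * exp (- E\<^sup>2 / 8)"
    unfolding inner by (simp add: cosL)
  also have "\<dots> = exp (- V / 2)" unfolding exp_add[symmetric] by (simp add: field_simps)
  finally show ?thesis unfolding W_combination(2)[OF T] V_def Z_def .
qed

end

section \<open>The supremum of the weighted bridge has no atom\<close>

lemma continuous_le_on_rationals:
  fixes f :: "real \<Rightarrow> real"
  assumes ab: "a < b" and f: "continuous_on {a..b} f" and le: "\<And>t. t \<in> \<rat> \<Longrightarrow> t \<in> {a..b} \<Longrightarrow> f t \<le> q"
    and t: "t \<in> {a..b}"
  shows "f t \<le> q"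
proof (rule ccontr)
  assume "\<not> f t \<le> q"
  then have "f t - q > 0" by simp
  then obtain d where d: "d > 0" "\<And>s. s \<in> {a..b} \<Longrightarrow> dist s t < d \<Longrightarrow> dist (f s) (f t) < f t - q"
    using f t unfolding continuous_on_iff by meson
  have "max a (t - d) < min b (t + d)" using ab t d by auto
  then obtain r where r: "r \<in> \<rat>" "max a (t - d) < r" "r < min b (t + d)" using Rats_dense_in_real by blast
  then have "f r \<le> q" by (intro le) auto
  moreover have "dist (f r) (f t) < f t - q" using r by (intro d) (auto simp: dist_real_def)
  ultimately show False by (simp add: dist_real_def)
qed

text \<open>If alpha + beta z reaches q at some t, any larger z exceeds q there because beta t > 0;
  so at most one z reaches q and, likewise, at most one reaches -q. The second condition says that
  the supremum over the rationals is not below q; by compactness the value q is then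
  attained.\<close>

lemma level_set_finite:
  fixes \<alpha> \<beta> :: "real \<Rightarrow> real"
  assumes ab: "a < b" and c: "continuous_on {a..b} \<alpha>" "continuous_on {a..b} \<beta>" and \<beta>: "\<And>t. t \<in> {a..b} \<Longrightarrow> \<beta> t > 0"
    and q: "q > 0"
  shows "finite {z. (\<forall>t\<in>\<rat> \<inter> {a..b}. \<bar>\<alpha> t + \<beta> t * z\<bar> \<le> q) \<and> (\<forall>m::nat. \<exists>t\<in>\<rat> \<inter> {a..b}. \<bar>\<alpha> t + \<beta> t * z\<bar> > q - q / (real m + 2))}" (is "finite ?S")
proof -
  have cf: "continuous_on {a..b} (\<lambda>t. \<bar>\<alpha> t + \<beta> t * z\<bar>)" for z
    by (intro continuous_intros c)
  have le: "\<bar>\<alpha> t + \<beta> t * z\<bar> \<le> q" if "z \<in> ?S" "t \<in> {a..b}" for z t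
    by (rule continuous_le_on_rationals[OF ab cf _ that(2)]) (use that(1) in blast)
  have att: "\<exists>t\<in>{a..b}. \<bar>\<alpha> t + \<beta> t * z\<bar> \<ge> q" if z: "z \<in> ?S" for z
  proof -
    have "\<exists>t\<in>{a..b}. \<forall>s\<in>{a..b}. \<bar>\<alpha> s + \<beta> s * z\<bar> \<le> \<bar>\<alpha> t + \<beta> t * z\<bar>"
      by (rule continuous_attains_sup[OF compact_Icc _ cf]) (use ab in simp)
    then obtain t where t: "t \<in> {a..b}" "\<forall>s\<in>{a..b}. \<bar>\<alpha> s + \<beta> s * z\<bar> \<le> \<bar>\<alpha> t + \<beta> t * z\<bar>"
      by (elim bexE)
    have "q - q / (real m + 2) \<le> \<bar>\<alpha> t + \<beta> t * z\<bar>" for m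
    proof -
      have "\<exists>s\<in>\<rat> \<inter> {a..b}. q - q / (real m + 2) < \<bar>\<alpha> s + \<beta> s * z\<bar>"
        using z unfolding mem_Collect_eq by (elim conjE allE)
      then obtain s where s: "s \<in> \<rat> \<inter> {a..b}" "q - q / (real m + 2) < \<bar>\<alpha> s + \<beta> s * z\<bar>" by (elim bexE)
      show ?thesis using less_le_trans[OF s(2) bspec[OF t(2) IntD2[OF s(1)]]] by (rule less_imp_le)
    qed
    moreover have "(\<lambda>m. q - q / (real m + 2)) \<longlonglongrightarrow> q - 0"
      using LIMSEQ_ignore_initial_segment[OF lim_const_over_n[of q], of 2]
      by (intro tendsto_diff tendsto_const) (simp add: add.commute)
    ultimately have "q \<le> \<bar>\<alpha> t + \<beta> t * z\<bar>"
      by (intro LIMSEQ_le_const2[of "\<lambda>m. q - q / (real m + 2)"]) auto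
    then show ?thesis using t(1) by blast
  qed
  define U where "U = {z \<in> ?S. \<exists>t\<in>{a..b}. \<alpha> t + \<beta> t * z \<ge> q}"
  define L where "L = {z \<in> ?S. \<exists>t\<in>{a..b}. \<alpha> t + \<beta> t * z \<le> - q}"
  have "?S \<subseteq> U \<union> L"
  proof
    fix z assume z: "z \<in> ?S"
    then obtain t where "t \<in> {a..b}" "\<bar>\<alpha> t + \<beta> t * z\<bar> \<ge> q" using att by blast
    then have "\<alpha> t + \<beta> t * z \<ge> q \<or> \<alpha> t + \<beta> t * z \<le> - q" by linarith
    then show "z \<in> U \<union> L" using z \<open>t \<in> {a..b}\<close> unfolding U_def L_def by blast
  qed
  moreover have "z' \<le> z" if zz: "z \<in> U" "z' \<in> U" for z z'
  proof (rule ccontr)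
    assume "\<not> z' \<le> z"
    obtain t where t: "t \<in> {a..b}" "\<alpha> t + \<beta> t * z \<ge> q" using zz(1) unfolding U_def by blast
    have "\<beta> t * z < \<beta> t * z'" using \<beta>[OF t(1)] \<open>\<not> z' \<le> z\<close> by simp
    moreover have "\<bar>\<alpha> t + \<beta> t * z'\<bar> \<le> q" using zz(2) t(1) by (intro le) (simp_all add: U_def)
    ultimately show False using t by linarith
  qed
  then have "is_singleton U \<or> U = {}" by (metis antisym is_singletonI' )
  then have "finite U" by (auto simp: is_singleton_def)
  moreover have "z' \<ge> z" if zz: "z \<in> L" "z' \<in> L" for z z'
  proof (rule ccontr)
    assume "\<not> z' \<ge> z"
    obtain t where t: "t \<in> {a..b}" "\<alpha> t + \<beta> t * z \<le> - q" using zz(1) unfolding L_def by blast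
    have "\<beta> t * z > \<beta> t * z'" using \<beta>[OF t(1)] \<open>\<not> z' \<ge> z\<close> by simp
    moreover have "\<bar>\<alpha> t + \<beta> t * z'\<bar> \<le> q" using zz(2) t(1) by (intro le) (simp_all add: L_def)
    ultimately show False using t by linarith
  qed
  then have "is_singleton L \<or> L = {}" by (metis antisym is_singletonI' )
  then have "finite L" by (auto simp: is_singleton_def)
  ultimately show ?thesis by (metis (lifting) finite_UnI finite_subset)
qed

lemma small_powr:
  fixes p K \<eta> d :: real
  assumes "p > 0" "K \<ge> 0" "\<eta> > 0" "d > 0"
  shows "\<exists>\<delta>. 0 < \<delta> \<and> \<delta> \<le> d \<and> K * \<delta> powr p \<le> \<eta>"
proof -
  define \<delta> where "\<delta> = min d ((\<eta> / (K + 1)) powr (1 / p))"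
  have pos: "\<eta> / (K + 1) > 0" using assms by simp
  have \<delta>: "0 < \<delta>" "\<delta> \<le> d" using assms pos by (auto simp: \<delta>_def)
  have "\<delta> powr p \<le> ((\<eta> / (K + 1)) powr (1 / p)) powr p"
    using \<delta> assms by (intro powr_mono2) (auto simp: \<delta>_def)
  also have "\<dots> = \<eta> / (K + 1)" using assms pos by (simp add: powr_powr)
  finally have "K * \<delta> powr p \<le> K * (\<eta> / (K + 1))" using assms by (intro mult_left_mono) auto
  also have "\<dots> \<le> \<eta>" using assms by (simp add: field_simps)
  finally show ?thesis using \<delta> by blast
qed

text \<open>A countable dense index set, so that the events are measurable; the grids j/m of the
  discrete approximation lie in it.\<close>

definition rat01 :: "real set" where "rat01 = \<rat> \<inter> {0<..<1}"

lemma countable_rat01: "countable rat01"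
  unfolding rat01_def using countable_rat by auto

lemma rat01_range: "t \<in> rat01 \<Longrightarrow> 0 < t \<and> t < 1" "t \<in> rat01 \<Longrightarrow> t \<in> {0..1}"
  by (auto simp: rat01_def)

context std_bridge
begin

definition Z :: "real \<Rightarrow> real \<Rightarrow> real \<Rightarrow> 'b \<Rightarrow> real" where
  "Z \<sigma> \<gamma> t \<omega> = \<sigma> * W t \<omega> / wgt \<gamma> t"

lemma Z_measurable[measurable]: "t \<in> {0..1} \<Longrightarrow> Z \<sigma> \<gamma> t \<in> borel_measurable N"
  unfolding Z_def by measurable

lemma Z_transform:
  assumes T: "finite T" "T \<subseteq> {0..1}"
  shows "expectation (\<lambda>\<omega>. cos (\<Sum>t\<in>T. c t * Z \<sigma> \<gamma> t \<omega>)) =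
    exp (- (\<sigma>\<^sup>2 * (\<Sum>s\<in>T. \<Sum>t\<in>T. c s / wgt \<gamma> s * (c t / wgt \<gamma> t) * (min s t - s * t)) / 2))"
proof -
  have e: "(\<Sum>t\<in>T. c t * Z \<sigma> \<gamma> t \<omega>) = (\<Sum>t\<in>T. (\<sigma> * (c t / wgt \<gamma> t)) * W t \<omega>)" for \<omega>
    by (simp add: Z_def mult_ac)
  have "(\<Sum>s\<in>T. \<Sum>t\<in>T. (\<sigma> * (c s / wgt \<gamma> s)) * (\<sigma> * (c t / wgt \<gamma> t)) * (min s t - s * t)) =
    \<sigma>\<^sup>2 * (\<Sum>s\<in>T. \<Sum>t\<in>T. c s / wgt \<gamma> s * (c t / wgt \<gamma> t) * (min s t - s * t))"
    by (simp add: sum_distrib_left power2_eq_square mult_ac)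
  then show ?thesis unfolding e W_combination(2)[OF T] by simp
qed

lemma Z_continuous:
  assumes "\<omega> \<in> space N" "S \<subseteq> {0<..<1}"
  shows "continuous_on S (\<lambda>t. Z \<sigma> \<gamma> t \<omega>)"
proof -
  have "continuous_on S (\<lambda>t. W t \<omega>)"
    by (rule continuous_on_subset[OF W_continuous[OF assms(1)]]) (use assms(2) in auto)
  moreover have "t * (1 - t) \<noteq> 0" "0 < t * (1 - t)" if "t \<in> S" for t using that assms by auto
  ultimately show ?thesis unfolding Z_def wgt_def
    by (intro continuous_intros) (auto simp: less_imp_le)
qed

text \<open>At 0 and 1 the weighted value is 0, which never exceeds q >= 0. Inside, continuity on
  the compact interval [t/2, (1 + t)/2] moves an exceedance to a rational point.\<close>

lemma sup_exceeds_iff: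
  assumes w: "\<omega> \<in> space N" and q: "q \<ge> 0" and \<sigma>: "\<sigma> > 0"
  shows "(SUP t\<in>{0..1}. ereal (weighted_abs \<sigma> \<gamma> (\<lambda>s. W s \<omega>) t)) > ereal q \<longleftrightarrow> \<not> (\<forall>t\<in>rat01. \<bar>Z \<sigma> \<gamma> t \<omega>\<bar> \<le> q)"
proof -
  have e: "weighted_abs \<sigma> \<gamma> (\<lambda>s. W s \<omega>) t = \<bar>Z \<sigma> \<gamma> t \<omega>\<bar>" if "0 < t" "t < 1" for t
    using that \<sigma> by (simp add: weighted_abs_def Z_def wgt_def abs_mult)
  have "(SUP t\<in>{0..1}. ereal (weighted_abs \<sigma> \<gamma> (\<lambda>s. W s \<omega>) t)) > ereal q \<longleftrightarrow>
    (\<exists>t\<in>{0..1}. weighted_abs \<sigma> \<gamma> (\<lambda>s. W s \<omega>) t > q)"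
    by (simp add: less_SUP_iff)
  also have "\<dots> \<longleftrightarrow> (\<exists>t\<in>{0<..<1}. \<bar>Z \<sigma> \<gamma> t \<omega>\<bar> > q)"
  proof safe
    fix t :: real assume t: "t \<in> {0..1}" "q < weighted_abs \<sigma> \<gamma> (\<lambda>s. W s \<omega>) t"
    then have "t \<noteq> 0" "t \<noteq> 1" using q by (auto simp: weighted_abs_def)
    then show "\<exists>t\<in>{0<..<1}. \<bar>Z \<sigma> \<gamma> t \<omega>\<bar> > q" using t e[of t] by (intro bexI[of _ t]) auto
  next
    fix t :: real assume t: "t \<in> {0<..<1}" "q < \<bar>Z \<sigma> \<gamma> t \<omega>\<bar>"
    then show "\<exists>t\<in>{0..1}. weighted_abs \<sigma> \<gamma> (\<lambda>s. W s \<omega>) t > q" using e[of t] by (intro bexI[of _ t]) auto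
  qed
  also have "\<dots> \<longleftrightarrow> \<not> (\<forall>t\<in>rat01. \<bar>Z \<sigma> \<gamma> t \<omega>\<bar> \<le> q)"
  proof
    assume "\<exists>t\<in>{0<..<1}. \<bar>Z \<sigma> \<gamma> t \<omega>\<bar> > q"
    then obtain t where t: "0 < t" "t < 1" "\<bar>Z \<sigma> \<gamma> t \<omega>\<bar> > q" by auto
    show "\<not> (\<forall>t\<in>rat01. \<bar>Z \<sigma> \<gamma> t \<omega>\<bar> \<le> q)"
    proof
      assume le: "\<forall>t\<in>rat01. \<bar>Z \<sigma> \<gamma> t \<omega>\<bar> \<le> q"
      have "\<bar>Z \<sigma> \<gamma> t \<omega>\<bar> \<le> q"
      proof (rule continuous_le_on_rationals[where f="\<lambda>t. \<bar>Z \<sigma> \<gamma> t \<omega>\<bar>" and a="t / 2" and b="(1 + t) / 2"])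
        show "t / 2 < (1 + t) / 2" "t \<in> {t / 2..(1 + t) / 2}" using t by auto
        show "continuous_on {t / 2..(1 + t) / 2} (\<lambda>t. \<bar>Z \<sigma> \<gamma> t \<omega>\<bar>)"
          by (intro continuous_on_rabs Z_continuous w) (use t in auto)
        show "\<bar>Z \<sigma> \<gamma> s \<omega>\<bar> \<le> q" if "s \<in> \<rat>" "s \<in> {t / 2..(1 + t) / 2}" for s
          using le that t by (auto simp: rat01_def)
      qed
      then show False using t by simp
    qed
  next
    assume "\<not> (\<forall>t\<in>rat01. \<bar>Z \<sigma> \<gamma> t \<omega>\<bar> \<le> q)"
    then show "\<exists>t\<in>{0<..<1}. \<bar>Z \<sigma> \<gamma> t \<omega>\<bar> > q" by (auto simp: rat01_def not_le)
  qed
  finally show ?thesis .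
qed

lemma bounded_set_measurable: "{\<omega> \<in> space N. \<forall>t\<in>rat01. \<bar>Z \<sigma> \<gamma> t \<omega>\<bar> \<le> q} \<in> sets N"
  by (rule sets_Collect_Ball_abs_le[OF countable_rat01]) (auto dest: rat01_range(2))

text \<open>For q < 0 the value 0 at the end point already exceeds q, giving level 1. For q = 0 a
  path that does not exceed q would vanish at 1/2, an event of probability zero, giving level 1
  again. Both contradict alpha < 1.\<close>

lemma critical_value_prob:
  assumes cv: "critical_value N W \<sigma> \<gamma> \<alpha> q" and \<alpha>: "0 < \<alpha>" "\<alpha> < 1" and \<sigma>: "\<sigma> > 0"
  shows "q > 0" and "prob {\<omega> \<in> space N. \<forall>t\<in>rat01. \<bar>Z \<sigma> \<gamma> t \<omega>\<bar> \<le> q} = 1 - \<alpha>"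
proof -
  have cv': "prob {\<omega> \<in> space N. (SUP t\<in>{0..1}. ereal (weighted_abs \<sigma> \<gamma> (\<lambda>s. W s \<omega>) t)) > ereal q} = \<alpha>"
    using cv by (simp add: critical_value_def)
  have q0: "q \<ge> 0"
  proof (rule ccontr)
    assume "\<not> q \<ge> 0"
    then have "ereal q < ereal (weighted_abs \<sigma> \<gamma> (\<lambda>s. W s \<omega>) 0)" for \<omega> by (simp add: weighted_abs_def)
    then have "\<exists>t\<in>{0..1}. ereal q < ereal (weighted_abs \<sigma> \<gamma> (\<lambda>s. W s \<omega>) t)" for \<omega>
      by (intro bexI[of _ 0]) auto
    then have "(SUP t\<in>{0..1}. ereal (weighted_abs \<sigma> \<gamma> (\<lambda>s. W s \<omega>) t)) > ereal q" for \<omega>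
      unfolding less_SUP_iff .
    then show False using cv' \<alpha> prob_space by simp
  qed
  have main: "prob {\<omega> \<in> space N. \<forall>t\<in>rat01. \<bar>Z \<sigma> \<gamma> t \<omega>\<bar> \<le> q} = 1 - \<alpha>"
  proof -
    have "{\<omega> \<in> space N. (SUP t\<in>{0..1}. ereal (weighted_abs \<sigma> \<gamma> (\<lambda>s. W s \<omega>) t)) > ereal q} =
      space N - {\<omega> \<in> space N. \<forall>t\<in>rat01. \<bar>Z \<sigma> \<gamma> t \<omega>\<bar> \<le> q}"
      (is "?L = ?R")
    proof (rule set_eqI)
      fix \<omega>
      show "\<omega> \<in> ?L \<longleftrightarrow> \<omega> \<in> ?R"
        using sup_exceeds_iff[OF _ q0 \<sigma>, of \<omega> \<gamma>] by (simp only: mem_Collect_eq Diff_iff cong: conj_cong) blast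
    qed
    then have "prob (space N - {\<omega> \<in> space N. \<forall>t\<in>rat01. \<bar>Z \<sigma> \<gamma> t \<omega>\<bar> \<le> q}) = \<alpha>"
      using cv' by (simp only:)
    then show ?thesis unfolding prob_compl[OF bounded_set_measurable] by linarith
  qed
  show "prob {\<omega> \<in> space N. \<forall>t\<in>rat01. \<bar>Z \<sigma> \<gamma> t \<omega>\<bar> \<le> q} = 1 - \<alpha>" by (rule main)
  show "q > 0"
  proof (rule ccontr)
    assume "\<not> q > 0"
    then have "q = 0" using q0 by simp
    have h: "(1 / 2 :: real) \<in> {0..1}" and hr: "1 / 2 \<in> rat01" by (auto simp: rat01_def)
    have "expectation (\<lambda>\<omega>. (W (1 / 2) \<omega>)\<^sup>2) \<noteq> 0"
      using W_cov[OF h h] by (simp add: power2_eq_square)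
    then have "prob {\<omega> \<in> space N. W (1 / 2) \<omega> = 0} = 0"
      by (rule gaussian_rv_centered(3)[OF prob_space_axioms W_gaussian1[OF h] W_mean[OF h]])
    moreover have "prob {\<omega> \<in> space N. \<forall>t\<in>rat01. \<bar>Z \<sigma> \<gamma> t \<omega>\<bar> \<le> q} \<le> prob {\<omega> \<in> space N. W (1 / 2) \<omega> = 0}"
    proof (rule finite_measure_mono)
      have [measurable]: "W (1 / 2) \<in> borel_measurable N" by (rule W_measurable[OF h])
      show "{\<omega> \<in> space N. W (1 / 2) \<omega> = 0} \<in> sets N" by measurable
      have "W (1 / 2) \<omega> = 0" if "\<bar>Z \<sigma> \<gamma> (1 / 2) \<omega>\<bar> \<le> 0" for \<omega>
      proof -
        have "Z \<sigma> \<gamma> (1 / 2) \<omega> = 0" using that by simp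
        then show ?thesis using \<sigma> wgt_pos[of "1 / 2" \<gamma>] by (simp add: Z_def)
      qed
      then show "{\<omega> \<in> space N. \<forall>t\<in>rat01. \<bar>Z \<sigma> \<gamma> t \<omega>\<bar> \<le> q} \<subseteq> {\<omega> \<in> space N. W (1 / 2) \<omega> = 0}"
        using hr \<open>q = 0\<close> by blast
    qed
    ultimately show False using main \<alpha> by simp
  qed
qed

definition ends :: "real \<Rightarrow> real set" where
  "ends \<delta> = {t \<in> rat01. t < \<delta> \<or> 1 - \<delta> < t}"

text \<open>A supremum over the open interval need not be attained, so
  \<open>level_set_finite\<close> is used on [delta, 1 - delta] only; near the ends the hypothesis
  \<open>small\<close> keeps the process below q/2 up to probability eta / 2. Fubini over the
  resampled normal variable shows that a middle supremum equal to q has probability zero.\<close>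

lemma no_atom:
  assumes \<sigma>: "\<sigma> > 0" and q: "q > 0" and \<eta>: "\<eta> > 0"
    and small: "\<And>a \<eta>. a > 0 \<Longrightarrow> \<eta> > 0 \<Longrightarrow>
      \<exists>\<delta>>0. \<delta> < 1 / 2 \<and> prob {\<omega> \<in> space N. \<forall>t\<in>ends \<delta>. \<bar>Z \<sigma> \<gamma> t \<omega>\<bar> \<le> a} \<ge> 1 - \<eta>"
  shows "\<exists>q'. 0 \<le> q' \<and> q' < q \<and> prob {\<omega> \<in> space N. \<forall>t\<in>rat01. \<bar>Z \<sigma> \<gamma> t \<omega>\<bar> \<le> q}
    \<le> prob {\<omega> \<in> space N. \<forall>t\<in>rat01. \<bar>Z \<sigma> \<gamma> t \<omega>\<bar> \<le> q'} + \<eta>"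
proof -
  define G where "G = std_normal_distribution"
  interpret G: real_distribution G unfolding G_def by (rule real_dist_normal_dist)
  interpret P: pair_prob_space N G ..
  define Z' where "Z' t p = \<sigma> * W_resampled t p / wgt \<gamma> t" for t p
  have Z'm: "Z' t \<in> borel_measurable (N \<Otimes>\<^sub>M G)" if "t \<in> {0..1}" for t
    unfolding Z'_def using W_resampled_measurable[OF that] by (auto simp: G_def)
  have Zm': "Z \<sigma> \<gamma> t \<in> borel_measurable N" "Z' t \<in> borel_measurable (N \<Otimes>\<^sub>M G)" if "t \<in> rat01" for t
    using rat01_range(2)[OF that] Z'm by auto
  have tr: "P.expectation (\<lambda>p. cos (\<Sum>t\<in>T. c t * Z' t p)) = expectation (\<lambda>\<omega>. cos (\<Sum>t\<in>T. c t * Z \<sigma> \<gamma> t \<omega>))"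
    if T: "finite T" "T \<subseteq> rat01" for T c
  proof -
    have T': "T \<subseteq> {0..1}" using T rat01_range(2) by auto
    have "(\<Sum>t\<in>T. c t * Z' t p) = (\<Sum>t\<in>T. (c t * \<sigma> / wgt \<gamma> t) * W_resampled t p)" for p
      by (simp add: Z'_def mult_ac)
    moreover have "(\<Sum>t\<in>T. c t * Z \<sigma> \<gamma> t \<omega>) = (\<Sum>t\<in>T. (c t * \<sigma> / wgt \<gamma> t) * W t \<omega>)" for \<omega>
      by (simp add: Z_def mult_ac)
    ultimately show ?thesis
      using W_resampled_transform[OF T(1) T', of "\<lambda>t. c t * \<sigma> / wgt \<gamma> t"] by (simp only: G_def)
  qed
  \<comment> \<open>Equality of the transforms gives both inequalities. The argument now runs on the
    product space, where the normal variable is a coordinate of its own, and returns to N at the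
    very end.\<close>
  have F: "P.prob {p \<in> space (N \<Otimes>\<^sub>M G). \<forall>t\<in>Q. \<bar>Z' t p\<bar> \<le> a} = prob {\<omega> \<in> space N. \<forall>t\<in>Q. \<bar>Z \<sigma> \<gamma> t \<omega>\<bar> \<le> a}"
    if "a \<ge> 0" and Q: "Q \<subseteq> rat01" for a Q
  proof (rule antisym)
    have cQ: "countable Q" by (rule countable_subset[OF Q countable_rat01])
    show "P.prob {p \<in> space (N \<Otimes>\<^sub>M G). \<forall>t\<in>Q. \<bar>Z' t p\<bar> \<le> a} \<le> prob {\<omega> \<in> space N. \<forall>t\<in>Q. \<bar>Z \<sigma> \<gamma> t \<omega>\<bar> \<le> a}"
      by (rule cos_transform_determines_le[where X="Z'" and Y="Z \<sigma> \<gamma>"])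
         (use that cQ Zm' tr P.prob_space_axioms prob_space_axioms in \<open>auto intro: order_trans\<close>)
    show "prob {\<omega> \<in> space N. \<forall>t\<in>Q. \<bar>Z \<sigma> \<gamma> t \<omega>\<bar> \<le> a} \<le> P.prob {p \<in> space (N \<Otimes>\<^sub>M G). \<forall>t\<in>Q. \<bar>Z' t p\<bar> \<le> a}"
      by (rule cos_transform_determines_le[where Y="Z'" and X="Z \<sigma> \<gamma>"])
         (use that cQ Zm' tr P.prob_space_axioms prob_space_axioms in \<open>auto intro: order_trans\<close>)
  qed
  \<comment> \<open>Levels increasing to q that start at q/2, so that the bound q/2 near the ends
    lies below each of them.\<close>
  define r where "r m = q - q / (real m + 2)" for m :: nat
  have r: "0 \<le> r m" "r m < q" "q / 2 \<le> r m" for m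
    using q by (auto simp: r_def field_simps)
  have rmono: "r i \<le> r j" if "i \<le> j" for i j
    unfolding r_def using that q by (intro diff_left_mono divide_left_mono) auto
  let ?B = "\<lambda>Q a. {p \<in> space (N \<Otimes>\<^sub>M G). \<forall>t\<in>Q. \<bar>Z' t p\<bar> \<le> a}"
  have Bm: "?B Q a \<in> sets (N \<Otimes>\<^sub>M G)" if "Q \<subseteq> rat01" for Q a
    by (rule sets_Collect_Ball_abs_le[OF countable_subset[OF that countable_rat01]]) (use that Zm' in auto)
  have "(\<lambda>m. P.prob (?B rat01 (r m))) \<longlonglongrightarrow> P.prob (\<Union>m. ?B rat01 (r m))"
  proof (rule P.finite_Lim_measure_incseq)
    show "range (\<lambda>m. ?B rat01 (r m)) \<subseteq> sets (N \<Otimes>\<^sub>M G)" using Bm by auto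
    show "incseq (\<lambda>m. ?B rat01 (r m))"
      unfolding incseq_def using rmono by (auto intro: order_trans)
  qed
  moreover have "P.prob (?B rat01 q) \<le> P.prob (\<Union>m. ?B rat01 (r m)) + \<eta> / 2"
  proof -
    obtain \<delta> where \<delta>: "\<delta> > 0" "\<delta> < 1 / 2" "prob {\<omega> \<in> space N. \<forall>t\<in>ends \<delta>. \<bar>Z \<sigma> \<gamma> t \<omega>\<bar> \<le> q / 2} \<ge> 1 - \<eta> / 2"
      using small[of "q / 2" "\<eta> / 2"] q \<eta> by auto
    have eQ: "ends \<delta> \<subseteq> rat01" by (auto simp: ends_def)
    define I where "I = \<rat> \<inter> {\<delta>..1 - \<delta>}"
    have IQ: "I \<subseteq> rat01" using \<delta> by (auto simp: I_def rat01_def)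
    define E where "E = ?B I q - (\<Union>m. ?B I (r m))"
    have Em: "E \<in> sets (N \<Otimes>\<^sub>M G)" unfolding E_def using Bm[OF IQ] by auto
    have Um: "(\<Union>m. ?B rat01 (r m)) \<in> sets (N \<Otimes>\<^sub>M G)"
      by (rule sets.countable_UN) (use Bm[OF order_refl] in blast)
    have Cm: "space (N \<Otimes>\<^sub>M G) - ?B (ends \<delta>) (q / 2) \<in> sets (N \<Otimes>\<^sub>M G)"
      by (rule sets.Diff[OF sets.top Bm[OF eQ]])
    have "P.prob (?B rat01 q) \<le> P.prob ((\<Union>m. ?B rat01 (r m)) \<union> (E \<union> (space (N \<Otimes>\<^sub>M G) - ?B (ends \<delta>) (q / 2))))"
    proof (rule P.finite_measure_mono)
      show "?B rat01 q \<subseteq> (\<Union>m. ?B rat01 (r m)) \<union> (E \<union> (space (N \<Otimes>\<^sub>M G) - ?B (ends \<delta>) (q / 2)))"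
      proof
        fix p assume p: "p \<in> ?B rat01 q"
        show "p \<in> (\<Union>m. ?B rat01 (r m)) \<union> (E \<union> (space (N \<Otimes>\<^sub>M G) - ?B (ends \<delta>) (q / 2)))"
        proof (cases "p \<in> (\<Union>m. ?B rat01 (r m)) \<or> p \<notin> ?B (ends \<delta>) (q / 2)")
          case True
          then show ?thesis using p by blast
        next
          case False
          have "p \<notin> ?B I (r m)" for m
          proof
            assume pI: "p \<in> ?B I (r m)"
            have "\<bar>Z' t p\<bar> \<le> r m" if t: "t \<in> rat01" for t
            proof (cases "t \<in> ends \<delta>")
              case True
              then have "\<bar>Z' t p\<bar> \<le> q / 2" using False by blast
              then show ?thesis using r(3)[of m] by linarith
            next
              case False
              then have "t \<in> I" using t by (auto simp: ends_def I_def rat01_def)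
              then show ?thesis using pI by blast
            qed
            then show False using False p by blast
          qed
          moreover have "p \<in> ?B I q" using p IQ by blast
          ultimately show ?thesis unfolding E_def by blast
        qed
      qed
    qed (rule sets.Un[OF Um sets.Un[OF Em Cm]])
    also have "\<dots> \<le> P.prob (\<Union>m. ?B rat01 (r m)) + P.prob (E \<union> (space (N \<Otimes>\<^sub>M G) - ?B (ends \<delta>) (q / 2)))"
      by (rule measure_Un_le[OF Um sets.Un[OF Em Cm]])
    also have "P.prob (E \<union> (space (N \<Otimes>\<^sub>M G) - ?B (ends \<delta>) (q / 2))) \<le> P.prob E + P.prob (space (N \<Otimes>\<^sub>M G) - ?B (ends \<delta>) (q / 2))"
      by (rule measure_Un_le[OF Em Cm])
    also have "P.prob (space (N \<Otimes>\<^sub>M G) - ?B (ends \<delta>) (q / 2)) \<le> \<eta> / 2"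
      using P.prob_compl[OF Bm[OF eQ, of "q / 2"]] F[OF _ eQ, of "q / 2"] q \<delta>(3) by simp
    also have "P.prob E = 0"
    proof -
      have "emeasure (N \<Otimes>\<^sub>M G) E = (\<integral>\<^sup>+\<omega>. emeasure G (Pair \<omega> -` E) \<partial>N)"
        by (rule G.emeasure_pair_measure_alt[OF Em])
      also have "\<dots> = (\<integral>\<^sup>+\<omega>. 0 \<partial>N)"
      proof (rule nn_integral_cong)
        fix \<omega> assume w: "\<omega> \<in> space N"
        define \<alpha> where "\<alpha> t = \<sigma> * (W t \<omega> - tent t * W (1 / 2) \<omega>) / wgt \<gamma> t" for t
        define \<beta> where "\<beta> t = \<sigma> * (tent t / 2) / wgt \<gamma> t" for t
        have e: "Z' t (\<omega>, z) = \<alpha> t + \<beta> t * z" for t z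
          by (simp add: Z'_def W_resampled_def \<alpha>_def \<beta>_def add_divide_distrib diff_divide_distrib algebra_simps)
        have nz: "wgt \<gamma> t \<noteq> 0" "t * (1 - t) \<noteq> 0" "0 \<le> t * (1 - t)" if "t \<in> {\<delta>..1 - \<delta>}" for t
          using that \<delta> wgt_pos[of t \<gamma>] by auto
        have cw: "continuous_on {\<delta>..1 - \<delta>} (wgt \<gamma>)"
          unfolding wgt_def[abs_def] using nz by (intro continuous_intros) auto
        have cW: "continuous_on {\<delta>..1 - \<delta>} (\<lambda>t. W t \<omega>)"
          by (rule continuous_on_subset[OF W_continuous[OF w]]) (use \<delta> in auto)
        have ct: "continuous_on {\<delta>..1 - \<delta>} tent"
          unfolding tent_def[abs_def] by (intro continuous_intros)
        have fin: "finite {z. (\<forall>t\<in>\<rat> \<inter> {\<delta>..1 - \<delta>}. \<bar>\<alpha> t + \<beta> t * z\<bar> \<le> q) \<and> (\<forall>m::nat. \<exists>t\<in>\<rat> \<inter> {\<delta>..1 - \<delta>}. \<bar>\<alpha> t + \<beta> t * z\<bar> > q - q / (real m + 2))}"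
        proof (rule level_set_finite)
          show "\<delta> < 1 - \<delta>" using \<delta> by simp
          show "continuous_on {\<delta>..1 - \<delta>} \<alpha>" "continuous_on {\<delta>..1 - \<delta>} \<beta>"
            unfolding \<alpha>_def \<beta>_def using nz by (intro continuous_intros cw cW ct; auto)+
          show "\<beta> t > 0" if "t \<in> {\<delta>..1 - \<delta>}" for t
            using that \<delta> \<sigma> wgt_pos[of t \<gamma>] by (auto simp: \<beta>_def tent_def)
        qed (rule q)
        have sub: "Pair \<omega> -` E \<subseteq> {z. (\<forall>t\<in>\<rat> \<inter> {\<delta>..1 - \<delta>}. \<bar>\<alpha> t + \<beta> t * z\<bar> \<le> q) \<and> (\<forall>m::nat. \<exists>t\<in>\<rat> \<inter> {\<delta>..1 - \<delta>}. \<bar>\<alpha> t + \<beta> t * z\<bar> > q - q / (real m + 2))}"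
        proof
          fix z assume "z \<in> Pair \<omega> -` E"
          then have z: "(\<omega>, z) \<in> space (N \<Otimes>\<^sub>M G)" "\<forall>t\<in>I. \<bar>\<alpha> t + \<beta> t * z\<bar> \<le> q" "\<forall>m. \<not> (\<forall>t\<in>I. \<bar>\<alpha> t + \<beta> t * z\<bar> \<le> r m)"
            unfolding E_def e[symmetric] by auto
          then show "z \<in> {z. (\<forall>t\<in>\<rat> \<inter> {\<delta>..1 - \<delta>}. \<bar>\<alpha> t + \<beta> t * z\<bar> \<le> q) \<and> (\<forall>m::nat. \<exists>t\<in>\<rat> \<inter> {\<delta>..1 - \<delta>}. \<bar>\<alpha> t + \<beta> t * z\<bar> > q - q / (real m + 2))}"
            unfolding I_def r_def not_le mem_Collect_eq by (metis not_le)
        qed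
        show "emeasure G (Pair \<omega> -` E) = 0"
          using finite_null_set_std_normal[OF finite_subset[OF sub fin]] by (simp add: G_def null_sets_def)
      qed
      finally show ?thesis by (simp add: measure_def)
    qed
    finally show ?thesis by simp
  qed
  ultimately have "\<forall>\<^sub>F m in sequentially. P.prob (?B rat01 (r m)) > P.prob (?B rat01 q) - \<eta>"
    using \<eta> by (intro order_tendstoD) auto
  then obtain m where m: "P.prob (?B rat01 (r m)) > P.prob (?B rat01 q) - \<eta>" by (auto simp: eventually_sequentially)
  show ?thesis
    using r(1,2)[of m] m q F[OF r(1)[of m] order_refl] F[of q rat01] by (intro exI[of _ "r m"]) auto
qed

end

section \<open>Weak convergence of the weighted maximum\<close>

context iid_score
begin

lemma A_eq: "A \<gamma> n k \<omega> * (sqrt n * wgt \<gamma> (k / n)) = tied_down Y n k \<omega>" if "k \<in> {1..<n}"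
proof -
  have "wgt \<gamma> (k / n) > 0" using that by (intro wgt_pos) auto
  then show ?thesis using that by (simp add: A_def)
qed

lemma A_ends:
  assumes n: "n \<ge> 1" and \<gamma>: "0 < \<gamma>" "\<gamma> < 1 / 2" and \<delta>: "0 < \<delta>" "\<delta> \<le> 1 / 2" and \<epsilon>: "\<epsilon> > 0"
  shows "prob {\<omega> \<in> space M. \<exists>k\<in>{1..<n}. (real k \<le> \<delta> * n \<or> real n - k \<le> \<delta> * n) \<and> \<bar>A \<gamma> n k \<omega>\<bar> \<ge> \<epsilon>}
    \<le> 8 * end_const \<gamma> * \<sigma>\<^sup>2 * \<delta> powr (1 - 2 * \<gamma>) / \<epsilon>\<^sup>2"
proof -
  interpret R: centered_row M Y n "\<sigma>\<^sup>2" by (rule row)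
  have "\<epsilon> \<le> \<bar>A \<gamma> n k \<omega>\<bar> \<longleftrightarrow> \<epsilon> * sqrt n * (real k / n * (1 - real k / n)) powr \<gamma> \<le> \<bar>tied_down Y n k \<omega>\<bar>" if k: "k \<in> {1..<n}" for k \<omega>
  proof -
    have w: "sqrt n * wgt \<gamma> (k / n) > 0" using k wgt_pos[of "k / n" \<gamma>] by auto
    have "\<bar>tied_down Y n k \<omega>\<bar> = \<bar>A \<gamma> n k \<omega>\<bar> * (sqrt n * wgt \<gamma> (k / n))"
      by (simp only: A_eq[OF k, of \<gamma>, symmetric] abs_mult[of "A \<gamma> n k \<omega>"] abs_of_pos[OF w])
    then show ?thesis
      unfolding mult.assoc wgt_def[symmetric] by (simp only: mult_le_cancel_right_pos[OF w])
  qed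
  then have "{\<omega> \<in> space M. \<exists>k\<in>{1..<n}. (real k \<le> \<delta> * n \<or> real n - k \<le> \<delta> * n) \<and> \<bar>A \<gamma> n k \<omega>\<bar> \<ge> \<epsilon>} =
    {\<omega> \<in> space M. \<exists>k\<in>{1..<n}. (real k \<le> \<delta> * n \<or> real n - k \<le> \<delta> * n) \<and>
      \<bar>tied_down Y n k \<omega>\<bar> \<ge> \<epsilon> * sqrt n * (real k / n * (1 - real k / n)) powr \<gamma>}" by auto
  then show ?thesis using R.both_ends[OF n \<gamma> \<delta> \<epsilon>] by simp
qed

text \<open>The grid point below k is i = floor (n j / m) with j = floor (k m / n). The two
  roundings cost less than n/m and 1, hence the window n div m + 1 of \<open>oscillation\<close>
  and, as m <= n, the bound 2n/m. The condition 2 < m delta keeps i away from 0.\<close>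

lemma grid_index:
  fixes k n m :: nat and \<delta> :: real
  assumes k: "k < n" "\<delta> * n < k" "\<delta> * n < real n - k" and \<delta>: "0 < \<delta>" "\<delta> < 1 / 2"
    and m: "m \<le> n" "m \<ge> 1" "2 < m * \<delta>"
  defines "j \<equiv> k * m div n"
  defines "i \<equiv> n * j div m"
  shows "1 \<le> j" "j < m" "1 \<le> i" "i \<le> k" "k \<le> i + (n div m + 1)" "real k - real i \<le> 2 * real n / real m"
proof -
  have n0: "real n > 0" and m0: "real m > 0" using m by auto
  have nj: "n * j \<le> k * m" "k * m < n * j + n"
  proof -
    have "n * j + k * m mod n = k * m" unfolding j_def by simp
    moreover have "k * m mod n < n" using k by simp
    ultimately show "n * j \<le> k * m" "k * m < n * j + n" by linarith+
  qed
  have mi: "m * i \<le> n * j" "n * j < m * i + m"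
  proof -
    have "m * i + n * j mod m = n * j" unfolding i_def by simp
    moreover have "n * j mod m < m" using m by simp
    ultimately show "m * i \<le> n * j" "n * j < m * i + m" by linarith+
  qed
  show jm: "j < m"
  proof -
    have "n * j < n * m" using nj(1) k m by (metis (no_types) le_less_trans mult.commute mult_less_mono1 less_le_trans zero_less_one)
    then show ?thesis by simp
  qed
  have "m * i \<le> m * k" using order_trans[OF mi(1) nj(1)] unfolding mult.commute[of k m] .
  then show ik: "i \<le> k" using m by simp
  have mk: "m * k < m * i + m + n"
    using mi(2) nj(2) unfolding mult.commute[of k m] by linarith
  show gap: "real k - real i \<le> 2 * real n / real m"
  proof -
    have "real m * real k \<le> real m * real i + real m + real n" using mk by (metis less_imp_le of_nat_add of_nat_le_iff of_nat_mult)
    then have "real m * (real k - real i) \<le> 2 * real n" using m by (simp add: algebra_simps)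
    then show ?thesis using m0 by (simp add: pos_le_divide_eq mult.commute)
  qed
  show "k \<le> i + (n div m + 1)"
  proof -
    have "m * k < m * (i + (n div m + 2))"
    proof -
      have "n < m * (n div m) + m" using m by (metis add.commute div_mult_mod_eq mod_less_divisor mult.commute nat_add_left_cancel_less less_le_trans zero_less_one)
      then show ?thesis using mk by (simp add: algebra_simps)
    qed
    then have "k < i + (n div m + 2)" by (simp only: mult_less_cancel1)
    then show ?thesis by linarith
  qed
  have "2 * real n / m < \<delta> * n"
  proof -
    have "2 * real n < (m * \<delta>) * n" using m(3) n0 by (intro mult_strict_right_mono) auto
    then show ?thesis using m0 by (simp add: pos_divide_less_eq mult_ac)
  qed
  then show i1: "1 \<le> i" using gap k by linarith
  show "1 \<le> j" using i1 unfolding i_def by (cases j) auto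
qed

text \<open>Passing from k to the grid point i changes the partial sum by at most e sqrt n, the
  tied-down correction by (x - y) |S_n| <= 2 e sqrt n, and the weight by at most the factor 1 + 2 /
  (m delta). The last multiplies the bound q; the other two are divided by a lower bound of the
  weight in the middle range.\<close>

lemma grid_approximation:
  fixes k n m :: nat and e q \<delta> \<gamma> :: real
  assumes k: "k < n" "\<delta> * n < k" "\<delta> * n < real n - k" and \<delta>: "0 < \<delta>" "\<delta> < 1 / 2" and \<gamma>: "0 < \<gamma>" "\<gamma> < 1 / 2"
    and m: "m \<le> n" "m \<ge> 1" "2 < m * \<delta>" and e: "e > 0"
    and q: "q \<ge> 0"
  defines "j \<equiv> k * m div n"
  defines "i \<equiv> n * j div m"
  assumes S: "\<bar>partial_sum Y k \<omega> - partial_sum Y i \<omega>\<bar> \<le> e * sqrt n" and Sn: "\<bar>partial_sum Y n \<omega>\<bar> \<le> m * e * sqrt n"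
    and Ai: "\<bar>A \<gamma> n i \<omega>\<bar> \<le> q"
  shows "\<bar>A \<gamma> n k \<omega>\<bar> \<le> q * (1 + 2 / (m * \<delta>)) + 3 * e / (\<delta> / 2) powr \<gamma>"
proof -
  have n0: "real n > 0" and m0: "real m > 0" using m by auto
  note idx = grid_index[OF k \<delta> m, folded j_def, folded i_def]
  have i1: "1 \<le> i" and ik: "i \<le> k" and gap: "real k - real i \<le> 2 * real n / real m" using idx by auto
  define x where "x = real k / n"
  define y where "y = real i / n"
  have xy: "0 < y" "y \<le> x" "x < 1" "\<delta> \<le> x" "\<delta> \<le> 1 - x" "x - y \<le> 2 / m"
  proof -
    show "0 < y" "y \<le> x" "x < 1" using i1 ik k n0 by (auto simp: x_def y_def divide_right_mono)
    show "\<delta> \<le> x" using k n0 by (simp add: x_def pos_le_divide_eq)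
    show "\<delta> \<le> 1 - x" using k n0 by (simp add: x_def field_simps)
    have "(real k - real i) / n \<le> 2 * real n / real m / n" using gap by (rule divide_right_mono) simp
    then show "x - y \<le> 2 / m" using n0 by (simp add: x_def y_def diff_divide_distrib)
  qed
  have wx: "wgt \<gamma> x \<ge> (\<delta> / 2) powr \<gamma>"
  proof -
    have "\<delta> * (1 / 2) \<le> x * (1 - x)"
    proof (cases "x \<le> 1 / 2")
      case True
      then show ?thesis using xy \<delta> by (intro mult_mono) auto
    next
      case False
      then have "(1 / 2) * \<delta> \<le> x * (1 - x)" using xy \<delta> by (intro mult_mono) auto
      then show ?thesis by simp
    qed
    then show ?thesis unfolding wgt_def using \<delta> \<gamma> by (intro powr_mono2) auto
  qed
  have w0: "(\<delta> / 2) powr \<gamma> > 0" using \<delta> by simp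
  then have wx0: "wgt \<gamma> x > 0" using wx by linarith
  \<comment> \<open>The chain is y (1 - y) <= x (1 - x + 2/m) <= r x (1 - x), the second step
    because 1 - x >= delta; raising r >= 1 to the power gamma < 1 does not increase it.\<close>
  define r where "r = 1 + 2 / (m * \<delta>)"
  have r1: "r \<ge> 1" using m0 \<delta> by (simp add: r_def)
  have wy: "wgt \<gamma> y \<le> r * wgt \<gamma> x"
  proof -
    have "y * (1 - y) \<le> x * (1 - x + 2 / m)" using xy by (intro mult_mono) auto
    also have "\<dots> \<le> x * ((1 - x) * r)"
    proof (rule mult_left_mono)
      have "(2 / m) / \<delta> * \<delta> \<le> (2 / m) / \<delta> * (1 - x)" using xy \<delta> m0 by (intro mult_left_mono) auto
      then show "1 - x + 2 / m \<le> (1 - x) * r" using \<delta> by (simp add: r_def algebra_simps)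
    qed (use xy \<delta> in auto)
    finally have "wgt \<gamma> y \<le> (r * (x * (1 - x))) powr \<gamma>"
      unfolding wgt_def using xy \<gamma> by (intro powr_mono2) (auto simp: mult_ac)
    also have "\<dots> = r powr \<gamma> * wgt \<gamma> x" using xy r1 by (simp add: wgt_def powr_mult)
    also have "\<dots> \<le> r powr 1 * wgt \<gamma> x" using r1 \<gamma> wx0 by (intro mult_right_mono powr_mono) auto
    finally show ?thesis using r1 by simp
  qed
  have td: "\<bar>tied_down Y n k \<omega>\<bar> \<le> \<bar>tied_down Y n i \<omega>\<bar> + 3 * e * sqrt n"
  proof -
    have e1: "tied_down Y n k \<omega> = tied_down Y n i \<omega> + ((partial_sum Y k \<omega> - partial_sum Y i \<omega>) - (x - y) * partial_sum Y n \<omega>)"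
      by (simp add: tied_down_def x_def y_def algebra_simps diff_divide_distrib)
    have "\<bar>(x - y) * partial_sum Y n \<omega>\<bar> \<le> (2 / m) * (m * e * sqrt n)"
      unfolding abs_mult using xy Sn by (intro mult_mono) auto
    also have "\<dots> = 2 * (e * sqrt n)" using m0 by simp
    finally have c: "\<bar>(x - y) * partial_sum Y n \<omega>\<bar> \<le> 2 * (e * sqrt n)" .
    have "\<bar>tied_down Y n k \<omega>\<bar> \<le> \<bar>tied_down Y n i \<omega>\<bar> +
        \<bar>(partial_sum Y k \<omega> - partial_sum Y i \<omega>) - (x - y) * partial_sum Y n \<omega>\<bar>"
      unfolding e1 by (rule abs_triangle_ineq)
    also have "\<dots> \<le> \<bar>tied_down Y n i \<omega>\<bar> + (e * sqrt n + 2 * (e * sqrt n))"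
      by (intro add_left_mono order_trans[OF abs_triangle_ineq4] add_mono S c)
    finally show ?thesis by simp
  qed
  have iin: "i \<in> {1..<n}" and kin: "k \<in> {1..<n}" using i1 ik k by auto
  have tA: "\<bar>tied_down Y n l \<omega>\<bar> = \<bar>A \<gamma> n l \<omega>\<bar> * (sqrt n * wgt \<gamma> (l / n))" if "l \<in> {1..<n}" for l
  proof -
    have w: "sqrt n * wgt \<gamma> (l / n) \<ge> 0" by (simp add: wgt_def)
    show ?thesis by (simp only: A_eq[OF that, of \<gamma>, symmetric] abs_mult[of "A \<gamma> n l \<omega>"] abs_of_nonneg[OF w])
  qed
  have "\<bar>A \<gamma> n k \<omega>\<bar> * (sqrt n * wgt \<gamma> x) \<le> \<bar>A \<gamma> n i \<omega>\<bar> * (sqrt n * wgt \<gamma> y) + 3 * e * sqrt n"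
    using td unfolding tA[OF iin] tA[OF kin] x_def y_def .
  also have "\<dots> \<le> q * (sqrt n * (r * wgt \<gamma> x)) + 3 * e / (\<delta> / 2) powr \<gamma> * (sqrt n * wgt \<gamma> x)"
  proof (rule add_mono)
    show "\<bar>A \<gamma> n i \<omega>\<bar> * (sqrt n * wgt \<gamma> y) \<le> q * (sqrt n * (r * wgt \<gamma> x))"
      using Ai wy q by (intro mult_mono) (auto simp: wgt_def)
    have "3 * e / (\<delta> / 2) powr \<gamma> * (sqrt n * (\<delta> / 2) powr \<gamma>) \<le> 3 * e / (\<delta> / 2) powr \<gamma> * (sqrt n * wgt \<gamma> x)"
      using wx e by (intro mult_left_mono) auto
    then show "3 * e * sqrt n \<le> 3 * e / (\<delta> / 2) powr \<gamma> * (sqrt n * wgt \<gamma> x)" using w0 by simp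
  qed
  also have "\<dots> = (q * r + 3 * e / (\<delta> / 2) powr \<gamma>) * (sqrt n * wgt \<gamma> x)" by (simp add: algebra_simps)
  finally have "\<bar>A \<gamma> n k \<omega>\<bar> \<le> q * r + 3 * e / (\<delta> / 2) powr \<gamma>"
    using wx0 n0 by (subst (asm) mult_le_cancel_right) auto
  then show "\<bar>A \<gamma> n k \<omega>\<bar> \<le> q * (1 + 2 / (m * \<delta>)) + 3 * e / (\<delta> / 2) powr \<gamma>" by (simp add: r_def)
qed

end

locale score_bridge = iid_score M \<xi> D h \<sigma> + B: std_bridge N W
  for M :: "'a measure" and \<xi> :: "nat \<Rightarrow> 'a \<Rightarrow> real" and D :: "real measure" and h :: "real \<Rightarrow> real" and \<sigma> :: real
    and N :: "'b measure" and W :: "real \<Rightarrow> 'b \<Rightarrow> real"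
begin

lemma transform_limit:
  assumes T: "finite T" "T \<subseteq> {0<..<1}"
  shows "(\<lambda>n. expectation (\<lambda>\<omega>. cos (\<Sum>t\<in>T. c t * A \<gamma> n (nat \<lfloor>real n * t\<rfloor>) \<omega>)))
    \<longlonglongrightarrow> B.expectation (\<lambda>\<omega>. cos (\<Sum>t\<in>T. c t * B.Z \<sigma> \<gamma> t \<omega>))"
proof -
  have "T \<subseteq> {0..1}" using T by auto
  from B.Z_transform[OF T(1) this] cos_transform_A[OF T] show ?thesis by (simp only:)
qed

lemma fdd_upper_A:
  assumes T: "finite T" "T \<subseteq> {0<..<1}" and ab: "0 \<le> a" "a < b" and \<eta>: "\<eta> > 0"
  shows "\<forall>\<^sub>F n in sequentially. prob {\<omega> \<in> space M. \<forall>t\<in>T. \<bar>A \<gamma> n (nat \<lfloor>real n * t\<rfloor>) \<omega>\<bar> \<le> a}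
    \<le> B.prob {\<omega> \<in> space N. \<forall>t\<in>T. \<bar>B.Z \<sigma> \<gamma> t \<omega>\<bar> \<le> b} + \<eta>"
  by (rule fdd_upper[where X="\<lambda>n t. A \<gamma> n (nat \<lfloor>real n * t\<rfloor>)" and Y="B.Z \<sigma> \<gamma>", OF prob_space_axioms B.prob_space_axioms T(1) _ _ transform_limit[OF T] ab \<eta>])
     (use T in \<open>auto intro!: B.Z_measurable simp: subset_eq less_imp_le\<close>)

lemma fdd_lower_A:
  assumes T: "finite T" "T \<subseteq> {0<..<1}" and ab: "0 \<le> a" "a < b" and \<eta>: "\<eta> > 0"
  shows "\<forall>\<^sub>F n in sequentially. B.prob {\<omega> \<in> space N. \<forall>t\<in>T. \<bar>B.Z \<sigma> \<gamma> t \<omega>\<bar> \<le> a} - \<eta>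
    \<le> prob {\<omega> \<in> space M. \<forall>t\<in>T. \<bar>A \<gamma> n (nat \<lfloor>real n * t\<rfloor>) \<omega>\<bar> \<le> b}"
  by (rule fdd_lower[where X="\<lambda>n t. A \<gamma> n (nat \<lfloor>real n * t\<rfloor>)" and Y="B.Z \<sigma> \<gamma>", OF prob_space_axioms B.prob_space_axioms T(1) _ _ transform_limit[OF T] A_tight[OF T] ab \<eta>])
     (use T in \<open>auto intro!: B.Z_measurable simp: subset_eq less_imp_le\<close>)

text \<open>On a finite set T of points near the ends \<open>fdd_upper_A\<close> compares the bridge
  with the discrete process, for which \<open>A_ends\<close> gives a bound that does not depend on
  n; finite sets exhaust the countable set \<open>ends\<close>. This is the hypothesis
  \<open>small\<close> of \<open>no_atom\<close>.\<close>

lemma Z_ends: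
  assumes \<gamma>: "0 < \<gamma>" "\<gamma> < 1 / 2" and a: "a > 0" and \<eta>: "\<eta> > 0"
  shows "\<exists>\<delta>>0. \<delta> < 1 / 2 \<and> B.prob {\<omega> \<in> space N. \<forall>t\<in>B.ends \<delta>. \<bar>B.Z \<sigma> \<gamma> t \<omega>\<bar> \<le> a} \<ge> 1 - \<eta>"
proof -
  have "2 powr (1 - 2 * \<gamma>) > 1" using \<gamma> by simp
  then have C0: "end_const \<gamma> \<ge> 0" by (simp add: end_const_def)
  obtain \<delta>' where \<delta>': "0 < \<delta>'" "\<delta>' \<le> 1 / 2" "8 * end_const \<gamma> * \<sigma>\<^sup>2 / (a / 2)\<^sup>2 * \<delta>' powr (1 - 2 * \<gamma>) \<le> \<eta> / 4"
    using small_powr[of "1 - 2 * \<gamma>" "8 * end_const \<gamma> * \<sigma>\<^sup>2 / (a / 2)\<^sup>2" "\<eta> / 4" "1 / 2"] \<gamma> C0 \<eta> by auto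
  \<comment> \<open>Halving leaves room for rounding: for t > 1 - delta the index floor (n t) is
    within n delta + 1 <= n delta' of n once n delta > 1.\<close>
  define \<delta> where "\<delta> = \<delta>' / 2"
  have \<delta>: "0 < \<delta>" "\<delta> < 1 / 2" using \<delta>' by (auto simp: \<delta>_def)
  have eQ: "B.ends \<delta> \<subseteq> rat01" by (auto simp: B.ends_def)
  have Zm: "B.Z \<sigma> \<gamma> t \<in> borel_measurable N" if "t \<in> B.ends \<delta>" for t
    using that eQ rat01_range(2) by (intro B.Z_measurable) auto
  have \<eta>4: "\<eta> / 4 > 0" using \<eta> by simp
  obtain T where T: "finite T" "T \<subseteq> B.ends \<delta>"
    "B.prob {\<omega> \<in> space N. \<forall>t\<in>T. \<bar>B.Z \<sigma> \<gamma> t \<omega>\<bar> \<le> a} \<le> B.prob {\<omega> \<in> space N. \<forall>t\<in>B.ends \<delta>. \<bar>B.Z \<sigma> \<gamma> t \<omega>\<bar> \<le> a} + \<eta> / 4"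
    using B.prob_bounded_finite_subset[OF countable_subset[OF eQ countable_rat01], where X="B.Z \<sigma> \<gamma>" and a=a, OF Zm \<eta>4] by blast
  have T01: "T \<subseteq> {0<..<1}" using T eQ rat01_range(1) by force
  obtain N0 :: nat where N0: "1 / \<delta> < real N0" using reals_Archimedean2 by blast
  have ev1: "\<forall>\<^sub>F n in sequentially. \<forall>t\<in>T. nat \<lfloor>real n * t\<rfloor> \<in> {1..<n}"
    by (rule eventually_ball_finite[OF T(1)]) (use T01 floor_index_range in force)
  have ev2: "\<forall>\<^sub>F n in sequentially. prob {\<omega> \<in> space M. \<forall>t\<in>T. \<bar>A \<gamma> n (nat \<lfloor>real n * t\<rfloor>) \<omega>\<bar> \<le> a / 2}
    \<le> B.prob {\<omega> \<in> space N. \<forall>t\<in>T. \<bar>B.Z \<sigma> \<gamma> t \<omega>\<bar> \<le> a} + \<eta> / 4"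
    using a \<eta> by (intro fdd_upper_A[OF T(1) T01]) auto
  have "\<forall>\<^sub>F n in sequentially. 1 - \<eta> \<le> B.prob {\<omega> \<in> space N. \<forall>t\<in>B.ends \<delta>. \<bar>B.Z \<sigma> \<gamma> t \<omega>\<bar> \<le> a}"
    using ev1 ev2 eventually_ge_at_top[of "max 1 N0"]
  proof eventually_elim
    case (elim n)
    have n: "n \<ge> 1" "real n * \<delta> > 1"
    proof -
      show "n \<ge> 1" using elim by simp
      have "1 < real N0 * \<delta>" using N0 \<delta> by (simp add: pos_divide_less_eq)
      also have "\<dots> \<le> real n * \<delta>" using elim \<delta> by (intro mult_right_mono) auto
      finally show "real n * \<delta> > 1" .
    qed
    let ?E = "{\<omega> \<in> space M. \<exists>k\<in>{1..<n}. (real k \<le> \<delta>' * n \<or> real n - k \<le> \<delta>' * n) \<and> \<bar>A \<gamma> n k \<omega>\<bar> \<ge> a / 2}"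
    let ?F = "{\<omega> \<in> space M. \<forall>t\<in>T. \<bar>A \<gamma> n (nat \<lfloor>real n * t\<rfloor>) \<omega>\<bar> \<le> a / 2}"
    have Em: "?E \<in> sets M" by measurable
    have Fm: "?F \<in> sets M" by (rule sets_Collect_Ball_abs_le[OF countable_finite[OF T(1)]]) simp
    have "prob ?E \<le> \<eta> / 4"
      using A_ends[OF n(1) \<gamma> \<delta>'(1,2), of "a / 2"] a \<delta>'(3) by simp
    moreover have "space M - ?E \<subseteq> ?F"
    proof safe
      fix \<omega> t assume w: "\<omega> \<in> space M" "\<not> (\<exists>k\<in>{1..<n}. (real k \<le> \<delta>' * n \<or> real n - k \<le> \<delta>' * n) \<and> \<bar>A \<gamma> n k \<omega>\<bar> \<ge> a / 2)" and t: "t \<in> T"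
      let ?k = "nat \<lfloor>real n * t\<rfloor>"
      have t01: "0 < t" "t < 1" using T01 t by auto
      have te: "t < \<delta> \<or> 1 - \<delta> < t" using t T(2) by (auto simp: B.ends_def)
      have kl: "real ?k \<le> real n * t" "real n * t - 1 < real ?k" using t01 by (auto simp: of_nat_nat)
      have "real ?k \<le> \<delta>' * n \<or> real n - ?k \<le> \<delta>' * n"
        using te
      proof
        assume "t < \<delta>"
        then have "real n * t \<le> real n * \<delta>'" using \<delta> by (intro mult_left_mono) (auto simp: \<delta>_def)
        then have "real ?k \<le> \<delta>' * n" using kl(1) unfolding mult.commute[of \<delta>'] by linarith
        then show ?thesis by (rule disjI1)
      next
        assume "1 - \<delta> < t"
        then have "real n * (1 - \<delta>) \<le> real n * t" by (intro mult_left_mono) auto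
        then have "real n - real n * \<delta> \<le> real n * t" unfolding right_diff_distrib mult_1_right .
        then have "real n - real ?k \<le> real n * \<delta> + 1" using kl by linarith
        also have "\<dots> \<le> \<delta>' * n"
        proof -
          have "\<delta>' * n = real n * \<delta> + real n * \<delta>" by (simp add: \<delta>_def)
          then show ?thesis using n(2) by linarith
        qed
        finally show ?thesis by (rule disjI2)
      qed
      moreover have "?k \<in> {1..<n}" using elim(1) t by blast
      ultimately have "\<not> \<bar>A \<gamma> n ?k \<omega>\<bar> \<ge> a / 2" using w(2) by blast
      then show "\<bar>A \<gamma> n ?k \<omega>\<bar> \<le> a / 2" by linarith
    qed
    then have "prob (space M - ?E) \<le> prob ?F" by (rule finite_measure_mono[OF _ Fm])
    ultimately have "1 - \<eta> / 4 \<le> prob ?F" using prob_compl[OF Em] by linarith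
    then show ?case using elim(2) T(3) \<eta> by linarith
  qed
  then have "1 - \<eta> \<le> B.prob {\<omega> \<in> space N. \<forall>t\<in>B.ends \<delta>. \<bar>B.Z \<sigma> \<gamma> t \<omega>\<bar> \<le> a}"
    by (auto simp: eventually_sequentially)
  then show ?thesis using \<delta> by blast
qed

text \<open>An exceedance of q in the middle forces a large oscillation within a block, a large
  |S_n|, or an exceedance of q1 on the fixed grid j/m. The first two are rare for large m, the third
  is governed by the finite-dimensional limit.\<close>

lemma A_middle:
  fixes \<gamma> \<delta> q q' \<eta> :: real
  assumes \<gamma>: "0 < \<gamma>" "\<gamma> < 1 / 2" and \<delta>: "0 < \<delta>" "\<delta> < 1 / 2" and q: "0 \<le> q'" "q' < q" and \<eta>: "\<eta> > 0"
  shows "\<forall>\<^sub>F n in sequentially. prob {\<omega> \<in> space M. \<exists>k<n. \<delta> * n < k \<and> \<delta> * n < real n - k \<and> \<bar>A \<gamma> n k \<omega>\<bar> \<ge> q}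
    \<le> 1 - B.prob {\<omega> \<in> space N. \<forall>t\<in>rat01. \<bar>B.Z \<sigma> \<gamma> t \<omega>\<bar> \<le> q'} + \<eta>"
proof -
  define \<theta> where "\<theta> = q - q'"
  have \<theta>: "\<theta> > 0" using q by (simp add: \<theta>_def)
  \<comment> \<open>The gap theta = q - q' is spent in thirds: on the distance from q' to q1 lost in
    the finite-dimensional limit, on the change of weight, and on the oscillation.\<close>
  define q1 where "q1 = q' + \<theta> / 3"
  have q1: "q1 \<ge> 0" "q' < q1" using q \<theta> by (auto simp: q1_def)
  define e where "e = (\<delta> / 2) powr \<gamma> * \<theta> / 10"
  have e: "e > 0" using \<delta> \<theta> by (simp add: e_def)
  have e3: "3 * e / (\<delta> / 2) powr \<gamma> < \<theta> / 3" using \<delta> \<theta> by (simp add: e_def)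
  have \<eta>3: "\<eta> / 3 > 0" using \<eta> by simp
  from oscillation[OF e \<eta>3] obtain m0 where m0: "\<And>m. m \<ge> m0 \<Longrightarrow> \<forall>\<^sub>F n in sequentially.
    prob {\<omega> \<in> space M. \<exists>j<m. \<exists>k\<le>n div m + 1. \<bar>partial_sum Y (n * j div m + k) \<omega> - partial_sum Y (n * j div m) \<omega>\<bar> \<ge> e * sqrt n} \<le> \<eta> / 3"
    by blast
  \<comment> \<open>In order: m delta >= 3 for \<open>grid_index\<close>, the weight error q1 * 2 /
    (m delta) <= theta / 3, and Chebyshev's bound sigma^2 / (m e)^2 <= eta / 3 for |S_n| >= m e sqrt
    n.\<close>
  define m where "m = max m0 (nat \<lceil>max (3 / \<delta>) (max (6 * q1 / (\<theta> * \<delta>)) (3 * \<sigma>\<^sup>2 / (e\<^sup>2 * \<eta>)))\<rceil> + 1)"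
  have m: "m0 \<le> m" "m \<ge> 1" "3 / \<delta> \<le> real m" "6 * q1 / (\<theta> * \<delta>) \<le> real m" "3 * \<sigma>\<^sup>2 / (e\<^sup>2 * \<eta>) \<le> real m"
  proof -
    have "real (nat \<lceil>max (3 / \<delta>) (max (6 * q1 / (\<theta> * \<delta>)) (3 * \<sigma>\<^sup>2 / (e\<^sup>2 * \<eta>)))\<rceil> + 1) \<le> real m"
      unfolding m_def by linarith
    then show "m0 \<le> m" "m \<ge> 1" "3 / \<delta> \<le> real m" "6 * q1 / (\<theta> * \<delta>) \<le> real m" "3 * \<sigma>\<^sup>2 / (e\<^sup>2 * \<eta>) \<le> real m"
      unfolding m_def by linarith+
  qed
  have m_real: "real m \<ge> 1" using m by simp
  have m2: "2 < m * \<delta>"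
  proof -
    have "3 \<le> m * \<delta>" using m(3) \<delta> by (simp add: pos_divide_le_eq)
    then show ?thesis by simp
  qed
  have mq: "q1 * (2 / (m * \<delta>)) \<le> \<theta> / 3"
  proof -
    have "6 * q1 \<le> m * (\<theta> * \<delta>)" using m(4) \<theta> \<delta> by (simp add: pos_divide_le_eq)
    then show ?thesis using m_real \<delta> by (simp add: pos_divide_le_eq mult_ac)
  qed
  have ms: "\<sigma>\<^sup>2 / (real m * e)\<^sup>2 \<le> \<eta> / 3"
  proof -
    have "3 * \<sigma>\<^sup>2 \<le> m * (e\<^sup>2 * \<eta>)" using m(5) e \<eta> by (simp add: pos_divide_le_eq)
    also have "\<dots> \<le> (real m)\<^sup>2 * (e\<^sup>2 * \<eta>)"
      using m_real e \<eta> by (intro mult_right_mono) (auto simp: power2_eq_square)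
    finally show ?thesis using m_real e by (simp add: pos_divide_le_eq power_mult_distrib mult_ac)
  qed
  define T where "T = (\<lambda>j. real j / real m) ` {1..<m}"
  have T: "finite T" "T \<subseteq> {0<..<1}" "T \<subseteq> rat01" by (auto simp: T_def rat01_def)
  have Tm: "B.Z \<sigma> \<gamma> t \<in> borel_measurable N" if "t \<in> T" for t
    using that T rat01_range(2) by (intro B.Z_measurable) auto
  have mono: "B.prob {\<omega> \<in> space N. \<forall>t\<in>rat01. \<bar>B.Z \<sigma> \<gamma> t \<omega>\<bar> \<le> q'} \<le> B.prob {\<omega> \<in> space N. \<forall>t\<in>T. \<bar>B.Z \<sigma> \<gamma> t \<omega>\<bar> \<le> q'}"
    by (rule B.finite_measure_mono[OF _ sets_Collect_Ball_abs_le[OF countable_finite[OF T(1)] Tm]]) (use T(3) in auto)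
  show ?thesis
    using m0[OF m(1)] fdd_lower_A[OF T(1,2) q(1) q1(2) \<eta>3, of \<gamma>] eventually_ge_at_top[of m]
  proof eventually_elim
    case (elim n)
    have n0: "real n > 0" using elim m by auto
    let ?E = "{\<omega> \<in> space M. \<exists>j<m. \<exists>k\<le>n div m + 1. \<bar>partial_sum Y (n * j div m + k) \<omega> - partial_sum Y (n * j div m) \<omega>\<bar> \<ge> e * sqrt n}"
    let ?F = "{\<omega> \<in> space M. \<forall>t\<in>T. \<bar>A \<gamma> n (nat \<lfloor>real n * t\<rfloor>) \<omega>\<bar> \<le> q1}"
    let ?G = "{\<omega> \<in> space M. \<bar>\<Sum>i\<in>{1..n}. Y i \<omega>\<bar> \<ge> m * e * sqrt n}"
    let ?H = "{\<omega> \<in> space M. \<exists>k<n. \<delta> * n < k \<and> \<delta> * n < real n - k \<and> \<bar>A \<gamma> n k \<omega>\<bar> \<ge> q}"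
    interpret R: centered_row M Y n "\<sigma>\<^sup>2" by (rule row)
    have Em: "?E \<in> sets M" by measurable
    have Fm: "?F \<in> sets M" by (rule sets_Collect_Ball_abs_le[OF countable_finite[OF T(1)]]) simp
    have Gm: "?G \<in> sets M" using partial_sum_Y_measurable[of n] unfolding partial_sum_def[abs_def] by measurable
    have pG: "prob ?G \<le> \<eta> / 3"
    proof -
      have "prob ?G \<le> card {1..n} * \<sigma>\<^sup>2 / (m * e * sqrt n)\<^sup>2"
        by (rule R.block_tail) (use m_real e n0 in auto)
      also have "\<dots> = \<sigma>\<^sup>2 / (real m * e)\<^sup>2" using n0 by (simp add: power_mult_distrib)
      finally show ?thesis using ms by linarith
    qed
    have sub: "?H \<subseteq> ?E \<union> (?G \<union> (space M - ?F))"
    proof (rule subsetI, rule ccontr)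
      fix \<omega> assume H: "\<omega> \<in> ?H" and no: "\<omega> \<notin> ?E \<union> (?G \<union> (space M - ?F))"
      obtain k where k: "k < n" "\<delta> * n < k" "\<delta> * n < real n - k" "\<bar>A \<gamma> n k \<omega>\<bar> \<ge> q" using H by blast
      have w: "\<omega> \<in> space M" using H by blast
      define j where "j = k * m div n"
      define i where "i = n * j div m"
      note ga = grid_approximation[OF k(1-3) \<delta> \<gamma> elim(3) m(2) m2 e q1(1), where \<omega>=\<omega>, folded j_def, folded i_def]
      have idx: "1 \<le> j" "j < m" "i \<le> k" "k \<le> i + (n div m + 1)"
      proof -
        show "1 \<le> j" "j < m" "i \<le> k" "k \<le> i + (n div m + 1)"
          using grid_index[OF k(1-3) \<delta> elim(3) m(2) m2] unfolding i_def j_def by auto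
      qed
      have 1: "\<bar>partial_sum Y k \<omega> - partial_sum Y i \<omega>\<bar> \<le> e * sqrt n"
      proof (rule ccontr)
        assume "\<not> ?thesis"
        then have "e * sqrt n \<le> \<bar>partial_sum Y (i + (k - i)) \<omega> - partial_sum Y i \<omega>\<bar>" using idx by simp
        moreover have "k - i \<le> n div m + 1" using idx by simp
        ultimately have "\<omega> \<in> ?E" using w idx(2) unfolding i_def by blast
        then show False using no by blast
      qed
      have 2: "\<bar>partial_sum Y n \<omega>\<bar> \<le> m * e * sqrt n"
      proof (rule ccontr)
        assume "\<not> ?thesis"
        then have "\<omega> \<in> ?G" using w by (simp add: partial_sum_def)
        then show False using no by blast
      qed
      have 3: "\<bar>A \<gamma> n i \<omega>\<bar> \<le> q1"
      proof -
        have "real j / real m \<in> T" using idx by (auto simp: T_def)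
        moreover have "nat \<lfloor>real n * (real j / real m)\<rfloor> = i"
          using floor_divide_of_nat_eq[of "n * j" m, where ?'a=real] by (simp add: i_def)
        ultimately show ?thesis using no w by fastforce
      qed
      have "\<bar>A \<gamma> n k \<omega>\<bar> \<le> q1 * (1 + 2 / (m * \<delta>)) + 3 * e / (\<delta> / 2) powr \<gamma>" by (rule ga[OF 1 2 3])
      also have "\<dots> = q1 + q1 * (2 / (m * \<delta>)) + 3 * e / (\<delta> / 2) powr \<gamma>" by (simp add: algebra_simps)
      also have "\<dots> < q1 + \<theta> / 3 + \<theta> / 3" using mq e3 by linarith
      also have "\<dots> = q" by (simp add: q1_def \<theta>_def field_simps)
      finally show False using k(4) by linarith
    qed
    have "prob ?H \<le> prob (?E \<union> (?G \<union> (space M - ?F)))"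
      by (rule finite_measure_mono[OF sub]) (intro sets.Un sets.Diff sets.top Em Fm Gm)
    also have "\<dots> \<le> prob ?E + prob (?G \<union> (space M - ?F))"
      by (rule measure_Un_le) (intro sets.Un sets.Diff sets.top Em Fm Gm)+
    also have "prob (?G \<union> (space M - ?F)) \<le> prob ?G + prob (space M - ?F)"
      by (rule measure_Un_le) (intro sets.Un sets.Diff sets.top Em Fm Gm)+
    finally show ?case using prob_compl[OF Fm] elim(1,2) pG mono by linarith
  qed
qed

end

section \<open>Negligible parts of the statistic\<close>

lemma log_square_powr_tendsto_0:
  fixes s :: real
  assumes "s > 0"
  shows "(\<lambda>n::nat. (log 2 n + 2)\<^sup>2 * n powr (- s)) \<longlonglongrightarrow> 0"
  using assms by real_asymp

lemma square_diff_le: "((a::real) - b)\<^sup>2 \<le> 2 * a\<^sup>2 + 2 * b\<^sup>2"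
proof -
  have "0 \<le> (a + b)\<^sup>2" by simp
  then show ?thesis by (simp add: power2_eq_square algebra_simps)
qed

lemma square_add_le: "((a::real) + b)\<^sup>2 \<le> 2 * a\<^sup>2 + 2 * b\<^sup>2"
  using square_diff_le[of a "- b"] by simp

lemma expectation_square_add_le:
  fixes f g :: "'a \<Rightarrow> real"
  assumes [measurable]: "f \<in> borel_measurable M" "g \<in> borel_measurable M"
    and i: "integrable M (\<lambda>x. (f x)\<^sup>2)" "integrable M (\<lambda>x. (g x)\<^sup>2)"
  shows "(\<integral>x. (f x + g x)\<^sup>2 \<partial>M) \<le> 2 * (\<integral>x. (f x)\<^sup>2 \<partial>M) + 2 * (\<integral>x. (g x)\<^sup>2 \<partial>M)"
proof -
  have "(\<integral>x. (f x + g x)\<^sup>2 \<partial>M) \<le> (\<integral>x. 2 * (f x)\<^sup>2 + 2 * (g x)\<^sup>2 \<partial>M)"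
    by (intro integral_mono integrable_square_add assms square_add_le) (use i in auto)
  then show ?thesis using i by simp
qed

section \<open>Maximal bounds for sums over moving index rectangles\<close>

definition rect_sum :: "(real \<times> real \<Rightarrow> real) \<Rightarrow> (nat \<Rightarrow> 'a \<Rightarrow> real) \<Rightarrow> nat set \<Rightarrow> nat set \<Rightarrow> 'a \<Rightarrow> real" where
  "rect_sum K \<xi> I J \<omega> = (\<Sum>i\<in>I. \<Sum>j\<in>J. K (\<xi> j \<omega>, \<xi> i \<omega>))"

lemma rect_sum_Un1:
  assumes "finite I" "finite I'" "I \<inter> I' = {}"
  shows "rect_sum K \<xi> (I \<union> I') J \<omega> = rect_sum K \<xi> I J \<omega> + rect_sum K \<xi> I' J \<omega>"
  unfolding rect_sum_def by (rule sum.union_disjoint[OF assms])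

lemma rect_sum_Un2:
  assumes "finite J" "finite J'" "J \<inter> J' = {}"
  shows "rect_sum K \<xi> I (J \<union> J') \<omega> = rect_sum K \<xi> I J \<omega> + rect_sum K \<xi> I J' \<omega>"
  unfolding rect_sum_def sum.distrib[symmetric] by (intro sum.cong refl sum.union_disjoint[OF assms])

lemma rect_sum_empty[simp]: "rect_sum K \<xi> {} J \<omega> = 0" "rect_sum K \<xi> I {} \<omega> = 0"
  by (simp_all add: rect_sum_def)

context iid_sample
begin

lemma rect_sum_measurable:
  assumes [measurable]: "K \<in> borel_measurable (borel \<Otimes>\<^sub>M borel)" and IJ: "I \<subseteq> {1..}" "J \<subseteq> {1..}"
  shows "rect_sum K \<xi> I J \<in> borel_measurable M"
  unfolding rect_sum_def
proof (intro borel_measurable_sum)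
  fix i j assume "i \<in> I" "j \<in> J"
  then have "i \<ge> 1" "j \<ge> 1" using IJ by auto
  then show "(\<lambda>\<omega>. K (\<xi> j \<omega>, \<xi> i \<omega>)) \<in> borel_measurable M" by measurable
qed

text \<open>From k to l the rectangle {1..k} x {k<..n} gains {k<..l} x {l<..n} and loses {1..k} x
  {k<..l}. By orthogonality the mean squared increment is at most 2 c (l - k) n, which is additive
  over the indices between k and l, the form that \<open>maximal_inequality_log\<close>
  takes.\<close>

lemma degenerate_maximal:
  fixes \<rho> :: "real \<times> real \<Rightarrow> real"
  assumes \<rho>: "\<rho> \<in> borel_measurable (borel \<Otimes>\<^sub>M borel)"
    and sq: "integrable (D \<Otimes>\<^sub>M D) (\<lambda>p. (\<rho> p)\<^sup>2)"
    and zero: "AE y in D. (\<integral>x. \<rho> (y, x) \<partial>D) = 0" "AE x in D. (\<integral>y. \<rho> (y, x) \<partial>D) = 0"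
    and x: "x > 0" and n: "n \<ge> 1"
  shows "prob {\<omega> \<in> space M. \<exists>k\<le>n. \<bar>rect_sum \<rho> \<xi> {1..k} {k<..n} \<omega>\<bar> \<ge> x}
    \<le> (log 2 n + 2)\<^sup>2 * (2 * (\<integral>p. (\<rho> p)\<^sup>2 \<partial>(D \<Otimes>\<^sub>M D)) * (real n)\<^sup>2) / x\<^sup>2"
proof -
  define c where "c = (\<integral>p. (\<rho> p)\<^sup>2 \<partial>(D \<Otimes>\<^sub>M D))"
  have c0: "c \<ge> 0" by (simp add: c_def)
  define U where "U k \<omega> = rect_sum \<rho> \<xi> {1..k} {k<..n} \<omega>" for k \<omega>
  have m: "rect_sum \<rho> \<xi> I J \<in> borel_measurable M" if "I \<subseteq> {1..}" "J \<subseteq> {1..}" for I J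
    by (rule rect_sum_measurable[OF \<rho> that])
  have mom: "integrable M (\<lambda>\<omega>. (rect_sum \<rho> \<xi> I J \<omega>)\<^sup>2)"
    "expectation (\<lambda>\<omega>. (rect_sum \<rho> \<xi> I J \<omega>)\<^sup>2) = card I * card J * c"
    if "finite I" "finite J" "I \<subseteq> {1..}" "J \<subseteq> {1..}" "I \<inter> J = {}" for I J
    unfolding rect_sum_def c_def using degenerate_second_moment[OF \<rho> sq zero that] by auto
  have diff: "U l \<omega> - U k \<omega> = rect_sum \<rho> \<xi> {k<..l} {l<..n} \<omega> + (- rect_sum \<rho> \<xi> {1..k} {k<..l} \<omega>)"
    if "k \<le> l" "l \<le> n" for k l \<omega>
  proof -
    have 1: "{1..l} = {1..k} \<union> {k<..l}" "{k<..n} = {k<..l} \<union> {l<..n}" using that by auto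
    have "U l \<omega> = rect_sum \<rho> \<xi> {1..k} {l<..n} \<omega> + rect_sum \<rho> \<xi> {k<..l} {l<..n} \<omega>"
      unfolding U_def 1(1) by (rule rect_sum_Un1) auto
    moreover have "U k \<omega> = rect_sum \<rho> \<xi> {1..k} {k<..l} \<omega> + rect_sum \<rho> \<xi> {1..k} {l<..n} \<omega>"
      unfolding U_def 1(2) by (rule rect_sum_Un2) auto
    ultimately show ?thesis by simp
  qed
  have "prob {\<omega> \<in> space M. \<exists>k\<le>n. \<bar>U k \<omega>\<bar> \<ge> x} \<le> (log 2 n + 2)\<^sup>2 * (\<Sum>i\<in>{1..n}. 2 * c * n) / x\<^sup>2"
  proof (rule maximal_inequality_log[OF _ _ _ _ x n])
    show "U k \<in> borel_measurable M" for k unfolding U_def by (intro m) auto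
    show "U 0 \<omega> = 0" for \<omega> by (simp add: U_def)
    fix k l assume kl: "k \<le> l" "l \<le> n"
    let ?a = "rect_sum \<rho> \<xi> {k<..l} {l<..n}" and ?b = "\<lambda>\<omega>. - rect_sum \<rho> \<xi> {1..k} {k<..l} \<omega>"
    have am: "?a \<in> borel_measurable M" "?b \<in> borel_measurable M" by (intro borel_measurable_uminus m; auto)+
    have a: "integrable M (\<lambda>\<omega>. (?a \<omega>)\<^sup>2)" "expectation (\<lambda>\<omega>. (?a \<omega>)\<^sup>2) = (l - k) * (n - l) * c"
    proof -
      have "{k<..l} \<subseteq> {1..}" "{l<..n} \<subseteq> {1..}" "{k<..l} \<inter> {l<..n} = {}" by auto
      note mm = mom[OF _ _ this]
      show "integrable M (\<lambda>\<omega>. (?a \<omega>)\<^sup>2)" "expectation (\<lambda>\<omega>. (?a \<omega>)\<^sup>2) = (l - k) * (n - l) * c"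
        using mm by auto
    qed
    have b: "integrable M (\<lambda>\<omega>. (?b \<omega>)\<^sup>2)" "expectation (\<lambda>\<omega>. (?b \<omega>)\<^sup>2) = k * (l - k) * c"
    proof -
      have "{1..k} \<subseteq> {1..}" "{k<..l} \<subseteq> {1..}" "{1..k} \<inter> {k<..l} = {}" by auto
      note mm = mom[OF _ _ this]
      show "integrable M (\<lambda>\<omega>. (?b \<omega>)\<^sup>2)" "expectation (\<lambda>\<omega>. (?b \<omega>)\<^sup>2) = k * (l - k) * c"
        using mm by auto
    qed
    show "integrable M (\<lambda>\<omega>. (U l \<omega> - U k \<omega>)\<^sup>2)"
      unfolding diff[OF kl] by (rule integrable_square_add[OF am a(1) b(1)])
    have "expectation (\<lambda>\<omega>. (U l \<omega> - U k \<omega>)\<^sup>2) \<le> 2 * ((l - k) * (n - l) * c) + 2 * (k * (l - k) * c)"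
      unfolding diff[OF kl] using expectation_square_add_le[OF am a(1) b(1)] unfolding a(2) b(2) .
    also have "\<dots> = 2 * c * (real ((l - k) * (n - l) + k * (l - k)))" by (simp add: algebra_simps)
    also have "\<dots> \<le> 2 * c * real ((l - k) * n)"
    proof -
      have "(l - k) * (n - l) + k * (l - k) = (l - k) * (n - l + k)" by (simp add: algebra_simps)
      also have "\<dots> \<le> (l - k) * n" using kl by (intro mult_left_mono) auto
      finally show ?thesis using c0 by (intro mult_left_mono) (simp_all only: of_nat_le_iff)
    qed
    also have "\<dots> = (\<Sum>i\<in>{k<..l}. 2 * c * n)" by simp
    finally show "expectation (\<lambda>\<omega>. (U l \<omega> - U k \<omega>)\<^sup>2) \<le> (\<Sum>i\<in>{k<..l}. 2 * c * n)" .
  qed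
  also have "(\<Sum>i\<in>{1..n}. 2 * c * n) = 2 * c * (real n)\<^sup>2" by (simp add: power2_eq_square)
  finally show ?thesis unfolding U_def c_def .
qed

text \<open>The rectangle {1..min k s} x {max k s<..n} gains one row per step up to k = s and loses
  one column per step afterwards. A row contributes at most C^2 n^2 and a column C^2 s n, so the
  number s of rows enters the total linearly.\<close>

lemma bounded_maximal:
  fixes K :: "real \<times> real \<Rightarrow> real"
  assumes K: "K \<in> borel_measurable (borel \<Otimes>\<^sub>M borel)"
    and Kb: "\<And>p. \<bar>K p\<bar> \<le> C" and mean: "(\<integral>p. K p \<partial>(D \<Otimes>\<^sub>M D)) = 0"
    and x: "x > 0" and s: "1 \<le> s" "s \<le> n"
  shows "prob {\<omega> \<in> space M. \<exists>k\<le>n. \<bar>rect_sum K \<xi> {1..min k s} {max k s<..n} \<omega>\<bar> \<ge> x}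
    \<le> (log 2 n + 2)\<^sup>2 * (4 * C\<^sup>2 * s * (real n)\<^sup>2) / x\<^sup>2"
proof -
  define V where "V k \<omega> = rect_sum K \<xi> {1..min k s} {max k s<..n} \<omega>" for k \<omega>
  \<comment> \<open>Twice what is used up on either side of s: an increment across s is split there
    by (a + b)^2 <= 2 a^2 + 2 b^2, and this doubles the bound.\<close>
  define w where "w i = (if i \<le> s then 2 * C\<^sup>2 * (real n)\<^sup>2 else 2 * C\<^sup>2 * s * n)" for i
  have w0: "w i \<ge> 0" for i by (simp add: w_def)
  have m: "rect_sum K \<xi> I J \<in> borel_measurable M" if "I \<subseteq> {1..}" "J \<subseteq> {1..}" for I J
    by (rule rect_sum_measurable[OF K that])
  have Vm: "V k \<in> borel_measurable M" for k unfolding V_def by (intro m) auto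
  have mom: "integrable M (\<lambda>\<omega>. (rect_sum K \<xi> I J \<omega>)\<^sup>2)"
    "expectation (\<lambda>\<omega>. (rect_sum K \<xi> I J \<omega>)\<^sup>2) \<le> C\<^sup>2 * (card I * card J * (card I + card J))"
    if "finite I" "finite J" "I \<subseteq> {1..}" "J \<subseteq> {1..}" "I \<inter> J = {}" for I J
    unfolding rect_sum_def using bounded_second_moment[OF K Kb mean that] by auto
  have low: "integrable M (\<lambda>\<omega>. (V l \<omega> - V k \<omega>)\<^sup>2) \<and> expectation (\<lambda>\<omega>. (V l \<omega> - V k \<omega>)\<^sup>2) \<le> (\<Sum>i\<in>{k<..l}. w i) / 2"
    if kl: "k \<le> l" "l \<le> s" for k l
  proof -
    have "V l \<omega> - V k \<omega> = rect_sum K \<xi> {k<..l} {s<..n} \<omega>" for \<omega>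
    proof -
      have "{1..l} = {1..k} \<union> {k<..l}" using kl by auto
      then have "V l \<omega> = rect_sum K \<xi> {1..k} {s<..n} \<omega> + rect_sum K \<xi> {k<..l} {s<..n} \<omega>"
        using kl unfolding V_def by (simp add: min_absorb1 max_absorb2) (rule rect_sum_Un1, auto)
      moreover have "V k \<omega> = rect_sum K \<xi> {1..k} {s<..n} \<omega>" using kl by (simp add: V_def min_absorb1 max_absorb2)
      ultimately show ?thesis by simp
    qed
    moreover have "expectation (\<lambda>\<omega>. (rect_sum K \<xi> {k<..l} {s<..n} \<omega>)\<^sup>2) \<le> (\<Sum>i\<in>{k<..l}. w i) / 2"
    proof -
      have "expectation (\<lambda>\<omega>. (rect_sum K \<xi> {k<..l} {s<..n} \<omega>)\<^sup>2) \<le> C\<^sup>2 * (card {k<..l} * card {s<..n} * (card {k<..l} + card {s<..n}))"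
        by (rule mom(2)) (use kl in auto)
      also have "\<dots> = C\<^sup>2 * real ((l - k) * ((n - s) * (l - k + (n - s))))" by simp
      also have "\<dots> \<le> C\<^sup>2 * real ((l - k) * (n * n))"
        using kl s by (intro mult_left_mono of_nat_mono mult_le_mono) auto
      also have "\<dots> = (\<Sum>i\<in>{k<..l}. 2 * C\<^sup>2 * (real n)\<^sup>2) / 2" by (simp add: power2_eq_square)
      also have "(\<Sum>i\<in>{k<..l}. 2 * C\<^sup>2 * (real n)\<^sup>2) = (\<Sum>i\<in>{k<..l}. w i)"
        using kl by (intro sum.cong) (auto simp: w_def)
      finally show ?thesis .
    qed
    moreover have "integrable M (\<lambda>\<omega>. (rect_sum K \<xi> {k<..l} {s<..n} \<omega>)\<^sup>2)" by (rule mom(1)) (use kl in auto)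
    ultimately show ?thesis by simp
  qed
  have high: "integrable M (\<lambda>\<omega>. (V l \<omega> - V k \<omega>)\<^sup>2) \<and> expectation (\<lambda>\<omega>. (V l \<omega> - V k \<omega>)\<^sup>2) \<le> (\<Sum>i\<in>{k<..l}. w i) / 2"
    if kl: "s \<le> k" "k \<le> l" "l \<le> n" for k l
  proof -
    have "V l \<omega> - V k \<omega> = - rect_sum K \<xi> {1..s} {k<..l} \<omega>" for \<omega>
    proof -
      have "{k<..n} = {k<..l} \<union> {l<..n}" using kl by auto
      then have "V k \<omega> = rect_sum K \<xi> {1..s} {k<..l} \<omega> + rect_sum K \<xi> {1..s} {l<..n} \<omega>"
        using kl unfolding V_def by (simp add: min_absorb2 max_absorb1) (rule rect_sum_Un2, auto)
      moreover have "V l \<omega> = rect_sum K \<xi> {1..s} {l<..n} \<omega>" using kl by (simp add: V_def min_absorb2 max_absorb1)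
      ultimately show ?thesis by simp
    qed
    moreover have "expectation (\<lambda>\<omega>. (rect_sum K \<xi> {1..s} {k<..l} \<omega>)\<^sup>2) \<le> (\<Sum>i\<in>{k<..l}. w i) / 2"
    proof -
      have "expectation (\<lambda>\<omega>. (rect_sum K \<xi> {1..s} {k<..l} \<omega>)\<^sup>2) \<le> C\<^sup>2 * (card {1..s} * card {k<..l} * (card {1..s} + card {k<..l}))"
        by (rule mom(2)) (use kl in auto)
      also have "\<dots> = C\<^sup>2 * real (s * ((l - k) * (s + (l - k))))" by simp
      also have "\<dots> \<le> C\<^sup>2 * real (s * ((l - k) * n))"
        using kl s by (intro mult_left_mono of_nat_mono mult_le_mono) auto
      also have "\<dots> = (\<Sum>i\<in>{k<..l}. 2 * C\<^sup>2 * s * n) / 2" by simp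
      also have "(\<Sum>i\<in>{k<..l}. 2 * C\<^sup>2 * s * n) = (\<Sum>i\<in>{k<..l}. w i)"
        using kl by (intro sum.cong) (auto simp: w_def)
      finally show ?thesis .
    qed
    moreover have "integrable M (\<lambda>\<omega>. (rect_sum K \<xi> {1..s} {k<..l} \<omega>)\<^sup>2)" by (rule mom(1)) (use kl in auto)
    ultimately show ?thesis by simp
  qed
  have wk: "0 \<le> (\<Sum>i\<in>{k<..l}. w i)" for k l by (intro sum_nonneg w0)
  have both: "integrable M (\<lambda>\<omega>. (V l \<omega> - V k \<omega>)\<^sup>2) \<and> expectation (\<lambda>\<omega>. (V l \<omega> - V k \<omega>)\<^sup>2) \<le> (\<Sum>i\<in>{k<..l}. w i)"
    if kl: "k \<le> l" "l \<le> n" for k l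
  proof -
    consider "l \<le> s" | "s \<le> k" | "k \<le> s" "s \<le> l" by linarith
    then show ?thesis
    proof cases
      case 1
      show ?thesis using low[OF kl(1) 1] wk[of k l] by linarith
    next
      case 2
      show ?thesis using high[OF 2 kl] wk[of k l] by linarith
    next
      case 3
      have a: "integrable M (\<lambda>\<omega>. (V s \<omega> - V k \<omega>)\<^sup>2)" "expectation (\<lambda>\<omega>. (V s \<omega> - V k \<omega>)\<^sup>2) \<le> (\<Sum>i\<in>{k<..s}. w i) / 2"
        using low[OF 3(1) order_refl] by auto
      have b: "integrable M (\<lambda>\<omega>. (V l \<omega> - V s \<omega>)\<^sup>2)" "expectation (\<lambda>\<omega>. (V l \<omega> - V s \<omega>)\<^sup>2) \<le> (\<Sum>i\<in>{s<..l}. w i) / 2"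
        using high[OF order_refl 3(2) kl(2)] by auto
      have d: "V l \<omega> - V k \<omega> = (V s \<omega> - V k \<omega>) + (V l \<omega> - V s \<omega>)" for \<omega> by simp
      have "(\<Sum>i\<in>{k<..l}. w i) = (\<Sum>i\<in>{k<..s}. w i) + (\<Sum>i\<in>{s<..l}. w i)"
        using 3 by (subst sum.union_disjoint[symmetric]) (auto intro!: sum.cong)
      moreover have "expectation (\<lambda>\<omega>. (V l \<omega> - V k \<omega>)\<^sup>2) \<le> 2 * expectation (\<lambda>\<omega>. (V s \<omega> - V k \<omega>)\<^sup>2) + 2 * expectation (\<lambda>\<omega>. (V l \<omega> - V s \<omega>)\<^sup>2)"
        unfolding d by (rule expectation_square_add_le) (use Vm a b in auto)
      moreover have "integrable M (\<lambda>\<omega>. (V l \<omega> - V k \<omega>)\<^sup>2)"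
        unfolding d by (rule integrable_square_add) (use Vm a b in auto)
      ultimately show ?thesis using a(2) b(2) by linarith
    qed
  qed
  have "prob {\<omega> \<in> space M. \<exists>k\<le>n. \<bar>V k \<omega>\<bar> \<ge> x} \<le> (log 2 n + 2)\<^sup>2 * (\<Sum>i\<in>{1..n}. w i) / x\<^sup>2"
  proof (rule maximal_inequality_log)
    show "V 0 \<omega> = 0" for \<omega> by (simp add: V_def)
  qed (use Vm both x s in auto)
  also have "\<dots> \<le> (log 2 n + 2)\<^sup>2 * (4 * C\<^sup>2 * s * (real n)\<^sup>2) / x\<^sup>2"
  proof (intro divide_right_mono mult_left_mono)
    have "(\<Sum>i\<in>{1..n}. w i) = (\<Sum>i\<in>{1..s}. w i) + (\<Sum>i\<in>{s<..n}. w i)"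
      using s by (subst sum.union_disjoint[symmetric]) (auto intro!: sum.cong)
    also have "(\<Sum>i\<in>{1..s}. w i) = s * (2 * C\<^sup>2 * (real n)\<^sup>2)" by (simp add: w_def)
    also have "(\<Sum>i\<in>{s<..n}. w i) = real (n - s) * (2 * C\<^sup>2 * s * n)" by (simp add: w_def)
    also have "\<dots> \<le> real n * (2 * C\<^sup>2 * s * n)" by (intro mult_right_mono) auto
    finally show "(\<Sum>i\<in>{1..n}. w i) \<le> 4 * C\<^sup>2 * s * (real n)\<^sup>2" by (simp add: power2_eq_square algebra_simps)
  qed auto
  finally show ?thesis unfolding V_def .
qed

end

section \<open>Size of the norming and of the set of shifted pairs\<close>

lemma sum_powr_minus_le:
  fixes \<gamma> :: real
  assumes "0 < \<gamma>" "\<gamma> < 1 / 2"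
  shows "(\<Sum>i\<in>{1..k}. real i powr (- \<gamma>)) \<le> 2 * real k powr (1 - \<gamma>)"
proof (induction k)
  case (Suc k)
  have step: "real (Suc k) powr (- \<gamma>) \<le> 2 * real (Suc k) powr (1 - \<gamma>) - 2 * real k powr (1 - \<gamma>)"
  proof -
    let ?n = "real (Suc k)"
    \<comment> \<open>Young's inequality acts as Bernoulli's for the exponent 1 - gamma: with n = k
      + 1, (1 - 1/n)^(1 - gamma) <= 1 - (1 - gamma)/n, and 1 - gamma >= 1/2. The sum then telescopes
      with the constant 2.\<close>
    have b: "(real k / ?n) powr (1 - \<gamma>) \<le> 1 - 1 / (2 * ?n)"
    proof (cases "k = 0")
      case False
      have "(real k / ?n) powr (1 - \<gamma>) * 1 powr \<gamma> \<le> (1 - \<gamma>) * (real k / ?n) + \<gamma> * 1"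
        by (rule Youngs_inequality_0) (use assms False in auto)
      also have "\<dots> = 1 - (1 - \<gamma>) / ?n" by (simp add: field_simps)
      also have "\<dots> \<le> 1 - (1 / 2) / ?n" using assms by (intro diff_left_mono divide_right_mono) auto
      finally show ?thesis by simp
    qed auto
    have "real k powr (1 - \<gamma>) = ?n powr (1 - \<gamma>) * (real k / ?n) powr (1 - \<gamma>)"
      by (simp add: powr_mult[symmetric])
    also have "\<dots> \<le> ?n powr (1 - \<gamma>) * (1 - 1 / (2 * ?n))" using b by (intro mult_left_mono) auto
    also have "\<dots> = ?n powr (1 - \<gamma>) - ?n powr (1 - \<gamma>) / ?n / 2" by (simp add: algebra_simps)
    also have "?n powr (1 - \<gamma>) / ?n = ?n powr (- \<gamma>)" 
      using powr_add[of ?n 1 "- \<gamma>"] by simp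
    finally show ?thesis by simp
  qed
  then show ?case using Suc by simp
qed simp

text \<open>The reciprocal of the prefactor in \<open>G_stat\<close>; estimates are stated for the
  undivided double sums.\<close>

definition nrm :: "real \<Rightarrow> nat \<Rightarrow> nat \<Rightarrow> real" where
  "nrm \<gamma> n k = real n powr (3 / 2) * wgt \<gamma> (k / n)"

text \<open>The number of pairs i <= k < j <= n that also satisfy i <= s < j, so that their
  difference contains the jump of a change after s.\<close>

definition mass :: "nat \<Rightarrow> nat \<Rightarrow> nat \<Rightarrow> real" where
  "mass s n k = real (min k s) * real (n - max k s)"

lemma nrm_eq:
  assumes "k \<in> {1..<n}"
  shows "nrm \<gamma> n k = real n powr (3 / 2 - 2 * \<gamma>) * (real k powr \<gamma> * real (n - k) powr \<gamma>)"
proof -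
  have n: "real n > 0" and k: "real k > 0" "real (n - k) > 0" using assms by auto
  have "real k / n * (1 - real k / n) = real k * real (n - k) / (real n)\<^sup>2"
    using assms by (simp add: of_nat_diff field_simps power2_eq_square)
  then have "wgt \<gamma> (k / n) = real k powr \<gamma> * real (n - k) powr \<gamma> / ((real n)\<^sup>2) powr \<gamma>"
    unfolding wgt_def by (simp add: powr_divide powr_mult)
  also have "((real n)\<^sup>2) powr \<gamma> = real n powr (2 * \<gamma>)"
    using n by (simp add: powr_powr[symmetric])
  finally have w: "wgt \<gamma> (k / n) = real k powr \<gamma> * real (n - k) powr \<gamma> / real n powr (2 * \<gamma>)" .
  show ?thesis unfolding nrm_def w powr_diff by simp
qed

lemma nrm_pos: "k \<in> {1..<n} \<Longrightarrow> nrm \<gamma> n k > 0"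
  by (subst nrm_eq) auto

text \<open>k (n - k) is smallest at k = 1 and k = n - 1, where it equals n - 1 >= n/2.\<close>

lemma nrm_lower:
  assumes k: "k \<in> {1..<n}" and \<gamma>: "0 < \<gamma>" "\<gamma> < 1 / 2"
  shows "real n powr (3 / 2 - \<gamma>) / 2 \<le> nrm \<gamma> n k"
proof -
  have n: "real n > 0" using k by auto
  have "n - 1 \<le> k * (n - k)"
  proof -
    obtain a where a: "k = Suc a" using k by (cases k) auto
    obtain b where b: "n - k = Suc b" using k by (cases "n - k") auto
    have "n = Suc a + Suc b" using a b k by linarith
    then show ?thesis unfolding b a by simp
  qed
  then have "real n / 2 \<le> real k * real (n - k)"
  proof -
    assume "n - 1 \<le> k * (n - k)"
    then have "real (n - 1) \<le> real k * real (n - k)" by (metis of_nat_le_iff of_nat_mult)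
    moreover have "real n / 2 \<le> real (n - 1)" using k by auto
    ultimately show ?thesis by linarith
  qed
  then have "(real n / 2) powr \<gamma> \<le> (real k * real (n - k)) powr \<gamma>" using \<gamma> by (intro powr_mono2) auto
  moreover have "real n powr \<gamma> / 2 \<le> (real n / 2) powr \<gamma>"
  proof -
    have "2 powr \<gamma> \<le> 2 powr (1 :: real)" using \<gamma> by (intro powr_mono) auto
    then have "real n powr \<gamma> / 2 \<le> real n powr \<gamma> / 2 powr \<gamma>" using n by (intro divide_left_mono) auto
    then show ?thesis using n by (simp add: powr_divide)
  qed
  ultimately have "real n powr \<gamma> / 2 \<le> real k powr \<gamma> * real (n - k) powr \<gamma>" by (simp add: powr_mult)
  then have "real n powr (3 / 2 - 2 * \<gamma>) * (real n powr \<gamma> / 2) \<le> nrm \<gamma> n k"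
    unfolding nrm_eq[OF k] by (intro mult_left_mono) auto
  also have "real n powr (3 / 2 - 2 * \<gamma>) * (real n powr \<gamma> / 2) = real n powr (3 / 2 - \<gamma>) / 2"
    by (simp add: powr_add[symmetric])
  finally show ?thesis .
qed

lemma powr_split: "x powr (1 - \<gamma>) * x powr \<gamma> = x" if "x > 0" for x \<gamma> :: real
  using that by (simp add: powr_add[symmetric])

lemma mass_bound_aux:
  assumes k: "k \<in> {1..<n}" and s: "1 \<le> s" "s < n" and \<gamma>: "0 < \<gamma>" "\<gamma> < 1 / 2"
  shows "real (n - max k s) \<le> real n powr (1 - \<gamma>) * real (n - k) powr \<gamma>"
    and "real (min k s) \<le> real s powr (1 - \<gamma>) * real k powr \<gamma>"
proof -
  have p: "real (n - max k s) > 0" "real (min k s) > 0" using k s by auto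
  have "real (n - max k s) = real (n - max k s) powr (1 - \<gamma>) * real (n - max k s) powr \<gamma>"
    by (rule powr_split[OF p(1), symmetric])
  also have "\<dots> \<le> real n powr (1 - \<gamma>) * real (n - k) powr \<gamma>"
    using \<gamma> by (intro mult_mono powr_mono2) auto
  finally show "real (n - max k s) \<le> real n powr (1 - \<gamma>) * real (n - k) powr \<gamma>" .
  have "real (min k s) = real (min k s) powr (1 - \<gamma>) * real (min k s) powr \<gamma>"
    by (rule powr_split[OF p(2), symmetric])
  also have "\<dots> \<le> real s powr (1 - \<gamma>) * real k powr \<gamma>"
    using \<gamma> by (intro mult_mono powr_mono2) auto
  finally show "real (min k s) \<le> real s powr (1 - \<gamma>) * real k powr \<gamma>" .
qed

text \<open>Each side length is split as x = x^(1 - gamma) x^gamma; the power gamma is absorbed by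
  the weight at k, the rest is bounded by s^(1 - gamma) and n^(1 - gamma). At k = s this is sharp up
  to (1 - s/n)^(1 - gamma), see \<open>mass_at_change\<close>, and for s = c n^kappa the factor in
  front of the norming is c^(1 - gamma).\<close>

lemma mass_le_nrm:
  assumes k: "k \<in> {1..<n}" and s: "1 \<le> s" "s < n" and \<gamma>: "0 < \<gamma>" "\<gamma> < 1 / 2"
  shows "mass s n k \<le> real s powr (1 - \<gamma>) * real n powr (\<gamma> - 1 / 2) * nrm \<gamma> n k"
proof -
  have "mass s n k \<le> (real s powr (1 - \<gamma>) * real k powr \<gamma>) * (real n powr (1 - \<gamma>) * real (n - k) powr \<gamma>)"
    unfolding mass_def by (rule mult_mono[OF mass_bound_aux(2)[OF k s \<gamma>] mass_bound_aux(1)[OF k s \<gamma>]]) auto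
  also have "real n powr (1 - \<gamma>) = real n powr (\<gamma> - 1 / 2) * real n powr (3 / 2 - 2 * \<gamma>)"
    by (simp add: powr_add[symmetric])
  finally show ?thesis unfolding nrm_eq[OF k] by (simp add: mult_ac)
qed

text \<open>For k >= delta n the weight supplies k^gamma >= (delta n)^gamma against the full row
  length s, which leaves s n^(-1/2): a vanishing factor for s of order n^kappa, since kappa <
  1/2.\<close>

lemma mass_le_nrm_late:
  assumes k: "k \<in> {1..<n}" and s: "1 \<le> s" "s < n" and \<gamma>: "0 < \<gamma>" "\<gamma> < 1 / 2" and \<delta>: "\<delta> > 0" "\<delta> * real n \<le> real k"
  shows "mass s n k \<le> real s * real n powr (- 1 / 2) * \<delta> powr (- \<gamma>) * nrm \<gamma> n k"
proof -
  have n: "real n > 0" using k by auto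
  have "(\<delta> * real n) powr \<gamma> \<le> real k powr \<gamma>" using \<delta> n \<gamma> by (intro powr_mono2) auto
  then have "1 \<le> \<delta> powr (- \<gamma>) * real n powr (- \<gamma>) * real k powr \<gamma>"
    using \<delta> n by (simp add: powr_mult powr_minus field_simps)
  then have "real s * 1 \<le> real s * (\<delta> powr (- \<gamma>) * real n powr (- \<gamma>) * real k powr \<gamma>)"
    by (intro mult_left_mono) auto
  then have "real (min k s) \<le> real s * (\<delta> powr (- \<gamma>) * real n powr (- \<gamma>) * real k powr \<gamma>)" by simp
  then have "mass s n k \<le> (real s * (\<delta> powr (- \<gamma>) * real n powr (- \<gamma>) * real k powr \<gamma>)) * (real n powr (1 - \<gamma>) * real (n - k) powr \<gamma>)"
    unfolding mass_def by (rule mult_mono[OF _ mass_bound_aux(1)[OF k s \<gamma>]]) auto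
  also have "\<dots> = real s * \<delta> powr (- \<gamma>) * (real n powr (- \<gamma>) * real n powr (1 - \<gamma>)) * (real k powr \<gamma> * real (n - k) powr \<gamma>)"
    by (simp add: mult_ac)
  also have "real n powr (- \<gamma>) * real n powr (1 - \<gamma>) = real n powr (- 1 / 2) * real n powr (3 / 2 - 2 * \<gamma>)"
    by (simp add: powr_add[symmetric])
  finally show ?thesis unfolding nrm_eq[OF k] by (simp add: mult_ac)
qed

lemma mass_at_change:
  assumes s: "1 \<le> s" "s < n"
  shows "mass s n s = real s powr (1 - \<gamma>) * real n powr (\<gamma> - 1 / 2) * (1 - real s / n) powr (1 - \<gamma>) * nrm \<gamma> n s"
proof -
  have n: "real n > 0" and ns: "real (n - s) > 0" using s by auto
  have "1 - real s / n = real (n - s) / n" using s by (simp add: of_nat_diff field_simps)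
  then have e1: "(1 - real s / n) powr (1 - \<gamma>) = real (n - s) powr (1 - \<gamma>) / real n powr (1 - \<gamma>)" by (simp add: powr_divide)
  have e2: "real n powr (\<gamma> - 1 / 2) * real n powr (3 / 2 - 2 * \<gamma>) / real n powr (1 - \<gamma>) = 1"
    using n by (simp add: powr_add[symmetric])
  have e3: "nrm \<gamma> n s = real n powr (3 / 2 - 2 * \<gamma>) * (real s powr \<gamma> * real (n - s) powr \<gamma>)"
    using s by (intro nrm_eq) auto
  have "a * b * (c / d) * (e * (f * g)) = (b * e / d) * (a * f) * (c * g)" for a b c d e f g :: real
    by (simp add: mult_ac)
  then have "real s powr (1 - \<gamma>) * real n powr (\<gamma> - 1 / 2) * (1 - real s / n) powr (1 - \<gamma>) * nrm \<gamma> n s =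
    (real n powr (\<gamma> - 1 / 2) * real n powr (3 / 2 - 2 * \<gamma>) / real n powr (1 - \<gamma>)) *
      (real s powr (1 - \<gamma>) * real s powr \<gamma>) * (real (n - s) powr (1 - \<gamma>) * real (n - s) powr \<gamma>)"
    unfolding e1 e3 .
  also have "\<dots> = mass s n s"
    unfolding e2 using powr_split[of "real s" \<gamma>] powr_split[OF ns, of \<gamma>] s by (simp add: mass_def)
  finally show ?thesis by simp
qed

lemma rect_sum_const: "rect_sum (\<lambda>_. v) \<xi> {1..min k s} {max k s<..n} \<omega> = v * mass s n k"
  by (simp add: rect_sum_def mass_def mult.commute)

context iid_sample
begin

text \<open>The squared maximum is of order n^2 up to log^2 n, the squared norming at least of order
  n^(3 - 2 gamma) for every k; the quotient n^(-(1 - 2 gamma)) beats the logarithms.\<close>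

lemma degenerate_negligible:
  fixes \<rho> :: "real \<times> real \<Rightarrow> real" and \<gamma> \<epsilon> \<eta> :: real
  assumes \<rho>: "\<rho> \<in> borel_measurable (borel \<Otimes>\<^sub>M borel)"
    and sq: "integrable (D \<Otimes>\<^sub>M D) (\<lambda>p. (\<rho> p)\<^sup>2)"
    and zero: "AE y in D. (\<integral>x. \<rho> (y, x) \<partial>D) = 0" "AE x in D. (\<integral>y. \<rho> (y, x) \<partial>D) = 0"
    and \<gamma>: "0 < \<gamma>" "\<gamma> < 1 / 2" and \<epsilon>: "\<epsilon> > 0" and \<eta>: "\<eta> > 0"
  shows "\<forall>\<^sub>F n in sequentially. prob {\<omega> \<in> space M. \<exists>k\<in>{1..<n}. \<bar>rect_sum \<rho> \<xi> {1..k} {k<..n} \<omega>\<bar> \<ge> \<epsilon> * nrm \<gamma> n k} \<le> \<eta>"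
proof -
  define c where "c = (\<integral>p. (\<rho> p)\<^sup>2 \<partial>(D \<Otimes>\<^sub>M D))"
  have "(\<lambda>n::nat. 8 * c / \<epsilon>\<^sup>2 * ((log 2 n + 2)\<^sup>2 * n powr (- (1 - 2 * \<gamma>)))) \<longlonglongrightarrow> 8 * c / \<epsilon>\<^sup>2 * 0"
    using \<gamma> by (intro tendsto_mult tendsto_const log_square_powr_tendsto_0) auto
  then have "\<forall>\<^sub>F n::nat in sequentially. 8 * c / \<epsilon>\<^sup>2 * ((log 2 n + 2)\<^sup>2 * n powr (- (1 - 2 * \<gamma>))) < \<eta>"
    using \<eta> by (intro order_tendstoD) auto
  then show ?thesis using eventually_ge_at_top[of 1]
  proof eventually_elim
    case (elim n)
    have n: "real n > 0" using elim by simp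
    define x where "x = \<epsilon> * (real n powr (3 / 2 - \<gamma>) / 2)"
    have x: "x > 0" using \<epsilon> n by (simp add: x_def)
    have x2: "x\<^sup>2 = \<epsilon>\<^sup>2 / 4 * real n powr (3 - 2 * \<gamma>)"
      by (simp add: x_def power_mult_distrib power_divide powr_square)
    have "prob {\<omega> \<in> space M. \<exists>k\<in>{1..<n}. \<bar>rect_sum \<rho> \<xi> {1..k} {k<..n} \<omega>\<bar> \<ge> \<epsilon> * nrm \<gamma> n k}
       \<le> prob {\<omega> \<in> space M. \<exists>k\<le>n. \<bar>rect_sum \<rho> \<xi> {1..k} {k<..n} \<omega>\<bar> \<ge> x}"
    proof (rule finite_measure_mono)
      show "{\<omega> \<in> space M. \<exists>k\<in>{1..<n}. \<bar>rect_sum \<rho> \<xi> {1..k} {k<..n} \<omega>\<bar> \<ge> \<epsilon> * nrm \<gamma> n k}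
        \<subseteq> {\<omega> \<in> space M. \<exists>k\<le>n. \<bar>rect_sum \<rho> \<xi> {1..k} {k<..n} \<omega>\<bar> \<ge> x}"
      proof safe
        fix \<omega> k assume k: "k \<in> {1..<n}" and le: "\<epsilon> * nrm \<gamma> n k \<le> \<bar>rect_sum \<rho> \<xi> {1..k} {k<..n} \<omega>\<bar>"
        have "x \<le> \<epsilon> * nrm \<gamma> n k" unfolding x_def using nrm_lower[OF k \<gamma>] \<epsilon> by (intro mult_left_mono) auto
        then show "\<exists>k\<le>n. x \<le> \<bar>rect_sum \<rho> \<xi> {1..k} {k<..n} \<omega>\<bar>" using le k by (intro exI[of _ k]) auto
      qed
      have [measurable]: "rect_sum \<rho> \<xi> {1..k} {k<..n} \<in> borel_measurable M" for k by (rule rect_sum_measurable[OF \<rho>]) auto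
      show "{\<omega> \<in> space M. \<exists>k\<le>n. \<bar>rect_sum \<rho> \<xi> {1..k} {k<..n} \<omega>\<bar> \<ge> x} \<in> sets M" by measurable
    qed
    also have "\<dots> \<le> (log 2 n + 2)\<^sup>2 * (2 * c * (real n)\<^sup>2) / x\<^sup>2"
      unfolding c_def by (rule degenerate_maximal[OF \<rho> sq zero x]) (use elim in auto)
    also have "\<dots> = 8 * c / \<epsilon>\<^sup>2 * ((log 2 n + 2)\<^sup>2 * ((real n)\<^sup>2 / n powr (3 - 2 * \<gamma>)))"
      unfolding x2 using \<epsilon> by (simp add: field_simps)
    also have "(real n)\<^sup>2 / n powr (3 - 2 * \<gamma>) = n powr (- (1 - 2 * \<gamma>))"
      using n powr_diff[of "real n" 2 "3 - 2 * \<gamma>"] by simp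
    finally show ?case using elim by linarith
  qed
qed

text \<open>With at most c n^kappa rows the squared maximum is of order n^(2 + kappa) up to log^2 n,
  against n^(3 - 2 gamma) for the squared norming; for kappa < 1 - 2 gamma the norming wins.\<close>

lemma bounded_negligible:
  fixes K :: "real \<times> real \<Rightarrow> real" and \<gamma> \<epsilon> \<eta> \<kappa> c :: real and s :: "nat \<Rightarrow> nat"
  assumes K: "K \<in> borel_measurable (borel \<Otimes>\<^sub>M borel)"
    and Kb: "\<And>p. \<bar>K p\<bar> \<le> C" and mean: "(\<integral>p. K p \<partial>(D \<Otimes>\<^sub>M D)) = 0"
    and \<gamma>: "0 < \<gamma>" "\<gamma> < 1 / 2" and \<epsilon>: "\<epsilon> > 0" and \<eta>: "\<eta> > 0" and \<kappa>: "\<kappa> < 1 - 2 * \<gamma>"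
    and s: "\<forall>\<^sub>F n in sequentially. 1 \<le> s n \<and> s n < n" "\<forall>\<^sub>F n in sequentially. real (s n) \<le> c * real n powr \<kappa>"
  shows "\<forall>\<^sub>F n in sequentially. prob {\<omega> \<in> space M. \<exists>k\<in>{1..<n}.
    \<bar>rect_sum K \<xi> {1..min k (s n)} {max k (s n)<..n} \<omega>\<bar> \<ge> \<epsilon> * nrm \<gamma> n k} \<le> \<eta>"
proof -
  have "(\<lambda>n::nat. 16 * C\<^sup>2 * c / \<epsilon>\<^sup>2 * ((log 2 n + 2)\<^sup>2 * n powr (- (1 - 2 * \<gamma> - \<kappa>)))) \<longlonglongrightarrow> 16 * C\<^sup>2 * c / \<epsilon>\<^sup>2 * 0"
    using \<kappa> by (intro tendsto_mult tendsto_const log_square_powr_tendsto_0) auto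
  then have "\<forall>\<^sub>F n::nat in sequentially. 16 * C\<^sup>2 * c / \<epsilon>\<^sup>2 * ((log 2 n + 2)\<^sup>2 * n powr (- (1 - 2 * \<gamma> - \<kappa>))) < \<eta>"
    using \<eta> by (intro order_tendstoD) auto
  then show ?thesis using s
  proof eventually_elim
    case (elim n)
    have n: "real n > 0" using elim by simp
    define x where "x = \<epsilon> * (real n powr (3 / 2 - \<gamma>) / 2)"
    have x: "x > 0" using \<epsilon> n by (simp add: x_def)
    have x2: "x\<^sup>2 = \<epsilon>\<^sup>2 / 4 * real n powr (3 - 2 * \<gamma>)"
      by (simp add: x_def power_mult_distrib power_divide powr_square)
    let ?V = "\<lambda>k. rect_sum K \<xi> {1..min k (s n)} {max k (s n)<..n}"
    have "prob {\<omega> \<in> space M. \<exists>k\<in>{1..<n}. \<bar>?V k \<omega>\<bar> \<ge> \<epsilon> * nrm \<gamma> n k}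
       \<le> prob {\<omega> \<in> space M. \<exists>k\<le>n. \<bar>?V k \<omega>\<bar> \<ge> x}"
    proof (rule finite_measure_mono)
      show "{\<omega> \<in> space M. \<exists>k\<in>{1..<n}. \<bar>?V k \<omega>\<bar> \<ge> \<epsilon> * nrm \<gamma> n k}
        \<subseteq> {\<omega> \<in> space M. \<exists>k\<le>n. \<bar>?V k \<omega>\<bar> \<ge> x}"
      proof safe
        fix \<omega> k assume k: "k \<in> {1..<n}" and le: "\<epsilon> * nrm \<gamma> n k \<le> \<bar>?V k \<omega>\<bar>"
        have "x \<le> \<epsilon> * nrm \<gamma> n k" unfolding x_def using nrm_lower[OF k \<gamma>] \<epsilon> by (intro mult_left_mono) auto
        then show "\<exists>k\<le>n. x \<le> \<bar>?V k \<omega>\<bar>" using le k by (intro exI[of _ k]) auto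
      qed
      have [measurable]: "?V k \<in> borel_measurable M" for k by (rule rect_sum_measurable[OF K]) auto
      show "{\<omega> \<in> space M. \<exists>k\<le>n. \<bar>?V k \<omega>\<bar> \<ge> x} \<in> sets M" by measurable
    qed
    also have "\<dots> \<le> (log 2 n + 2)\<^sup>2 * (4 * C\<^sup>2 * s n * (real n)\<^sup>2) / x\<^sup>2"
      by (rule bounded_maximal[OF K Kb mean x]) (use elim in auto)
    also have "\<dots> \<le> (log 2 n + 2)\<^sup>2 * (4 * C\<^sup>2 * (c * real n powr \<kappa>) * (real n)\<^sup>2) / x\<^sup>2"
      using elim by (intro divide_right_mono mult_left_mono mult_right_mono) auto
    also have "\<dots> = 16 * C\<^sup>2 * c / \<epsilon>\<^sup>2 * ((log 2 n + 2)\<^sup>2 * (real n powr \<kappa> * (real n)\<^sup>2 / n powr (3 - 2 * \<gamma>)))"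
      unfolding x2 using \<epsilon> by (simp add: field_simps)
    also have "real n powr \<kappa> * (real n)\<^sup>2 / n powr (3 - 2 * \<gamma>) = n powr (- (1 - 2 * \<gamma> - \<kappa>))"
      using n powr_diff[of "real n" "\<kappa> + 2" "3 - 2 * \<gamma>"] by (simp add: powr_add algebra_simps)
    finally show ?case using elim by linarith
  qed
qed

text \<open>For a kernel that is only integrable, a bound valid for all k has to come from first
  moments. For i <= k < j the product k^gamma (n - k)^gamma i^(-gamma) (n + 1 - j)^(-gamma) is at
  least 1; hence every rectangle sum is at most k^gamma (n - k)^gamma times one weighted sum
  \<open>H\<close> that does not depend on k, and the dependence on k cancels against the norming.
  Markov's inequality for \<open>H\<close> then loses only a constant.\<close>

lemma weighted_remainder_bound:
  fixes r :: "real \<times> real \<Rightarrow> real" and \<gamma> \<epsilon> :: real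
  assumes r[measurable]: "r \<in> borel_measurable (borel \<Otimes>\<^sub>M borel)" and r0: "\<And>p. r p \<ge> 0"
    and ri: "integrable (D \<Otimes>\<^sub>M D) r"
    and \<gamma>: "0 < \<gamma>" "\<gamma> < 1 / 2" and \<epsilon>: "\<epsilon> > 0" and s: "1 \<le> s" "s < n"
  shows "prob {\<omega> \<in> space M. \<exists>k\<in>{1..<n}. rect_sum r \<xi> {1..min k s} {max k s<..n} \<omega> \<ge> \<epsilon> * nrm \<gamma> n k}
    \<le> 4 / \<epsilon> * (\<integral>p. r p \<partial>(D \<Otimes>\<^sub>M D)) * (real s powr (1 - \<gamma>) * real n powr (\<gamma> - 1 / 2))"
proof -
  define R where "R = (\<integral>p. r p \<partial>(D \<Otimes>\<^sub>M D))"
  have R0: "R \<ge> 0" unfolding R_def by (simp add: r0)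
  have n: "real n > 0" using s by simp
  define a where "a i = real i powr (- \<gamma>)" for i :: nat
  \<comment> \<open>n + 1 - j is positive for every j <= n and still at most n - k for j >
    k.\<close>
  define b where "b j = real (n + 1 - j) powr (- \<gamma>)" for j :: nat
  define H where "H \<omega> = (\<Sum>i\<in>{1..s}. \<Sum>j\<in>{s<..n}. a i * b j * r (\<xi> j \<omega>, \<xi> i \<omega>))" for \<omega>
  have ab0: "a i \<ge> 0" "b j \<ge> 0" for i j by (auto simp: a_def b_def)
  have ij: "integrable M (\<lambda>\<omega>. a i * b j * r (\<xi> j \<omega>, \<xi> i \<omega>))" "expectation (\<lambda>\<omega>. a i * b j * r (\<xi> j \<omega>, \<xi> i \<omega>)) = a i * b j * R"
    if "i \<in> {1..s}" "j \<in> {s<..n}" for i j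
    using that kernel_expectation[of i j r] ri by (auto simp: R_def)
  have Hi: "integrable M H" unfolding H_def by (intro Bochner_Integration.integrable_sum ij)
  have H0: "H \<omega> \<ge> 0" for \<omega> unfolding H_def by (intro sum_nonneg mult_nonneg_nonneg ab0 r0)
  have "expectation H = (\<Sum>i\<in>{1..s}. expectation (\<lambda>\<omega>. \<Sum>j\<in>{s<..n}. a i * b j * r (\<xi> j \<omega>, \<xi> i \<omega>)))"
    unfolding H_def by (intro Bochner_Integration.integral_sum Bochner_Integration.integrable_sum ij(1))
  also have "\<dots> = (\<Sum>i\<in>{1..s}. \<Sum>j\<in>{s<..n}. expectation (\<lambda>\<omega>. a i * b j * r (\<xi> j \<omega>, \<xi> i \<omega>)))"
    by (intro sum.cong refl Bochner_Integration.integral_sum ij(1))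
  also have "\<dots> = (\<Sum>i\<in>{1..s}. \<Sum>j\<in>{s<..n}. a i * b j * R)"
    by (intro sum.cong refl ij(2))
  also have "\<dots> = (\<Sum>i\<in>{1..s}. a i) * (\<Sum>j\<in>{s<..n}. b j) * R"
    unfolding sum_product by (simp only: sum_distrib_right)
  also have "\<dots> \<le> (2 * real s powr (1 - \<gamma>)) * (2 * real n powr (1 - \<gamma>)) * R"
  proof (intro mult_right_mono mult_mono R0)
    show "(\<Sum>i\<in>{1..s}. a i) \<le> 2 * real s powr (1 - \<gamma>)" unfolding a_def by (rule sum_powr_minus_le[OF \<gamma>])
    have "(\<Sum>j\<in>{s<..n}. b j) = (\<Sum>i\<in>{1..n - s}. real i powr (- \<gamma>))"
      unfolding b_def by (rule sum.reindex_bij_witness[of _ "\<lambda>i. n + 1 - i" "\<lambda>j. n + 1 - j"]) auto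
    also have "\<dots> \<le> 2 * real (n - s) powr (1 - \<gamma>)" by (rule sum_powr_minus_le[OF \<gamma>])
    also have "\<dots> \<le> 2 * real n powr (1 - \<gamma>)" using \<gamma> by (intro mult_left_mono powr_mono2) auto
    finally show "(\<Sum>j\<in>{s<..n}. b j) \<le> 2 * real n powr (1 - \<gamma>)" .
  qed (auto intro!: sum_nonneg ab0)
  finally have EH: "expectation H \<le> 4 * real s powr (1 - \<gamma>) * real n powr (1 - \<gamma>) * R" by simp
  define y where "y = \<epsilon> * real n powr (3 / 2 - 2 * \<gamma>)"
  have y: "y > 0" using \<epsilon> n by (simp add: y_def)
  have path: "rect_sum r \<xi> {1..min k s} {max k s<..n} \<omega> \<le> real k powr \<gamma> * real (n - k) powr \<gamma> * H \<omega>" if k: "k \<in> {1..<n}" for k \<omega>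
  proof -
    have kp: "real k powr \<gamma> * real (n - k) powr \<gamma> \<ge> 0" by simp
    have "rect_sum r \<xi> {1..min k s} {max k s<..n} \<omega> \<le>
      (\<Sum>i\<in>{1..min k s}. \<Sum>j\<in>{max k s<..n}. real k powr \<gamma> * real (n - k) powr \<gamma> * (a i * b j * r (\<xi> j \<omega>, \<xi> i \<omega>)))"
      unfolding rect_sum_def
    proof (intro sum_mono)
      fix i j assume i: "i \<in> {1..min k s}" and j: "j \<in> {max k s<..n}"
      have "1 \<le> real k powr \<gamma> * a i"
      proof -
        have "real i powr \<gamma> \<le> real k powr \<gamma>" using i \<gamma> by (intro powr_mono2) auto
        then show ?thesis using i by (simp add: a_def powr_minus field_simps)
      qed
      moreover have "1 \<le> real (n - k) powr \<gamma> * b j"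
      proof -
        have "real (n + 1 - j) powr \<gamma> \<le> real (n - k) powr \<gamma>" using j \<gamma> by (intro powr_mono2) auto
        moreover have "real (n + 1 - j) > 0" using j by auto
        ultimately show ?thesis by (simp add: b_def powr_minus field_simps del: of_nat_diff)
      qed
      ultimately have "1 * 1 \<le> (real k powr \<gamma> * a i) * (real (n - k) powr \<gamma> * b j)"
        by (intro mult_mono) (auto intro: order_trans[OF zero_le_one])
      then have "1 * r (\<xi> j \<omega>, \<xi> i \<omega>) \<le> (real k powr \<gamma> * a i) * (real (n - k) powr \<gamma> * b j) * r (\<xi> j \<omega>, \<xi> i \<omega>)"
        by (intro mult_right_mono r0) simp
      then show "r (\<xi> j \<omega>, \<xi> i \<omega>) \<le> real k powr \<gamma> * real (n - k) powr \<gamma> * (a i * b j * r (\<xi> j \<omega>, \<xi> i \<omega>))"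
        by (simp only: mult_ac mult_1)
    qed
    also have "\<dots> = real k powr \<gamma> * real (n - k) powr \<gamma> * (\<Sum>i\<in>{1..min k s}. \<Sum>j\<in>{max k s<..n}. a i * b j * r (\<xi> j \<omega>, \<xi> i \<omega>))"
      by (simp only: sum_distrib_left)
    also have "\<dots> \<le> real k powr \<gamma> * real (n - k) powr \<gamma> * H \<omega>"
    proof (rule mult_left_mono[OF _ kp])
      have "(\<Sum>i\<in>{1..min k s}. \<Sum>j\<in>{max k s<..n}. a i * b j * r (\<xi> j \<omega>, \<xi> i \<omega>)) \<le> (\<Sum>i\<in>{1..min k s}. \<Sum>j\<in>{s<..n}. a i * b j * r (\<xi> j \<omega>, \<xi> i \<omega>))"
        by (intro sum_mono sum_mono2 mult_nonneg_nonneg ab0 r0) auto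
      also have "\<dots> \<le> H \<omega>" unfolding H_def
        by (intro sum_mono2 sum_nonneg mult_nonneg_nonneg ab0 r0) auto
      finally show "(\<Sum>i\<in>{1..min k s}. \<Sum>j\<in>{max k s<..n}. a i * b j * r (\<xi> j \<omega>, \<xi> i \<omega>)) \<le> H \<omega>" .
    qed
    finally show ?thesis .
  qed
  have Hm: "H \<in> borel_measurable M" using Hi by auto
  have "prob {\<omega> \<in> space M. \<exists>k\<in>{1..<n}. rect_sum r \<xi> {1..min k s} {max k s<..n} \<omega> \<ge> \<epsilon> * nrm \<gamma> n k} \<le> prob {\<omega> \<in> space M. H \<omega> \<ge> y}"
  proof (rule finite_measure_mono)
    show "{\<omega> \<in> space M. \<exists>k\<in>{1..<n}. rect_sum r \<xi> {1..min k s} {max k s<..n} \<omega> \<ge> \<epsilon> * nrm \<gamma> n k} \<subseteq> {\<omega> \<in> space M. H \<omega> \<ge> y}"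
    proof safe
      fix \<omega> k assume k: "k \<in> {1..<n}" and le: "\<epsilon> * nrm \<gamma> n k \<le> rect_sum r \<xi> {1..min k s} {max k s<..n} \<omega>"
      have p: "real k powr \<gamma> * real (n - k) powr \<gamma> > 0" using k by auto
      have "(real k powr \<gamma> * real (n - k) powr \<gamma>) * y = \<epsilon> * nrm \<gamma> n k" unfolding nrm_eq[OF k] y_def by (simp only: mult_ac)
      also have "\<dots> \<le> (real k powr \<gamma> * real (n - k) powr \<gamma>) * H \<omega>" using le path[OF k, of \<omega>] by linarith
      finally show "y \<le> H \<omega>" using p by (simp only: mult_le_cancel_left_pos)
    qed
    show "{\<omega> \<in> space M. H \<omega> \<ge> y} \<in> sets M" using Hm by measurable
  qed
  also have "\<dots> \<le> expectation H / y"
    using y H0 by (intro integral_Markov_inequality_measure[OF Hi, of "{}"]) auto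
  also have "\<dots> \<le> 4 * real s powr (1 - \<gamma>) * real n powr (1 - \<gamma>) * R / y"
    using EH y by (intro divide_right_mono) auto
  also have "\<dots> = 4 / \<epsilon> * R * (real s powr (1 - \<gamma>) * (real n powr (1 - \<gamma>) / real n powr (3 / 2 - 2 * \<gamma>)))"
    by (simp add: y_def)
  also have "real n powr (1 - \<gamma>) / real n powr (3 / 2 - 2 * \<gamma>) = real n powr (\<gamma> - 1 / 2)"
    by (simp add: powr_diff[symmetric])
  finally show ?thesis unfolding R_def .
qed

text \<open>f = K + v + rest: K is f cut off at a high level minus the mean v of the cut-off kernel,
  and the rest is small in L1. The main part of a merely integrable kernel thus becomes accessible
  to second moments.\<close>

lemma truncation:
  fixes f :: "real \<times> real \<Rightarrow> real"
  assumes f[measurable]: "f \<in> borel_measurable (borel \<Otimes>\<^sub>M borel)" and fi: "integrable (D \<Otimes>\<^sub>M D) f" and \<eta>: "\<eta> > 0"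
  shows "\<exists>K C v. K \<in> borel_measurable (borel \<Otimes>\<^sub>M borel) \<and> (\<forall>p. \<bar>K p\<bar> \<le> C) \<and> (\<integral>p. K p \<partial>(D \<Otimes>\<^sub>M D)) = 0 \<and>
    \<bar>v - (\<integral>p. f p \<partial>(D \<Otimes>\<^sub>M D))\<bar> \<le> \<eta> \<and> (\<integral>p. \<bar>f p - K p - v\<bar> \<partial>(D \<Otimes>\<^sub>M D)) \<le> \<eta>"
proof -
  let ?P = "D \<Otimes>\<^sub>M D"
  have fm[measurable]: "f \<in> borel_measurable ?P" using fi by auto
  define F where "F m p = (if \<bar>f p\<bar> \<le> real m then f p else 0)" for m :: nat and p
  have Fm[measurable]: "F m \<in> borel_measurable (borel \<Otimes>\<^sub>M borel)" for m unfolding F_def by measurable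
  have Fm'[measurable]: "F m \<in> borel_measurable ?P" for m unfolding F_def by measurable
  have Fb: "\<bar>F m p\<bar> \<le> real m" for m p by (simp add: F_def)
  have Fi: "integrable ?P (F m)" for m by (rule DD.integrable_const_bound[where B="real m"]) (use Fb in auto)
  have "(\<lambda>m. \<integral>p. \<bar>f p - F m p\<bar> \<partial>?P) \<longlonglongrightarrow> (\<integral>p. 0 \<partial>?P)"
  proof (rule integral_dominated_convergence[where w="\<lambda>p. \<bar>f p\<bar>"])
    show "AE p in ?P. (\<lambda>m. \<bar>f p - F m p\<bar>) \<longlonglongrightarrow> 0"
    proof (rule AE_I2)
      fix p
      obtain m0 :: nat where "\<bar>f p\<bar> \<le> real m0" using real_arch_simple by blast
      then have "\<forall>\<^sub>F m in sequentially. \<bar>f p - F m p\<bar> = 0"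
        by (intro eventually_sequentiallyI[of m0]) (auto simp: F_def)
      then show "(\<lambda>m. \<bar>f p - F m p\<bar>) \<longlonglongrightarrow> 0" by (rule tendsto_eventually)
    qed
    show "AE p in ?P. norm \<bar>f p - F m p\<bar> \<le> \<bar>f p\<bar>" for m by (auto simp: F_def)
  qed (use fi in auto)
  then have "\<forall>\<^sub>F m in sequentially. (\<integral>p. \<bar>f p - F m p\<bar> \<partial>?P) < \<eta>" using \<eta> by (intro order_tendstoD) auto
  then obtain m where m: "(\<integral>p. \<bar>f p - F m p\<bar> \<partial>?P) < \<eta>" by (auto simp: eventually_sequentially)
  define v where "v = (\<integral>p. F m p \<partial>?P)"
  define K where "K p = F m p - v" for p
  have "K \<in> borel_measurable (borel \<Otimes>\<^sub>M borel)" unfolding K_def by measurable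
  moreover have "\<forall>p. \<bar>K p\<bar> \<le> real m + \<bar>v\<bar>" unfolding K_def using Fb[of m] by (auto intro: order_trans[OF abs_triangle_ineq4])
  moreover have "(\<integral>p. K p \<partial>?P) = 0" unfolding K_def using Fi DD.prob_space by (simp add: v_def)
  moreover have "\<bar>v - (\<integral>p. f p \<partial>?P)\<bar> \<le> \<eta>"
  proof -
    have "\<bar>(\<integral>p. f p \<partial>?P) - v\<bar> = \<bar>\<integral>p. f p - F m p \<partial>?P\<bar>" unfolding v_def using fi Fi by simp
    also have "\<dots> \<le> (\<integral>p. \<bar>f p - F m p\<bar> \<partial>?P)" by (rule integral_abs_bound)
    finally show ?thesis using m by linarith
  qed
  moreover have "(\<integral>p. \<bar>f p - K p - v\<bar> \<partial>?P) \<le> \<eta>" using m by (simp add: K_def)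
  ultimately show ?thesis by blast
qed

end

lemma three_term_excess:
  fixes x y z r e :: real
  assumes "e \<le> \<bar>x + y + z\<bar>" "\<not> e / 3 \<le> \<bar>x\<bar>" "\<bar>y\<bar> \<le> e / 4" "\<bar>z\<bar> \<le> r" "e > 0"
  shows "e / 3 \<le> r"
  using assms by linarith

context iid_sample
begin

lemma rect_sum_decompose:
  "rect_sum f \<xi> I J \<omega> = rect_sum K \<xi> I J \<omega> + rect_sum (\<lambda>_. v) \<xi> I J \<omega> + rect_sum (\<lambda>p. f p - K p - v) \<xi> I J \<omega>"
  unfolding rect_sum_def sum.distrib[symmetric] by (simp add: algebra_simps)

lemma rect_sum_abs_le: "\<bar>rect_sum f \<xi> I J \<omega>\<bar> \<le> rect_sum (\<lambda>p. \<bar>f p\<bar>) \<xi> I J \<omega>"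
  unfolding rect_sum_def by (intro order_trans[OF sum_abs] sum_mono) simp

text \<open>The bounded part K goes to \<open>bounded_negligible\<close>, the deviation v - m of the
  mean to \<open>mass_le_nrm\<close>, the rest small in L1 to
  \<open>weighted_remainder_bound\<close>. The last two bounds are multiples of tau and of s^(1 -
  gamma) n^(gamma - 1/2) <= b, so a small tau controls them for all k.\<close>

lemma shift_error_small:
  fixes f :: "real \<times> real \<Rightarrow> real" and \<gamma> \<epsilon> \<eta> c \<kappa> :: real and s :: "nat \<Rightarrow> nat"
  assumes f[measurable]: "f \<in> borel_measurable (borel \<Otimes>\<^sub>M borel)" and fi: "integrable (D \<Otimes>\<^sub>M D) f"
    and \<gamma>: "0 < \<gamma>" "\<gamma> < 1 / 2" and \<kappa>: "\<kappa> = (1 - 2 * \<gamma>) / (2 * (1 - \<gamma>))" and \<epsilon>: "\<epsilon> > 0" and \<eta>: "\<eta> > 0"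
    and s: "\<forall>\<^sub>F n in sequentially. 1 \<le> s n \<and> s n < n" and c: "\<forall>\<^sub>F n in sequentially. real (s n) \<le> c * real n powr \<kappa>" "c > 0"
  shows "\<forall>\<^sub>F n in sequentially. prob {\<omega> \<in> space M. \<exists>k\<in>{1..<n}.
    \<bar>rect_sum f \<xi> {1..min k (s n)} {max k (s n)<..n} \<omega> - (\<integral>p. f p \<partial>(D \<Otimes>\<^sub>M D)) * mass (s n) n k\<bar> \<ge> \<epsilon> * nrm \<gamma> n k} \<le> \<eta>"
proof -
  define m where "m = (\<integral>p. f p \<partial>(D \<Otimes>\<^sub>M D))"
  define b where "b = c powr (1 - \<gamma>)"
  have b: "b > 0" using c by (simp add: b_def)
  \<comment> \<open>The first bound keeps the deviation of the mean below epsilon / 4 of the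
    norming, the second makes Markov's bound 12 / epsilon * tau * b at most eta / 2.\<close>
  define \<tau> where "\<tau> = min (\<epsilon> / (4 * b)) (\<eta> * \<epsilon> / (24 * b))"
  have \<tau>: "\<tau> > 0" "\<tau> * b \<le> \<epsilon> / 4" "\<tau> * b \<le> \<eta> * \<epsilon> / 24"
  proof -
    show "\<tau> > 0" using b \<epsilon> \<eta> by (simp add: \<tau>_def)
    have "\<tau> * b \<le> \<epsilon> / (4 * b) * b" "\<tau> * b \<le> \<eta> * \<epsilon> / (24 * b) * b" using b by (intro mult_right_mono; simp add: \<tau>_def)+
    then show "\<tau> * b \<le> \<epsilon> / 4" "\<tau> * b \<le> \<eta> * \<epsilon> / 24" using b by auto
  qed
  have \<kappa>1: "\<kappa> * (1 - \<gamma>) = 1 / 2 - \<gamma>" using \<gamma> by (simp add: \<kappa> field_simps)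
  have \<kappa>2: "\<kappa> < 1 - 2 * \<gamma>"
  proof -
    have "(1 - 2 * \<gamma>) / (2 * (1 - \<gamma>)) < (1 - 2 * \<gamma>) / 1" using \<gamma> by (intro divide_strict_left_mono) auto
    then show ?thesis by (simp add: \<kappa>)
  qed
  obtain K C v where K: "K \<in> borel_measurable (borel \<Otimes>\<^sub>M borel)" and Kb: "\<And>p. \<bar>K p\<bar> \<le> C" and K0: "(\<integral>p. K p \<partial>(D \<Otimes>\<^sub>M D)) = 0"
    and v: "\<bar>v - m\<bar> \<le> \<tau>" and r: "(\<integral>p. \<bar>f p - K p - v\<bar> \<partial>(D \<Otimes>\<^sub>M D)) \<le> \<tau>"
    using truncation[OF f fi \<tau>(1)] unfolding m_def by blast
  note [measurable] = K
  define R where "R p = \<bar>f p - K p - v\<bar>" for p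
  have Rm[measurable]: "R \<in> borel_measurable (borel \<Otimes>\<^sub>M borel)" unfolding R_def by measurable
  have Ki: "integrable (D \<Otimes>\<^sub>M D) K"
    by (rule DD.integrable_const_bound[where B=C]) (use Kb in auto)
  have Ri: "integrable (D \<Otimes>\<^sub>M D) R" unfolding R_def using fi Ki by auto
  have \<epsilon>3: "\<epsilon> / 3 > 0" and \<eta>2: "\<eta> / 2 > 0" using \<epsilon> \<eta> by auto
  show ?thesis
    using bounded_negligible[OF K Kb K0 \<gamma> \<epsilon>3 \<eta>2 \<kappa>2 s c(1)] s c(1)
  proof eventually_elim
    case (elim n)
    have n: "real n > 0" using elim by simp
    have sb: "real (s n) powr (1 - \<gamma>) * real n powr (\<gamma> - 1 / 2) \<le> b"
    proof -
      have "real (s n) powr (1 - \<gamma>) \<le> (c * real n powr \<kappa>) powr (1 - \<gamma>)" using elim \<gamma> by (intro powr_mono2) auto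
      also have "\<dots> = b * real n powr (1 / 2 - \<gamma>)" using c by (simp add: powr_mult powr_powr b_def \<kappa>1)
      finally have "real (s n) powr (1 - \<gamma>) * real n powr (\<gamma> - 1 / 2) \<le> b * real n powr (1 / 2 - \<gamma>) * real n powr (\<gamma> - 1 / 2)"
        by (intro mult_right_mono) auto
      also have "\<dots> = b" using n by (simp add: mult.assoc powr_add[symmetric])
      finally show ?thesis .
    qed
    let ?I = "\<lambda>k. {1..min k (s n)}" and ?J = "\<lambda>k. {max k (s n)<..n}"
    let ?E = "{\<omega> \<in> space M. \<exists>k\<in>{1..<n}. \<bar>rect_sum K \<xi> (?I k) (?J k) \<omega>\<bar> \<ge> \<epsilon> / 3 * nrm \<gamma> n k}"
    let ?F = "{\<omega> \<in> space M. \<exists>k\<in>{1..<n}. rect_sum R \<xi> (?I k) (?J k) \<omega> \<ge> \<epsilon> / 3 * nrm \<gamma> n k}"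
    have [measurable]: "rect_sum K \<xi> (?I k) (?J k) \<in> borel_measurable M" "rect_sum R \<xi> (?I k) (?J k) \<in> borel_measurable M" for k
      by (intro rect_sum_measurable K Rm; auto)+
    have m1: "?E \<in> sets M" "?F \<in> sets M" by measurable
    have "prob {\<omega> \<in> space M. \<exists>k\<in>{1..<n}. \<bar>rect_sum f \<xi> (?I k) (?J k) \<omega> - m * mass (s n) n k\<bar> \<ge> \<epsilon> * nrm \<gamma> n k} \<le> prob (?E \<union> ?F)"
    proof (rule finite_measure_mono)
      show "{\<omega> \<in> space M. \<exists>k\<in>{1..<n}. \<bar>rect_sum f \<xi> (?I k) (?J k) \<omega> - m * mass (s n) n k\<bar> \<ge> \<epsilon> * nrm \<gamma> n k} \<subseteq> ?E \<union> ?F"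
      proof (rule subsetI, rule ccontr)
        fix \<omega> assume "\<omega> \<in> {\<omega> \<in> space M. \<exists>k\<in>{1..<n}. \<bar>rect_sum f \<xi> (?I k) (?J k) \<omega> - m * mass (s n) n k\<bar> \<ge> \<epsilon> * nrm \<gamma> n k}"
          and no: "\<omega> \<notin> ?E \<union> ?F"
        then obtain k where w: "\<omega> \<in> space M" and k: "k \<in> {1..<n}"
          and le: "\<bar>rect_sum f \<xi> (?I k) (?J k) \<omega> - m * mass (s n) n k\<bar> \<ge> \<epsilon> * nrm \<gamma> n k" by blast
        have 1: "\<not> \<bar>rect_sum K \<xi> (?I k) (?J k) \<omega>\<bar> \<ge> \<epsilon> / 3 * nrm \<gamma> n k" using no w k by blast
        have 2: "\<not> rect_sum R \<xi> (?I k) (?J k) \<omega> \<ge> \<epsilon> / 3 * nrm \<gamma> n k" using no w k by blast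
        have N0: "nrm \<gamma> n k > 0" by (rule nrm_pos[OF k])
        have m0: "mass (s n) n k \<ge> 0" by (simp add: mass_def)
        have "\<bar>v * mass (s n) n k - m * mass (s n) n k\<bar> = \<bar>v - m\<bar> * mass (s n) n k"
          unfolding left_diff_distrib[symmetric] abs_mult abs_of_nonneg[OF m0] ..
        also have "\<dots> \<le> \<tau> * (b * nrm \<gamma> n k)"
        proof (intro mult_mono v m0)
          have "mass (s n) n k \<le> real (s n) powr (1 - \<gamma>) * real n powr (\<gamma> - 1 / 2) * nrm \<gamma> n k"
            by (rule mass_le_nrm[OF k _ _ \<gamma>]) (use elim in auto)
          also have "\<dots> \<le> b * nrm \<gamma> n k" using sb N0 by (intro mult_right_mono) auto
          finally show "mass (s n) n k \<le> b * nrm \<gamma> n k" .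
        qed (use \<tau> in auto)
        also have "\<dots> = (\<tau> * b) * nrm \<gamma> n k" by simp
        also have "\<dots> \<le> \<epsilon> / 4 * nrm \<gamma> n k" using \<tau>(2) N0 by (intro mult_right_mono) auto
        finally have 3: "\<bar>v * mass (s n) n k - m * mass (s n) n k\<bar> \<le> \<epsilon> / 4 * nrm \<gamma> n k" .
        have 4: "\<bar>rect_sum (\<lambda>p. f p - K p - v) \<xi> (?I k) (?J k) \<omega>\<bar> \<le> rect_sum R \<xi> (?I k) (?J k) \<omega>"
          using rect_sum_abs_le[of "\<lambda>p. f p - K p - v"] unfolding R_def .
        have d: "rect_sum f \<xi> (?I k) (?J k) \<omega> - m * mass (s n) n k = rect_sum K \<xi> (?I k) (?J k) \<omega> +
          (v * mass (s n) n k - m * mass (s n) n k) + rect_sum (\<lambda>p. f p - K p - v) \<xi> (?I k) (?J k) \<omega>"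
          using rect_sum_decompose[of f "?I k" "?J k" \<omega> K v] unfolding rect_sum_const by linarith
        have "\<epsilon> * nrm \<gamma> n k / 3 \<le> rect_sum R \<xi> (?I k) (?J k) \<omega>"
          by (rule three_term_excess[OF le[unfolded d] _ _ 4]) (use 1 3 \<epsilon> N0 in simp_all)
        then show False using 2 by simp
      qed
    qed (use m1 in auto)
    also have "\<dots> \<le> prob ?E + prob ?F" by (rule measure_Un_le[OF m1])
    also have "prob ?F \<le> 4 / (\<epsilon> / 3) * (\<integral>p. R p \<partial>(D \<Otimes>\<^sub>M D)) * (real (s n) powr (1 - \<gamma>) * real n powr (\<gamma> - 1 / 2))"
      by (rule weighted_remainder_bound[OF Rm _ Ri \<gamma> \<epsilon>3]) (use elim in \<open>auto simp: R_def\<close>)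
    also have "\<dots> \<le> 4 / (\<epsilon> / 3) * \<tau> * b"
      using sb r \<epsilon> \<tau> unfolding R_def[symmetric] by (intro mult_mono mult_left_mono) auto
    also have "\<dots> \<le> \<eta> / 2"
    proof -
      have "4 / (\<epsilon> / 3) * \<tau> * b = 12 / \<epsilon> * (\<tau> * b)" by simp
      also have "\<dots> \<le> 12 / \<epsilon> * (\<eta> * \<epsilon> / 24)" using \<tau>(3) \<epsilon> by (intro mult_left_mono) auto
      also have "\<dots> = \<eta> / 2" using \<epsilon> by simp
      finally show ?thesis .
    qed
    finally show ?case using elim(1) unfolding m_def by linarith
  qed
qed

text \<open>A weak law at the single index k = s n, normed by the number of pairs. It is meant for
  the regime in which s n is bounded from below, where the maximal bounds that rest on s n <= c
  n^kappa are out of reach; the variance ratio n / (s (n - s)) tends to 0 as s tends to infinity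
  with s / n -> 0.\<close>

lemma shift_at_change:
  fixes f :: "real \<times> real \<Rightarrow> real" and \<epsilon> \<eta> :: real and s :: "nat \<Rightarrow> nat"
  assumes f[measurable]: "f \<in> borel_measurable (borel \<Otimes>\<^sub>M borel)" and fi: "integrable (D \<Otimes>\<^sub>M D) f"
    and \<epsilon>: "\<epsilon> > 0" and \<eta>: "\<eta> > 0"
    and s: "\<forall>\<^sub>F n in sequentially. 1 \<le> s n \<and> s n < n" and early: "(\<lambda>n. real (s n) / real n) \<longlonglongrightarrow> 0"
    and large: "filterlim (\<lambda>n. real (s n)) at_top sequentially"
  shows "\<forall>\<^sub>F n in sequentially. prob {\<omega> \<in> space M.
    \<bar>rect_sum f \<xi> {1..s n} {s n<..n} \<omega> - (\<integral>p. f p \<partial>(D \<Otimes>\<^sub>M D)) * mass (s n) n (s n)\<bar> \<ge> \<epsilon> * mass (s n) n (s n)} \<le> \<eta>"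
proof -
  define m where "m = (\<integral>p. f p \<partial>(D \<Otimes>\<^sub>M D))"
  define \<tau> where "\<tau> = min (\<epsilon> / 4) (\<eta> * \<epsilon> / 6)"
  have \<tau>: "\<tau> > 0" "\<tau> \<le> \<epsilon> / 4" "\<tau> \<le> \<eta> * \<epsilon> / 6" using \<epsilon> \<eta> by (auto simp: \<tau>_def)
  obtain K C v where K: "K \<in> borel_measurable (borel \<Otimes>\<^sub>M borel)" and Kb: "\<And>p. \<bar>K p\<bar> \<le> C" and K0: "(\<integral>p. K p \<partial>(D \<Otimes>\<^sub>M D)) = 0"
    and v: "\<bar>v - m\<bar> \<le> \<tau>" and r: "(\<integral>p. \<bar>f p - K p - v\<bar> \<partial>(D \<Otimes>\<^sub>M D)) \<le> \<tau>"
    using truncation[OF f fi \<tau>(1)] unfolding m_def by blast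
  note [measurable] = K
  define R where "R p = \<bar>f p - K p - v\<bar>" for p
  have Rm[measurable]: "R \<in> borel_measurable (borel \<Otimes>\<^sub>M borel)" unfolding R_def by measurable
  have Ki: "integrable (D \<Otimes>\<^sub>M D) K"
    by (rule DD.integrable_const_bound[where B=C]) (use Kb in auto)
  have Ri: "integrable (D \<Otimes>\<^sub>M D) R" unfolding R_def using fi Ki by auto
  have "(\<lambda>n. 9 * C\<^sup>2 / \<epsilon>\<^sup>2 / (1 - real (s n) / n) / real (s n)) \<longlonglongrightarrow> 0"
  proof (rule tendsto_divide_0)
    have "(\<lambda>n. 9 * C\<^sup>2 / \<epsilon>\<^sup>2 / (1 - real (s n) / n)) \<longlonglongrightarrow> 9 * C\<^sup>2 / \<epsilon>\<^sup>2 / (1 - 0)"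
      by (intro tendsto_intros early) auto
    then show "(\<lambda>n. 9 * C\<^sup>2 / \<epsilon>\<^sup>2 / (1 - real (s n) / n)) \<longlonglongrightarrow> 9 * C\<^sup>2 / \<epsilon>\<^sup>2" by simp
    show "filterlim (\<lambda>n. real (s n)) at_infinity sequentially" by (rule filterlim_at_top_imp_at_infinity[OF large])
  qed
  then have "\<forall>\<^sub>F n in sequentially. 9 * C\<^sup>2 / \<epsilon>\<^sup>2 / (1 - real (s n) / n) / real (s n) < \<eta> / 2"
    using \<eta> by (intro order_tendstoD) auto
  then show ?thesis using s
  proof eventually_elim
    case (elim n)
    have sn: "real (s n) > 0" "real (n - s n) > 0" "real n > 0" using elim by auto
    define ms where "ms = mass (s n) n (s n)"
    have ms: "ms = real (s n) * real (n - s n)" "ms > 0" using sn by (auto simp: ms_def mass_def)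
    let ?I = "{1..s n}" and ?J = "{s n<..n}"
    let ?E = "{\<omega> \<in> space M. \<bar>rect_sum K \<xi> ?I ?J \<omega>\<bar> \<ge> \<epsilon> / 3 * ms}"
    let ?F = "{\<omega> \<in> space M. rect_sum R \<xi> ?I ?J \<omega> \<ge> \<epsilon> / 3 * ms}"
    have [measurable]: "rect_sum K \<xi> ?I ?J \<in> borel_measurable M" "rect_sum R \<xi> ?I ?J \<in> borel_measurable M"
      by (intro rect_sum_measurable K Rm; auto)+
    have m1: "?E \<in> sets M" "?F \<in> sets M" by measurable
    have ms3: "\<epsilon> / 3 * ms > 0" using \<epsilon> ms(2) by simp
    have pE: "prob ?E \<le> \<eta> / 2"
    proof -
      have I: "finite ?I" "finite ?J" "?I \<subseteq> {1..}" "?J \<subseteq> {1..}" "?I \<inter> ?J = {}" by auto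
      note bs = bounded_second_moment[OF K Kb K0 I, folded rect_sum_def]
      have "prob ?E \<le> C\<^sup>2 * (card ?I * card ?J * (card ?I + card ?J)) / (\<epsilon> / 3 * ms)\<^sup>2"
        by (rule chebyshev_second_moment[OF rect_sum_measurable[OF K I(3,4)] bs(1) ms3 bs(2)])
      also have "\<dots> = C\<^sup>2 * (ms * n) / (\<epsilon> / 3 * ms)\<^sup>2" using elim by (simp add: ms of_nat_add[symmetric])
      also have "\<dots> = 9 * C\<^sup>2 / \<epsilon>\<^sup>2 * (n / ms)" using ms(2) \<epsilon> by (simp add: power_mult_distrib power_divide power2_eq_square mult_ac)
      also have "real n / ms = 1 / (1 - real (s n) / n) / real (s n)"
        unfolding ms using sn elim by (simp add: of_nat_diff field_simps)
      finally show ?thesis using elim(1) by simp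
    qed
    have pF: "prob ?F \<le> \<eta> / 2"
    proof -
      have ij: "integrable M (\<lambda>\<omega>. R (\<xi> j \<omega>, \<xi> i \<omega>))" "expectation (\<lambda>\<omega>. R (\<xi> j \<omega>, \<xi> i \<omega>)) = (\<integral>p. R p \<partial>(D \<Otimes>\<^sub>M D))"
        if "i \<in> ?I" "j \<in> ?J" for i j
        using that kernel_expectation[of i j R] Ri by auto
      have i: "integrable M (rect_sum R \<xi> ?I ?J)" unfolding rect_sum_def by (intro Bochner_Integration.integrable_sum ij(1))
      have "expectation (rect_sum R \<xi> ?I ?J) = (\<Sum>i\<in>?I. expectation (\<lambda>\<omega>. \<Sum>j\<in>?J. R (\<xi> j \<omega>, \<xi> i \<omega>)))"
        unfolding rect_sum_def by (intro Bochner_Integration.integral_sum Bochner_Integration.integrable_sum ij(1))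
      also have "\<dots> = (\<Sum>i\<in>?I. \<Sum>j\<in>?J. expectation (\<lambda>\<omega>. R (\<xi> j \<omega>, \<xi> i \<omega>)))"
        by (intro sum.cong refl Bochner_Integration.integral_sum ij(1))
      also have "\<dots> = (\<Sum>i\<in>?I. \<Sum>j\<in>?J. (\<integral>p. R p \<partial>(D \<Otimes>\<^sub>M D)))" by (intro sum.cong refl ij(2))
      also have "\<dots> = ms * (\<integral>p. R p \<partial>(D \<Otimes>\<^sub>M D))" by (simp add: ms)
      also have "\<dots> \<le> ms * \<tau>" using r ms(2) unfolding R_def[symmetric] by (intro mult_left_mono) auto
      finally have E: "expectation (rect_sum R \<xi> ?I ?J) \<le> ms * \<tau>" .
      have "prob ?F \<le> expectation (rect_sum R \<xi> ?I ?J) / (\<epsilon> / 3 * ms)"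
        using ms3 by (intro integral_Markov_inequality_measure[OF i, of "{}"])
          (auto simp: rect_sum_def R_def intro!: sum_nonneg)
      also have "\<dots> \<le> ms * \<tau> / (\<epsilon> / 3 * ms)" using E ms3 by (intro divide_right_mono) auto
      also have "\<dots> = 3 / \<epsilon> * \<tau>" using ms(2) by simp
      also have "\<dots> \<le> 3 / \<epsilon> * (\<eta> * \<epsilon> / 6)" using \<tau>(3) \<epsilon> by (intro mult_left_mono) auto
      also have "\<dots> = \<eta> / 2" using \<epsilon> by simp
      finally show ?thesis .
    qed
    have "prob {\<omega> \<in> space M. \<bar>rect_sum f \<xi> ?I ?J \<omega> - m * ms\<bar> \<ge> \<epsilon> * ms} \<le> prob (?E \<union> ?F)"
    proof (rule finite_measure_mono)
      show "{\<omega> \<in> space M. \<bar>rect_sum f \<xi> ?I ?J \<omega> - m * ms\<bar> \<ge> \<epsilon> * ms} \<subseteq> ?E \<union> ?F"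
      proof (rule subsetI, rule ccontr)
        fix \<omega> assume "\<omega> \<in> {\<omega> \<in> space M. \<bar>rect_sum f \<xi> ?I ?J \<omega> - m * ms\<bar> \<ge> \<epsilon> * ms}" and no: "\<omega> \<notin> ?E \<union> ?F"
        then have w: "\<omega> \<in> space M" and le: "\<bar>rect_sum f \<xi> ?I ?J \<omega> - m * ms\<bar> \<ge> \<epsilon> * ms" by auto
        have 1: "\<not> \<bar>rect_sum K \<xi> ?I ?J \<omega>\<bar> \<ge> \<epsilon> / 3 * ms" using no w by blast
        have 2: "\<not> rect_sum R \<xi> ?I ?J \<omega> \<ge> \<epsilon> / 3 * ms" using no w by blast
        have m0: "ms \<ge> 0" using ms(2) by simp
        have "\<bar>v * ms - m * ms\<bar> = \<bar>v - m\<bar> * ms"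
          unfolding left_diff_distrib[symmetric] abs_mult abs_of_nonneg[OF m0] ..
        also have "\<dots> \<le> \<epsilon> / 4 * ms" using v \<tau> m0 by (intro mult_right_mono) auto
        finally have 3: "\<bar>v * ms - m * ms\<bar> \<le> \<epsilon> / 4 * ms" .
        have 4: "\<bar>rect_sum (\<lambda>p. f p - K p - v) \<xi> ?I ?J \<omega>\<bar> \<le> rect_sum R \<xi> ?I ?J \<omega>"
          using rect_sum_abs_le[of "\<lambda>p. f p - K p - v"] unfolding R_def .
        have cs: "rect_sum (\<lambda>_. v) \<xi> ?I ?J \<omega> = v * ms"
          using rect_sum_const[of v \<xi> "s n" "s n" n \<omega>] by (simp add: ms_def)
        have d: "rect_sum f \<xi> ?I ?J \<omega> - m * ms = rect_sum K \<xi> ?I ?J \<omega> + (v * ms - m * ms) + rect_sum (\<lambda>p. f p - K p - v) \<xi> ?I ?J \<omega>"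
          using rect_sum_decompose[of f ?I ?J \<omega> K v] unfolding cs by linarith
        have "\<epsilon> * ms / 3 \<le> rect_sum R \<xi> ?I ?J \<omega>"
          by (rule three_term_excess[OF le[unfolded d] _ _ 4]) (use 1 3 \<epsilon> ms(2) in simp_all)
        then show False using 2 by simp
      qed
    qed (use m1 in auto)
    also have "\<dots> \<le> prob ?E + prob ?F" by (rule measure_Un_le[OF m1])
    finally show ?case using pE pF unfolding m_def ms_def by linarith
  qed
qed

end

section \<open>The change-point model\<close>

locale odd_kernel = iid_sample M \<xi> D for M :: "'a measure" and \<xi> :: "nat \<Rightarrow> 'a \<Rightarrow> real" and D :: "real measure" +
  fixes g :: "real \<Rightarrow> real"
  assumes g_measurable[measurable]: "g \<in> borel_measurable borel"
    and g_odd: "\<And>x. g (- x) = - g x"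
    and g_square: "integrable (D \<Otimes>\<^sub>M D) (\<lambda>p. (g (fst p - snd p))\<^sup>2)"
begin

definition score :: "real \<Rightarrow> real" where "score x = (\<integral>y. g (y - x) \<partial>D)"

lemma g_integrable: "integrable (D \<Otimes>\<^sub>M D) (\<lambda>p. g (fst p - snd p))"
  by (rule DD.square_integrable_imp_integrable[OF _ g_square]) measurable

lemma g_flip: "g (y - x) = - g (x - y)"
  using g_odd[of "x - y"] by simp

text \<open>Exchanging the two independent copies reverses the sign of the odd kernel; hence the
  centring constant in \<open>g1\<close> vanishes.\<close>

lemma g_mean_zero: "(\<integral>p. g (fst p - snd p) \<partial>(D \<Otimes>\<^sub>M D)) = 0"
proof -
  have "(\<integral>p. g (fst p - snd p) \<partial>(D \<Otimes>\<^sub>M D)) = (\<integral>(x, y). g (y - x) \<partial>(D \<Otimes>\<^sub>M D))"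
    using DD.integral_product_swap[of "\<lambda>p. g (fst p - snd p)"] g_integrable by (simp add: case_prod_unfold)
  also have "\<dots> = (\<integral>p. - g (fst p - snd p) \<partial>(D \<Otimes>\<^sub>M D))"
    by (simp add: case_prod_unfold g_flip[of "snd _"])
  finally show ?thesis by simp
qed

lemma g1_eq_score: "g1 D g = score"
  by (rule ext) (simp add: g1_def score_def g_mean_zero)

lemma score_measurable[measurable]: "score \<in> borel_measurable borel"
proof -
  have "(\<lambda>x. \<integral>y. g (y - x) \<partial>D) \<in> borel_measurable borel"
    by (rule D.borel_measurable_lebesgue_integral) measurable
  then show ?thesis unfolding score_def[abs_def] .
qed

lemma AE_g_integrable: "AE x in D. integrable D (\<lambda>y. g (y - x))"
proof -
  have "integrable (D \<Otimes>\<^sub>M D) (\<lambda>(y, x). g (y - x))" using g_integrable by (simp add: case_prod_unfold)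
  from DD.AE_integrable_snd[OF this] show ?thesis by simp
qed

lemma score_flip: "(\<integral>x. g (y - x) \<partial>D) = - score y"
  unfolding score_def by (subst g_flip) simp

lemma score_mean: "(\<integral>x. score x \<partial>D) = 0"
  using DD.integral_snd[of "\<lambda>y x. g (y - x)"] g_integrable g_mean_zero
  by (simp add: score_def[abs_def] case_prod_unfold)

text \<open>Degenerate part of the Hoeffding decomposition. By oddness the second projection of the
  kernel is the negative of the first, whence the opposite signs of the two scores.\<close>

definition remainder :: "real \<times> real \<Rightarrow> real" where
  "remainder p = g (fst p - snd p) - score (snd p) + score (fst p)"

lemma remainder_measurable[measurable]: "remainder \<in> borel_measurable (borel \<Otimes>\<^sub>M borel)"
  unfolding remainder_def[abs_def] by measurable

lemma remainder_square:
  assumes sq: "integrable D (\<lambda>x. (score x)\<^sup>2)"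
  shows "integrable (D \<Otimes>\<^sub>M D) (\<lambda>p. (remainder p)\<^sup>2)"
proof -
  have M: "integrable M (\<lambda>\<omega>. (score (\<xi> i \<omega>))\<^sup>2)" if "i \<ge> 1" for i
    using one_variable_expectation(2)[of i "\<lambda>x. (score x)\<^sup>2"] sq that by simp
  have 1: "integrable (D \<Otimes>\<^sub>M D) (\<lambda>p. (score (snd p))\<^sup>2)"
    using kernel_expectation(2)[of 1 2 "\<lambda>p. (score (snd p))\<^sup>2"] M[of 1] by simp
  have 2: "integrable (D \<Otimes>\<^sub>M D) (\<lambda>p. (score (fst p))\<^sup>2)"
    using kernel_expectation(2)[of 1 2 "\<lambda>p. (score (fst p))\<^sup>2"] M[of 2] by simp
  have "integrable (D \<Otimes>\<^sub>M D) (\<lambda>p. (g (fst p - snd p) + - score (snd p))\<^sup>2)"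
    by (rule integrable_square_add[where f="\<lambda>p. g (fst p - snd p)" and g="\<lambda>p. - score (snd p)"])
      (use g_square 1 in auto)
  then have "integrable (D \<Otimes>\<^sub>M D) (\<lambda>p. ((g (fst p - snd p) + - score (snd p)) + score (fst p))\<^sup>2)"
    by (intro integrable_square_add[where f="\<lambda>p. g (fst p - snd p) + - score (snd p)" and g="\<lambda>p. score (fst p)"])
      (use 2 in auto)
  then show ?thesis by (simp add: remainder_def)
qed

text \<open>Integrating out one argument of g gives plus or minus the score of the other, which
  cancels the score subtracted or added, while the integrated score has mean zero. Only almost every
  slice of g is known to be integrable, hence the exceptional null sets.\<close>

lemma remainder_degenerate:
  assumes sq: "integrable D (\<lambda>x. (score x)\<^sup>2)"
  shows "AE y in D. (\<integral>x. remainder (y, x) \<partial>D) = 0" and "AE x in D. (\<integral>y. remainder (y, x) \<partial>D) = 0"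
proof -
  have si: "integrable D score" by (rule D.square_integrable_imp_integrable[OF _ sq]) simp
  show "AE x in D. (\<integral>y. remainder (y, x) \<partial>D) = 0"
    using AE_g_integrable
  proof eventually_elim
    case (elim x)
    have "(\<integral>y. remainder (y, x) \<partial>D) = (\<integral>y. g (y - x) \<partial>D) - score x + (\<integral>y. score y \<partial>D)"
      using elim si D.prob_space by (simp add: remainder_def)
    then show ?case unfolding score_mean by (simp add: score_def)
  qed
  show "AE y in D. (\<integral>x. remainder (y, x) \<partial>D) = 0"
    using AE_g_integrable
  proof eventually_elim
    case (elim y)
    then have i: "integrable D (\<lambda>x. g (y - x))" by (subst g_flip) simp
    have "(\<integral>x. remainder (y, x) \<partial>D) = (\<integral>x. g (y - x) \<partial>D) - (\<integral>x. score x \<partial>D) + score y"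
      using i si D.prob_space by (simp add: remainder_def)
    then show ?case unfolding score_mean score_flip by simp
  qed
qed

end

section \<open>The observed statistic and its three parts\<close>

locale change_point = score_bridge M \<xi> D "g1 D g" \<sigma> N W + odd_kernel M \<xi> D g
  for M :: "'a measure" and \<xi> :: "nat \<Rightarrow> 'a \<Rightarrow> real" and D :: "real measure" and g :: "real \<Rightarrow> real" and \<sigma> :: real
    and N :: "'b measure" and W :: "real \<Rightarrow> 'b \<Rightarrow> real" +
  fixes s :: "nat \<Rightarrow> nat" and \<mu> \<Delta> \<gamma> \<kappa> \<alpha> q :: real
  assumes gamma: "0 < \<gamma>" "\<gamma> < 1 / 2"
    and kappa: "\<kappa> = (1 - 2 * \<gamma>) / (2 * (1 - \<gamma>))"
    and u_exists: "integrable (D \<Otimes>\<^sub>M D) (\<lambda>p. g (fst p - snd p + \<Delta>))"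
    and u_pos: "u D g \<Delta> > 0"
    and s_range: "\<And>n. n \<ge> 2 \<Longrightarrow> s n \<in> {1..n - 1}"
    and s_early: "(\<lambda>n. real (s n) / real n) \<longlonglongrightarrow> 0"
    and q_pos: "q > 0"
    and q_level: "B.prob {\<omega> \<in> space N. \<forall>t\<in>rat01. \<bar>B.Z \<sigma> \<gamma> t \<omega>\<bar> \<le> q} = 1 - \<alpha>"
begin

definition shift :: "real \<times> real \<Rightarrow> real" where
  "shift p = g (fst p - snd p + \<Delta>) - g (fst p - snd p)"

lemma shift_measurable[measurable]: "shift \<in> borel_measurable (borel \<Otimes>\<^sub>M borel)"
  unfolding shift_def[abs_def] by measurable

lemma shift_integrable: "integrable (D \<Otimes>\<^sub>M D) shift"
  unfolding shift_def[abs_def] using u_exists g_integrable by auto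

lemma shift_mean: "(\<integral>p. shift p \<partial>(D \<Otimes>\<^sub>M D)) = u D g \<Delta>"
  by (simp add: shift_def u_def)

lemma score_square: "integrable D (\<lambda>x. (score x)\<^sup>2)"
  using h_square unfolding g1_eq_score .

lemma kappa_mult: "\<kappa> * (1 - \<gamma>) = 1 / 2 - \<gamma>"
  using gamma by (simp add: kappa field_simps)

lemma kappa_bounds: "0 < \<kappa>" "\<kappa> < 1 / 2"
  using gamma by (auto simp: kappa divide_less_eq less_divide_eq)

lemma ev_s_range: "\<forall>\<^sub>F n in sequentially. 1 \<le> s n \<and> s n < n"
  using eventually_ge_at_top[of 2]
proof eventually_elim
  case (elim n)
  then show ?case using s_range[OF elim] by auto
qed

definition G :: "nat \<Rightarrow> nat \<Rightarrow> 'a \<Rightarrow> real" where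
  "G n k \<omega> = G_stat g \<gamma> n (\<lambda>i. observation \<mu> \<Delta> (s n) \<xi> i \<omega>) k"

definition U :: "nat \<Rightarrow> nat \<Rightarrow> 'a \<Rightarrow> real" where
  "U n k = rect_sum remainder \<xi> {1..k} {k<..n}"

definition V :: "nat \<Rightarrow> nat \<Rightarrow> 'a \<Rightarrow> real" where
  "V n k = rect_sum shift \<xi> {1..min k (s n)} {max k (s n)<..n}"

lemma U_measurable[measurable]: "U n k \<in> borel_measurable M"
  unfolding U_def by (rule rect_sum_measurable) auto

lemma V_measurable[measurable]: "V n k \<in> borel_measurable M"
  unfolding V_def by (rule rect_sum_measurable) auto

text \<open>For i <= k < j the jump enters the difference of observations exactly if i <= s n < j,
  and these pairs form the rectangle {1..min k (s n)} x {max k (s n)<..n}; the level mu cancels. The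
  linear part is n times the tied-down sum, and n sqrt n = n^(3/2) matches the norming.\<close>

lemma G_decomposition:
  assumes k: "k \<in> {1..<n}"
  shows "nrm \<gamma> n k * G n k \<omega> = nrm \<gamma> n k * A \<gamma> n k \<omega> + U n k \<omega> + V n k \<omega>"
proof -
  have n: "real n > 0" using k by simp
  have w: "nrm \<gamma> n k > 0" by (rule nrm_pos[OF k])
  let ?X = "\<lambda>i. observation \<mu> \<Delta> (s n) \<xi> i \<omega>"
  have nG: "nrm \<gamma> n k * G n k \<omega> = (\<Sum>i\<in>{1..k}. \<Sum>j\<in>{k<..n}. g (?X j - ?X i))"
  proof -
    have "{k + 1..n} = {k<..n}" by auto
    then have "G n k \<omega> = 1 / nrm \<gamma> n k * (\<Sum>i\<in>{1..k}. \<Sum>j\<in>{k<..n}. g (?X j - ?X i))"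
      by (simp add: G_def G_stat_def nrm_def wgt_def)
    then show ?thesis using w by simp
  qed
  have Ye: "Y i \<omega> = score (\<xi> i \<omega>)" for i
    unfolding Y_def unfolding g1_eq_score ..
  have summand: "g (?X j - ?X i) = (Y i \<omega> - Y j \<omega>) + remainder (\<xi> j \<omega>, \<xi> i \<omega>) + (if i \<le> s n \<and> s n < j then shift (\<xi> j \<omega>, \<xi> i \<omega>) else 0)"
    if "i \<in> {1..k}" "j \<in> {k<..n}" for i j
  proof -
    have "?X j - ?X i = \<xi> j \<omega> - \<xi> i \<omega> + (if i \<le> s n \<and> s n < j then \<Delta> else 0)"
      using that by (auto simp: observation_def)
    then show ?thesis by (simp add: shift_def remainder_def Ye)
  qed
  have S: "(\<Sum>i\<in>{1..k}. \<Sum>j\<in>{k<..n}. Y i \<omega> - Y j \<omega>) = n * tied_down Y n k \<omega>"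
  proof -
    have "partial_sum Y n \<omega> = partial_sum Y k \<omega> + (\<Sum>j\<in>{k<..n}. Y j \<omega>)"
      unfolding partial_sum_def by (subst sum.union_disjoint[symmetric]) (use k in \<open>auto intro!: sum.cong\<close>)
    moreover have "(\<Sum>i\<in>{1..k}. \<Sum>j\<in>{k<..n}. Y i \<omega> - Y j \<omega>) = real (n - k) * partial_sum Y k \<omega> - real k * (\<Sum>j\<in>{k<..n}. Y j \<omega>)"
      by (simp add: sum_subtractf partial_sum_def sum_distrib_left)
    ultimately show ?thesis using k n by (simp add: tied_down_def of_nat_diff algebra_simps)
  qed
  have "n * tied_down Y n k \<omega> = nrm \<gamma> n k * A \<gamma> n k \<omega>"
  proof -
    have "real n powr (3 / 2) = n * sqrt n"
      using n powr_add[of "real n" 1 "1 / 2"] by (simp add: powr_half_sqrt)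
    then show ?thesis using A_eq[OF k, of \<gamma> \<omega>] by (simp add: nrm_def mult_ac)
  qed
  moreover have "(\<Sum>i\<in>{1..k}. \<Sum>j\<in>{k<..n}. if i \<le> s n \<and> s n < j then shift (\<xi> j \<omega>, \<xi> i \<omega>) else 0) = V n k \<omega>"
  proof -
    have "V n k \<omega> = (\<Sum>i\<in>{1..min k (s n)}. \<Sum>j\<in>{k<..n}. if i \<le> s n \<and> s n < j then shift (\<xi> j \<omega>, \<xi> i \<omega>) else 0)"
      unfolding V_def rect_sum_def by (intro sum.cong refl sum.mono_neutral_cong_left) auto
    also have "\<dots> = (\<Sum>i\<in>{1..k}. \<Sum>j\<in>{k<..n}. if i \<le> s n \<and> s n < j then shift (\<xi> j \<omega>, \<xi> i \<omega>) else 0)"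
      by (rule sum.mono_neutral_left) auto
    finally show ?thesis by simp
  qed
  moreover have "(\<Sum>i\<in>{1..k}. \<Sum>j\<in>{k<..n}. remainder (\<xi> j \<omega>, \<xi> i \<omega>)) = U n k \<omega>" by (simp add: U_def rect_sum_def)
  moreover have "(\<Sum>i\<in>{1..k}. \<Sum>j\<in>{k<..n}. g (?X j - ?X i)) = (\<Sum>i\<in>{1..k}. \<Sum>j\<in>{k<..n}. Y i \<omega> - Y j \<omega>) +
      (\<Sum>i\<in>{1..k}. \<Sum>j\<in>{k<..n}. remainder (\<xi> j \<omega>, \<xi> i \<omega>)) +
      (\<Sum>i\<in>{1..k}. \<Sum>j\<in>{k<..n}. if i \<le> s n \<and> s n < j then shift (\<xi> j \<omega>, \<xi> i \<omega>) else 0)"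
    unfolding sum.distrib[symmetric] by (intro sum.cong refl summand)
  ultimately show ?thesis unfolding nG S by simp
qed

lemma G_measurable[measurable]: "k \<in> {1..<n} \<Longrightarrow> G n k \<in> borel_measurable M"
proof -
  assume k: "k \<in> {1..<n}"
  have "G n k \<omega> = (nrm \<gamma> n k * A \<gamma> n k \<omega> + U n k \<omega> + V n k \<omega>) / nrm \<gamma> n k" for \<omega>
    using G_decomposition[OF k, of \<omega>] nrm_pos[OF k, of \<gamma>] by (simp add: field_simps)
  then have "G n k = (\<lambda>\<omega>. (nrm \<gamma> n k * A \<gamma> n k \<omega> + U n k \<omega> + V n k \<omega>) / nrm \<gamma> n k)" by (rule ext)
  then show ?thesis by simp
qed

definition power :: "nat \<Rightarrow> real" where
  "power n = rejection_prob M (observation \<mu> \<Delta> (s n) \<xi>) g \<gamma> q n"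

lemma power_eq:
  assumes "n \<ge> 2"
  shows "power n = prob {\<omega> \<in> space M. \<exists>k\<in>{1..<n}. \<bar>G n k \<omega>\<bar> > q}"
    and "{\<omega> \<in> space M. \<exists>k\<in>{1..<n}. \<bar>G n k \<omega>\<bar> > q} \<in> sets M"
proof -
  have "{1..<n} \<noteq> {}" using assms by simp
  then have "Max ((\<lambda>k. \<bar>G n k \<omega>\<bar>) ` {1..<n}) > q \<longleftrightarrow> (\<exists>k\<in>{1..<n}. \<bar>G n k \<omega>\<bar> > q)" for \<omega>
    by (subst Max_gr_iff) auto
  then show "power n = prob {\<omega> \<in> space M. \<exists>k\<in>{1..<n}. \<bar>G n k \<omega>\<bar> > q}"
    by (simp add: power_def rejection_prob_def G_def)
  have "{\<omega> \<in> space M. \<exists>k\<in>{1..<n}. \<bar>G n k \<omega>\<bar> > q} = (\<Union>k\<in>{1..<n}. {\<omega> \<in> space M. \<bar>G n k \<omega>\<bar> > q})" by auto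
  moreover have "{\<omega> \<in> space M. \<bar>G n k \<omega>\<bar> > q} \<in> sets M" if "k \<in> {1..<n}" for k
    using G_measurable[OF that] by measurable
  ultimately show "{\<omega> \<in> space M. \<exists>k\<in>{1..<n}. \<bar>G n k \<omega>\<bar> > q} \<in> sets M" by auto
qed

lemma U_negligible:
  assumes "\<epsilon> > 0" "\<eta> > 0"
  shows "\<forall>\<^sub>F n in sequentially. prob {\<omega> \<in> space M. \<exists>k\<in>{1..<n}. \<bar>U n k \<omega>\<bar> \<ge> \<epsilon> * nrm \<gamma> n k} \<le> \<eta>"
  unfolding U_def
  by (rule degenerate_negligible[OF remainder_measurable remainder_square[OF score_square] remainder_degenerate[OF score_square] gamma assms])

lemma A_ends_negligible:
  assumes \<epsilon>: "\<epsilon> > 0" and \<eta>: "\<eta> > 0"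
  shows "\<exists>\<delta>>0. \<delta> < 1 / 2 \<and> (\<forall>n\<ge>1. prob {\<omega> \<in> space M. \<exists>k\<in>{1..<n}. (real k \<le> \<delta> * n \<or> real n - k \<le> \<delta> * n) \<and> \<bar>A \<gamma> n k \<omega>\<bar> \<ge> \<epsilon>} \<le> \<eta>)"
proof -
  have "2 powr (1 - 2 * \<gamma>) > 1" using gamma by simp
  then have C0: "end_const \<gamma> \<ge> 0" by (simp add: end_const_def)
  obtain \<delta> where \<delta>: "0 < \<delta>" "\<delta> \<le> 1 / 3" "8 * end_const \<gamma> * \<sigma>\<^sup>2 / \<epsilon>\<^sup>2 * \<delta> powr (1 - 2 * \<gamma>) \<le> \<eta>"
    using small_powr[of "1 - 2 * \<gamma>" "8 * end_const \<gamma> * \<sigma>\<^sup>2 / \<epsilon>\<^sup>2" \<eta> "1 / 3"] gamma C0 \<eta> by auto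
  have "prob {\<omega> \<in> space M. \<exists>k\<in>{1..<n}. (real k \<le> \<delta> * n \<or> real n - k \<le> \<delta> * n) \<and> \<bar>A \<gamma> n k \<omega>\<bar> \<ge> \<epsilon>} \<le> \<eta>" if "n \<ge> 1" for n
    using A_ends[OF that gamma \<delta>(1) _ \<epsilon>] \<delta> by simp
  then show ?thesis using \<delta> by (intro exI[of _ \<delta>]) auto
qed

lemma q_continuity:
  assumes "\<eta> > 0"
  shows "\<exists>q'. 0 \<le> q' \<and> q' < q \<and> 1 - \<alpha> \<le> B.prob {\<omega> \<in> space N. \<forall>t\<in>rat01. \<bar>B.Z \<sigma> \<gamma> t \<omega>\<bar> \<le> q'} + \<eta>"
  using B.no_atom[OF sigma_pos q_pos assms Z_ends[OF gamma]] unfolding q_level by blast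

text \<open>Above the boundary the statistic exceeds the critical value already at the change-point.\<close>

lemma consistent:
  assumes c: "\<forall>\<^sub>F n in sequentially. c * real n powr \<kappa> \<le> real (s n)" "c > 0" "u D g \<Delta> * c powr (1 - \<gamma>) > q"
  shows "power \<longlonglongrightarrow> 1"
proof -
  define m where "m = u D g \<Delta>"
  define b where "b = c powr (1 - \<gamma>)"
  have b: "b > 0" using c by (simp add: b_def)
  have mb: "m * b > q" "m > 0" using c(3) u_pos by (auto simp: m_def b_def)
  \<comment> \<open>The excess over q is spent in five parts: the error epsilon of the mean jump,
    the factor (1 - s/n)^(1 - gamma), the remainder U, the linear part A, and one part that keeps
    the inequality strict.\<close>
  define \<theta> where "\<theta> = (m * b - q) / 5"
  have \<theta>: "\<theta> > 0" using mb by (simp add: \<theta>_def)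
  define \<epsilon> where "\<epsilon> = min (m / 2) (\<theta> / b)"
  have \<epsilon>: "\<epsilon> > 0" "\<epsilon> < m" "\<epsilon> * b \<le> \<theta>"
  proof -
    show "\<epsilon> > 0" "\<epsilon> < m" using mb \<theta> b by (auto simp: \<epsilon>_def)
    have "\<epsilon> * b \<le> \<theta> / b * b" using b by (intro mult_right_mono) (auto simp: \<epsilon>_def)
    then show "\<epsilon> * b \<le> \<theta>" using b by simp
  qed
  have mb4: "(m - \<epsilon>) * b \<ge> q + 4 * \<theta>" 
  proof -
    have "5 * \<theta> = m * b - q" by (simp add: \<theta>_def)
    then show ?thesis using \<epsilon>(3) unfolding left_diff_distrib by linarith
  qed
  \<comment> \<open>As kappa > 0, the lower bound c n^kappa drives the change-point to infinity,
    which the weak law \<open>shift_at_change\<close> requires.\<close>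
  have large: "filterlim (\<lambda>n. real (s n)) at_top sequentially"
  proof (rule filterlim_at_top_mono[OF _ c(1)])
    show "filterlim (\<lambda>n. c * real n powr \<kappa>) at_top sequentially"
      using c(2) kappa_bounds(1) by real_asymp
  qed
  have "(\<lambda>n. (m - \<epsilon>) * b * (1 - real (s n) / n) powr (1 - \<gamma>)) \<longlonglongrightarrow> (m - \<epsilon>) * b * (1 - 0) powr (1 - \<gamma>)"
    by (intro tendsto_intros s_early) auto
  then have ev1: "\<forall>\<^sub>F n in sequentially. (m - \<epsilon>) * b * (1 - real (s n) / n) powr (1 - \<gamma>) > q + 3 * \<theta>"
    using mb4 \<theta> by (intro order_tendstoD) auto
  have lower: "\<forall>\<^sub>F n in sequentially. 1 - \<eta> \<le> power n" if \<eta>: "\<eta> > 0" for \<eta>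
  proof -
    have \<eta>3: "\<eta> / 3 > 0" using \<eta> by simp
    \<comment> \<open>Since s n / n tends to 0, the change-point eventually lies in the end range,
      where the linear part stays below theta.\<close>
    obtain \<delta> where \<delta>: "\<delta> > 0" "\<delta> < 1 / 2" "\<And>n. n \<ge> 1 \<Longrightarrow> prob {\<omega> \<in> space M. \<exists>k\<in>{1..<n}. (real k \<le> \<delta> * n \<or> real n - k \<le> \<delta> * n) \<and> \<bar>A \<gamma> n k \<omega>\<bar> \<ge> \<theta>} \<le> \<eta> / 3"
      using A_ends_negligible[OF \<theta> \<eta>3] by blast
    have "\<forall>\<^sub>F n in sequentially. real (s n) / real n < \<delta>" using s_early \<delta>(1) by (rule order_tendstoD)
    then show ?thesis
      using U_negligible[OF \<theta> \<eta>3] shift_at_change[OF shift_measurable shift_integrable \<epsilon>(1) \<eta>3 ev_s_range s_early large]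
        ev1 ev_s_range c(1) eventually_ge_at_top[of 2]
    proof eventually_elim
      case (elim n)
      have sn: "1 \<le> s n" "s n < n" and n: "real n > 0" "n \<ge> 1" using elim by auto
      have k: "s n \<in> {1..<n}" using sn by auto
      let ?E = "{\<omega> \<in> space M. \<exists>k\<in>{1..<n}. \<bar>U n k \<omega>\<bar> \<ge> \<theta> * nrm \<gamma> n k}"
      let ?F = "{\<omega> \<in> space M. \<bar>rect_sum shift \<xi> {1..s n} {s n<..n} \<omega> - (\<integral>p. shift p \<partial>(D \<Otimes>\<^sub>M D)) * mass (s n) n (s n)\<bar> \<ge> \<epsilon> * mass (s n) n (s n)}"
      let ?H = "{\<omega> \<in> space M. \<exists>k\<in>{1..<n}. (real k \<le> \<delta> * n \<or> real n - k \<le> \<delta> * n) \<and> \<bar>A \<gamma> n k \<omega>\<bar> \<ge> \<theta>}"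
      let ?R = "{\<omega> \<in> space M. \<exists>k\<in>{1..<n}. \<bar>G n k \<omega>\<bar> > q}"
      have [measurable]: "rect_sum shift \<xi> {1..s n} {s n<..n} \<in> borel_measurable M" by (rule rect_sum_measurable) auto
      have m1: "?E \<in> sets M" "?F \<in> sets M" "?H \<in> sets M" by measurable
      have sub: "space M - (?E \<union> (?F \<union> ?H)) \<subseteq> ?R"
      proof
        fix \<omega> assume "\<omega> \<in> space M - (?E \<union> (?F \<union> ?H))"
        then have w: "\<omega> \<in> space M" and no: "\<omega> \<notin> ?E" "\<omega> \<notin> ?F" "\<omega> \<notin> ?H" by auto
        have N0: "nrm \<gamma> n (s n) > 0" by (rule nrm_pos[OF k])
        have 1: "\<not> \<theta> * nrm \<gamma> n (s n) \<le> \<bar>U n (s n) \<omega>\<bar>" using no(1) w k by blast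
        have "real (s n) \<le> \<delta> * n" using elim(1) n by (simp add: pos_divide_less_eq)
        then have 2: "\<not> \<theta> \<le> \<bar>A \<gamma> n (s n) \<omega>\<bar>" using no(3) w k by blast
        have V: "V n (s n) \<omega> = rect_sum shift \<xi> {1..s n} {s n<..n} \<omega>" by (simp add: V_def)
        have 3: "\<not> \<epsilon> * mass (s n) n (s n) \<le> \<bar>V n (s n) \<omega> - m * mass (s n) n (s n)\<bar>"
          using no(2) w unfolding V shift_mean m_def by blast
        have "V n (s n) \<omega> \<ge> (m - \<epsilon>) * mass (s n) n (s n)" using 3 unfolding left_diff_distrib by linarith
        moreover have "(m - \<epsilon>) * mass (s n) n (s n) \<ge> (q + 3 * \<theta>) * nrm \<gamma> n (s n)"
        proof -
          have "b \<le> real (s n) powr (1 - \<gamma>) * real n powr (\<gamma> - 1 / 2)"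
          proof -
            have "b = b * real n powr (1 / 2 - \<gamma>) * real n powr (\<gamma> - 1 / 2)" using n by (simp add: mult.assoc powr_add[symmetric])
            also have "b * real n powr (1 / 2 - \<gamma>) = (c * real n powr \<kappa>) powr (1 - \<gamma>)"
              using c by (simp add: powr_mult powr_powr b_def kappa_mult)
            also have "\<dots> * real n powr (\<gamma> - 1 / 2) \<le> real (s n) powr (1 - \<gamma>) * real n powr (\<gamma> - 1 / 2)"
              using elim c gamma by (intro mult_right_mono powr_mono2) auto
            finally show ?thesis .
          qed
          then have "(m - \<epsilon>) * (b * (1 - real (s n) / n) powr (1 - \<gamma>) * nrm \<gamma> n (s n)) \<le>
            (m - \<epsilon>) * (real (s n) powr (1 - \<gamma>) * real n powr (\<gamma> - 1 / 2) * (1 - real (s n) / n) powr (1 - \<gamma>) * nrm \<gamma> n (s n))"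
            using \<epsilon> N0 by (intro mult_left_mono mult_right_mono) auto
          also have "\<dots> = (m - \<epsilon>) * mass (s n) n (s n)" unfolding mass_at_change[OF sn, of \<gamma>] ..
          finally have "((m - \<epsilon>) * b * (1 - real (s n) / n) powr (1 - \<gamma>)) * nrm \<gamma> n (s n) \<le> (m - \<epsilon>) * mass (s n) n (s n)"
            by (simp only: mult_ac)
          moreover have "(q + 3 * \<theta>) * nrm \<gamma> n (s n) \<le> ((m - \<epsilon>) * b * (1 - real (s n) / n) powr (1 - \<gamma>)) * nrm \<gamma> n (s n)"
            using elim(4) N0 by (intro mult_right_mono) auto
          ultimately show ?thesis by linarith
        qed
        ultimately have 4: "(q + 3 * \<theta>) * nrm \<gamma> n (s n) \<le> V n (s n) \<omega>" by linarith
        have 5: "- \<theta> * nrm \<gamma> n (s n) \<le> nrm \<gamma> n (s n) * A \<gamma> n (s n) \<omega>"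
        proof -
          have "nrm \<gamma> n (s n) * (- \<theta>) \<le> nrm \<gamma> n (s n) * A \<gamma> n (s n) \<omega>" using 2 N0 by (intro mult_left_mono) linarith+
          then show ?thesis by (simp only: mult.commute)
        qed
        have "(q + \<theta>) * nrm \<gamma> n (s n) \<le> nrm \<gamma> n (s n) * G n (s n) \<omega>"
          unfolding G_decomposition[OF k] using 1 4 5 unfolding distrib_right by linarith
        then have "q + \<theta> \<le> G n (s n) \<omega>" using N0 by (simp only: mult.commute[of "q + \<theta>"] mult_le_cancel_left_pos)
        then have "\<bar>G n (s n) \<omega>\<bar> > q" using \<theta> by linarith
        then show "\<omega> \<in> ?R" using w k by blast
      qed
      have "1 - prob (?E \<union> (?F \<union> ?H)) = prob (space M - (?E \<union> (?F \<union> ?H)))"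
        by (rule prob_compl[symmetric]) (intro sets.Un m1)
      also have "\<dots> \<le> prob ?R" by (rule finite_measure_mono[OF sub power_eq(2)[OF elim(7)]])
      also have "\<dots> = power n" by (rule power_eq(1)[OF elim(7), symmetric])
      finally have "1 - prob (?E \<union> (?F \<union> ?H)) \<le> power n" .
      moreover have "prob (?E \<union> (?F \<union> ?H)) \<le> prob ?E + prob (?F \<union> ?H)"
        by (rule measure_Un_le[OF m1(1)]) (intro sets.Un m1)
      moreover have "prob (?F \<union> ?H) \<le> prob ?F + prob ?H" by (rule measure_Un_le[OF m1(2,3)])
      ultimately show ?case using elim(2,3) \<delta>(3)[OF n(2)] by linarith
    qed
  qed
  show ?thesis
  proof (rule tendstoI)
    fix e :: real assume e: "e > 0"
    have "\<forall>\<^sub>F n in sequentially. 1 - e / 2 \<le> power n" using e by (intro lower) simp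
    then show "\<forall>\<^sub>F n in sequentially. dist (power n) 1 < e"
    proof eventually_elim
      case (elim n)
      have "power n \<le> 1" by (simp add: power_def rejection_prob_def)
      then show ?case using elim e by (simp add: dist_real_def abs_le_iff)
    qed
  qed
qed

end

section \<open>Changes below the boundary\<close>

context change_point
begin

lemma early_shift_bound:
  assumes c: "\<forall>\<^sub>F n in sequentially. real (s n) \<le> c * real n powr \<kappa>" "c > 0"
  shows "\<forall>\<^sub>F n in sequentially. \<forall>k\<in>{1..<n}. mass (s n) n k \<le> c powr (1 - \<gamma>) * nrm \<gamma> n k"
  using c(1) ev_s_range
proof eventually_elim
  case (elim n)
  have n: "real n > 0" using elim by simp
  have sb: "real (s n) powr (1 - \<gamma>) * real n powr (\<gamma> - 1 / 2) \<le> c powr (1 - \<gamma>)"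
  proof -
    have "real (s n) powr (1 - \<gamma>) \<le> (c * real n powr \<kappa>) powr (1 - \<gamma>)" using elim gamma by (intro powr_mono2) auto
    also have "\<dots> = c powr (1 - \<gamma>) * real n powr (1 / 2 - \<gamma>)" using c by (simp add: powr_mult powr_powr kappa_mult)
    finally have "real (s n) powr (1 - \<gamma>) * real n powr (\<gamma> - 1 / 2) \<le> c powr (1 - \<gamma>) * real n powr (1 / 2 - \<gamma>) * real n powr (\<gamma> - 1 / 2)"
      by (intro mult_right_mono) auto
    also have "\<dots> = c powr (1 - \<gamma>)" using n by (simp add: mult.assoc powr_add[symmetric])
    finally show ?thesis .
  qed
  show ?case
  proof
    fix k assume k: "k \<in> {1..<n}"
    have "mass (s n) n k \<le> real (s n) powr (1 - \<gamma>) * real n powr (\<gamma> - 1 / 2) * nrm \<gamma> n k"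
      by (rule mass_le_nrm[OF k _ _ gamma]) (use elim in auto)
    also have "\<dots> \<le> c powr (1 - \<gamma>) * nrm \<gamma> n k" using sb nrm_pos[OF k, of \<gamma>] by (intro mult_right_mono) auto
    finally show "mass (s n) n k \<le> c powr (1 - \<gamma>) * nrm \<gamma> n k" .
  qed
qed

text \<open>At indices k >= delta n the jump is of relative order n^(kappa - 1/2) at most, and kappa
  < 1/2, although near the change-point it can be of order one.\<close>

lemma late_shift_negligible:
  assumes c: "\<forall>\<^sub>F n in sequentially. real (s n) \<le> c * real n powr \<kappa>" "c > 0" and \<delta>: "\<delta> > 0" and \<epsilon>: "\<epsilon> > 0"
  shows "\<forall>\<^sub>F n in sequentially. \<forall>k\<in>{1..<n}. \<delta> * real n \<le> real k \<longrightarrow> u D g \<Delta> * mass (s n) n k \<le> \<epsilon> * nrm \<gamma> n k"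
proof -
  have "(\<lambda>n. u D g \<Delta> * c * \<delta> powr (- \<gamma>) * real n powr (- (1 / 2 - \<kappa>))) \<longlonglongrightarrow> u D g \<Delta> * c * \<delta> powr (- \<gamma>) * 0"
    using kappa_bounds by (intro tendsto_mult tendsto_const tendsto_neg_powr filterlim_real_sequentially) auto
  then have "\<forall>\<^sub>F n in sequentially. u D g \<Delta> * c * \<delta> powr (- \<gamma>) * real n powr (- (1 / 2 - \<kappa>)) < \<epsilon>"
    using \<epsilon> by (intro order_tendstoD) auto
  then show ?thesis using c(1) ev_s_range
  proof eventually_elim
    case (elim n)
    show ?case
    proof (intro ballI impI)
      fix k assume k: "k \<in> {1..<n}" and late: "\<delta> * real n \<le> real k"
      have n: "real n > 0" using k by simp
      have N0: "nrm \<gamma> n k > 0" by (rule nrm_pos[OF k])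
      have "mass (s n) n k \<le> real (s n) * real n powr (- 1 / 2) * \<delta> powr (- \<gamma>) * nrm \<gamma> n k"
        by (rule mass_le_nrm_late[OF k _ _ gamma \<delta> late]) (use elim in auto)
      also have "\<dots> \<le> (c * real n powr \<kappa>) * real n powr (- 1 / 2) * \<delta> powr (- \<gamma>) * nrm \<gamma> n k"
        using elim N0 by (intro mult_right_mono) auto
      also have "\<dots> = c * \<delta> powr (- \<gamma>) * (real n powr \<kappa> * real n powr (- 1 / 2)) * nrm \<gamma> n k"
        by (simp only: mult_ac)
      also have "real n powr \<kappa> * real n powr (- 1 / 2) = real n powr (- (1 / 2 - \<kappa>))"
        by (simp add: powr_add[symmetric])
      finally have "u D g \<Delta> * mass (s n) n k \<le> u D g \<Delta> * (c * \<delta> powr (- \<gamma>) * real n powr (- (1 / 2 - \<kappa>)) * nrm \<gamma> n k)"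
        using u_pos by (intro mult_left_mono) auto
      also have "\<dots> = (u D g \<Delta> * c * \<delta> powr (- \<gamma>) * real n powr (- (1 / 2 - \<kappa>))) * nrm \<gamma> n k" by (simp only: mult_ac)
      also have "\<dots> \<le> \<epsilon> * nrm \<gamma> n k" using elim N0 by (intro mult_right_mono) auto
      finally show "u D g \<Delta> * mass (s n) n k \<le> \<epsilon> * nrm \<gamma> n k" .
    qed
  qed
qed

lemma G_minus_A:
  assumes k: "k \<in> {1..<n}" and U: "\<bar>U n k \<omega>\<bar> < \<epsilon> * nrm \<gamma> n k"
    and V: "\<bar>V n k \<omega> - u D g \<Delta> * mass (s n) n k\<bar> < \<epsilon> * nrm \<gamma> n k"
    and m: "u D g \<Delta> * mass (s n) n k \<le> b * nrm \<gamma> n k"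
  shows "\<bar>G n k \<omega> - A \<gamma> n k \<omega>\<bar> \<le> 2 * \<epsilon> + b"
proof -
  have N0: "nrm \<gamma> n k > 0" by (rule nrm_pos[OF k])
  have m0: "0 \<le> u D g \<Delta> * mass (s n) n k" using u_pos by (simp add: mass_def)
  have "nrm \<gamma> n k * (G n k \<omega> - A \<gamma> n k \<omega>) = U n k \<omega> + V n k \<omega>"
    using G_decomposition[OF k, of \<omega>] by (simp add: right_diff_distrib)
  then have "\<bar>nrm \<gamma> n k * (G n k \<omega> - A \<gamma> n k \<omega>)\<bar> \<le> 2 * (\<epsilon> * nrm \<gamma> n k) + b * nrm \<gamma> n k"
    using U V m m0 by linarith
  then have "nrm \<gamma> n k * \<bar>G n k \<omega> - A \<gamma> n k \<omega>\<bar> \<le> nrm \<gamma> n k * (2 * \<epsilon> + b)"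
  proof -
    have "\<bar>nrm \<gamma> n k * (G n k \<omega> - A \<gamma> n k \<omega>)\<bar> = nrm \<gamma> n k * \<bar>G n k \<omega> - A \<gamma> n k \<omega>\<bar>"
      by (simp only: abs_mult abs_of_pos[OF N0])
    moreover have "nrm \<gamma> n k * (2 * \<epsilon> + b) = 2 * (\<epsilon> * nrm \<gamma> n k) + b * nrm \<gamma> n k" by (simp add: algebra_simps)
    ultimately show ?thesis using \<open>\<bar>nrm \<gamma> n k * (G n k \<omega> - A \<gamma> n k \<omega>)\<bar> \<le> 2 * (\<epsilon> * nrm \<gamma> n k) + b * nrm \<gamma> n k\<close> by simp
  qed
  then show ?thesis using N0 by (simp only: mult_le_cancel_left_pos)
qed

text \<open>Upper bound: in the end ranges A is below epsilon and the jump contributes at most b <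
  q, so that G cannot exceed q there; in the middle G and A differ by at most 3 epsilon, and A has
  to reach q - 3 epsilon. Lower bound: finitely many interior points already carry the probability
  of an exceedance up to a fraction of eta, and at these the jump is negligible.\<close>

lemma trivial_power:
  assumes c: "\<forall>\<^sub>F n in sequentially. real (s n) \<le> c * real n powr \<kappa>" "c > 0" "u D g \<Delta> * c powr (1 - \<gamma>) < q"
  shows "power \<longlonglongrightarrow> \<alpha>"
proof -
  define m where "m = u D g \<Delta>"
  define E where "E \<epsilon> n = {\<omega> \<in> space M. \<exists>k\<in>{1..<n}. \<bar>U n k \<omega>\<bar> \<ge> \<epsilon> * nrm \<gamma> n k}" for \<epsilon> n
  define F where "F \<epsilon> n = {\<omega> \<in> space M. \<exists>k\<in>{1..<n}. \<bar>V n k \<omega> - m * mass (s n) n k\<bar> \<ge> \<epsilon> * nrm \<gamma> n k}" for \<epsilon> n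
  define R where "R n = {\<omega> \<in> space M. \<exists>k\<in>{1..<n}. \<bar>G n k \<omega>\<bar> > q}" for n
  have EFm: "E \<epsilon> n \<in> sets M" "F \<epsilon> n \<in> sets M" for \<epsilon> n unfolding E_def F_def by measurable
  have Es: "\<forall>\<^sub>F n in sequentially. prob (E \<epsilon> n) \<le> \<eta>" if "\<epsilon> > 0" "\<eta> > 0" for \<epsilon> \<eta>
    unfolding E_def by (rule U_negligible[OF that])
  have Fs: "\<forall>\<^sub>F n in sequentially. prob (F \<epsilon> n) \<le> \<eta>" if "\<epsilon> > 0" "\<eta> > 0" for \<epsilon> \<eta>
    unfolding F_def V_def m_def shift_mean[symmetric]
    by (rule shift_error_small[OF shift_measurable shift_integrable gamma kappa that ev_s_range c(1,2)])
  have pR: "\<forall>\<^sub>F n in sequentially. power n = prob (R n) \<and> R n \<in> sets M"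
    using eventually_ge_at_top[of 2] unfolding R_def by eventually_elim (simp add: power_eq)
  have upper: "\<forall>\<^sub>F n in sequentially. power n \<le> \<alpha> + \<eta>" if \<eta>: "\<eta> > 0" for \<eta>
  proof -
    have \<eta>5: "\<eta> / 5 > 0" using \<eta> by simp
    obtain q' where q': "0 \<le> q'" "q' < q" "1 - \<alpha> \<le> B.prob {\<omega> \<in> space N. \<forall>t\<in>rat01. \<bar>B.Z \<sigma> \<gamma> t \<omega>\<bar> \<le> q'} + \<eta> / 5"
      using q_continuity[OF \<eta>5] by blast
    define b where "b = m * c powr (1 - \<gamma>)"
    have bq: "b < q" using c(3) by (simp add: b_def m_def)
    \<comment> \<open>Three errors of size epsilon occur: U, the deviation of V from its mean, and
      either A (in the end ranges) or the mean jump (in the middle). The same 3 epsilon must fit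
      below q - b and below the margin q - q' given by \<open>q_continuity\<close>.\<close>
    define \<epsilon> where "\<epsilon> = min (q - b) (q - q') / 5"
    have \<epsilon>: "\<epsilon> > 0" "b + 3 * \<epsilon> < q" "q' < q - 3 * \<epsilon>"
    proof -
      have "5 * \<epsilon> = min (q - b) (q - q')" by (simp add: \<epsilon>_def)
      moreover have "min (q - b) (q - q') > 0" "min (q - b) (q - q') \<le> q - b" "min (q - b) (q - q') \<le> q - q'"
        using bq q'(2) by auto
      ultimately show "\<epsilon> > 0" "b + 3 * \<epsilon> < q" "q' < q - 3 * \<epsilon>" by linarith+
    qed
    obtain \<delta> where \<delta>: "\<delta> > 0" "\<delta> < 1 / 2" "\<And>n. n \<ge> 1 \<Longrightarrow> prob {\<omega> \<in> space M. \<exists>k\<in>{1..<n}. (real k \<le> \<delta> * n \<or> real n - k \<le> \<delta> * n) \<and> \<bar>A \<gamma> n k \<omega>\<bar> \<ge> \<epsilon>} \<le> \<eta> / 5"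
      using A_ends_negligible[OF \<epsilon>(1) \<eta>5] by blast
    show ?thesis
      using Es[OF \<epsilon>(1) \<eta>5] Fs[OF \<epsilon>(1) \<eta>5] pR early_shift_bound[OF c(1,2)] late_shift_negligible[OF c(1,2) \<delta>(1) \<epsilon>(1)]
        A_middle[OF gamma \<delta>(1,2) q'(1) \<epsilon>(3) \<eta>5] eventually_ge_at_top[of 1]
    proof eventually_elim
      case (elim n)
      let ?H = "{\<omega> \<in> space M. \<exists>k\<in>{1..<n}. (real k \<le> \<delta> * n \<or> real n - k \<le> \<delta> * n) \<and> \<bar>A \<gamma> n k \<omega>\<bar> \<ge> \<epsilon>}"
      let ?L = "{\<omega> \<in> space M. \<exists>k<n. \<delta> * n < k \<and> \<delta> * n < real n - k \<and> \<bar>A \<gamma> n k \<omega>\<bar> \<ge> q - 3 * \<epsilon>}"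
      have HLm: "?H \<in> sets M" "?L \<in> sets M" by measurable
      have sub: "R n \<subseteq> E \<epsilon> n \<union> (F \<epsilon> n \<union> (?H \<union> ?L))"
      proof (rule subsetI, rule ccontr)
        fix \<omega> assume "\<omega> \<in> R n" and no: "\<omega> \<notin> E \<epsilon> n \<union> (F \<epsilon> n \<union> (?H \<union> ?L))"
        then obtain k where w: "\<omega> \<in> space M" and k: "k \<in> {1..<n}" and Gq: "\<bar>G n k \<omega>\<bar> > q" unfolding R_def by blast
        have 1: "\<bar>U n k \<omega>\<bar> < \<epsilon> * nrm \<gamma> n k" using no w k unfolding E_def not_le[symmetric] by blast
        have 2: "\<bar>V n k \<omega> - u D g \<Delta> * mass (s n) n k\<bar> < \<epsilon> * nrm \<gamma> n k"
          using no w k unfolding F_def not_le[symmetric] m_def by blast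
        show False
        proof (cases "real k \<le> \<delta> * n \<or> real n - k \<le> \<delta> * n")
          case True
          then have "\<not> \<bar>A \<gamma> n k \<omega>\<bar> \<ge> \<epsilon>" using no w k by blast
          moreover have "u D g \<Delta> * mass (s n) n k \<le> b * nrm \<gamma> n k"
          proof -
            have "m * mass (s n) n k \<le> m * (c powr (1 - \<gamma>) * nrm \<gamma> n k)"
              using elim(4) k u_pos by (intro mult_left_mono) (auto simp: m_def)
            then show ?thesis unfolding b_def m_def by (simp only: mult.assoc)
          qed
          note G_minus_A[OF k 1 2 this]
          ultimately show False using Gq \<epsilon> by linarith
        next
          case False
          have "u D g \<Delta> * mass (s n) n k \<le> \<epsilon> * nrm \<gamma> n k" using elim(5) k False by auto
          note d = G_minus_A[OF k 1 2 this]
          have "\<bar>A \<gamma> n k \<omega>\<bar> \<ge> q - 3 * \<epsilon>" using d Gq by linarith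
          moreover have "\<delta> * n < k" "\<delta> * n < real n - k" "k < n" using False k by auto
          ultimately have "\<omega> \<in> ?L" using w by blast
          then show False using no by blast
        qed
      qed
      have "prob (R n) \<le> prob (E \<epsilon> n \<union> (F \<epsilon> n \<union> (?H \<union> ?L)))"
        by (rule finite_measure_mono[OF sub]) (intro sets.Un EFm HLm)
      also have "\<dots> \<le> prob (E \<epsilon> n) + prob (F \<epsilon> n \<union> (?H \<union> ?L))"
        by (rule measure_Un_le[OF EFm(1)]) (intro sets.Un EFm HLm)
      also have "prob (F \<epsilon> n \<union> (?H \<union> ?L)) \<le> prob (F \<epsilon> n) + prob (?H \<union> ?L)"
        by (rule measure_Un_le[OF EFm(2)]) (intro sets.Un HLm)
      also have "prob (?H \<union> ?L) \<le> prob ?H + prob ?L" by (rule measure_Un_le[OF HLm])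
      finally show ?case using elim(1,2,3,6) \<delta>(3)[OF elim(7)] q'(3) by linarith
    qed
  qed
  have lower: "\<forall>\<^sub>F n in sequentially. \<alpha> - \<eta> \<le> power n" if \<eta>: "\<eta> > 0" for \<eta>
  proof -
    have \<eta>5: "\<eta> / 5 > 0" using \<eta> by simp
    have Zm: "B.Z \<sigma> \<gamma> t \<in> borel_measurable N" if "t \<in> rat01" for t
      using rat01_range(2)[OF that] by (rule B.Z_measurable)
    \<comment> \<open>In this direction the level is raised, and the distribution function of the
      supremum is continuous from the right; the upper bound lowered the level and rested on the
      absence of an atom.\<close>
    obtain b where b: "b > q" "B.prob {\<omega> \<in> space N. \<forall>t\<in>rat01. \<bar>B.Z \<sigma> \<gamma> t \<omega>\<bar> \<le> b} \<le> 1 - \<alpha> + \<eta> / 5"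
      using B.prob_bounded_from_above[OF countable_rat01, where X="B.Z \<sigma> \<gamma>" and a=q, OF Zm \<eta>5] unfolding q_level by blast
    obtain T where T: "finite T" "T \<subseteq> rat01"
      "B.prob {\<omega> \<in> space N. \<forall>t\<in>T. \<bar>B.Z \<sigma> \<gamma> t \<omega>\<bar> \<le> b} \<le> B.prob {\<omega> \<in> space N. \<forall>t\<in>rat01. \<bar>B.Z \<sigma> \<gamma> t \<omega>\<bar> \<le> b} + \<eta> / 5"
      using B.prob_bounded_finite_subset[OF countable_rat01, where X="B.Z \<sigma> \<gamma>" and a=b, OF Zm \<eta>5] by blast
    have T01: "T \<subseteq> {0<..<1}" using T(2) rat01_range(1) by auto
    define a where "a = (q + b) / 2"
    have a: "0 \<le> a" "a < b" "q < a" using q_pos b(1) by (auto simp: a_def)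
    define \<epsilon> where "\<epsilon> = (a - q) / 4"
    have \<epsilon>: "\<epsilon> > 0" "q + 3 * \<epsilon> < a" using a by (auto simp: \<epsilon>_def field_simps)
    have ev: "\<forall>\<^sub>F n in sequentially. \<forall>t\<in>T. nat \<lfloor>real n * t\<rfloor> \<in> {1..<n} \<and>
      u D g \<Delta> * mass (s n) n (nat \<lfloor>real n * t\<rfloor>) \<le> \<epsilon> * nrm \<gamma> n (nat \<lfloor>real n * t\<rfloor>)"
    proof (rule eventually_ball_finite[OF T(1)], rule ballI)
      fix t assume "t \<in> T"
      then have t: "0 < t" "t < 1" using T01 by auto
      \<comment> \<open>Rounding down costs less than one, so floor (n t) >= n t / 2 as soon as n t
        > 2; every index that comes from T is therefore late in the sense of
        \<open>late_shift_negligible\<close>.\<close>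
      have t2: "t / 2 > 0" using t by simp
      obtain N0 :: nat where N0: "2 / t < real N0" using reals_Archimedean2 by blast
      show "\<forall>\<^sub>F n in sequentially. nat \<lfloor>real n * t\<rfloor> \<in> {1..<n} \<and>
        u D g \<Delta> * mass (s n) n (nat \<lfloor>real n * t\<rfloor>) \<le> \<epsilon> * nrm \<gamma> n (nat \<lfloor>real n * t\<rfloor>)"
        using floor_index_range[OF t] late_shift_negligible[OF c(1,2) t2 \<epsilon>(1)] eventually_ge_at_top[of N0]
      proof eventually_elim
        case (elim n)
        have "2 < real N0 * t" using N0 t by (simp add: pos_divide_less_eq)
        also have "\<dots> \<le> real n * t" using elim t by (intro mult_right_mono) auto
        finally have "2 < real n * t" .
        moreover have "real n * t - 1 < real (nat \<lfloor>real n * t\<rfloor>)" using t by (auto simp: of_nat_nat)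
        ultimately have "t / 2 * real n \<le> real (nat \<lfloor>real n * t\<rfloor>)"
          by (simp only: mult.commute[of "t / 2"] times_divide_eq_right)
        then show ?case using elim by blast
      qed
    qed
    show ?thesis
      using Es[OF \<epsilon>(1) \<eta>5] Fs[OF \<epsilon>(1) \<eta>5] pR ev fdd_upper_A[OF T(1) T01 a(1,2) \<eta>5, of \<gamma>]
    proof eventually_elim
      case (elim n)
      let ?Q = "{\<omega> \<in> space M. \<forall>t\<in>T. \<bar>A \<gamma> n (nat \<lfloor>real n * t\<rfloor>) \<omega>\<bar> \<le> a}"
      have Qm: "?Q \<in> sets M" by (rule sets_Collect_Ball_abs_le[OF countable_finite[OF T(1)]]) simp
      have sub: "space M - R n \<subseteq> E \<epsilon> n \<union> (F \<epsilon> n \<union> ?Q)"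
      proof (rule subsetI, rule ccontr)
        fix \<omega> assume wR: "\<omega> \<in> space M - R n" and no: "\<omega> \<notin> E \<epsilon> n \<union> (F \<epsilon> n \<union> ?Q)"
        then obtain t where w: "\<omega> \<in> space M" and t: "t \<in> T" and At: "\<not> \<bar>A \<gamma> n (nat \<lfloor>real n * t\<rfloor>) \<omega>\<bar> \<le> a" by blast
        define k where "k = nat \<lfloor>real n * t\<rfloor>"
        have k: "k \<in> {1..<n}" and mk: "u D g \<Delta> * mass (s n) n k \<le> \<epsilon> * nrm \<gamma> n k"
          using elim(4) t unfolding k_def by blast+
        have 1: "\<bar>U n k \<omega>\<bar> < \<epsilon> * nrm \<gamma> n k" using no w k unfolding E_def not_le[symmetric] by blast
        have 2: "\<bar>V n k \<omega> - u D g \<Delta> * mass (s n) n k\<bar> < \<epsilon> * nrm \<gamma> n k"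
          using no w k unfolding F_def not_le[symmetric] m_def by blast
        have "\<bar>G n k \<omega>\<bar> > q" using G_minus_A[OF k 1 2 mk] At \<epsilon>(2) unfolding k_def[symmetric] by linarith
        then have "\<omega> \<in> R n" using w k unfolding R_def by blast
        then show False using wR by blast
      qed
      have "1 - prob (R n) = prob (space M - R n)" using elim(3) by (intro prob_compl[symmetric]) simp
      also have "\<dots> \<le> prob (E \<epsilon> n \<union> (F \<epsilon> n \<union> ?Q))"
        by (rule finite_measure_mono[OF sub]) (intro sets.Un EFm Qm)
      also have "\<dots> \<le> prob (E \<epsilon> n) + prob (F \<epsilon> n \<union> ?Q)"
        by (rule measure_Un_le[OF EFm(1)]) (intro sets.Un EFm Qm)
      also have "prob (F \<epsilon> n \<union> ?Q) \<le> prob (F \<epsilon> n) + prob ?Q" by (rule measure_Un_le[OF EFm(2) Qm])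
      finally show ?case using elim(1,2,3,5) b(2) T(3) by linarith
    qed
  qed
  show ?thesis
  proof (rule tendstoI)
    fix e :: real assume e: "e > 0"
    have "\<forall>\<^sub>F n in sequentially. \<alpha> - e / 2 \<le> power n" "\<forall>\<^sub>F n in sequentially. power n \<le> \<alpha> + e / 2"
      using e by (intro lower upper; simp)+
    then show "\<forall>\<^sub>F n in sequentially. dist (power n) \<alpha> < e"
    proof eventually_elim
      case (elim n)
      then show ?case using e by (simp add: dist_real_def abs_less_iff)
    qed
  qed
qed

end

theorem theorem4:
  fixes M :: "'a measure" and \<xi> :: "nat \<Rightarrow> 'a \<Rightarrow> real"
    and N :: "'b measure" and W :: "real \<Rightarrow> 'b \<Rightarrow> real"
    and g :: "real \<Rightarrow> real" and kstar :: "nat \<Rightarrow> nat"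
    and \<mu> \<Delta> \<gamma> \<kappa> \<alpha> \<sigma> q :: real
  defines "D \<equiv> distr M borel (\<xi> 1)"
  defines "p \<equiv> (\<lambda>n. rejection_prob M (observation \<mu> \<Delta> (kstar n) \<xi>) g \<gamma> q n)"
  assumes iid: "iid_mean_zero M \<xi>"
    and gamma: "0 < \<gamma>" "\<gamma> < 1/2"
    and kappa: "\<kappa> = (1 - 2 * \<gamma>) / (2 * (1 - \<gamma>))"
    and alpha: "0 < \<alpha>" "\<alpha> < 1"
    and g_meas: "g \<in> borel_measurable borel"
    and g_odd: "\<And>x. g (- x) = - g x"
    and second_moment: "integrable M (\<lambda>\<omega>. (g (\<xi> 2 \<omega> - \<xi> 1 \<omega>))\<^sup>2)"
    and sigma: "\<sigma>\<^sup>2 = (\<integral>\<omega>. (g1 D g (\<xi> 1 \<omega>))\<^sup>2 \<partial>M)" "\<sigma> > 0"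
    and jump: "\<Delta> \<noteq> 0"
    and u_exists: "integrable (D \<Otimes>\<^sub>M D) (\<lambda>p. g (fst p - snd p + \<Delta>))"
    and u_pos: "u D g \<Delta> > 0"
    and kstar_range: "\<And>n. n \<ge> 2 \<Longrightarrow> kstar n \<in> {1..n - 1}"
    and kstar_early: "(\<lambda>n. real (kstar n) / real n) \<longlonglongrightarrow> 0"
    and bridge: "brownian_bridge N W"
    and q: "critical_value N W \<sigma> \<gamma> \<alpha> q"
  shows "(liminf (\<lambda>n. ereal (real (kstar n) / real n powr \<kappa>))
            > ereal ((q / u D g \<Delta>) powr (1 / (1 - \<gamma>))) \<longrightarrow> p \<longlonglongrightarrow> 1) \<and>
         (limsup (\<lambda>n. ereal (real (kstar n) / real n powr \<kappa>))
            < ereal ((q / u D g \<Delta>) powr (1 / (1 - \<gamma>))) \<longrightarrow> p \<longlonglongrightarrow> \<alpha>)"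
proof -
  interpret prob_space M using iid unfolding iid_mean_zero_def by blast
  interpret iid_sample M \<xi> D
  proof
    show "indep_vars (\<lambda>_. borel) \<xi> {1..}" "\<And>i. i \<ge> 1 \<Longrightarrow> distr M borel (\<xi> i) = D"
      using iid unfolding iid_mean_zero_def D_def by blast+
  qed
  have gsq: "integrable (D \<Otimes>\<^sub>M D) (\<lambda>p. (g (fst p - snd p))\<^sup>2)"
    using kernel_expectation(2)[of 1 2 "\<lambda>p. (g (fst p - snd p))\<^sup>2"] second_moment g_meas by simp
  interpret odd_kernel M \<xi> D g
    by unfold_locales (use g_meas g_odd gsq in auto)
  have hm: "g1 D g \<in> borel_measurable borel" unfolding g1_eq_score by simp
  have h2: "(\<integral>x. (g1 D g x)\<^sup>2 \<partial>D) = \<sigma>\<^sup>2"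
    using one_variable_expectation(1)[of 1 "\<lambda>x. (g1 D g x)\<^sup>2"] hm sigma(1) by simp
  \<comment> \<open>The integral of a function that is not integrable is 0 by convention, so sigma^2
    > 0 forces the square of the score to be integrable.\<close>
  have hi: "integrable D (\<lambda>x. (g1 D g x)\<^sup>2)"
  proof (rule ccontr)
    assume "\<not> ?thesis"
    then show False using h2 sigma(2) by (simp add: not_integrable_integral_eq)
  qed
  interpret iid_score M \<xi> D "g1 D g" \<sigma>
    by unfold_locales (use hm h2 hi sigma(2) score_mean g1_eq_score in auto)
  have "prob_space N" using bridge by (simp add: brownian_bridge_def)
  interpret B: prob_space N by fact
  interpret B: std_bridge N W by unfold_locales (rule bridge)
  interpret score_bridge M \<xi> D "g1 D g" \<sigma> N W ..
  note cv = B.critical_value_prob[OF q alpha sigma(2)]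
  interpret change_point M \<xi> D g \<sigma> N W kstar \<mu> \<Delta> \<gamma> \<kappa> \<alpha> q
    by unfold_locales (use gamma kappa u_exists u_pos kstar_range kstar_early cv in auto)
  have p: "p = power" by (simp add: p_def power_def fun_eq_iff)
  \<comment> \<open>The boundary c0 solves u * c^(1 - gamma) = q, and the left side increases in c.
    A strict inequality for the lower or upper limit leaves room for a constant c strictly on one
    side of c0 that bounds the ratios eventually.\<close>
  define c0 where "c0 = (q / u D g \<Delta>) powr (1 / (1 - \<gamma>))"
  have qu: "q / u D g \<Delta> > 0" using cv(1) u_pos by simp
  have c0: "c0 > 0" using cv(1) u_pos by (simp add: c0_def)
  have c0_powr: "u D g \<Delta> * c0 powr (1 - \<gamma>) = q"
    using qu cv(1) u_pos gamma by (simp add: c0_def powr_powr)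
  have 1: "p \<longlonglongrightarrow> 1" if lim: "liminf (\<lambda>n. ereal (real (kstar n) / real n powr \<kappa>)) > ereal c0"
  proof -
    obtain c where c: "c0 < c" "ereal c < liminf (\<lambda>n. ereal (real (kstar n) / real n powr \<kappa>))"
      using ereal_dense2[OF lim] by auto
    have "\<forall>\<^sub>F n in sequentially. ereal c < ereal (real (kstar n) / real n powr \<kappa>)" by (rule less_LiminfD[OF c(2)])
    then have ev: "\<forall>\<^sub>F n in sequentially. c * real n powr \<kappa> \<le> real (kstar n)"
      using eventually_gt_at_top[of 0] by eventually_elim (simp add: pos_less_divide_eq)
    have "c0 powr (1 - \<gamma>) < c powr (1 - \<gamma>)" using c c0 gamma by (intro powr_less_mono2) auto
    then have "u D g \<Delta> * c powr (1 - \<gamma>) > q" using u_pos c0_powr by (metis mult_less_cancel_left_pos)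
    then show ?thesis unfolding p using ev c c0 by (intro consistent) auto
  qed
  have 2: "p \<longlonglongrightarrow> \<alpha>" if lim: "limsup (\<lambda>n. ereal (real (kstar n) / real n powr \<kappa>)) < ereal c0"
  proof -
    obtain c where c: "limsup (\<lambda>n. ereal (real (kstar n) / real n powr \<kappa>)) < ereal c" "c < c0"
      using ereal_dense2[OF lim] by auto
    have ev0: "\<forall>\<^sub>F n in sequentially. ereal (real (kstar n) / real n powr \<kappa>) < ereal c" by (rule Limsup_lessD[OF c(1)])
    then have ev: "\<forall>\<^sub>F n in sequentially. real (kstar n) \<le> c * real n powr \<kappa>"
      using eventually_gt_at_top[of 0] by eventually_elim (simp add: pos_divide_less_eq)
    \<comment> \<open>The ratios are nonnegative, so a single one below c makes c positive.\<close>
    have "\<exists>n. real (kstar n) / real n powr \<kappa> < c" using ev0 by (auto simp: eventually_sequentially)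
    then obtain n where "real (kstar n) / real n powr \<kappa> < c" by blast
    moreover have "0 \<le> real (kstar n) / real n powr \<kappa>" by simp
    ultimately have cp: "c > 0" by linarith
    have "c powr (1 - \<gamma>) < c0 powr (1 - \<gamma>)" using c cp gamma by (intro powr_less_mono2) auto
    then have "u D g \<Delta> * c powr (1 - \<gamma>) < q" using u_pos c0_powr by (metis mult_less_cancel_left_pos)
    then show ?thesis unfolding p using ev cp by (intro trivial_power) auto
  qed
  show ?thesis using 1 2 unfolding c0_def by blast
qed

end
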